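(* Let $n\geq 3$ and let $S_n$ act on $\mathfrak{h}^*\oplus\mathfrak{h}\cong\mathbb{C}^{2n-2}$ by the doubled standard representation. (1) There are no degree-one Lie orbifold algebras: if $\kappa=\kappa^L+\kappa^C$ is a Drinfeld orbifold algebra map for $S_n$ acting on $\mathfrak{h}^*\oplus\mathfrak{h}$ with $\kappa^L$ supported only on the identity, then $\kappa^L=0$. (2) There is a three-parameter family of Drinfeld orbifold algebras, given by Drinfeld orbifold algebra maps with linear part supported only off the identity: for all $a^\perp,b^\perp,c\in\mathbb{C}$ the map $\kappa=\kappa^L+\kappa^C$ defined for $1\le i\neq j\le n$ by $$\kappa^L(\bar x_i,\bar x_j)=\kappa^L(\bar y_i,\bar y_j)=0,$$ $$\kappa^L(\bar x_i,\bar y_i)=-\tfrac n2\sum_{k\neq i}\big(a^\perp(\bar x_i+\bar x_k)+b^\perp(\bar y_i+\bar y_k)\big)\otimes(ik),$$ $$\kappa^L(\bar x_i,\bar y_j)=\tfrac n2\big(a^\perp(\bar x_i+\bar x_j)+b^\perp(\bar y_i+\bar y_j)\big)\otimes(ij),$$ $$\kappa^C(\bar x_i,\bar x_j)=\tfrac{n^2}{4}(b^\perp)^2\sum_{k\neq i,j}\big((ijk)-(kji)\big),\qquad \kappa^C(\bar y_i,\bar y_j)=\tfrac{n^2}{4}(a^\perp)^2\sum_{k\neq i,j}\big((ijk)-(kji)\big),$$ $$\kappa^C(\bar x_i,\bar y_i)=c\sum_{k\neq i}(ik),\qquad \kappa^C(\bar x_i,\bar y_j)=-c\,(ij)-\tfrac{n^2}{4}a^\perp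 b^\perp\sum_{k\neq i,j}\big((ijk)-(kji)\big)$$ is a Drinfeld orbifold algebra map, so $\mathcal{H}_\kappa$ is a Drinfeld orbifold algebra. (3) These are the only degree-one deformations of $S(\mathfrak{h}^*\oplus\mathfrak{h})\#S_n$ whose parameter maps have linear part supported only on or only off the identity: every Drinfeld orbifold algebra map for $S_n$ acting on $\mathfrak{h}^*\oplus\mathfrak{h}$ with nonzero linear part supported only on or only off the identity is of the form given in (2) for some $a^\perp,b^\perp,c\in\mathbb{C}$.
   Context: Let $G$ be a finite group acting linearly on a finite-dimensional complex vector space $V$; write ${}^{g}v$ for the action and $V^g$ for the fixed space of $g$. For a $\mathbb{C}$-algebra $R$ with $G$-action by automorphisms, $R\#G$ is $R\otimes\mathbb{C}G$ with product $(r\otimes g)(s\otimes h)=r({}^{g}s)\otimes gh$. A 2-cochain is $\kappa=\sum_{g\in G}\kappa_g g$ with linear components $\kappa_g:\bigwedge^2V\to S(V)$ (skew-symmetric bilinear maps; $\kappa(u,v)=\sum_g\kappa_g(u,v)\otimes g$); it is linear if every $\kappa_g$ maps into $V$, constant if every $\kappa_g$ maps into $\mathbb{C}$. It is supported only on (resp. only off) $X\subseteq G$ if $\kappa_g=0$ for all $g\notin X$ (resp. $g\in X$). It is $G$-invariant if ${}^{h}(\kappa_g(u,v))=\kappa_{hgh^{-1}}({}^{h}u,{}^{h}v)$ for all $g,h,u,v$. For linear $\kappa^L$ and constant $\kappa^C$, $\kappa=\kappa^L+\kappa^C$ is a Drinfeld orbifold algebra map if for all $g\in G$, $v_1,v_2,v_3\in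 V$ ($\mathrm{Alt}_3$ the alternating group on three letters): (0) $\mathrm{im}\,\kappa^L_g\subseteq V^g$; (i) $\kappa^L,\kappa^C$ are $G$-invariant; (ii) $\sum_{\sigma\in\mathrm{Alt}_3}\kappa^L_g(v_{\sigma(2)},v_{\sigma(3)})({}^{g}v_{\sigma(1)}-v_{\sigma(1)})=0$ in $S(V)$; (iii) $\sum_{\sigma\in\mathrm{Alt}_3}\sum_{xy=g}\kappa^L_x\big(v_{\sigma(1)}+{}^{y}v_{\sigma(1)},\kappa^L_y(v_{\sigma(2)},v_{\sigma(3)})\big)=2\sum_{\sigma\in\mathrm{Alt}_3}\kappa^C_g(v_{\sigma(2)},v_{\sigma(3)})({}^{g}v_{\sigma(1)}-v_{\sigma(1)})$; (iv) $\sum_{\sigma\in\mathrm{Alt}_3}\sum_{xy=g}\kappa^C_x\big(v_{\sigma(1)}+{}^{y}v_{\sigma(1)},\kappa^L_y(v_{\sigma(2)},v_{\sigma(3)})\big)=0$. It is a Lie orbifold algebra map if moreover $\kappa^L$ is supported only on the identity. "Degree-one" means $\kappa^L\ne0$. $\mathcal{H}_\kappa=T(V)\#G/\langle vw-wv-\kappa^L(v,w)-\kappa^C(v,w)\mid v,w\in V\rangle$ is a Drinfeld orbifold algebra if its associated graded algebra (elements of $V$ in degree one, of $G$ in degree zero) is isomorphic to $S(V)\#G$. $W\cong\mathbb{C}^n$ is the permutation representation of $S_n$ with basis $y_1,\dots,y_n$, $W^*$ has dual basis $x_1,\dots,x_n$, and ${}^{\sigma}y_i=y_{\sigma(i)}$,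 ${}^{\sigma}x_i=x_{\sigma(i)}$. Let $x_{[n]}=\sum x_i$, $y_{[n]}=\sum y_i$, $\bar x_i=x_i-\frac1n x_{[n]}$, $\bar y_i=y_i-\frac1n y_{[n]}$. The doubled standard representation is the subrepresentation $\mathfrak{h}^*\oplus\mathfrak{h}$ of $W^*\oplus W$ spanned by all $\bar x_i,\bar y_i$. Sums $\sum_{k\ne i}$, $\sum_{k\ne i,j}$ run over $k\in\{1,\dots,n\}$. *)

theory Defs
  imports
    Complex_Main
    "HOL-Library.Multiset"
    "HOL-Library.Poly_Mapping"
    "HOL-Algebra.QuotRing"
    "HOL-Algebra.Sym_Groups"
begin

section \<open>Linear algebra and the algebras \<open>T(V)\<close> and \<open>S(V)\<close>\<close>

text \<open>
  All vector spaces are subspaces \<open>V\<close> of the complex vector space \<open>'i \<Rightarrow>\<^sub>0 complex\<close> with basis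
  \<open>'i\<close>.  The tensor algebra of the ambient space is the free algebra, i.e. the monoid algebra
  \<open>'i list \<Rightarrow>\<^sub>0 complex\<close> of the free monoid of words; its symmetric algebra is the polynomial ring
  \<open>'i multiset \<Rightarrow>\<^sub>0 complex\<close>.  Since \<open>T\<close> and \<open>S\<close> preserve injections of vector spaces, \<open>T(V)\<close> and
  \<open>S(V)\<close> are the subalgebras spanned by the products of vectors of \<open>V\<close>.
\<close>

definition cscale :: "complex \<Rightarrow> ('a \<Rightarrow>\<^sub>0 complex) \<Rightarrow> ('a \<Rightarrow>\<^sub>0 complex)" (infixr \<open>*\<^sub>c\<close> 75)
  where "c *\<^sub>c v = Poly_Mapping.map ((*) c) v"

lemma lookup_cscale [simp]: "Poly_Mapping.lookup (c *\<^sub>c v) i = c * Poly_Mapping.lookup v i"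
  by (simp add: cscale_def Poly_Mapping.map.rep_eq when_def)

global_interpretation cvs: vector_space cscale
  by unfold_locales (auto intro!: poly_mapping_eqI simp: lookup_add algebra_simps)

instantiation list :: (type) monoid_add
begin

definition zero_list :: "'a list" where "zero_list = []"

definition plus_list :: "'a list \<Rightarrow> 'a list \<Rightarrow> 'a list" where "plus_list = (@)"

instance
  by standard (simp_all add: zero_list_def plus_list_def)

end

definition tvec :: "('i \<Rightarrow>\<^sub>0 complex) \<Rightarrow> ('i list \<Rightarrow>\<^sub>0 complex)"
  where "tvec v = (\<Sum>i\<in>Poly_Mapping.keys v. Poly_Mapping.single [i] (Poly_Mapping.lookup v i))"

definition svec :: "('i \<Rightarrow>\<^sub>0 complex) \<Rightarrow> ('i multiset \<Rightarrow>\<^sub>0 complex)"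
  where "svec v = (\<Sum>i\<in>Poly_Mapping.keys v. Poly_Mapping.single {#i#} (Poly_Mapping.lookup v i))"

definition tensor_algebra :: "('i \<Rightarrow>\<^sub>0 complex) set \<Rightarrow> ('i list \<Rightarrow>\<^sub>0 complex) ring"
  where "tensor_algebra V =
    \<lparr>carrier = cvs.span {prod_list (map tvec vs) | vs. set vs \<subseteq> V},
     monoid.mult = (*), one = 1, zero = 0, add = (+)\<rparr>"

definition tensor_upto :: "('i \<Rightarrow>\<^sub>0 complex) set \<Rightarrow> nat \<Rightarrow> ('i list \<Rightarrow>\<^sub>0 complex) set"
  where "tensor_upto V k = cvs.span {prod_list (map tvec vs) | vs. set vs \<subseteq> V \<and> length vs \<le> k}"

definition sym_algebra :: "('i \<Rightarrow>\<^sub>0 complex) set \<Rightarrow> ('i multiset \<Rightarrow>\<^sub>0 complex) ring"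
  where "sym_algebra V =
    \<lparr>carrier = cvs.span {prod_list (map svec vs) | vs. set vs \<subseteq> V},
     monoid.mult = (*), one = 1, zero = 0, add = (+)\<rparr>"

definition sym_power :: "('i \<Rightarrow>\<^sub>0 complex) set \<Rightarrow> nat \<Rightarrow> ('i multiset \<Rightarrow>\<^sub>0 complex) set"
  where "sym_power V k = cvs.span {prod_list (map svec vs) | vs. set vs \<subseteq> V \<and> length vs = k}"

text \<open>The algebra endomorphisms \<open>T(f)\<close> and \<open>S(f)\<close> induced by a linear endomorphism \<open>f\<close>.\<close>

definition tensor_map ::
    "(('i \<Rightarrow>\<^sub>0 complex) \<Rightarrow> ('i \<Rightarrow>\<^sub>0 complex)) \<Rightarrow> ('i list \<Rightarrow>\<^sub>0 complex) \<Rightarrow> ('i list \<Rightarrow>\<^sub>0 complex)"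
  where "tensor_map f p =
    (\<Sum>w\<in>Poly_Mapping.keys p. Poly_Mapping.lookup p w *\<^sub>c
       prod_list (map (\<lambda>i. tvec (f (Poly_Mapping.single i 1))) w))"

definition sym_map ::
    "(('i \<Rightarrow>\<^sub>0 complex) \<Rightarrow> ('i \<Rightarrow>\<^sub>0 complex)) \<Rightarrow> ('i multiset \<Rightarrow>\<^sub>0 complex) \<Rightarrow> ('i multiset \<Rightarrow>\<^sub>0 complex)"
  where "sym_map f p =
    (\<Sum>m\<in>Poly_Mapping.keys p. Poly_Mapping.lookup p m *\<^sub>c
       prod_mset (image_mset (\<lambda>i. svec (f (Poly_Mapping.single i 1))) m))"

section \<open>Skew group algebras and associated graded algebras\<close>

definition factorizations :: "('g, 'k) monoid_scheme \<Rightarrow> 'g \<Rightarrow> ('g \<times> 'g) set"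
  where "factorizations G g = {(x, y). x \<in> carrier G \<and> y \<in> carrier G \<and> x \<otimes>\<^bsub>G\<^esub> y = g}"

text \<open>
  An element \<open>\<Sum>g. r\<^sub>g \<otimes> g\<close> of \<open>R # G\<close> is the function \<open>g \<mapsto> r\<^sub>g\<close>, set to zero outside \<open>G\<close>.
  The group acts on \<open>R\<close> by \<open>\<alpha>\<close>.
\<close>

definition skew_group_algebra ::
    "('r, 'm) ring_scheme \<Rightarrow> ('g, 'k) monoid_scheme \<Rightarrow> ('g \<Rightarrow> 'r \<Rightarrow> 'r) \<Rightarrow> ('g \<Rightarrow> 'r) ring"
  where "skew_group_algebra R G \<alpha> =
    \<lparr>carrier = {f. (\<forall>g\<in>carrier G. f g \<in> carrier R) \<and> (\<forall>g. g \<notin> carrier G \<longrightarrow> f g = \<zero>\<^bsub>R\<^esub>)},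
     monoid.mult = (\<lambda>f h g. \<Oplus>\<^bsub>R\<^esub>p\<in>factorizations G g.
        f (fst p) \<otimes>\<^bsub>R\<^esub> \<alpha> (fst p) (h (snd p))),
     one = (\<lambda>g. if g = \<one>\<^bsub>G\<^esub> then \<one>\<^bsub>R\<^esub> else \<zero>\<^bsub>R\<^esub>),
     zero = (\<lambda>g. \<zero>\<^bsub>R\<^esub>),
     add = (\<lambda>f h g. f g \<oplus>\<^bsub>R\<^esub> h g)\<rparr>"

text \<open>
  For an increasing filtration \<open>F\<close> of a ring \<open>R\<close> by additive subgroups with
  \<open>F i \<cdot> F j \<subseteq> F (i + j)\<close>, the associated graded ring is the direct sum of the \<open>F k / F (k - 1)\<close>
  with \<open>F (-1) = 0\<close>.  An element is the sequence of its homogeneous components, each a coset of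
  \<open>F (k - 1)\<close> in \<open>F k\<close>; as for quotient rings in the library, products are formed with all representatives.
\<close>

definition fil_below :: "('a, 'm) ring_scheme \<Rightarrow> (nat \<Rightarrow> 'a set) \<Rightarrow> nat \<Rightarrow> 'a set"
  where "fil_below R F k = (case k of 0 \<Rightarrow> {\<zero>\<^bsub>R\<^esub>} | Suc j \<Rightarrow> F j)"

definition assoc_graded :: "('a, 'm) ring_scheme \<Rightarrow> (nat \<Rightarrow> 'a set) \<Rightarrow> (nat \<Rightarrow> 'a set) ring"
  where "assoc_graded R F =
    \<lparr>carrier = {f. (\<forall>k. \<exists>x\<in>F k. f k = fil_below R F k +>\<^bsub>R\<^esub> x) \<and> finite {k. f k \<noteq> fil_below R F k}},
     monoid.mult = (\<lambda>f h k. \<Union>x\<in>{x. \<forall>i. x i \<in> f i}. \<Union>y\<in>{y. \<forall>i. y i \<in> h i}.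
        fil_below R F k +>\<^bsub>R\<^esub> (\<Oplus>\<^bsub>R\<^esub>i\<in>{..k}. x i \<otimes>\<^bsub>R\<^esub> y (k - i))),
     one = (\<lambda>k. fil_below R F k +>\<^bsub>R\<^esub> (if k = 0 then \<one>\<^bsub>R\<^esub> else \<zero>\<^bsub>R\<^esub>)),
     zero = fil_below R F,
     add = (\<lambda>f h k. f k <+>\<^bsub>R\<^esub> h k)\<rparr>"

definition graded_part :: "('a, 'm) ring_scheme \<Rightarrow> (nat \<Rightarrow> 'a set) \<Rightarrow> nat \<Rightarrow> (nat \<Rightarrow> 'a set) set"
  where "graded_part R F k = {f \<in> carrier (assoc_graded R F). \<forall>j. j \<noteq> k \<longrightarrow> f j = fil_below R F j}"

text \<open>
  A graded \<open>\<complex>\<close>-algebra is given by a ring \<open>A\<close>, its structure map \<open>\<iota>\<close> (sending \<open>c\<close> to \<open>c \<cdot> 1\<close>) and its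
  homogeneous parts \<open>D\<close>.
\<close>

definition graded_algebra_iso ::
    "('a, 'm) ring_scheme \<Rightarrow> (complex \<Rightarrow> 'a) \<Rightarrow> (nat \<Rightarrow> 'a set) \<Rightarrow>
     ('b, 'l) ring_scheme \<Rightarrow> (complex \<Rightarrow> 'b) \<Rightarrow> (nat \<Rightarrow> 'b set) \<Rightarrow> bool"
  where "graded_algebra_iso A \<iota>\<^sub>A D\<^sub>A B \<iota>\<^sub>B D\<^sub>B \<longleftrightarrow>
    (\<exists>\<phi>\<in>ring_iso A B. (\<forall>c. \<phi> (\<iota>\<^sub>A c) = \<iota>\<^sub>B c) \<and> (\<forall>k. \<phi> ` D\<^sub>A k = D\<^sub>B k))"

section \<open>Cochains and Drinfeld orbifold algebra maps\<close>

text \<open>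
  Throughout, \<open>G\<close> is a finite group, \<open>\<rho>\<close> its linear action on the ambient space and \<open>V\<close> a \<open>G\<close>-stable
  subspace.  Components \<open>\<kappa> g\<close> of cochains are functions on the ambient space of which only the
  restriction to \<open>V \<times> V\<close> matters.
\<close>

definition skew_bilinear_on ::
    "('i \<Rightarrow>\<^sub>0 complex) set \<Rightarrow> (complex \<Rightarrow> 'w \<Rightarrow> 'w) \<Rightarrow> 'w set \<Rightarrow>
     (('i \<Rightarrow>\<^sub>0 complex) \<Rightarrow> ('i \<Rightarrow>\<^sub>0 complex) \<Rightarrow> 'w::ab_group_add) \<Rightarrow> bool"
  where "skew_bilinear_on V scale U B \<longleftrightarrow>
    (\<forall>u\<in>V. \<forall>v\<in>V. B u v \<in> U \<and> B u v = - B v u) \<and>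
    (\<forall>u\<in>V. \<forall>u'\<in>V. \<forall>v\<in>V. B (u + u') v = B u v + B u' v) \<and>
    (\<forall>c. \<forall>u\<in>V. \<forall>v\<in>V. B (c *\<^sub>c u) v = scale c (B u v))"

definition linear_cochain ::
    "('g, 'k) monoid_scheme \<Rightarrow> ('i \<Rightarrow>\<^sub>0 complex) set \<Rightarrow>
     ('g \<Rightarrow> ('i \<Rightarrow>\<^sub>0 complex) \<Rightarrow> ('i \<Rightarrow>\<^sub>0 complex) \<Rightarrow> ('i \<Rightarrow>\<^sub>0 complex)) \<Rightarrow> bool"
  where "linear_cochain G V \<kappa>L \<longleftrightarrow> (\<forall>g\<in>carrier G. skew_bilinear_on V cscale V (\<kappa>L g))"

definition constant_cochain ::
    "('g, 'k) monoid_scheme \<Rightarrow> ('i \<Rightarrow>\<^sub>0 complex) set \<Rightarrow>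
     ('g \<Rightarrow> ('i \<Rightarrow>\<^sub>0 complex) \<Rightarrow> ('i \<Rightarrow>\<^sub>0 complex) \<Rightarrow> complex) \<Rightarrow> bool"
  where "constant_cochain G V \<kappa>C \<longleftrightarrow> (\<forall>g\<in>carrier G. skew_bilinear_on V (*) UNIV (\<kappa>C g))"

definition supported_only_on ::
    "('g, 'k) monoid_scheme \<Rightarrow> 'v set \<Rightarrow> ('g \<Rightarrow> 'v \<Rightarrow> 'v \<Rightarrow> 'w::zero) \<Rightarrow> 'g set \<Rightarrow> bool"
  where "supported_only_on G V \<kappa> X \<longleftrightarrow> (\<forall>g\<in>carrier G. g \<notin> X \<longrightarrow> (\<forall>u\<in>V. \<forall>v\<in>V. \<kappa> g u v = 0))"

definition supported_only_off ::
    "('g, 'k) monoid_scheme \<Rightarrow> 'v set \<Rightarrow> ('g \<Rightarrow> 'v \<Rightarrow> 'v \<Rightarrow> 'w::zero) \<Rightarrow> 'g set \<Rightarrow> bool"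
  where "supported_only_off G V \<kappa> X \<longleftrightarrow> (\<forall>g\<in>carrier G. g \<in> X \<longrightarrow> (\<forall>u\<in>V. \<forall>v\<in>V. \<kappa> g u v = 0))"

definition zero_cochain ::
    "('g, 'k) monoid_scheme \<Rightarrow> 'v set \<Rightarrow> ('g \<Rightarrow> 'v \<Rightarrow> 'v \<Rightarrow> 'w::zero) \<Rightarrow> bool"
  where "zero_cochain G V \<kappa> \<longleftrightarrow> (\<forall>g\<in>carrier G. \<forall>u\<in>V. \<forall>v\<in>V. \<kappa> g u v = 0)"

text \<open>The sum of \<open>F v\<^bsub>\<sigma>(1)\<^esub> v\<^bsub>\<sigma>(2)\<^esub> v\<^bsub>\<sigma>(3)\<^esub>\<close> over the three cyclic permutations \<open>\<sigma>\<close> in \<open>Alt\<^sub>3\<close>.\<close>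

definition alt3_sum :: "('v \<Rightarrow> 'v \<Rightarrow> 'v \<Rightarrow> 'w::comm_monoid_add) \<Rightarrow> 'v \<Rightarrow> 'v \<Rightarrow> 'v \<Rightarrow> 'w"
  where "alt3_sum F v1 v2 v3 = F v1 v2 v3 + F v2 v3 v1 + F v3 v1 v2"

definition drinfeld_orbifold_map ::
    "('g, 'k) monoid_scheme \<Rightarrow> ('g \<Rightarrow> ('i \<Rightarrow>\<^sub>0 complex) \<Rightarrow> ('i \<Rightarrow>\<^sub>0 complex)) \<Rightarrow> ('i \<Rightarrow>\<^sub>0 complex) set \<Rightarrow>
     ('g \<Rightarrow> ('i \<Rightarrow>\<^sub>0 complex) \<Rightarrow> ('i \<Rightarrow>\<^sub>0 complex) \<Rightarrow> ('i \<Rightarrow>\<^sub>0 complex)) \<Rightarrow>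
     ('g \<Rightarrow> ('i \<Rightarrow>\<^sub>0 complex) \<Rightarrow> ('i \<Rightarrow>\<^sub>0 complex) \<Rightarrow> complex) \<Rightarrow> bool"
  where "drinfeld_orbifold_map G \<rho> V \<kappa>L \<kappa>C \<longleftrightarrow>
    linear_cochain G V \<kappa>L \<and> constant_cochain G V \<kappa>C \<and>
    (\<forall>g\<in>carrier G. \<forall>u\<in>V. \<forall>v\<in>V. \<rho> g (\<kappa>L g u v) = \<kappa>L g u v) \<and>
    (\<forall>g\<in>carrier G. \<forall>h\<in>carrier G. \<forall>u\<in>V. \<forall>v\<in>V.
       \<rho> h (\<kappa>L g u v) = \<kappa>L (h \<otimes>\<^bsub>G\<^esub> g \<otimes>\<^bsub>G\<^esub> inv\<^bsub>G\<^esub> h) (\<rho> h u) (\<rho> h v)) \<and>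
    (\<forall>g\<in>carrier G. \<forall>h\<in>carrier G. \<forall>u\<in>V. \<forall>v\<in>V.
       \<kappa>C g u v = \<kappa>C (h \<otimes>\<^bsub>G\<^esub> g \<otimes>\<^bsub>G\<^esub> inv\<^bsub>G\<^esub> h) (\<rho> h u) (\<rho> h v)) \<and>
    (\<forall>g\<in>carrier G. \<forall>v1\<in>V. \<forall>v2\<in>V. \<forall>v3\<in>V.
       alt3_sum (\<lambda>v1 v2 v3. svec (\<kappa>L g v2 v3) * svec (\<rho> g v1 - v1)) v1 v2 v3 = 0) \<and>
    (\<forall>g\<in>carrier G. \<forall>v1\<in>V. \<forall>v2\<in>V. \<forall>v3\<in>V.
       alt3_sum (\<lambda>v1 v2 v3. \<Sum>(x, y)\<in>factorizations G g. \<kappa>L x (v1 + \<rho> y v1) (\<kappa>L y v2 v3)) v1 v2 v3 =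
       2 *\<^sub>c alt3_sum (\<lambda>v1 v2 v3. \<kappa>C g v2 v3 *\<^sub>c (\<rho> g v1 - v1)) v1 v2 v3) \<and>
    (\<forall>g\<in>carrier G. \<forall>v1\<in>V. \<forall>v2\<in>V. \<forall>v3\<in>V.
       alt3_sum (\<lambda>v1 v2 v3. \<Sum>(x, y)\<in>factorizations G g. \<kappa>C x (v1 + \<rho> y v1) (\<kappa>L y v2 v3)) v1 v2 v3 = 0)"

definition lie_orbifold_map ::
    "('g, 'k) monoid_scheme \<Rightarrow> ('g \<Rightarrow> ('i \<Rightarrow>\<^sub>0 complex) \<Rightarrow> ('i \<Rightarrow>\<^sub>0 complex)) \<Rightarrow> ('i \<Rightarrow>\<^sub>0 complex) set \<Rightarrow>
     ('g \<Rightarrow> ('i \<Rightarrow>\<^sub>0 complex) \<Rightarrow> ('i \<Rightarrow>\<^sub>0 complex) \<Rightarrow> ('i \<Rightarrow>\<^sub>0 complex)) \<Rightarrow>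
     ('g \<Rightarrow> ('i \<Rightarrow>\<^sub>0 complex) \<Rightarrow> ('i \<Rightarrow>\<^sub>0 complex) \<Rightarrow> complex) \<Rightarrow> bool"
  where "lie_orbifold_map G \<rho> V \<kappa>L \<kappa>C \<longleftrightarrow>
    drinfeld_orbifold_map G \<rho> V \<kappa>L \<kappa>C \<and> supported_only_on G V \<kappa>L {\<one>\<^bsub>G\<^esub>}"

section \<open>The algebra \<open>H\<^sub>\<kappa>\<close>\<close>

definition tensor_skew ::
    "('g, 'k) monoid_scheme \<Rightarrow> ('g \<Rightarrow> ('i \<Rightarrow>\<^sub>0 complex) \<Rightarrow> ('i \<Rightarrow>\<^sub>0 complex)) \<Rightarrow> ('i \<Rightarrow>\<^sub>0 complex) set \<Rightarrow>
     ('g \<Rightarrow> ('i list \<Rightarrow>\<^sub>0 complex)) ring"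
  where "tensor_skew G \<rho> V = skew_group_algebra (tensor_algebra V) G (\<lambda>g. tensor_map (\<rho> g))"

definition sym_skew ::
    "('g, 'k) monoid_scheme \<Rightarrow> ('g \<Rightarrow> ('i \<Rightarrow>\<^sub>0 complex) \<Rightarrow> ('i \<Rightarrow>\<^sub>0 complex)) \<Rightarrow> ('i \<Rightarrow>\<^sub>0 complex) set \<Rightarrow>
     ('g \<Rightarrow> ('i multiset \<Rightarrow>\<^sub>0 complex)) ring"
  where "sym_skew G \<rho> V = skew_group_algebra (sym_algebra V) G (\<lambda>g. sym_map (\<rho> g))"

text \<open>The element \<open>vw - wv - \<kappa>L(v,w) - \<kappa>C(v,w)\<close> of \<open>T(V) # G\<close>.\<close>

definition orbifold_relator ::
    "('g, 'k) monoid_scheme \<Rightarrow>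
     ('g \<Rightarrow> ('i \<Rightarrow>\<^sub>0 complex) \<Rightarrow> ('i \<Rightarrow>\<^sub>0 complex) \<Rightarrow> ('i \<Rightarrow>\<^sub>0 complex)) \<Rightarrow>
     ('g \<Rightarrow> ('i \<Rightarrow>\<^sub>0 complex) \<Rightarrow> ('i \<Rightarrow>\<^sub>0 complex) \<Rightarrow> complex) \<Rightarrow>
     ('i \<Rightarrow>\<^sub>0 complex) \<Rightarrow> ('i \<Rightarrow>\<^sub>0 complex) \<Rightarrow> 'g \<Rightarrow> ('i list \<Rightarrow>\<^sub>0 complex)"
  where "orbifold_relator G \<kappa>L \<kappa>C v w = (\<lambda>g.
    ((tvec v * tvec w - tvec w * tvec v) when g = \<one>\<^bsub>G\<^esub>)
    - ((tvec (\<kappa>L g v w) + Poly_Mapping.single 0 (\<kappa>C g v w)) when g \<in> carrier G))"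

definition orbifold_ideal ::
    "('g, 'k) monoid_scheme \<Rightarrow> ('g \<Rightarrow> ('i \<Rightarrow>\<^sub>0 complex) \<Rightarrow> ('i \<Rightarrow>\<^sub>0 complex)) \<Rightarrow> ('i \<Rightarrow>\<^sub>0 complex) set \<Rightarrow>
     ('g \<Rightarrow> ('i \<Rightarrow>\<^sub>0 complex) \<Rightarrow> ('i \<Rightarrow>\<^sub>0 complex) \<Rightarrow> ('i \<Rightarrow>\<^sub>0 complex)) \<Rightarrow>
     ('g \<Rightarrow> ('i \<Rightarrow>\<^sub>0 complex) \<Rightarrow> ('i \<Rightarrow>\<^sub>0 complex) \<Rightarrow> complex) \<Rightarrow>
     ('g \<Rightarrow> ('i list \<Rightarrow>\<^sub>0 complex)) set"
  where "orbifold_ideal G \<rho> V \<kappa>L \<kappa>C =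
    Idl\<^bsub>tensor_skew G \<rho> V\<^esub> {orbifold_relator G \<kappa>L \<kappa>C v w | v w. v \<in> V \<and> w \<in> V}"

definition orbifold_algebra ::
    "('g, 'k) monoid_scheme \<Rightarrow> ('g \<Rightarrow> ('i \<Rightarrow>\<^sub>0 complex) \<Rightarrow> ('i \<Rightarrow>\<^sub>0 complex)) \<Rightarrow> ('i \<Rightarrow>\<^sub>0 complex) set \<Rightarrow>
     ('g \<Rightarrow> ('i \<Rightarrow>\<^sub>0 complex) \<Rightarrow> ('i \<Rightarrow>\<^sub>0 complex) \<Rightarrow> ('i \<Rightarrow>\<^sub>0 complex)) \<Rightarrow>
     ('g \<Rightarrow> ('i \<Rightarrow>\<^sub>0 complex) \<Rightarrow> ('i \<Rightarrow>\<^sub>0 complex) \<Rightarrow> complex) \<Rightarrow>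
     ('g \<Rightarrow> ('i list \<Rightarrow>\<^sub>0 complex)) set ring"
  where "orbifold_algebra G \<rho> V \<kappa>L \<kappa>C = tensor_skew G \<rho> V Quot orbifold_ideal G \<rho> V \<kappa>L \<kappa>C"

definition orbifold_filtration ::
    "('g, 'k) monoid_scheme \<Rightarrow> ('g \<Rightarrow> ('i \<Rightarrow>\<^sub>0 complex) \<Rightarrow> ('i \<Rightarrow>\<^sub>0 complex)) \<Rightarrow> ('i \<Rightarrow>\<^sub>0 complex) set \<Rightarrow>
     ('g \<Rightarrow> ('i \<Rightarrow>\<^sub>0 complex) \<Rightarrow> ('i \<Rightarrow>\<^sub>0 complex) \<Rightarrow> ('i \<Rightarrow>\<^sub>0 complex)) \<Rightarrow>
     ('g \<Rightarrow> ('i \<Rightarrow>\<^sub>0 complex) \<Rightarrow> ('i \<Rightarrow>\<^sub>0 complex) \<Rightarrow> complex) \<Rightarrow>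
     nat \<Rightarrow> ('g \<Rightarrow> ('i list \<Rightarrow>\<^sub>0 complex)) set set"
  where "orbifold_filtration G \<rho> V \<kappa>L \<kappa>C k =
    {orbifold_ideal G \<rho> V \<kappa>L \<kappa>C +>\<^bsub>tensor_skew G \<rho> V\<^esub> f | f.
       f \<in> carrier (tensor_skew G \<rho> V) \<and> (\<forall>g\<in>carrier G. f g \<in> tensor_upto V k)}"

definition orbifold_scalar ::
    "('g, 'k) monoid_scheme \<Rightarrow> ('g \<Rightarrow> ('i \<Rightarrow>\<^sub>0 complex) \<Rightarrow> ('i \<Rightarrow>\<^sub>0 complex)) \<Rightarrow> ('i \<Rightarrow>\<^sub>0 complex) set \<Rightarrow>
     ('g \<Rightarrow> ('i \<Rightarrow>\<^sub>0 complex) \<Rightarrow> ('i \<Rightarrow>\<^sub>0 complex) \<Rightarrow> ('i \<Rightarrow>\<^sub>0 complex)) \<Rightarrow>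
     ('g \<Rightarrow> ('i \<Rightarrow>\<^sub>0 complex) \<Rightarrow> ('i \<Rightarrow>\<^sub>0 complex) \<Rightarrow> complex) \<Rightarrow>
     complex \<Rightarrow> ('g \<Rightarrow> ('i list \<Rightarrow>\<^sub>0 complex)) set"
  where "orbifold_scalar G \<rho> V \<kappa>L \<kappa>C c =
    orbifold_ideal G \<rho> V \<kappa>L \<kappa>C +>\<^bsub>tensor_skew G \<rho> V\<^esub> (\<lambda>g. Poly_Mapping.single 0 c when g = \<one>\<^bsub>G\<^esub>)"

definition is_drinfeld_orbifold_algebra ::
    "('g, 'k) monoid_scheme \<Rightarrow> ('g \<Rightarrow> ('i \<Rightarrow>\<^sub>0 complex) \<Rightarrow> ('i \<Rightarrow>\<^sub>0 complex)) \<Rightarrow> ('i \<Rightarrow>\<^sub>0 complex) set \<Rightarrow>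
     ('g \<Rightarrow> ('i \<Rightarrow>\<^sub>0 complex) \<Rightarrow> ('i \<Rightarrow>\<^sub>0 complex) \<Rightarrow> ('i \<Rightarrow>\<^sub>0 complex)) \<Rightarrow>
     ('g \<Rightarrow> ('i \<Rightarrow>\<^sub>0 complex) \<Rightarrow> ('i \<Rightarrow>\<^sub>0 complex) \<Rightarrow> complex) \<Rightarrow> bool"
  where "is_drinfeld_orbifold_algebra G \<rho> V \<kappa>L \<kappa>C \<longleftrightarrow>
    (let H = orbifold_algebra G \<rho> V \<kappa>L \<kappa>C; F = orbifold_filtration G \<rho> V \<kappa>L \<kappa>C in
     graded_algebra_iso
       (assoc_graded H F)
       (\<lambda>c k. fil_below H F k +>\<^bsub>H\<^esub> (if k = 0 then orbifold_scalar G \<rho> V \<kappa>L \<kappa>C c else \<zero>\<^bsub>H\<^esub>))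
       (graded_part H F)
       (sym_skew G \<rho> V)
       (\<lambda>c g. Poly_Mapping.single 0 c when g = \<one>\<^bsub>G\<^esub>)
       (\<lambda>k. {f \<in> carrier (sym_skew G \<rho> V). \<forall>g\<in>carrier G. f g \<in> sym_power V k}))"

section \<open>The doubled standard representation of \<open>S\<^sub>n\<close>\<close>

text \<open>
  \<open>W\<^sup>* \<oplus> W\<close> is spanned by \<open>x\<^sub>i = xb i\<close> and \<open>y\<^sub>i = yb i\<close> for \<open>1 \<le> i \<le> n\<close> inside the space with basis
  \<open>nat + nat\<close>, on which permutations act by \<open>x\<^sub>i \<mapsto> x\<^bsub>\<sigma>(i)\<^esub>\<close> and \<open>y\<^sub>i \<mapsto> y\<^bsub>\<sigma>(i)\<^esub>\<close>.
\<close>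

type_synonym xy_space = "nat + nat \<Rightarrow>\<^sub>0 complex"

definition perm_act :: "(nat \<Rightarrow> nat) \<Rightarrow> xy_space \<Rightarrow> xy_space"
  where "perm_act \<sigma> v =
    (\<Sum>b\<in>Poly_Mapping.keys v. Poly_Mapping.single (map_sum \<sigma> \<sigma> b) (Poly_Mapping.lookup v b))"

definition xb :: "nat \<Rightarrow> xy_space" where "xb i = Poly_Mapping.single (Inl i) 1"

definition yb :: "nat \<Rightarrow> xy_space" where "yb i = Poly_Mapping.single (Inr i) 1"

definition xbar :: "nat \<Rightarrow> nat \<Rightarrow> xy_space"
  where "xbar n i = xb i - (1 / of_nat n) *\<^sub>c (\<Sum>j\<in>{1..n}. xb j)"

definition ybar :: "nat \<Rightarrow> nat \<Rightarrow> xy_space"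
  where "ybar n i = yb i - (1 / of_nat n) *\<^sub>c (\<Sum>j\<in>{1..n}. yb j)"

definition doubled_std :: "nat \<Rightarrow> xy_space set"
  where "doubled_std n = cvs.span (xbar n ` {1..n} \<union> ybar n ` {1..n})"

text \<open>
  The three-parameter family, given componentwise: a summand \<open>w \<otimes> h\<close> of a value contributes
  \<open>w when g = h\<close> to the component at \<open>g\<close>.  The cycle \<open>(i j k)\<close> sends \<open>i\<close> to \<open>j\<close>, \<open>j\<close> to \<open>k\<close> and \<open>k\<close>
  to \<open>i\<close>.  Together with bilinearity and skew-symmetry the values determine \<open>\<kappa>\<close> on \<open>doubled_std n\<close>.
\<close>

definition three_cycle_diff :: "nat \<Rightarrow> nat \<Rightarrow> nat \<Rightarrow> (nat \<Rightarrow> nat) \<Rightarrow> complex"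
  where "three_cycle_diff n i j g =
    (\<Sum>k\<in>{1..n} - {i, j}. (1 when g = cycle_of_list [i, j, k]) - (1 when g = cycle_of_list [k, j, i]))"

definition in_family ::
    "nat \<Rightarrow> complex \<Rightarrow> complex \<Rightarrow> complex \<Rightarrow>
     ((nat \<Rightarrow> nat) \<Rightarrow> xy_space \<Rightarrow> xy_space \<Rightarrow> xy_space) \<Rightarrow>
     ((nat \<Rightarrow> nat) \<Rightarrow> xy_space \<Rightarrow> xy_space \<Rightarrow> complex) \<Rightarrow> bool"
  where "in_family n a b c \<kappa>L \<kappa>C \<longleftrightarrow>
    linear_cochain (sym_group n) (doubled_std n) \<kappa>L \<and>
    constant_cochain (sym_group n) (doubled_std n) \<kappa>C \<and>
    (\<forall>g\<in>carrier (sym_group n). \<forall>i\<in>{1..n}. \<forall>j\<in>{1..n}. i \<noteq> j \<longrightarrow>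
       \<kappa>L g (xbar n i) (xbar n j) = 0 \<and>
       \<kappa>L g (ybar n i) (ybar n j) = 0 \<and>
       \<kappa>L g (xbar n i) (ybar n i) =
         (- (of_nat n / 2)) *\<^sub>c (\<Sum>k\<in>{1..n} - {i}.
            (a *\<^sub>c (xbar n i + xbar n k) + b *\<^sub>c (ybar n i + ybar n k)) when g = cycle_of_list [i, k]) \<and>
       \<kappa>L g (xbar n i) (ybar n j) =
         (of_nat n / 2) *\<^sub>c
            ((a *\<^sub>c (xbar n i + xbar n j) + b *\<^sub>c (ybar n i + ybar n j)) when g = cycle_of_list [i, j]) \<and>
       \<kappa>C g (xbar n i) (xbar n j) = (of_nat n)\<^sup>2 / 4 * b\<^sup>2 * three_cycle_diff n i j g \<and>
       \<kappa>C g (ybar n i) (ybar n j) = (of_nat n)\<^sup>2 / 4 * a\<^sup>2 * three_cycle_diff n i j g \<and>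
       \<kappa>C g (xbar n i) (ybar n i) = c * (\<Sum>k\<in>{1..n} - {i}. 1 when g = cycle_of_list [i, k]) \<and>
       \<kappa>C g (xbar n i) (ybar n j) =
         - c * (1 when g = cycle_of_list [i, j])
         - (of_nat n)\<^sup>2 / 4 * a * b * three_cycle_diff n i j g)"

end

theory Submission
  imports Defs
begin

text \<open>
  \<^bold>\<open>Existence.\<close> The relations of the three-parameter family hold for operators of Dunkl type.  Put
  \<open>\<xi>\<^sub>i = \<alpha> x\<^sub>i + \<beta> y\<^sub>i\<close> for the barred vectors, viewed as functions of a point \<open>z\<close>, write \<open>s\<^bsub>ij\<^esub>\<close> for the
  transposition of \<open>i\<close> and \<open>j\<close>, and let \<open>v\<close> act on functions by
  \<open>D\<^sub>v F(z) = v(z) F(z) / e + 1/2 \<Sum>\<^bsub>i,j\<^esub> \<theta>\<^bsub>ij\<^esub>(v) \<phi>\<^bsub>ij\<^esub>(z) F(s\<^bsub>ij\<^esub> z)\<close>,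
  where \<open>\<theta>\<^bsub>ij\<^esub>\<close> is a linear form that vanishes on all \<open>\<xi>\<^sub>k\<close> and \<open>\<phi>\<^bsub>ij\<^esub>\<close> has the denominator
  \<open>\<xi>\<^sub>i(z) - \<xi>\<^sub>j(z)\<close>.  The terms of the commutator \<open>[D\<^sub>u, D\<^sub>v]\<close> with one transposition give \<open>\<kappa>L\<close> and the
  parameter \<open>c\<close> (\<open>first_order\<close>).  In those with two transpositions the disjoint pairs cancel, and
  the denominators of each three-cycle cancel by an identity of Lagrange type (\<open>second_order\<close>).

  As \<open>e\<close> tends to zero, \<open>e D\<^sub>v\<close> becomes multiplication by \<open>v\<close>.  Hence an element of the defining ideal,
  which acts by zero, has vanishing top-degree part, because points with trivial stabilizer separate
  the group elements.  So the associated graded algebra, which is never larger than \<open>S(V) # G\<close>, is not smaller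
  either (\<open>orbifold_rep.top_symbol_ideal_zero\<close>, \<open>pbw_cochains.pbw\<close>).  The same limit, applied to
  the Jacobi identity for three operators and compared in the orders \<open>e\<^sup>-\<^sup>2\<close>, \<open>e\<^sup>-\<^sup>1\<close> and \<open>e\<^sup>0\<close>, yields the
  linear and the quadratic conditions on a Drinfeld orbifold algebra map (\<open>orbifold_rep.drinfeld\<close>).

  \<^bold>\<open>Linear part on the identity.\<close> An invariant bracket consists of invariant tensors of the
  standard representation.  The antisymmetric ones vanish and the others form a line, so only the mixed
  brackets survive, with two parameters, and the Jacobi identity kills these
  (\<open>invariant_bracket.lie_zero\<close>).

  \<^bold>\<open>Linear part off the identity.\<close> The value of \<open>\<kappa>L\<close> at \<open>g\<close>, evaluated at a point fixed by \<open>g\<close>, is a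
  scalar form \<open>C\<close> with \<open>C(v\<^sub>2, v\<^sub>3) (g v\<^sub>1 - v\<^sub>1) + (cyclic) = 0\<close>.  A nonzero form of this kind forces \<open>g - 1\<close>
  to have rank at most two, so \<open>g\<close> is the identity or a transposition, and in the latter case \<open>C\<close> is
  unique up to a factor (locale \<open>compatible_form\<close>).  Invariance under the stabilizer of a transposition
  then leaves the two parameters \<open>a\<close> and \<open>b\<close>.  The difference of the constant part and that of the family
  obeys the same kind of condition, which leaves the parameter \<open>c\<close> and a form at the identity;
  the last condition shows that this form has the vectors \<open>a x\<^sub>i + b y\<^sub>i\<close> in its kernel, and an invariant form
  with this property is zero unless \<open>a = b = 0\<close> (\<open>drinfeld_pair.\<delta>_id_zero\<close>).
\<close>


section \<open>Linear extension from a basis\<close>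

definition lin_ext :: "('k \<Rightarrow> ('w \<Rightarrow>\<^sub>0 complex)) \<Rightarrow> ('k \<Rightarrow>\<^sub>0 complex) \<Rightarrow> ('w \<Rightarrow>\<^sub>0 complex)"
  where "lin_ext h p = (\<Sum>k\<in>Poly_Mapping.keys p. Poly_Mapping.lookup p k *\<^sub>c h k)"

definition lin_form :: "('k \<Rightarrow> complex) \<Rightarrow> ('k \<Rightarrow>\<^sub>0 complex) \<Rightarrow> complex"
  where "lin_form h p = (\<Sum>k\<in>Poly_Mapping.keys p. Poly_Mapping.lookup p k * h k)"

lemma cscale_eq_single_times: "c *\<^sub>c p = Poly_Mapping.single 0 c * (p :: 'a::monoid_add \<Rightarrow>\<^sub>0 complex)"
  by (simp add: cscale_def mult_map_scale_conv_mult)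

lemma cscale_times_left: "(c *\<^sub>c p) * q = c *\<^sub>c (p * (q :: 'a::monoid_add \<Rightarrow>\<^sub>0 complex))"
  by (simp add: cscale_eq_single_times mult.assoc)

lemma cscale_single: "c *\<^sub>c Poly_Mapping.single k d = Poly_Mapping.single k (c * d)"
  by (rule poly_mapping_eqI) (simp add: lookup_single when_def)

lemma lin_ext_superset:
  assumes "finite A" "Poly_Mapping.keys p \<subseteq> A"
  shows "lin_ext h p = (\<Sum>k\<in>A. Poly_Mapping.lookup p k *\<^sub>c h k)"
  unfolding lin_ext_def using assms
  by (intro sum.mono_neutral_left) (auto simp: in_keys_iff)

lemma lin_form_superset:
  assumes "finite A" "Poly_Mapping.keys p \<subseteq> A"
  shows "lin_form h p = (\<Sum>k\<in>A. Poly_Mapping.lookup p k * h k)"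
  unfolding lin_form_def using assms
  by (intro sum.mono_neutral_left) (auto simp: in_keys_iff)

lemma lin_ext_zero [simp]: "lin_ext h 0 = 0"
  by (simp add: lin_ext_def)

lemma lin_form_zero [simp]: "lin_form h 0 = 0"
  by (simp add: lin_form_def)

lemma lin_ext_single [simp]: "lin_ext h (Poly_Mapping.single k c) = c *\<^sub>c h k"
  by (simp add: lin_ext_def)

lemma lin_form_single [simp]: "lin_form h (Poly_Mapping.single k c) = c * h k"
  by (simp add: lin_form_def)

lemma lin_ext_add: "lin_ext h (p + q) = lin_ext h p + lin_ext h q"
proof -
  let ?A = "Poly_Mapping.keys p \<union> Poly_Mapping.keys q"
  have "lin_ext h (p + q) = (\<Sum>k\<in>?A. Poly_Mapping.lookup (p + q) k *\<^sub>c h k)"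
    by (rule lin_ext_superset) (use keys_add[of p q] in auto)
  moreover have "lin_ext h p = (\<Sum>k\<in>?A. Poly_Mapping.lookup p k *\<^sub>c h k)"
    by (rule lin_ext_superset) auto
  moreover have "lin_ext h q = (\<Sum>k\<in>?A. Poly_Mapping.lookup q k *\<^sub>c h k)"
    by (rule lin_ext_superset) auto
  ultimately show ?thesis
    by (simp add: lookup_add cvs.scale_left_distrib sum.distrib)
qed

lemma lin_form_add: "lin_form h (p + q) = lin_form h p + lin_form h q"
proof -
  let ?A = "Poly_Mapping.keys p \<union> Poly_Mapping.keys q"
  have "lin_form h (p + q) = (\<Sum>k\<in>?A. Poly_Mapping.lookup (p + q) k * h k)"
    by (rule lin_form_superset) (use keys_add[of p q] in auto)
  moreover have "lin_form h p = (\<Sum>k\<in>?A. Poly_Mapping.lookup p k * h k)"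
    by (rule lin_form_superset) auto
  moreover have "lin_form h q = (\<Sum>k\<in>?A. Poly_Mapping.lookup q k * h k)"
    by (rule lin_form_superset) auto
  ultimately show ?thesis
    by (simp add: lookup_add algebra_simps sum.distrib)
qed

lemma keys_cscale: "Poly_Mapping.keys (c *\<^sub>c p) \<subseteq> Poly_Mapping.keys p"
  by (auto simp: in_keys_iff)

lemma lin_ext_cscale: "lin_ext h (c *\<^sub>c p) = c *\<^sub>c lin_ext h p"
  by (subst lin_ext_superset[OF _ keys_cscale])
     (simp_all add: lin_ext_def cvs.scale_sum_right)

lemma lin_form_cscale: "lin_form h (c *\<^sub>c p) = c * lin_form h p"
  by (subst lin_form_superset[OF _ keys_cscale])
     (simp_all add: lin_form_def sum_distrib_left mult.assoc)

lemma additive_uminus_diff: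
  fixes f :: "'a::ab_group_add \<Rightarrow> 'b::ab_group_add"
  assumes "\<And>x y. f (x + y) = f x + f y"
  shows "f 0 = 0" "f (- x) = - f x" "f (x - y) = f x - f y"
proof -
  show z: "f 0 = 0" using assms[of 0 0] by simp
  have m: "f (- x) = - f x" for x
    using assms[of x "- x"] z by (simp add: eq_neg_iff_add_eq_0 add.commute)
  show "f (- x) = - f x" by (rule m)
  show "f (x - y) = f x - f y" using assms[of x "- y"] m[of y] by simp
qed

lemma additive_sum:
  fixes f :: "'a::ab_group_add \<Rightarrow> 'b::ab_group_add"
  assumes "\<And>x y. f (x + y) = f x + f y"
  shows "f (\<Sum>i\<in>I. g i) = (\<Sum>i\<in>I. f (g i))"
  by (induction I rule: infinite_finite_induct)
     (simp_all add: additive_uminus_diff(1)[OF assms] assms)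

lemmas lin_ext_diff = additive_uminus_diff(3)[of "lin_ext h" for h, OF lin_ext_add]
lemmas lin_ext_sum = additive_sum[of "lin_ext h" for h, OF lin_ext_add]
lemmas lin_form_diff = additive_uminus_diff(3)[of "lin_form h" for h, OF lin_form_add]
lemmas lin_form_uminus = additive_uminus_diff(2)[of "lin_form h" for h, OF lin_form_add]
lemmas lin_form_sum = additive_sum[of "lin_form h" for h, OF lin_form_add]

lemma poly_mapping_sum_singles:
  "(\<Sum>k\<in>Poly_Mapping.keys p. Poly_Mapping.single k (Poly_Mapping.lookup p k)) = (p :: 'k \<Rightarrow>\<^sub>0 complex)"
  by (rule poly_mapping_eqI)
     (auto simp: lookup_sum lookup_single when_def in_keys_iff sum.delta)

lemma lin_ext_basis [simp]: "lin_ext (\<lambda>k. Poly_Mapping.single k 1) p = p"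
  by (simp add: lin_ext_def cscale_single poly_mapping_sum_singles)

text \<open>Linear identities reduce to words or monomials.  Only basis elements in the support occur, which
  keeps degree bounds available.\<close>

lemma poly_mapping_linear_induct [case_names basis cscale add zero]:
  fixes p :: "'k \<Rightarrow>\<^sub>0 complex"
  assumes "\<And>k. k \<in> Poly_Mapping.keys p \<Longrightarrow> Q (Poly_Mapping.single k 1)"
    "\<And>c q. Q q \<Longrightarrow> Q (c *\<^sub>c q)" "\<And>q r. Q q \<Longrightarrow> Q r \<Longrightarrow> Q (q + r)" "Q 0"
  shows "Q p"
proof -
  have "Q (\<Sum>k\<in>A. Poly_Mapping.lookup p k *\<^sub>c Poly_Mapping.single k 1)"
    if "A \<subseteq> Poly_Mapping.keys p" for A
    using finite_subset[OF that finite_keys] that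
    by (induction A rule: finite_induct) (auto intro!: assms)
  from this[of "Poly_Mapping.keys p"] show ?thesis
    by (simp add: cscale_single poly_mapping_sum_singles)
qed

lemma times_single_zero: "p * Poly_Mapping.single 0 c = c *\<^sub>c (p :: 'a::monoid_add \<Rightarrow>\<^sub>0 complex)"
  by (induction p rule: poly_mapping_linear_induct)
     (simp_all add: mult_single cscale_single cscale_times_left cvs.scale_right_distrib distrib_right
        cvs.scale_left_commute)

lemma cscale_times_right: "p * (c *\<^sub>c q) = c *\<^sub>c (p * (q :: 'a::monoid_add \<Rightarrow>\<^sub>0 complex))"
proof -
  have "p * (c *\<^sub>c q) = (p * Poly_Mapping.single 0 c) * q"
    by (simp add: cscale_eq_single_times mult.assoc)
  then show ?thesis by (simp add: times_single_zero cscale_times_left)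
qed

lemma lin_ext_comp: "lin_ext h (lin_ext h' p) = lin_ext (\<lambda>k. lin_ext h (h' k)) p"
  by (simp add: lin_ext_def[of h'] lin_ext_def[of "\<lambda>k. lin_ext h (h' k)"] lin_ext_sum lin_ext_cscale)

lemma lin_form_lin_ext: "lin_form h (lin_ext h' p) = lin_form (\<lambda>k. lin_form h (h' k)) p"
  by (simp add: lin_ext_def[of h'] lin_form_def[of "\<lambda>k. lin_form h (h' k)"] lin_form_sum lin_form_cscale)

lemma lin_ext_times:
  fixes h :: "'k::monoid_add \<Rightarrow> ('w::monoid_add \<Rightarrow>\<^sub>0 complex)"
  assumes "\<And>k l. h (k + l) = h k * h l"
  shows "lin_ext h (p * q) = lin_ext h p * lin_ext h q"
proof (induction p rule: poly_mapping_linear_induct)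
  case (basis k)
  show ?case
    by (induction q rule: poly_mapping_linear_induct)
       (simp_all add: mult_single assms lin_ext_add lin_ext_cscale distrib_left cscale_times_right)
qed (simp_all add: lin_ext_add lin_ext_cscale distrib_right cscale_times_left)

lemma lin_form_times:
  fixes h :: "'k::monoid_add \<Rightarrow> complex"
  assumes "\<And>k l. h (k + l) = h k * h l"
  shows "lin_form h (p * q) = lin_form h p * lin_form h q"
proof (induction p rule: poly_mapping_linear_induct)
  case (basis k)
  show ?case
    by (induction q rule: poly_mapping_linear_induct)
       (simp_all add: mult_single assms lin_form_add lin_form_cscale distrib_left cscale_times_right)
qed (simp_all add: lin_form_add lin_form_cscale distrib_right cscale_times_left)

lemma linear_eq_lin_ext:
  assumes "Vector_Spaces.linear cscale cscale f"
  shows "f p = lin_ext (\<lambda>k. f (Poly_Mapping.single k 1)) p"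
proof -
  interpret f: Vector_Spaces.linear cscale cscale f by fact
  show ?thesis
    by (induction p rule: poly_mapping_linear_induct)
       (simp_all add: f.scale f.add lin_ext_add lin_ext_cscale f.zero)
qed

lemma linear_lin_ext: "Vector_Spaces.linear cscale cscale (lin_ext h)"
  by unfold_locales (simp_all add: lin_ext_add lin_ext_cscale)


section \<open>Tensor and symmetric algebras\<close>

lemma tvec_eq_lin_ext: "tvec v = lin_ext (\<lambda>i. Poly_Mapping.single [i] 1) v"
  by (simp add: tvec_def lin_ext_def cscale_single)

lemma svec_eq_lin_ext: "svec v = lin_ext (\<lambda>i. Poly_Mapping.single {#i#} 1) v"
  by (simp add: svec_def lin_ext_def cscale_single)

lemma tensor_map_eq_lin_ext:
  "tensor_map f = lin_ext (\<lambda>w. prod_list (map (\<lambda>i. tvec (f (Poly_Mapping.single i 1))) w))"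
  by (simp add: fun_eq_iff tensor_map_def lin_ext_def)

lemma sym_map_eq_lin_ext:
  "sym_map f = lin_ext (\<lambda>m. prod_mset (image_mset (\<lambda>i. svec (f (Poly_Mapping.single i 1))) m))"
  by (simp add: fun_eq_iff sym_map_def lin_ext_def)

lemma tvec_add: "tvec (u + v) = tvec u + tvec v"
  and tvec_cscale: "tvec (c *\<^sub>c v) = c *\<^sub>c tvec v"
  by (simp_all add: tvec_eq_lin_ext lin_ext_add lin_ext_cscale)

lemma svec_add: "svec (u + v) = svec u + svec v"
  and svec_cscale: "svec (c *\<^sub>c v) = c *\<^sub>c svec v"
  by (simp_all add: svec_eq_lin_ext lin_ext_add lin_ext_cscale)

lemma tvec_zero [simp]: "tvec 0 = 0" and svec_zero [simp]: "svec 0 = 0"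
  by (simp_all add: tvec_eq_lin_ext svec_eq_lin_ext)

lemma tvec_single: "tvec (Poly_Mapping.single i 1) = Poly_Mapping.single [i] 1"
  by (simp add: tvec_eq_lin_ext)

lemma svec_single: "svec (Poly_Mapping.single i 1) = Poly_Mapping.single {#i#} 1"
  by (simp add: svec_eq_lin_ext)

lemma tensor_map_add: "tensor_map f (p + q) = tensor_map f p + tensor_map f q"
  and tensor_map_cscale: "tensor_map f (c *\<^sub>c p) = c *\<^sub>c tensor_map f p"
  by (simp_all add: tensor_map_eq_lin_ext lin_ext_add lin_ext_cscale)

lemma sym_map_add: "sym_map f (p + q) = sym_map f p + sym_map f q"
  and sym_map_cscale: "sym_map f (c *\<^sub>c p) = c *\<^sub>c sym_map f p"
  by (simp_all add: sym_map_eq_lin_ext lin_ext_add lin_ext_cscale)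

lemma tensor_map_times: "tensor_map f (p * q) = tensor_map f p * tensor_map f q"
  unfolding tensor_map_eq_lin_ext by (rule lin_ext_times) (simp add: plus_list_def)

lemma sym_map_times: "sym_map f (p * q) = sym_map f p * sym_map f q"
  unfolding sym_map_eq_lin_ext by (rule lin_ext_times) simp

lemma single_zero_one: "Poly_Mapping.single [] 1 = (1 :: 'i list \<Rightarrow>\<^sub>0 complex)"
  by (metis single_one zero_list_def)

lemma tensor_map_one [simp]: "tensor_map f 1 = 1"
  by (simp add: tensor_map_eq_lin_ext flip: single_zero_one)

lemma sym_map_one [simp]: "sym_map f 1 = 1"
  by (simp add: sym_map_eq_lin_ext flip: single_one)

lemma tensor_map_tvec:
  assumes "Vector_Spaces.linear cscale cscale f"
  shows "tensor_map f (tvec v) = tvec (f v)"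
  unfolding tensor_map_eq_lin_ext tvec_eq_lin_ext
  by (subst linear_eq_lin_ext[OF assms, of v]) (simp add: lin_ext_comp)

lemma sym_map_svec:
  assumes "Vector_Spaces.linear cscale cscale f"
  shows "sym_map f (svec v) = svec (f v)"
  unfolding sym_map_eq_lin_ext svec_eq_lin_ext
  by (subst linear_eq_lin_ext[OF assms, of v]) (simp add: lin_ext_comp)

abbreviation tprod :: "('i \<Rightarrow>\<^sub>0 complex) list \<Rightarrow> ('i list \<Rightarrow>\<^sub>0 complex)"
  where "tprod vs \<equiv> prod_list (map tvec vs)"

abbreviation sprod :: "('i \<Rightarrow>\<^sub>0 complex) list \<Rightarrow> ('i multiset \<Rightarrow>\<^sub>0 complex)"
  where "sprod vs \<equiv> prod_list (map svec vs)"

lemma tensor_map_tprod: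
  assumes "Vector_Spaces.linear cscale cscale f"
  shows "tensor_map f (tprod vs) = tprod (map f vs)"
  by (induction vs) (simp_all add: tensor_map_times tensor_map_tvec[OF assms])

lemma sym_map_sprod:
  assumes "Vector_Spaces.linear cscale cscale f"
  shows "sym_map f (sprod vs) = sprod (map f vs)"
  by (induction vs) (simp_all add: sym_map_times sym_map_svec[OF assms])

lemma single_word: "Poly_Mapping.single w 1 = tprod (map (\<lambda>i. Poly_Mapping.single i 1) w)"
proof (induction w)
  case (Cons i w)
  then show ?case
    using mult_single[of "[i]" 1 w "1::complex"] by (simp add: tvec_single plus_list_def)
qed (simp add: single_zero_one)

lemma single_multiset: "Poly_Mapping.single (mset w) 1 = sprod (map (\<lambda>i. Poly_Mapping.single i 1) w)"
proof (induction w)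
  case (Cons i w)
  then show ?case
    using mult_single[of "{#i#}" 1 "mset w" "1::complex"] by (simp add: svec_single)
qed simp

lemma tensor_map_comp:
  assumes "Vector_Spaces.linear cscale cscale f" "Vector_Spaces.linear cscale cscale h"
  shows "tensor_map f (tensor_map h p) = tensor_map (f \<circ> h) p"
  unfolding tensor_map_eq_lin_ext[of h] tensor_map_eq_lin_ext[of "f \<circ> h"]
proof (induction p rule: poly_mapping_linear_induct)
  case (basis w)
  have "tensor_map f (tprod (map (\<lambda>i. h (Poly_Mapping.single i 1)) w)) =
      tprod (map (\<lambda>i. f (h (Poly_Mapping.single i 1))) w)"
    using tensor_map_tprod[OF assms(1), of "map (\<lambda>i. h (Poly_Mapping.single i 1)) w"] by (simp add: o_def)
  then show ?case by (simp add: o_def)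
qed (simp_all add: lin_ext_add lin_ext_cscale tensor_map_add tensor_map_cscale,
     simp add: tensor_map_eq_lin_ext)

lemma sym_map_comp:
  assumes "Vector_Spaces.linear cscale cscale f" "Vector_Spaces.linear cscale cscale h"
  shows "sym_map f (sym_map h p) = sym_map (f \<circ> h) p"
  unfolding sym_map_eq_lin_ext[of h] sym_map_eq_lin_ext[of "f \<circ> h"]
proof (induction p rule: poly_mapping_linear_induct)
  case (basis m)
  obtain w where m: "m = mset w" by (metis ex_mset)
  have "sym_map f (sprod (map (\<lambda>i. h (Poly_Mapping.single i 1)) w)) =
      sprod (map (\<lambda>i. f (h (Poly_Mapping.single i 1))) w)"
    using sym_map_sprod[OF assms(1), of "map (\<lambda>i. h (Poly_Mapping.single i 1)) w"] by (simp add: o_def)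
  then show ?case by (simp add: o_def m mset_map[symmetric] prod_mset_prod_list del: mset_map)
qed (simp_all add: lin_ext_add lin_ext_cscale sym_map_add sym_map_cscale,
     simp add: sym_map_eq_lin_ext)

lemma tensor_map_id [simp]: "tensor_map id (p :: 'i list \<Rightarrow>\<^sub>0 complex) = p"
proof -
  have "(\<lambda>w. prod_list (map (\<lambda>i. tvec (Poly_Mapping.single i 1)) w))
      = (\<lambda>w :: 'i list. Poly_Mapping.single w 1)"
    by (simp add: single_word o_def)
  then show ?thesis
    by (simp only: tensor_map_eq_lin_ext id_apply lin_ext_basis)
qed

lemma sym_map_id [simp]: "sym_map id p = p"
proof -
  have "prod_mset (image_mset (\<lambda>i. svec (Poly_Mapping.single i 1)) m) = Poly_Mapping.single m (1::complex)"
    for m :: "'a multiset"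
  proof -
    obtain w where m: "m = mset w" by (metis ex_mset)
    show ?thesis
      by (simp add: m single_multiset mset_map[symmetric] prod_mset_prod_list o_def del: mset_map)
  qed
  then show ?thesis by (simp add: sym_map_eq_lin_ext)
qed

text \<open>Vectors are linear forms, and elements of the symmetric algebra polynomial functions, on the space of
  coordinate functions \<open>z\<close>.  Identities in the symmetric algebra are tested at such points.\<close>

abbreviation vec_eval :: "('i \<Rightarrow>\<^sub>0 complex) \<Rightarrow> ('i \<Rightarrow> complex) \<Rightarrow> complex"
  where "vec_eval v z \<equiv> lin_form z v"

definition poly_eval :: "('i multiset \<Rightarrow>\<^sub>0 complex) \<Rightarrow> ('i \<Rightarrow> complex) \<Rightarrow> complex"
  where "poly_eval p z = lin_form (\<lambda>m. prod_mset (image_mset z m)) p"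

lemma poly_eval_add: "poly_eval (p + q) z = poly_eval p z + poly_eval q z"
  and poly_eval_cscale: "poly_eval (c *\<^sub>c p) z = c * poly_eval p z"
  and poly_eval_zero [simp]: "poly_eval 0 z = 0"
  and poly_eval_times: "poly_eval (p * q) z = poly_eval p z * poly_eval q z"
  unfolding poly_eval_def
  by (simp_all add: lin_form_add lin_form_diff lin_form_cscale)
     (rule lin_form_times, simp)

lemma poly_eval_svec: "poly_eval (svec v) z = vec_eval v z"
  by (simp add: poly_eval_def svec_eq_lin_ext lin_form_lin_ext)

text \<open>Distinct monomials are distinct characters of the multiplicative monoid of points, hence linearly
  independent (Dedekind).\<close>

lemma monomials_independent:
  fixes c :: "'i multiset \<Rightarrow> complex"
  assumes "finite S" "\<And>z. (\<Sum>m\<in>S. c m * prod_mset (image_mset z m)) = 0" "m \<in> S"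
  shows "c m = 0"
  using assms
proof (induction S arbitrary: c m rule: finite_induct)
  case (insert m0 S)
  have tail: "c m = 0" if m: "m \<in> S" for m
  proof -
    have "m \<noteq> m0" using m insert.hyps by auto
    then obtain i where i: "count m i \<noteq> count m0 i" by (meson multiset_eqI)
    define w where "w = (\<lambda>j. if j = i then 2 else (1::complex))"
    have w: "prod_mset (image_mset w m) = 2 ^ count m i" for m
      by (induction m) (auto simp: w_def)
    have "(c m * (2 ^ count m i - 2 ^ count m0 i)) = 0"
    proof (rule insert.IH[OF _ m])
      fix z :: "'i \<Rightarrow> complex"
      have shift: "prod_mset (image_mset (\<lambda>j. w j * z j) m) = 2 ^ count m i * prod_mset (image_mset z m)" for m
        using w[of m] by (simp add: prod_mset.distrib)
      have "(\<Sum>m\<in>insert m0 S. c m * prod_mset (image_mset (\<lambda>j. w j * z j) m))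
          - 2 ^ count m0 i * (\<Sum>m\<in>insert m0 S. c m * prod_mset (image_mset z m)) = 0"
        by (simp only: insert.prems(1)) simp
      then show "(\<Sum>m\<in>S. c m * (2 ^ count m i - 2 ^ count m0 i) * prod_mset (image_mset z m)) = 0"
        using insert.hyps unfolding shift
        by (simp add: algebra_simps sum_distrib_left sum_subtractf)
    qed
    moreover have "(2::complex) ^ count m i \<noteq> 2 ^ count m0 i"
    proof
      assume "(2::complex) ^ count m i = 2 ^ count m0 i"
      then have "of_nat (2 ^ count m i) = (of_nat (2 ^ count m0 i) :: complex)" by simp
      then have "(2::nat) ^ count m i = 2 ^ count m0 i" by (simp only: of_nat_eq_iff)
      with i show False by simp
    qed
    ultimately show ?thesis by simp
  qed
  moreover have "c m0 = 0"
    using insert.prems(1)[of "\<lambda>_. 1"] tail insert.hyps by simp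
  ultimately show ?case using insert.prems(2) by auto
qed simp

lemma poly_eval_eq_zero_imp:
  assumes "\<And>z. poly_eval p z = 0"
  shows "p = 0"
proof (rule poly_mapping_eqI)
  fix m
  show "Poly_Mapping.lookup p m = Poly_Mapping.lookup 0 m"
  proof (cases "m \<in> Poly_Mapping.keys p")
    case True
    have "Poly_Mapping.lookup p m = 0"
      by (rule monomials_independent[of "Poly_Mapping.keys p"])
         (use assms True in \<open>auto simp: poly_eval_def lin_form_def\<close>)
    then show ?thesis by simp
  qed (simp add: in_keys_iff)
qed


section \<open>Skew group algebras\<close>

abbreviation class_ring :: "'r::ring_1 set \<Rightarrow> 'r ring"
  where "class_ring C \<equiv> \<lparr>carrier = C, monoid.mult = (*), one = 1, zero = 0, add = (+)\<rparr>"

text \<open>The coefficient ring is a subset \<open>C\<close> of a ring type because \<open>T(V)\<close> and \<open>S(V)\<close> are subalgebras of the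
  tensor and the symmetric algebra of the ambient space.\<close>

locale skew_data = group G for G :: "('g, 'k) monoid_scheme" (structure) +
  fixes C :: "'r::ring_1 set" and \<alpha> :: "'g \<Rightarrow> 'r \<Rightarrow> 'r"
  assumes finite_G: "finite (carrier G)"
    and zero_C: "0 \<in> C" and one_C: "1 \<in> C"
    and add_C: "\<And>x y. x \<in> C \<Longrightarrow> y \<in> C \<Longrightarrow> x + y \<in> C"
    and uminus_C: "\<And>x. x \<in> C \<Longrightarrow> - x \<in> C"
    and mult_C: "\<And>x y. x \<in> C \<Longrightarrow> y \<in> C \<Longrightarrow> x * y \<in> C"
    and act_C: "\<And>g x. g \<in> carrier G \<Longrightarrow> x \<in> C \<Longrightarrow> \<alpha> g x \<in> C"
    and act_add: "\<And>g x y. g \<in> carrier G \<Longrightarrow> \<alpha> g (x + y) = \<alpha> g x + \<alpha> g y"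
    and act_mult: "\<And>g x y. g \<in> carrier G \<Longrightarrow> \<alpha> g (x * y) = \<alpha> g x * \<alpha> g y"
    and act_unit: "\<And>g. g \<in> carrier G \<Longrightarrow> \<alpha> g 1 = 1"
    and act_one: "\<And>x. \<alpha> \<one> x = x"
    and act_comp: "\<And>g h x. g \<in> carrier G \<Longrightarrow> h \<in> carrier G \<Longrightarrow> \<alpha> (g \<otimes> h) x = \<alpha> g (\<alpha> h x)"
begin

lemma class_ring_C: "ring (class_ring C)"
proof (rule ringI)
  show "abelian_group (class_ring C)"
    by (rule abelian_groupI)
       (auto simp: add_C zero_C intro: bexI[where x="- x" for x] uminus_C add.assoc add.commute)
  show "Group.monoid (class_ring C)"
    by (rule monoidI) (auto simp: mult_C one_C mult.assoc)
qed (simp_all add: distrib_left distrib_right)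

lemma finsum_class_ring:
  assumes "finite A" "\<And>x. x \<in> A \<Longrightarrow> f x \<in> C"
  shows "finsum (class_ring C) f A = sum f A"
proof -
  interpret C: ring "class_ring C" by (rule class_ring_C)
  show ?thesis using assms
  proof (induction A rule: finite_induct)
    case (insert x A)
    then show ?case
      using C.finsum_insert[of A x f] by (auto simp: Pi_iff)
  qed simp
qed

definition scarrier :: "('g \<Rightarrow> 'r) set"
  where "scarrier = {f. (\<forall>g\<in>carrier G. f g \<in> C) \<and> (\<forall>g. g \<notin> carrier G \<longrightarrow> f g = 0)}"

text \<open>Summing over the first factor \<open>x\<close> of \<open>g = x (x\<inverse> g)\<close> replaces the sum over factorizations; the
  multiplication is then total and additive without any membership condition.\<close>

definition smult :: "('g \<Rightarrow> 'r) \<Rightarrow> ('g \<Rightarrow> 'r) \<Rightarrow> 'g \<Rightarrow> 'r"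
  where "smult f h g = ((\<Sum>x\<in>carrier G. f x * \<alpha> x (h (inv x \<otimes> g))) when g \<in> carrier G)"

definition sone :: "'g \<Rightarrow> 'r"
  where "sone g = (1 when g = \<one>)"

abbreviation skew :: "('g \<Rightarrow> 'r) ring"
  where "skew \<equiv> skew_group_algebra (class_ring C) G \<alpha>"

lemma act_zero: "g \<in> carrier G \<Longrightarrow> \<alpha> g 0 = 0"
  using additive_uminus_diff(1,2)[of "\<alpha> g"] act_add by blast+

lemma act_sum: "g \<in> carrier G \<Longrightarrow> \<alpha> g (\<Sum>i\<in>I. f i) = (\<Sum>i\<in>I. \<alpha> g (f i))"
  using additive_sum[of "\<alpha> g"] act_add by blast

lemma sum_C: "(\<And>x. x \<in> A \<Longrightarrow> f x \<in> C) \<Longrightarrow> sum f A \<in> C"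
  by (induction A rule: infinite_finite_induct) (auto simp: zero_C add_C)

lemma factorizations_eq:
  "g \<in> carrier G \<Longrightarrow> factorizations G g = (\<lambda>x. (x, inv x \<otimes> g)) ` carrier G"
  "g \<notin> carrier G \<Longrightarrow> factorizations G g = {}"
  by (auto simp: factorizations_def image_iff inv_solve_left' m_assoc[symmetric])

lemma sum_factorizations:
  "(\<Sum>p\<in>factorizations G g. F (fst p) (snd p)) =
     ((\<Sum>x\<in>carrier G. F x (inv x \<otimes> g)) when g \<in> carrier G)" for F :: "'g \<Rightarrow> 'g \<Rightarrow> 'w::comm_monoid_add"
proof (cases "g \<in> carrier G")
  case True
  have "inj_on (\<lambda>x. (x, inv x \<otimes> g)) (carrier G)" by (rule inj_onI) simp
  then show ?thesis using True by (simp add: factorizations_eq sum.reindex)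
qed (simp add: factorizations_eq)

lemma skew_simps:
  "carrier skew = scarrier" "one skew = sone" "zero skew = (\<lambda>g. 0)" "add skew = (\<lambda>f h g. f g + h g)"
  by (simp_all add: skew_group_algebra_def scarrier_def sone_def when_def fun_eq_iff)

lemma skew_mult:
  assumes "f \<in> scarrier" "h \<in> scarrier"
  shows "monoid.mult skew f h = smult f h"
proof
  fix g
  have fin: "finite (factorizations G g)"
    by (rule finite_subset[of _ "carrier G \<times> carrier G"]) (auto simp: factorizations_def finite_G)
  have "monoid.mult skew f h g
      = finsum (class_ring C) (\<lambda>p. f (fst p) * \<alpha> (fst p) (h (snd p))) (factorizations G g)"
    by (simp add: skew_group_algebra_def)
  also have "\<dots> = (\<Sum>p\<in>factorizations G g. f (fst p) * \<alpha> (fst p) (h (snd p)))"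
    by (rule finsum_class_ring)
       (use assms fin in \<open>auto simp: factorizations_def scarrier_def intro!: mult_C act_C\<close>)
  also have "\<dots> = smult f h g"
    using sum_factorizations[of "\<lambda>x y. f x * \<alpha> x (h y)"] by (simp add: smult_def when_def)
  finally show "monoid.mult skew f h g = smult f h g" .
qed

lemma scarrierD: "f \<in> scarrier \<Longrightarrow> g \<in> carrier G \<Longrightarrow> f g \<in> C"
  "f \<in> scarrier \<Longrightarrow> g \<notin> carrier G \<Longrightarrow> f g = 0"
  by (auto simp: scarrier_def)

lemma smult_closed: "f \<in> scarrier \<Longrightarrow> h \<in> scarrier \<Longrightarrow> smult f h \<in> scarrier"
  by (auto simp: scarrier_def smult_def when_def intro!: sum_C mult_C act_C)

lemma sone_closed: "sone \<in> scarrier"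
  by (auto simp: scarrier_def sone_def when_def one_C zero_C)

lemma sadd_closed: "f \<in> scarrier \<Longrightarrow> h \<in> scarrier \<Longrightarrow> (\<lambda>g. f g + h g) \<in> scarrier"
  by (auto simp: scarrier_def add_C)

lemma reindex_inv_left:
  fixes F :: "'g \<Rightarrow> 'w::comm_monoid_add"
  assumes "y \<in> carrier G"
  shows "(\<Sum>x\<in>carrier G. F (inv y \<otimes> x)) = sum F (carrier G)"
  using assms
  by (intro sum.reindex_bij_witness[where i="\<lambda>x. y \<otimes> x" and j="\<lambda>x. inv y \<otimes> x"])
     (auto simp: m_assoc[symmetric])

lemma smult_assoc:
  assumes "h \<in> scarrier"
  shows "smult (smult f h) k = smult f (smult h k)"
proof
  fix g
  show "smult (smult f h) k g = smult f (smult h k) g"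
  proof (cases "g \<in> carrier G")
    case True
    have "smult (smult f h) k g
        = (\<Sum>x\<in>carrier G. \<Sum>y\<in>carrier G. f y * \<alpha> y (h (inv y \<otimes> x)) * \<alpha> x (k (inv x \<otimes> g)))"
      using True by (simp add: smult_def sum_distrib_right)
    also have "\<dots> = (\<Sum>y\<in>carrier G. \<Sum>x\<in>carrier G.
        f y * \<alpha> y (h (inv y \<otimes> x)) * \<alpha> (y \<otimes> (inv y \<otimes> x)) (k (inv (inv y \<otimes> x) \<otimes> (inv y \<otimes> g))))"
    proof (subst sum.swap, intro sum.cong refl)
      fix y x assume yx: "y \<in> carrier G" "x \<in> carrier G"
      have "inv (inv y \<otimes> x) \<otimes> (inv y \<otimes> g) = (inv x \<otimes> y) \<otimes> (inv y \<otimes> g)"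
        using yx by (simp add: inv_mult_group)
      also have "\<dots> = inv x \<otimes> ((y \<otimes> inv y) \<otimes> g)" using yx True by (simp only: m_assoc m_closed inv_closed)
      finally have "inv (inv y \<otimes> x) \<otimes> (inv y \<otimes> g) = inv x \<otimes> g" using yx True by simp
      moreover have "y \<otimes> (inv y \<otimes> x) = x" using yx by (simp add: m_assoc[symmetric])
      ultimately show "f y * \<alpha> y (h (inv y \<otimes> x)) * \<alpha> x (k (inv x \<otimes> g)) =
        f y * \<alpha> y (h (inv y \<otimes> x)) * \<alpha> (y \<otimes> (inv y \<otimes> x)) (k (inv (inv y \<otimes> x) \<otimes> (inv y \<otimes> g)))"
        by simp
    qed
    also have "\<dots> = (\<Sum>y\<in>carrier G. \<Sum>x\<in>carrier G.
        f y * \<alpha> y (h x) * \<alpha> (y \<otimes> x) (k (inv x \<otimes> (inv y \<otimes> g))))"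
      by (intro sum.cong refl reindex_inv_left[where
          F="\<lambda>x. f y * \<alpha> y (h x) * \<alpha> (y \<otimes> x) (k (inv x \<otimes> (inv y \<otimes> g)))" for y])
    also have "\<dots> = (\<Sum>y\<in>carrier G. f y * \<alpha> y (\<Sum>x\<in>carrier G. h x * \<alpha> x (k (inv x \<otimes> (inv y \<otimes> g)))))"
      by (auto simp: act_sum act_mult act_comp sum_distrib_left mult.assoc intro!: sum.cong)
    also have "\<dots> = smult f (smult h k) g"
      using True by (simp add: smult_def)
    finally show ?thesis .
  qed (simp add: smult_def)
qed

lemma smult_one_left: "f \<in> scarrier \<Longrightarrow> smult sone f = f"
proof
  fix g assume f: "f \<in> scarrier"
  have "(\<Sum>x\<in>carrier G. sone x * \<alpha> x (f (inv x \<otimes> g))) = (\<Sum>x\<in>carrier G. if x = \<one> then f g else 0)"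
    if "g \<in> carrier G"
    using that by (intro sum.cong) (auto simp: sone_def act_one)
  then show "smult sone f g = f g"
    using f by (auto simp: smult_def when_def finite_G scarrier_def sum.delta)
qed

lemma smult_one_right: "f \<in> scarrier \<Longrightarrow> smult f sone = f"
proof
  fix g assume f: "f \<in> scarrier"
  have "(\<Sum>x\<in>carrier G. f x * \<alpha> x (sone (inv x \<otimes> g))) = (\<Sum>x\<in>carrier G. if x = g then f g else 0)"
    if "g \<in> carrier G"
  proof (intro sum.cong refl)
    fix x assume x: "x \<in> carrier G"
    have "inv x \<otimes> g = \<one> \<longleftrightarrow> x = g" using x that
      by (metis inv_equality inv_inv inv_closed l_inv)
    then show "f x * \<alpha> x (sone (inv x \<otimes> g)) = (if x = g then f g else 0)"
      using x by (auto simp: sone_def act_unit act_zero)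
  qed
  then show "smult f sone g = f g"
    using f by (auto simp: smult_def when_def finite_G scarrier_def sum.delta)
qed

lemma smult_add_left: "smult (\<lambda>g. f g + f' g) h = (\<lambda>g. smult f h g + smult f' h g)"
  and smult_add_right: "smult h (\<lambda>g. f g + f' g) = (\<lambda>g. smult h f g + smult h f' g)"
  by (auto simp: fun_eq_iff smult_def when_def act_add distrib_left distrib_right sum.distrib)

lemma ring_skew: "ring skew"
proof (rule ringI)
  show "abelian_group skew"
  proof (rule abelian_groupI)
    fix x assume "x \<in> carrier skew"
    then show "\<exists>y\<in>carrier skew. y \<oplus>\<^bsub>skew\<^esub> x = \<zero>\<^bsub>skew\<^esub>"
      by (intro bexI[of _ "\<lambda>g. - x g"]) (auto simp: skew_simps scarrier_def uminus_C)
  qed (auto simp: skew_simps fun_eq_iff add.assoc add.commute scarrier_def add_C zero_C)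
  show "Group.monoid skew"
    by (rule monoidI)
       (auto simp: skew_simps skew_mult smult_closed sone_closed smult_one_left smult_one_right smult_assoc)
qed (auto simp: skew_simps skew_mult sadd_closed smult_add_left smult_add_right)

lemma skew_a_minus:
  assumes "f \<in> scarrier" "h \<in> scarrier"
  shows "a_minus skew f h = (\<lambda>g. f g - h g)"
proof -
  interpret S: ring skew by (rule ring_skew)
  have "a_inv skew h = (\<lambda>g. - h g)"
    by (rule S.minus_equality) (use assms in \<open>auto simp: skew_simps scarrier_def uminus_C\<close>)
  then show ?thesis by (simp add: a_minus_def skew_simps)
qed

definition pure :: "'g \<Rightarrow> 'r \<Rightarrow> 'g \<Rightarrow> 'r"
  where "pure g r = (\<lambda>x. r when x = g)"

lemma pure_closed: "g \<in> carrier G \<Longrightarrow> r \<in> C \<Longrightarrow> pure g r \<in> scarrier"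
  by (auto simp: pure_def scarrier_def when_def zero_C)

lemma smult_pure_left:
  assumes "x \<in> carrier G"
  shows "smult (pure x r) f = (\<lambda>g. r * \<alpha> x (f (inv x \<otimes> g)) when g \<in> carrier G)"
proof
  fix g
  have "(\<Sum>y\<in>carrier G. pure x r y * \<alpha> y (f (inv y \<otimes> g)))
      = (\<Sum>y\<in>carrier G. if y = x then r * \<alpha> x (f (inv x \<otimes> g)) else 0)"
    by (rule sum.cong) (auto simp: pure_def)
  then show "smult (pure x r) f g = (r * \<alpha> x (f (inv x \<otimes> g)) when g \<in> carrier G)"
    using assms by (simp add: smult_def finite_G)
qed

lemma smult_pure_right:
  assumes "x \<in> carrier G"
  shows "smult f (pure x r) = (\<lambda>g. f (g \<otimes> inv x) * \<alpha> (g \<otimes> inv x) r when g \<in> carrier G)"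
proof
  fix g
  have "(\<Sum>y\<in>carrier G. f y * \<alpha> y (pure x r (inv y \<otimes> g)))
      = (\<Sum>y\<in>carrier G. if y = g \<otimes> inv x then f (g \<otimes> inv x) * \<alpha> (g \<otimes> inv x) r else 0)"
    if g: "g \<in> carrier G"
  proof (intro sum.cong refl)
    fix y assume y: "y \<in> carrier G"
    have "inv y \<otimes> g = x \<longleftrightarrow> y = g \<otimes> inv x"
      using y g assms by (metis inv_solve_left inv_solve_right m_closed)
    then show "f y * \<alpha> y (pure x r (inv y \<otimes> g)) = (if y = g \<otimes> inv x then f (g \<otimes> inv x) * \<alpha> (g \<otimes> inv x) r else 0)"
      using y by (auto simp: pure_def act_zero)
  qed
  then show "smult f (pure x r) g = (f (g \<otimes> inv x) * \<alpha> (g \<otimes> inv x) r when g \<in> carrier G)"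
    using assms by (auto simp: smult_def finite_G when_def)
qed

end


section \<open>Associated graded rings from symbol maps\<close>

text \<open>To identify the associated graded ring of a filtration \<open>F\<close> with a graded ring \<open>S\<close>, it suffices to have
  additive and multiplicative maps \<open>\<sigma> k\<close> from \<open>F k\<close> onto the \<open>k\<close>-th part of \<open>S\<close> whose kernel is the previous step
  of the filtration.  The grading of \<open>S\<close> is given by its projections \<open>pr k\<close>; addition in \<open>S\<close> is pointwise since
  elements of a skew group algebra are functions on the group.\<close>

locale symbol_maps = ring R for R :: "('a, 'm) ring_scheme" (structure) +
  fixes F :: "nat \<Rightarrow> 'a set" and S :: "('g \<Rightarrow> 's::ab_group_add) ring"
    and pr :: "nat \<Rightarrow> ('g \<Rightarrow> 's) \<Rightarrow> 'g \<Rightarrow> 's" and \<sigma> :: "nat \<Rightarrow> 'a \<Rightarrow> 'g \<Rightarrow> 's"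
  assumes F_carrier: "F k \<subseteq> carrier R"
    and F_zero: "\<zero> \<in> F k"
    and F_add: "x \<in> F k \<Longrightarrow> y \<in> F k \<Longrightarrow> x \<oplus> y \<in> F k"
    and F_uminus: "x \<in> F k \<Longrightarrow> \<ominus> x \<in> F k"
    and F_mono: "F k \<subseteq> F (Suc k)"
    and F_mult: "x \<in> F k \<Longrightarrow> y \<in> F l \<Longrightarrow> x \<otimes> y \<in> F (k + l)"
    and F_one: "\<one> \<in> F 0"
    and S_add: "add S = (\<lambda>f h g. f g + h g)"
    and S_add_closed: "s \<in> carrier S \<Longrightarrow> t \<in> carrier S \<Longrightarrow> (\<lambda>g. s g + t g) \<in> carrier S"
    and S_mult_closed: "s \<in> carrier S \<Longrightarrow> t \<in> carrier S \<Longrightarrow> s \<otimes>\<^bsub>S\<^esub> t \<in> carrier S"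
    and S_one_closed: "one S \<in> carrier S"
    and pr_add: "pr k (\<lambda>g. s g + t g) = (\<lambda>g. pr k s g + pr k t g)"
    and pr_eqI: "s \<in> carrier S \<Longrightarrow> t \<in> carrier S \<Longrightarrow> (\<And>k. pr k s = pr k t) \<Longrightarrow> s = t"
    and pr_finite: "s \<in> carrier S \<Longrightarrow> finite {k. pr k s \<noteq> (\<lambda>g. 0)}"
    and pr_range: "s \<in> carrier S \<Longrightarrow> pr k s \<in> \<sigma> k ` F k"
    and pr_exists: "\<lbrakk>\<And>k. c k \<in> \<sigma> k ` F k; finite {k. c k \<noteq> (\<lambda>g. 0)}\<rbrakk> \<Longrightarrow> \<exists>s\<in>carrier S. \<forall>k. pr k s = c k"
    and pr_mult: "s \<in> carrier S \<Longrightarrow> t \<in> carrier S \<Longrightarrow>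
          pr k (s \<otimes>\<^bsub>S\<^esub> t) = (\<lambda>g. \<Sum>i\<le>k. (pr i s \<otimes>\<^bsub>S\<^esub> pr (k - i) t) g)"
    and pr_one: "pr k (one S) = (if k = 0 then one S else (\<lambda>g. 0))"
    and symbol_add: "x \<in> F k \<Longrightarrow> y \<in> F k \<Longrightarrow> \<sigma> k (x \<oplus> y) = (\<lambda>g. \<sigma> k x g + \<sigma> k y g)"
    and symbol_zero_iff: "x \<in> F k \<Longrightarrow> \<sigma> k x = (\<lambda>g. 0) \<longleftrightarrow> x \<in> fil_below R F k"
    and symbol_mult: "x \<in> F k \<Longrightarrow> y \<in> F l \<Longrightarrow> \<sigma> (k + l) (x \<otimes> y) = \<sigma> k x \<otimes>\<^bsub>S\<^esub> \<sigma> l y"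
    and symbol_one: "\<sigma> 0 \<one> = one S"
begin

abbreviation "gr \<equiv> assoc_graded R F"

lemma fil_below_subset: "fil_below R F k \<subseteq> F k"
  using F_mono F_zero by (cases k) (auto simp: fil_below_def)

lemma symbol_zero: "\<sigma> k \<zero> = (\<lambda>g. 0)"
  using symbol_zero_iff[OF F_zero[of k]] F_zero by (cases k) (auto simp: fil_below_def)

lemma symbol_uminus: assumes "x \<in> F k" shows "\<sigma> k (\<ominus> x) = (\<lambda>g. - \<sigma> k x g)"
proof -
  have "x \<oplus> \<ominus> x = \<zero>" using assms F_carrier by (auto intro: r_neg)
  then have "\<sigma> k x g + \<sigma> k (\<ominus> x) g = 0" for g
    using symbol_add[OF assms F_uminus[OF assms]] symbol_zero[of k] by (simp add: fun_eq_iff)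
  then show ?thesis by (simp add: fun_eq_iff eq_neg_iff_add_eq_0 add.commute)
qed

lemma symbol_eq_iff:
  assumes "x \<in> F k" "y \<in> F k"
  shows "\<sigma> k x = \<sigma> k y \<longleftrightarrow> x \<in> fil_below R F k +> y"
proof -
  have c: "x \<in> carrier R" "y \<in> carrier R" using assms F_carrier by auto
  have d: "x \<oplus> \<ominus> y \<in> F k" by (intro F_add F_uminus assms)
  have "\<sigma> k x = \<sigma> k y \<longleftrightarrow> \<sigma> k (x \<oplus> \<ominus> y) = (\<lambda>g. 0)"
    using symbol_add[OF assms(1) F_uminus[OF assms(2)]] symbol_uminus[OF assms(2)]
    by (auto simp: fun_eq_iff)
  also have "\<dots> \<longleftrightarrow> x \<oplus> \<ominus> y \<in> fil_below R F k" by (rule symbol_zero_iff[OF d])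
  also have "\<dots> \<longleftrightarrow> x \<in> fil_below R F k +> y"
  proof
    assume "x \<oplus> \<ominus> y \<in> fil_below R F k"
    moreover have "x = (x \<oplus> \<ominus> y) \<oplus> y" using c by (simp add: a_assoc l_neg)
    ultimately show "x \<in> fil_below R F k +> y" by (auto simp: a_r_coset_def')
  next
    assume "x \<in> fil_below R F k +> y"
    then obtain h where h: "h \<in> fil_below R F k" "x = h \<oplus> y" by (auto simp: a_r_coset_def')
    then have "h \<in> carrier R" using fil_below_subset F_carrier by blast
    then have "x \<oplus> \<ominus> y = h" using c h by (simp add: a_assoc r_neg)
    with h show "x \<oplus> \<ominus> y \<in> fil_below R F k" by simp
  qed
  finally show ?thesis .
qed

lemma coset_eq: "x \<in> F k \<Longrightarrow> fil_below R F k +> x = {y \<in> F k. \<sigma> k y = \<sigma> k x}"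
proof -
  assume x: "x \<in> F k"
  then have "fil_below R F k +> x \<subseteq> F k"
    using fil_below_subset[of k] F_add[of _ k x] by (auto simp: a_r_coset_def')
  with symbol_eq_iff[OF _ x] show ?thesis by blast
qed

lemma fil_below_eq: "fil_below R F k = {y \<in> F k. \<sigma> k y = (\<lambda>g. 0)}"
  using symbol_zero_iff[of _ k] fil_below_subset[of k] by blast

text \<open>A coset of the previous step of the filtration is a fibre of the symbol map, so an element of the
  associated graded ring is the same as a finitely supported sequence of symbols.\<close>

definition symbol_fibre :: "nat \<Rightarrow> ('g \<Rightarrow> 's) \<Rightarrow> 'a set"
  where "symbol_fibre k s = {y \<in> F k. \<sigma> k y = s}"

definition comp :: "nat \<Rightarrow> (nat \<Rightarrow> 'a set) \<Rightarrow> 'g \<Rightarrow> 's"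
  where "comp k f = \<sigma> k (SOME x. x \<in> f k)"

lemma comp_symbol_fibre:
  assumes "f k = symbol_fibre k s" "s \<in> \<sigma> k ` F k"
  shows "comp k f = s"
proof -
  have "\<exists>x. x \<in> f k" using assms by (auto simp: symbol_fibre_def)
  then have "(SOME x. x \<in> f k) \<in> f k" by (rule someI_ex)
  then show ?thesis using assms by (simp add: comp_def symbol_fibre_def)
qed

lemma carrier_gr:
  "f \<in> carrier gr \<longleftrightarrow> (\<exists>c. (\<forall>k. c k \<in> \<sigma> k ` F k \<and> f k = symbol_fibre k (c k)) \<and> finite {k. c k \<noteq> (\<lambda>g. 0)})"
proof
  assume f: "f \<in> carrier gr"
  then have "\<forall>k. \<exists>x\<in>F k. f k = fil_below R F k +> x" by (simp add: assoc_graded_def)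
  then obtain x where x: "\<And>k. x k \<in> F k" "\<And>k. f k = fil_below R F k +> x k" by metis
  have "\<sigma> k (x k) = (\<lambda>g. 0)" if "f k = fil_below R F k" for k
  proof -
    have "x k \<in> f k" unfolding x(2) coset_eq[OF x(1)] using x(1) by simp
    then have "x k \<in> fil_below R F k" using that by simp
    then show ?thesis using symbol_zero_iff[OF x(1)[of k]] by simp
  qed
  then have "{k. \<sigma> k (x k) \<noteq> (\<lambda>g. 0)} \<subseteq> {k. f k \<noteq> fil_below R F k}" by blast
  moreover have "finite {k. f k \<noteq> fil_below R F k}" using f by (simp add: assoc_graded_def)
  ultimately have "finite {k. \<sigma> k (x k) \<noteq> (\<lambda>g. 0)}" by (rule finite_subset)
  moreover have "\<forall>k. \<sigma> k (x k) \<in> \<sigma> k ` F k \<and> f k = symbol_fibre k (\<sigma> k (x k))"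
    using x coset_eq by (auto simp: symbol_fibre_def)
  ultimately show "\<exists>c. (\<forall>k. c k \<in> \<sigma> k ` F k \<and> f k = symbol_fibre k (c k)) \<and> finite {k. c k \<noteq> (\<lambda>g. 0)}"
    by (intro exI[of _ "\<lambda>k. \<sigma> k (x k)"]) auto
next
  assume "\<exists>c. (\<forall>k. c k \<in> \<sigma> k ` F k \<and> f k = symbol_fibre k (c k)) \<and> finite {k. c k \<noteq> (\<lambda>g. 0)}"
  then obtain c where c: "\<And>k. c k \<in> \<sigma> k ` F k" "\<And>k. f k = symbol_fibre k (c k)" "finite {k. c k \<noteq> (\<lambda>g. 0)}" by auto
  have "{k. f k \<noteq> fil_below R F k} \<subseteq> {k. c k \<noteq> (\<lambda>g. 0)}"
    using c(2) fil_below_eq by (auto simp: symbol_fibre_def)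
  then have "finite {k. f k \<noteq> fil_below R F k}" using c(3) by (rule finite_subset)
  moreover have "\<exists>x\<in>F k. f k = fil_below R F k +> x" for k
    using c(1,2)[of k] coset_eq[of _ k] by (auto simp: symbol_fibre_def)
  ultimately show "f \<in> carrier gr" by (simp add: assoc_graded_def)
qed

lemma gr_comp:
  assumes "f \<in> carrier gr"
  shows "f k = symbol_fibre k (comp k f)" "comp k f \<in> \<sigma> k ` F k" "finite {k. comp k f \<noteq> (\<lambda>g. 0)}"
proof -
  obtain c where c: "\<And>k. c k \<in> \<sigma> k ` F k" "\<And>k. f k = symbol_fibre k (c k)" "finite {k. c k \<noteq> (\<lambda>g. 0)}"
    using assms unfolding carrier_gr by blast
  have "comp k f = c k" for k by (rule comp_symbol_fibre[OF c(2,1)])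
  with c show "f k = symbol_fibre k (comp k f)" "comp k f \<in> \<sigma> k ` F k" "finite {k. comp k f \<noteq> (\<lambda>g. 0)}" by auto
qed

definition gr_iso :: "(nat \<Rightarrow> 'a set) \<Rightarrow> 'g \<Rightarrow> 's"
  where "gr_iso f = (SOME s. s \<in> carrier S \<and> (\<forall>k. pr k s = comp k f))"

lemma gr_iso:
  assumes "f \<in> carrier gr"
  shows "gr_iso f \<in> carrier S" "pr k (gr_iso f) = comp k f"
proof -
  have "\<exists>s. s \<in> carrier S \<and> (\<forall>k. pr k s = comp k f)"
    using pr_exists[of "\<lambda>k. comp k f"] gr_comp[OF assms] by blast
  from someI_ex[OF this] show "gr_iso f \<in> carrier S" "pr k (gr_iso f) = comp k f"
    by (auto simp: gr_iso_def)
qed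

lemma gr_isoI:
  assumes "f \<in> carrier gr" "s \<in> carrier S" "\<And>k. pr k s = comp k f"
  shows "gr_iso f = s"
  by (rule pr_eqI) (use assms gr_iso in auto)

lemma gr_eqI:
  assumes "f \<in> carrier gr" "h \<in> carrier gr" "\<And>k. comp k f = comp k h"
  shows "f = h"
proof
  fix k
  show "f k = h k" using gr_comp(1)[OF assms(1), of k] gr_comp(1)[OF assms(2), of k] assms(3) by simp
qed

lemma bij_gr_iso: "bij_betw gr_iso (carrier gr) (carrier S)"
proof (rule bij_betwI')
  fix f h assume fh: "f \<in> carrier gr" "h \<in> carrier gr"
  show "gr_iso f = gr_iso h \<longleftrightarrow> f = h"
    using gr_eqI[OF fh] gr_iso(2)[OF fh(1)] gr_iso(2)[OF fh(2)] by metis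
next
  fix f assume "f \<in> carrier gr" then show "gr_iso f \<in> carrier S" by (rule gr_iso)
next
  fix s assume s: "s \<in> carrier S"
  define f where "f = (\<lambda>k. symbol_fibre k (pr k s))"
  have f: "f \<in> carrier gr"
    using pr_range[OF s] pr_finite[OF s] by (auto simp: carrier_gr f_def intro!: exI[of _ "\<lambda>k. pr k s"])
  have "comp k f = pr k s" for k by (rule comp_symbol_fibre) (auto simp: f_def pr_range[OF s])
  then have "gr_iso f = s" by (intro gr_isoI[OF f s]) simp
  with f show "\<exists>f\<in>carrier gr. s = gr_iso f" by auto
qed

lemma finsum_F:
  assumes "finite I" "\<And>i. i \<in> I \<Longrightarrow> x i \<in> F k"
  shows "finsum R x I \<in> F k \<and> \<sigma> k (finsum R x I) = (\<lambda>g. \<Sum>i\<in>I. \<sigma> k (x i) g)"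
  using assms
proof (induction I rule: finite_induct)
  case (insert i I)
  have "finsum R x (insert i I) = x i \<oplus> finsum R x I"
    by (rule finsum_insert) (use insert F_carrier in auto)
  then show ?case using insert by (auto simp: F_add symbol_add)
qed (simp add: F_zero symbol_zero)

lemma gr_add:
  assumes f: "f \<in> carrier gr" and h: "h \<in> carrier gr"
  shows "f \<oplus>\<^bsub>gr\<^esub> h \<in> carrier gr" "comp k (f \<oplus>\<^bsub>gr\<^esub> h) = (\<lambda>g. comp k f g + comp k h g)"
proof -
  let ?c = "\<lambda>k g. comp k f g + comp k h g"
  have cs: "?c k \<in> \<sigma> k ` F k" for k
  proof -
    obtain x y where "x \<in> F k" "comp k f = \<sigma> k x" "y \<in> F k" "comp k h = \<sigma> k y"
      using gr_comp(2)[OF f, of k] gr_comp(2)[OF h, of k] by blast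
    then have "?c k = \<sigma> k (x \<oplus> y)" "x \<oplus> y \<in> F k" by (simp_all add: symbol_add F_add)
    then show ?thesis by blast
  qed
  have eq: "(f \<oplus>\<^bsub>gr\<^esub> h) k = symbol_fibre k (?c k)" for k
  proof -
    obtain x where x: "x \<in> F k" "comp k f = \<sigma> k x" using gr_comp(2)[OF f, of k] by auto
    have "f k <+>\<^bsub>R\<^esub> h k = symbol_fibre k (?c k)"
    proof (intro equalityI subsetI)
      fix y assume "y \<in> f k <+>\<^bsub>R\<^esub> h k"
      then show "y \<in> symbol_fibre k (?c k)"
        using gr_comp(1)[OF f, of k] gr_comp(1)[OF h, of k]
        by (auto simp: set_add_def' symbol_fibre_def F_add symbol_add)
    next
      fix y assume y: "y \<in> symbol_fibre k (?c k)"
      then have yF: "y \<in> F k" and ys: "\<sigma> k y = ?c k" by (auto simp: symbol_fibre_def)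
      have d: "\<ominus> x \<oplus> y \<in> F k" by (intro F_add F_uminus x yF)
      have "\<sigma> k (\<ominus> x \<oplus> y) = comp k h"
        using x ys by (simp add: symbol_add F_uminus yF symbol_uminus)
      then have "\<ominus> x \<oplus> y \<in> h k" using d gr_comp(1)[OF h, of k] by (auto simp: symbol_fibre_def)
      moreover have "x \<in> f k" using x gr_comp(1)[OF f, of k] by (auto simp: symbol_fibre_def)
      moreover have "y = x \<oplus> (\<ominus> x \<oplus> y)"
      proof -
        have "x \<in> carrier R" "y \<in> carrier R" using x(1) yF F_carrier by blast+
        then show ?thesis by (simp add: a_assoc[symmetric] r_neg)
      qed
      ultimately show "y \<in> f k <+>\<^bsub>R\<^esub> h k" by (auto simp: set_add_def')
    qed
    then show ?thesis by (simp add: assoc_graded_def)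
  qed
  have "finite {k. ?c k \<noteq> (\<lambda>g. 0)}"
    by (rule finite_subset[OF _ finite_UnI[OF gr_comp(3)[OF f] gr_comp(3)[OF h]]]) auto
  then show "f \<oplus>\<^bsub>gr\<^esub> h \<in> carrier gr" using cs eq by (auto simp: carrier_gr intro!: exI[of _ ?c])
  show "comp k (f \<oplus>\<^bsub>gr\<^esub> h) = ?c k" by (rule comp_symbol_fibre[OF eq cs])
qed

text \<open>The product of two cosets is formed with all representatives.  They all have the same symbols, hence so do
  the products, and the union in the definition is over equal sets.\<close>

lemma gr_mult:
  assumes f: "f \<in> carrier gr" and h: "h \<in> carrier gr"
  shows "f \<otimes>\<^bsub>gr\<^esub> h \<in> carrier gr"
    "comp k (f \<otimes>\<^bsub>gr\<^esub> h) = (\<lambda>g. \<Sum>i\<le>k. (comp i f \<otimes>\<^bsub>S\<^esub> comp (k - i) h) g)"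
proof -
  let ?c = "\<lambda>k g. \<Sum>i\<le>k. (comp i f \<otimes>\<^bsub>S\<^esub> comp (k - i) h) g"
  have P: "finsum R (\<lambda>i. x i \<otimes> y (k - i)) {..k} \<in> F k \<and>
      \<sigma> k (finsum R (\<lambda>i. x i \<otimes> y (k - i)) {..k}) = ?c k"
    if "\<forall>i. x i \<in> f i" "\<forall>i. y i \<in> h i" for x y k
  proof -
    have xy: "x i \<in> F i" "\<sigma> i (x i) = comp i f" "y i \<in> F i" "\<sigma> i (y i) = comp i h" for i
      using that gr_comp(1)[OF f, of i] gr_comp(1)[OF h, of i] by (auto simp: symbol_fibre_def)
    have "x i \<otimes> y (k - i) \<in> F k \<and> \<sigma> k (x i \<otimes> y (k - i)) = comp i f \<otimes>\<^bsub>S\<^esub> comp (k - i) h"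
      if "i \<in> {..k}" for i
      using F_mult[OF xy(1)[of i] xy(3)[of "k - i"]] symbol_mult[OF xy(1)[of i] xy(3)[of "k - i"]] that xy
      by simp
    then show ?thesis using finsum_F[of "{..k}" "\<lambda>i. x i \<otimes> y (k - i)" k] by auto
  qed
  have ne: "\<exists>x. \<forall>i. x i \<in> f i" if "f \<in> carrier gr" for f
  proof -
    have "\<exists>x. x \<in> f i" for i
      using gr_comp(1,2)[OF that, of i] by (auto simp: symbol_fibre_def)
    then show ?thesis by (intro choice) blast
  qed
  obtain x0 y0 where xy0: "\<forall>i. x0 i \<in> f i" "\<forall>i. y0 i \<in> h i" using ne[OF f] ne[OF h] by auto
  have cs: "?c k \<in> \<sigma> k ` F k" for k
    using P[OF xy0, of k] by (intro image_eqI[where x="finsum R (\<lambda>i. x0 i \<otimes> y0 (k - i)) {..k}"]) auto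
  have eq: "(f \<otimes>\<^bsub>gr\<^esub> h) k = symbol_fibre k (?c k)" for k
  proof -
    have "(f \<otimes>\<^bsub>gr\<^esub> h) k = (\<Union>x\<in>{x. \<forall>i. x i \<in> f i}. \<Union>y\<in>{y. \<forall>i. y i \<in> h i}.
        fil_below R F k +> finsum R (\<lambda>i. x i \<otimes> y (k - i)) {..k})"
      by (simp add: assoc_graded_def)
    also have "\<dots> = (\<Union>x\<in>{x. \<forall>i. x i \<in> f i}. \<Union>y\<in>{y. \<forall>i. y i \<in> h i}. symbol_fibre k (?c k))"
      using P coset_eq by (intro SUP_cong refl) (auto simp: symbol_fibre_def)
    also have "\<dots> = symbol_fibre k (?c k)" using xy0 by auto
    finally show ?thesis .
  qed
  obtain N where N: "\<And>i. comp i f \<noteq> (\<lambda>g. 0) \<Longrightarrow> i \<le> N"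
    using gr_comp(3)[OF f] unfolding finite_nat_set_iff_bounded_le by blast
  obtain M where M: "\<And>i. comp i h \<noteq> (\<lambda>g. 0) \<Longrightarrow> i \<le> M"
    using gr_comp(3)[OF h] unfolding finite_nat_set_iff_bounded_le by blast
  have z: "(\<lambda>g. 0) \<otimes>\<^bsub>S\<^esub> \<sigma> l y = (\<lambda>g. 0)" "\<sigma> l y \<otimes>\<^bsub>S\<^esub> (\<lambda>g. 0) = (\<lambda>g. 0)" if "y \<in> F l" for l y
  proof -
    have y: "y \<in> carrier R" using that F_carrier by blast
    show "(\<lambda>g. 0) \<otimes>\<^bsub>S\<^esub> \<sigma> l y = (\<lambda>g. 0)"
      using symbol_mult[OF F_zero[of 0] that] y by (simp add: symbol_zero)
    show "\<sigma> l y \<otimes>\<^bsub>S\<^esub> (\<lambda>g. 0) = (\<lambda>g. 0)"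
      using symbol_mult[OF that F_zero[of 0]] y by (simp add: symbol_zero)
  qed
  have "{k. ?c k \<noteq> (\<lambda>g. 0)} \<subseteq> {..N + M}"
  proof (rule subsetI, rule ccontr)
    fix k assume k: "k \<in> {k. ?c k \<noteq> (\<lambda>g. 0)}" "k \<notin> {..N + M}"
    have "comp i f \<otimes>\<^bsub>S\<^esub> comp (k - i) h = (\<lambda>g. 0)" if "i \<le> k" for i
    proof (cases "i \<le> N")
      case True
      then have "comp (k - i) h = (\<lambda>g. 0)" using M[of "k - i"] k that by fastforce
      then show ?thesis using z(2) gr_comp(2)[OF f, of i] by auto
    next
      case False
      then have "comp i f = (\<lambda>g. 0)" using N by blast
      then show ?thesis using z(1) gr_comp(2)[OF h, of "k - i"] by auto
    qed
    with k(1) show False by simp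
  qed
  then have "finite {k. ?c k \<noteq> (\<lambda>g. 0)}" by (rule finite_subset) simp
  then show "f \<otimes>\<^bsub>gr\<^esub> h \<in> carrier gr" using cs eq by (auto simp: carrier_gr intro!: exI[of _ ?c])
  show "comp k (f \<otimes>\<^bsub>gr\<^esub> h) = ?c k" by (rule comp_symbol_fibre[OF eq cs])
qed

lemma gr_degree_zero:
  assumes "x \<in> F 0" "\<sigma> 0 x \<in> carrier S" "pr 0 (\<sigma> 0 x) = \<sigma> 0 x" "\<And>k. k \<noteq> 0 \<Longrightarrow> pr k (\<sigma> 0 x) = (\<lambda>g. 0)"
  shows "(\<lambda>k. fil_below R F k +> (if k = 0 then x else \<zero>)) \<in> carrier gr"
    "gr_iso (\<lambda>k. fil_below R F k +> (if k = 0 then x else \<zero>)) = \<sigma> 0 x"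
proof -
  let ?f = "\<lambda>k. fil_below R F k +> (if k = 0 then x else \<zero>)"
  let ?c = "\<lambda>k. if k = 0 then \<sigma> 0 x else (\<lambda>g. 0)"
  have eq: "?f k = symbol_fibre k (?c k)" for k
    using coset_eq[OF assms(1)] coset_eq[OF F_zero[of k]] symbol_zero by (auto simp: symbol_fibre_def)
  have cs: "?c k \<in> \<sigma> k ` F k" for k
    using assms(1) image_eqI[of "\<lambda>g. 0" "\<sigma> k" \<zero> "F k"] symbol_zero[of k] F_zero[of k] by auto
  have "finite {k. ?c k \<noteq> (\<lambda>g. 0)}" by (rule finite_subset[of _ "{0}"]) auto
  then show f: "?f \<in> carrier gr" using eq cs by (auto simp: carrier_gr intro!: exI[of _ ?c])
  show "gr_iso ?f = \<sigma> 0 x"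
    by (rule gr_isoI[OF f assms(2)]) (use comp_symbol_fibre[where f="?f", OF eq cs] assms(3,4) in auto)
qed

lemma gr_iso_ring_iso: "gr_iso \<in> ring_iso gr S"
proof (rule ring_iso_memI)
  fix f h assume f: "f \<in> carrier gr" and h: "h \<in> carrier gr"
  show "gr_iso f \<in> carrier S" by (rule gr_iso[OF f])
  show "gr_iso (f \<otimes>\<^bsub>gr\<^esub> h) = gr_iso f \<otimes>\<^bsub>S\<^esub> gr_iso h"
    by (rule gr_isoI) (simp_all add: gr_mult[OF f h] S_mult_closed gr_iso f h pr_mult)
  show "gr_iso (f \<oplus>\<^bsub>gr\<^esub> h) = gr_iso f \<oplus>\<^bsub>S\<^esub> gr_iso h"
    by (rule gr_isoI) (simp_all add: gr_add[OF f h] S_add S_add_closed gr_iso f h pr_add)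
next
  show "gr_iso \<one>\<^bsub>gr\<^esub> = \<one>\<^bsub>S\<^esub>"
    using gr_degree_zero(2)[OF F_one] symbol_one pr_one S_one_closed by (simp add: assoc_graded_def)
qed (rule bij_gr_iso)

lemma gr_iso_graded_part: "gr_iso ` graded_part R F k = {s \<in> carrier S. \<forall>j. j \<noteq> k \<longrightarrow> pr j s = (\<lambda>g. 0)}"
proof -
  have "f \<in> graded_part R F k \<longleftrightarrow> (\<forall>j. j \<noteq> k \<longrightarrow> pr j (gr_iso f) = (\<lambda>g. 0))" if f: "f \<in> carrier gr" for f
  proof -
    have "f j = fil_below R F j \<longleftrightarrow> comp j f = (\<lambda>g. 0)" for j
    proof
      assume "f j = fil_below R F j"
      then have "f j = symbol_fibre j (\<lambda>g. 0)" by (simp add: fil_below_eq symbol_fibre_def)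
      moreover have "(\<lambda>g. 0) \<in> \<sigma> j ` F j"
        using image_eqI[of "\<lambda>g. 0" "\<sigma> j" \<zero> "F j"] symbol_zero[of j] F_zero[of j] by simp
      ultimately show "comp j f = (\<lambda>g. 0)" by (rule comp_symbol_fibre)
    next
      assume "comp j f = (\<lambda>g. 0)"
      then show "f j = fil_below R F j"
        using gr_comp(1)[OF f, of j] by (simp add: fil_below_eq symbol_fibre_def)
    qed
    then show ?thesis using f gr_iso(2)[OF f] by (simp add: graded_part_def)
  qed
  then have "graded_part R F k = {f \<in> carrier gr. \<forall>j. j \<noteq> k \<longrightarrow> pr j (gr_iso f) = (\<lambda>g. 0)}"
    by (auto simp: graded_part_def)
  moreover have "gr_iso ` {f \<in> carrier gr. \<forall>j. j \<noteq> k \<longrightarrow> pr j (gr_iso f) = (\<lambda>g. 0)}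
      = {s \<in> gr_iso ` carrier gr. \<forall>j. j \<noteq> k \<longrightarrow> pr j s = (\<lambda>g. 0)}" by blast
  ultimately show ?thesis using bij_gr_iso by (simp add: bij_betw_def)
qed

end


section \<open>The symmetric algebra as a graded quotient of the tensor algebra\<close>

definition abelianize :: "('i list \<Rightarrow>\<^sub>0 complex) \<Rightarrow> ('i multiset \<Rightarrow>\<^sub>0 complex)"
  where "abelianize = lin_ext (\<lambda>w. Poly_Mapping.single (mset w) 1)"

definition hpart :: "nat \<Rightarrow> ('i multiset \<Rightarrow>\<^sub>0 complex) \<Rightarrow> ('i multiset \<Rightarrow>\<^sub>0 complex)"
  where "hpart k = lin_ext (\<lambda>m. Poly_Mapping.single m 1 when size m = k)"

lemma abelianize_add: "abelianize (p + q) = abelianize p + abelianize q"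
  and abelianize_diff: "abelianize (p - q) = abelianize p - abelianize q"
  and abelianize_cscale: "abelianize (c *\<^sub>c p) = c *\<^sub>c abelianize p"
  and abelianize_zero [simp]: "abelianize 0 = 0"
  by (simp_all add: abelianize_def lin_ext_add lin_ext_cscale lin_ext_diff)

lemma hpart_add: "hpart k (p + q) = hpart k p + hpart k q"
  and hpart_diff: "hpart k (p - q) = hpart k p - hpart k q"
  and hpart_cscale: "hpart k (c *\<^sub>c p) = c *\<^sub>c hpart k p"
  and hpart_zero [simp]: "hpart k 0 = 0"
  by (simp_all add: hpart_def lin_ext_add lin_ext_cscale lin_ext_diff)

lemma hpart_sum: "hpart k (\<Sum>i\<in>I. f i) = (\<Sum>i\<in>I. hpart k (f i))"
  by (simp add: hpart_def lin_ext_sum)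

lemma abelianize_times: "abelianize (p * q) = abelianize p * abelianize q"
  unfolding abelianize_def by (rule lin_ext_times) (simp add: plus_list_def mult_single)

lemma abelianize_one [simp]: "abelianize 1 = 1"
  by (simp add: abelianize_def flip: single_zero_one)

lemma abelianize_tvec: "abelianize (tvec v) = svec v"
  by (simp add: abelianize_def tvec_eq_lin_ext svec_eq_lin_ext lin_ext_comp)

lemma abelianize_tprod: "abelianize (tprod vs) = sprod vs"
  by (induction vs) (simp_all add: abelianize_times abelianize_tvec)

lemma abelianize_tensor_map:
  assumes "Vector_Spaces.linear cscale cscale f"
  shows "abelianize (tensor_map f p) = sym_map f (abelianize p)"
proof (induction p rule: poly_mapping_linear_induct)
  case (basis w)
  have "abelianize (Poly_Mapping.single w 1) = Poly_Mapping.single (mset w) 1" by (simp add: abelianize_def)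
  then show ?case
    by (simp only: single_word single_multiset tensor_map_tprod[OF assms] abelianize_tprod sym_map_sprod[OF assms])
qed (simp_all add: abelianize_add abelianize_cscale tensor_map_add tensor_map_cscale sym_map_add sym_map_cscale,
     simp add: tensor_map_eq_lin_ext sym_map_eq_lin_ext)

lemma lookup_hpart: "Poly_Mapping.lookup (hpart k p) m = (Poly_Mapping.lookup p m when size m = k)"
proof (induction p rule: poly_mapping_linear_induct)
  case (basis m')
  then show ?case by (auto simp: hpart_def lookup_single when_def)
qed (simp_all add: hpart_add hpart_cscale lookup_add when_def)

lemma hpart_finite: "finite {k. hpart k p \<noteq> 0}"
proof (rule finite_subset)
  show "{k. hpart k p \<noteq> 0} \<subseteq> size ` Poly_Mapping.keys p"
    by (auto simp: image_iff in_keys_iff lookup_hpart when_def poly_mapping_eq_iff fun_eq_iff)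
qed simp

lemma hpart_eqI: "(\<And>k. hpart k p = hpart k q) \<Longrightarrow> p = q"
proof (rule poly_mapping_eqI)
  fix m assume "\<And>k. hpart k p = hpart k q"
  then show "Poly_Mapping.lookup p m = Poly_Mapping.lookup q m"
    using lookup_hpart[of "size m" p m] lookup_hpart[of "size m" q m] by simp
qed

definition homogeneous :: "nat \<Rightarrow> ('i multiset \<Rightarrow>\<^sub>0 complex) \<Rightarrow> bool"
  where "homogeneous k p \<longleftrightarrow> (\<forall>j. hpart j p = (p when j = k))"

lemma homogeneous_iff: "homogeneous k p \<longleftrightarrow> (\<forall>m\<in>Poly_Mapping.keys p. size m = k)"
proof
  assume h: "homogeneous k p"
  show "\<forall>m\<in>Poly_Mapping.keys p. size m = k"
  proof
    fix m assume m: "m \<in> Poly_Mapping.keys p"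
    have "Poly_Mapping.lookup (hpart k p) m = Poly_Mapping.lookup p m" using h by (simp add: homogeneous_def)
    then show "size m = k" using m by (auto simp: lookup_hpart in_keys_iff when_def split: if_splits)
  qed
next
  assume h: "\<forall>m\<in>Poly_Mapping.keys p. size m = k"
  have "Poly_Mapping.lookup (hpart j p) m = Poly_Mapping.lookup (p when j = k) m" for j m
    using h by (cases "m \<in> Poly_Mapping.keys p") (auto simp: lookup_hpart in_keys_iff when_def)
  then show "homogeneous k p" by (auto simp: homogeneous_def intro: poly_mapping_eqI)
qed

lemma homogeneous_add: "homogeneous k p \<Longrightarrow> homogeneous k q \<Longrightarrow> homogeneous k (p + q)"
  and homogeneous_cscale: "homogeneous k p \<Longrightarrow> homogeneous k (c *\<^sub>c p)"
  and homogeneous_zero: "homogeneous k 0"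
  by (auto simp: homogeneous_def hpart_add hpart_cscale when_def)

lemma homogeneous_times: "homogeneous k p \<Longrightarrow> homogeneous l q \<Longrightarrow> homogeneous (k + l) (p * q)"
  unfolding homogeneous_iff using keys_mult[of p q] by fastforce

lemma homogeneous_svec: "homogeneous 1 (svec v)"
proof (induction v rule: poly_mapping_linear_induct)
  case (basis i)
  then show ?case by (simp add: svec_single homogeneous_iff)
qed (simp_all add: svec_add svec_cscale homogeneous_add homogeneous_cscale homogeneous_zero)

lemma homogeneous_sprod: "homogeneous (length vs) (sprod vs)"
proof (induction vs)
  case (Cons v vs)
  from homogeneous_times[OF homogeneous_svec Cons] show ?case by simp
qed (simp add: homogeneous_iff)

lemma hpart_times: "hpart k (p * q) = (\<Sum>i\<le>k. hpart i p * hpart (k - i) q)"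
proof (induction p rule: poly_mapping_linear_induct)
  case (basis m)
  show ?case
  proof (induction q rule: poly_mapping_linear_induct)
    case (basis m')
    have "(\<Sum>i\<le>k. hpart i (Poly_Mapping.single m 1) * hpart (k - i) (Poly_Mapping.single m' 1))
        = (\<Sum>i\<le>k. if i = size m then (Poly_Mapping.single (m + m') 1 when k = size m + size m') else 0)"
      by (rule sum.cong) (auto simp: hpart_def when_def mult_single)
    also have "\<dots> = hpart k (Poly_Mapping.single m 1 * Poly_Mapping.single m' 1)"
      by (auto simp: hpart_def when_def mult_single)
    finally show ?case by simp
  qed (simp_all add: hpart_add hpart_cscale distrib_left sum.distrib cscale_times_right cvs.scale_sum_right)
qed (simp_all add: hpart_add hpart_cscale distrib_right sum.distrib cscale_times_left cvs.scale_sum_right)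

lemma hpart_sym_map:
  assumes "Vector_Spaces.linear cscale cscale f"
  shows "hpart k (sym_map f p) = sym_map f (hpart k p)"
proof (induction p rule: poly_mapping_linear_induct)
  case (basis m)
  obtain w where m: "m = mset w" by (metis ex_mset)
  have "homogeneous (length w) (sym_map f (Poly_Mapping.single (mset w) 1))"
    using homogeneous_sprod[of "map f (map (\<lambda>i. Poly_Mapping.single i 1) w)"]
    by (simp only: single_multiset sym_map_sprod[OF assms] length_map)
  then have "homogeneous (size m) (sym_map f (Poly_Mapping.single m 1))"
    by (simp add: m)
  then have "hpart k (sym_map f (Poly_Mapping.single m 1)) = (sym_map f (Poly_Mapping.single m 1) when k = size m)"
    by (simp add: homogeneous_def)
  moreover have "sym_map f 0 = 0" by (simp add: sym_map_eq_lin_ext)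
  ultimately show ?case by (auto simp: hpart_def when_def)
qed (simp_all add: hpart_add hpart_cscale sym_map_add sym_map_cscale, simp add: sym_map_eq_lin_ext)

lemma span_times:
  fixes A B C :: "('k::monoid_add \<Rightarrow>\<^sub>0 complex) set"
  assumes "p \<in> cvs.span A" "q \<in> cvs.span B" "\<And>a b. a \<in> A \<Longrightarrow> b \<in> B \<Longrightarrow> a * b \<in> cvs.span C"
  shows "p * q \<in> cvs.span C"
  using assms(1)
proof (induction p rule: cvs.span_induct_alt)
  case (step c a p)
  have "a * q \<in> cvs.span C"
    using assms(2)
  proof (induction q rule: cvs.span_induct_alt)
    case (step d b q)
    then show ?case
      using assms(3)[OF \<open>a \<in> A\<close> \<open>b \<in> B\<close>]
      by (simp add: distrib_left cscale_times_right cvs.span_add cvs.span_scale)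
  qed (simp add: cvs.span_zero)
  with step show ?case by (simp add: distrib_right cscale_times_left cvs.span_add cvs.span_scale)
qed (simp add: cvs.span_zero)

lemma span_linear_image:
  assumes "p \<in> cvs.span A" "\<And>p q. f (p + q) = f p + f q" "\<And>c p. f (c *\<^sub>c p) = c *\<^sub>c f p"
    "\<And>a. a \<in> A \<Longrightarrow> f a \<in> cvs.span B"
  shows "f p \<in> cvs.span B"
  using assms(1)
proof (induction p rule: cvs.span_induct_alt)
  case base
  have "f 0 = 0" using assms(3)[of 0 0] by simp
  then show ?case by (simp add: cvs.span_zero)
next
  case (step c a p)
  then show ?case using assms(4) by (simp add: assms(2,3) cvs.span_add cvs.span_scale)
qed

lemma tensor_upto_times:
  "p \<in> tensor_upto V k \<Longrightarrow> q \<in> tensor_upto V l \<Longrightarrow> p * q \<in> tensor_upto V (k + l)"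
  unfolding tensor_upto_def
proof (erule span_times, assumption, clarify)
  fix vs ws assume "set vs \<subseteq> V" "length vs \<le> k" "set ws \<subseteq> V" "length ws \<le> l"
  then show "tprod vs * tprod ws \<in> cvs.span {tprod us | us. set us \<subseteq> V \<and> length us \<le> k + l}"
    by (intro cvs.span_base CollectI exI[of _ "vs @ ws"]) auto
qed

lemma tensor_upto_mono: "k \<le> l \<Longrightarrow> tensor_upto V k \<subseteq> tensor_upto V l"
  unfolding tensor_upto_def by (intro cvs.span_mono) auto

lemma tensor_upto_tprod: "set vs \<subseteq> V \<Longrightarrow> length vs \<le> k \<Longrightarrow> tprod vs \<in> tensor_upto V k"
  unfolding tensor_upto_def by (rule cvs.span_base) auto

lemma tensor_upto_closed:
  "p \<in> tensor_upto V k \<Longrightarrow> q \<in> tensor_upto V k \<Longrightarrow> p + q \<in> tensor_upto V k"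
  "p \<in> tensor_upto V k \<Longrightarrow> q \<in> tensor_upto V k \<Longrightarrow> p - q \<in> tensor_upto V k"
  "p \<in> tensor_upto V k \<Longrightarrow> - p \<in> tensor_upto V k"
  "p \<in> tensor_upto V k \<Longrightarrow> c *\<^sub>c p \<in> tensor_upto V k"
  "0 \<in> tensor_upto V k"
  unfolding tensor_upto_def
  by (auto intro: cvs.span_add cvs.span_diff cvs.span_neg cvs.span_scale cvs.span_zero)

lemma tensor_upto_single_zero: "Poly_Mapping.single 0 c \<in> tensor_upto V k"
proof -
  have "c *\<^sub>c tprod [] \<in> tensor_upto V k"
    by (intro tensor_upto_closed tensor_upto_tprod) auto
  then show ?thesis by (simp add: cscale_eq_single_times)
qed

lemma tensor_upto_tvec: "v \<in> V \<Longrightarrow> tvec v \<in> tensor_upto V 1"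
  using tensor_upto_tprod[of "[v]" V 1] by simp

lemma hpart_abelianize_tensor_upto:
  assumes "p \<in> tensor_upto V k" "j > k"
  shows "hpart j (abelianize p) = 0"
  using assms(1) unfolding tensor_upto_def
proof (induction p rule: cvs.span_induct_alt)
  case (step c a p)
  then obtain vs where "a = tprod vs" "length vs \<le> k" by auto
  then have "hpart j (abelianize a) = 0"
    using homogeneous_sprod[of vs] assms(2) by (simp add: abelianize_tprod homogeneous_def)
  then show ?case using step by (simp add: abelianize_add abelianize_cscale hpart_add hpart_cscale)
qed simp

text \<open>Only the top-degree parts contribute in the top degree of a product.  This makes the symbol
  multiplicative.\<close>

lemma hpart_abelianize_times:
  assumes "p \<in> tensor_upto V k" "q \<in> tensor_upto V l"
  shows "hpart (k + l) (abelianize (p * q)) = hpart k (abelianize p) * hpart l (abelianize q)"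
proof -
  have "hpart (k + l) (abelianize (p * q)) = (\<Sum>i\<le>k + l. hpart i (abelianize p) * hpart (k + l - i) (abelianize q))"
    by (simp add: abelianize_times hpart_times)
  also have "\<dots> = (\<Sum>i\<le>k + l. if i = k then hpart k (abelianize p) * hpart l (abelianize q) else 0)"
  proof (rule sum.cong)
    fix i
    show "hpart i (abelianize p) * hpart (k + l - i) (abelianize q) = (if i = k then hpart k (abelianize p) * hpart l (abelianize q) else 0)"
      using hpart_abelianize_tensor_upto[OF assms(1), of i] hpart_abelianize_tensor_upto[OF assms(2), of "k + l - i"]
      by (cases i k rule: linorder_cases) auto
  qed simp
  also have "\<dots> = hpart k (abelianize p) * hpart l (abelianize q)" by (simp add: sum.delta)
  finally show ?thesis .
qed

lemma sym_power_homogeneous: "q \<in> sym_power V k \<Longrightarrow> homogeneous k q"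
  unfolding sym_power_def
proof (induction q rule: cvs.span_induct_alt)
  case (step c a p)
  then show ?case using homogeneous_sprod by (auto intro!: homogeneous_add homogeneous_cscale)
qed (rule homogeneous_zero)

text \<open>The homogeneous polynomials of degree \<open>k\<close> are exactly the symbols of tensors of filtration degree \<open>k\<close>;
  products of fewer than \<open>k\<close> vectors have no part of degree \<open>k\<close>.\<close>

lemma sym_power_eq_image: "sym_power V k = (\<lambda>p. hpart k (abelianize p)) ` tensor_upto V k"
proof (intro equalityI subsetI)
  fix q assume "q \<in> sym_power V k"
  then show "q \<in> (\<lambda>p. hpart k (abelianize p)) ` tensor_upto V k"
    unfolding sym_power_def
  proof (induction q rule: cvs.span_induct_alt)
    case base
    show ?case by (rule image_eqI[where x=0]) (simp_all add: tensor_upto_closed)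
  next
    case (step c a q)
    then obtain vs where a: "a = sprod vs" "set vs \<subseteq> V" "length vs = k" by auto
    obtain p where p: "p \<in> tensor_upto V k" "q = hpart k (abelianize p)" using step by auto
    have "hpart k (abelianize (tprod vs)) = a"
      using homogeneous_sprod[of vs] a by (simp add: abelianize_tprod homogeneous_def)
    then show ?case
      using p a by (intro image_eqI[where x="c *\<^sub>c tprod vs + p"])
        (simp_all add: abelianize_add abelianize_cscale hpart_add hpart_cscale tensor_upto_closed tensor_upto_tprod)
  qed
next
  fix q assume "q \<in> (\<lambda>p. hpart k (abelianize p)) ` tensor_upto V k"
  then obtain p where p: "p \<in> tensor_upto V k" "q = hpart k (abelianize p)" by auto
  have "hpart k (abelianize p) \<in> sym_power V k"
    using p(1) unfolding tensor_upto_def sym_power_def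
  proof (rule span_linear_image)
    fix a assume "a \<in> {tprod vs |vs. set vs \<subseteq> V \<and> length vs \<le> k}"
    then obtain vs where a: "a = tprod vs" "set vs \<subseteq> V" by auto
    show "hpart k (abelianize a) \<in> cvs.span {sprod vs |vs. set vs \<subseteq> V \<and> length vs = k}"
    proof (cases "length vs = k")
      case True
      then show ?thesis using a homogeneous_sprod[of vs]
        by (auto simp: abelianize_tprod homogeneous_def intro!: cvs.span_base)
    next
      case False
      then show ?thesis using a homogeneous_sprod[of vs]
        by (simp add: abelianize_tprod homogeneous_def cvs.span_zero)
    qed
  qed (simp_all add: abelianize_add abelianize_cscale hpart_add hpart_cscale)
  with p show "q \<in> sym_power V k" by simp
qed

lemma tensor_upto_keys:
  assumes "p \<in> tensor_upto V k" "w \<in> Poly_Mapping.keys p"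
  shows "length w \<le> k"
proof -
  have tprod_keys: "length w = length vs" if "w \<in> Poly_Mapping.keys (tprod vs)" for w and vs :: "('a \<Rightarrow>\<^sub>0 complex) list"
  proof -
    from that show "length w = length vs"
    proof (induction vs arbitrary: w)
      case Nil
      then show ?case by (simp add: zero_list_def)
    next
      case (Cons v vs)
      then obtain a b where ab: "w = a + b" "a \<in> Poly_Mapping.keys (tvec v)" "b \<in> Poly_Mapping.keys (tprod vs)"
        using keys_mult[of "tvec v" "tprod vs"] by auto
      have "length a = 1"
      proof -
        have "a \<in> (\<Union>i\<in>Poly_Mapping.keys v. Poly_Mapping.keys (Poly_Mapping.single [i] (Poly_Mapping.lookup v i)))"
          using ab(2) unfolding tvec_def by (rule subsetD[rotated]) (rule keys_sum)
        then show ?thesis by (auto split: if_splits)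
      qed
      then show ?case using ab Cons.IH by (simp add: plus_list_def)
    qed
  qed
  have "\<forall>w. Poly_Mapping.lookup p w \<noteq> 0 \<longrightarrow> length w \<le> k"
    using assms(1) unfolding tensor_upto_def
  proof (induction p rule: cvs.span_induct_alt)
    case (step c a p)
    then obtain vs where a: "a = tprod vs" "length vs \<le> k" by auto
    show ?case
    proof (intro allI impI)
      fix w assume "Poly_Mapping.lookup (c *\<^sub>c a + p) w \<noteq> 0"
      then have "Poly_Mapping.lookup a w \<noteq> 0 \<or> Poly_Mapping.lookup p w \<noteq> 0" by (auto simp: lookup_add)
      then show "length w \<le> k" using step.IH a tprod_keys[of w vs] by (auto simp: in_keys_iff)
    qed
  qed simp
  then show ?thesis using assms(2) by (simp add: in_keys_iff)
qed


section \<open>A criterion for the associated graded algebra\<close>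

text \<open>As in bubble sort, rearrangements of a list are connected by swaps of neighbours.  The swaps need only be
  related by \<open>E\<close> for rearrangements of \<open>vs\<close> itself, whose length and entries are thus under control.\<close>

lemma mset_eq_induct_adjacent:
  assumes "mset vs = mset ws"
    and "\<And>xs. E xs xs" "\<And>xs ys zs. E xs ys \<Longrightarrow> E ys zs \<Longrightarrow> E xs zs"
    and "\<And>xs v w ys. mset (xs @ v # w # ys) = mset vs \<Longrightarrow> E (xs @ v # w # ys) (xs @ w # v # ys)"
  shows "E vs ws"
proof -
  have move: "E (xs @ v # as @ bs) (xs @ as @ v # bs)" if "mset (xs @ v # as @ bs) = mset vs" for xs v as bs
    using that
  proof (induction as arbitrary: xs)
    case (Cons a as)
    have "E (xs @ v # a # as @ bs) (xs @ a # v # as @ bs)" using Cons.prems by (intro assms(4)) simp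
    moreover have "E ((xs @ [a]) @ v # as @ bs) ((xs @ [a]) @ as @ v # bs)"
      using Cons.prems by (intro Cons.IH) (simp add: add_mset_commute ac_simps)
    ultimately show ?case using assms(3) by simp
  qed (simp add: assms(2))
  have "E (xs @ us) (xs @ us')" if "mset us = mset us'" "mset (xs @ us) = mset vs" for xs us us'
    using that
  proof (induction us arbitrary: xs us')
    case (Cons v us)
    have "v \<in> set us'" using Cons.prems(1) by (metis list.set_intros(1) set_mset_mset)
    then obtain as bs where us': "us' = as @ v # bs" by (meson split_list)
    have "E ((xs @ [v]) @ us) ((xs @ [v]) @ as @ bs)"
      using Cons.prems us' by (intro Cons.IH) (simp_all add: ac_simps)
    moreover have "E (xs @ v # as @ bs) (xs @ as @ v # bs)"
      using Cons.prems us' by (intro move) (simp add: ac_simps)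
    ultimately show ?case using assms(3) us' by simp
  qed (simp add: assms(2))
  from this[of vs ws "[]"] assms(1) show ?thesis by simp
qed

text \<open>The projection \<open>P\<close> onto \<open>V\<close> turns words in the basis of the ambient space into products of vectors
  of \<open>V\<close>, so that no basis of \<open>V\<close> is needed.\<close>

locale linear_action = group G for G :: "('g, 'k) monoid_scheme" (structure) +
  fixes \<rho> :: "'g \<Rightarrow> ('i \<Rightarrow>\<^sub>0 complex) \<Rightarrow> ('i \<Rightarrow>\<^sub>0 complex)" and V :: "('i \<Rightarrow>\<^sub>0 complex) set"
    and P :: "('i \<Rightarrow>\<^sub>0 complex) \<Rightarrow> ('i \<Rightarrow>\<^sub>0 complex)"
  assumes fin_G: "finite (carrier G)"
    and act_linear: "g \<in> carrier G \<Longrightarrow> Vector_Spaces.linear cscale cscale (\<rho> g)"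
    and act_id: "\<rho> \<one> = id"
    and act_times: "g \<in> carrier G \<Longrightarrow> h \<in> carrier G \<Longrightarrow> \<rho> (g \<otimes> h) = \<rho> g \<circ> \<rho> h"
    and V_subspace: "cvs.subspace V"
    and act_V: "g \<in> carrier G \<Longrightarrow> v \<in> V \<Longrightarrow> \<rho> g v \<in> V"
    and P_linear: "Vector_Spaces.linear cscale cscale P"
    and P_V: "P v \<in> V"
    and P_fix: "v \<in> V \<Longrightarrow> P v = v"
begin

abbreviation TV where "TV \<equiv> cvs.span {tprod vs | vs. set vs \<subseteq> V}"
abbreviation SV where "SV \<equiv> cvs.span {sprod vs | vs. set vs \<subseteq> V}"

lemma TV_times: "p \<in> TV \<Longrightarrow> q \<in> TV \<Longrightarrow> p * q \<in> TV"
proof (erule span_times, assumption, clarify)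
  fix vs ws assume "set vs \<subseteq> V" "set ws \<subseteq> V"
  then show "tprod vs * tprod ws \<in> TV" by (intro cvs.span_base CollectI exI[of _ "vs @ ws"]) auto
qed

lemma SV_times: "p \<in> SV \<Longrightarrow> q \<in> SV \<Longrightarrow> p * q \<in> SV"
proof (erule span_times, assumption, clarify)
  fix vs ws assume "set vs \<subseteq> V" "set ws \<subseteq> V"
  then show "sprod vs * sprod ws \<in> SV" by (intro cvs.span_base CollectI exI[of _ "vs @ ws"]) auto
qed

lemma one_TV: "1 \<in> TV" and one_SV: "1 \<in> SV"
  by (intro cvs.span_base CollectI exI[of _ "[]"], simp)+

lemma tensor_upto_act:
  assumes "g \<in> carrier G" "p \<in> tensor_upto V k"
  shows "tensor_map (\<rho> g) p \<in> tensor_upto V k"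
  using assms(2) unfolding tensor_upto_def
proof (rule span_linear_image)
  fix a assume "a \<in> {tprod vs |vs. set vs \<subseteq> V \<and> length vs \<le> k}"
  then obtain vs where a: "a = tprod vs" "set vs \<subseteq> V" "length vs \<le> k" by auto
  then show "tensor_map (\<rho> g) a \<in> cvs.span {tprod vs |vs. set vs \<subseteq> V \<and> length vs \<le> k}"
    using assms(1) by (auto simp: tensor_map_tprod[OF act_linear] intro!: act_V cvs.span_base exI[of _ "map (\<rho> g) vs"])
qed (simp_all add: tensor_map_add tensor_map_cscale)

lemma TV_act: "tensor_map (\<rho> g) p \<in> TV" if "g \<in> carrier G" "p \<in> TV"
  using that(2)
proof (rule span_linear_image)
  fix a assume "a \<in> {tprod vs |vs. set vs \<subseteq> V}"
  then obtain vs where a: "a = tprod vs" "set vs \<subseteq> V" by auto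
  then show "tensor_map (\<rho> g) a \<in> TV"
    using that(1) by (auto simp: tensor_map_tprod[OF act_linear] intro!: act_V cvs.span_base exI[of _ "map (\<rho> g) vs"])
qed (simp_all add: tensor_map_add tensor_map_cscale)

lemma SV_act: "sym_map (\<rho> g) p \<in> SV" if "g \<in> carrier G" "p \<in> SV"
  using that(2)
proof (rule span_linear_image)
  fix a assume "a \<in> {sprod vs |vs. set vs \<subseteq> V}"
  then obtain vs where a: "a = sprod vs" "set vs \<subseteq> V" by auto
  then show "sym_map (\<rho> g) a \<in> SV"
    using that(1) by (auto simp: sym_map_sprod[OF act_linear] intro!: act_V cvs.span_base exI[of _ "map (\<rho> g) vs"])
qed (simp_all add: sym_map_add sym_map_cscale)

sublocale T: skew_data G TV "\<lambda>g. tensor_map (\<rho> g)"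
proof
  fix g h x assume "g \<in> carrier G" "h \<in> carrier G"
  then show "tensor_map (\<rho> (g \<otimes> h)) x = tensor_map (\<rho> g) (tensor_map (\<rho> h) x)"
    by (simp add: act_times tensor_map_comp act_linear)
qed (use TV_times one_TV TV_act in \<open>auto simp: fin_G cvs.span_zero cvs.span_add cvs.span_neg
      tensor_map_add tensor_map_times act_id\<close>)

sublocale S: skew_data G SV "\<lambda>g. sym_map (\<rho> g)"
proof
  fix g h x assume "g \<in> carrier G" "h \<in> carrier G"
  then show "sym_map (\<rho> (g \<otimes> h)) x = sym_map (\<rho> g) (sym_map (\<rho> h) x)"
    by (simp add: act_times sym_map_comp act_linear)
qed (use SV_times one_SV SV_act in \<open>auto simp: fin_G cvs.span_zero cvs.span_add cvs.span_neg
      sym_map_add sym_map_times act_id\<close>)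

lemma tensor_skew_eq: "tensor_skew G \<rho> V = T.skew"
  by (simp add: tensor_skew_def tensor_algebra_def)

lemma sym_skew_eq: "sym_skew G \<rho> V = S.skew"
  by (simp add: sym_skew_def sym_algebra_def)

definition upto :: "nat \<Rightarrow> ('g \<Rightarrow> ('i list \<Rightarrow>\<^sub>0 complex)) set"
  where "upto k = {f \<in> T.scarrier. \<forall>g\<in>carrier G. f g \<in> tensor_upto V k}"

definition below :: "nat \<Rightarrow> ('g \<Rightarrow> ('i list \<Rightarrow>\<^sub>0 complex)) set"
  where "below k = (case k of 0 \<Rightarrow> {\<lambda>g. 0} | Suc j \<Rightarrow> upto j)"

definition top_symbol :: "nat \<Rightarrow> ('g \<Rightarrow> ('i list \<Rightarrow>\<^sub>0 complex)) \<Rightarrow> 'g \<Rightarrow> ('i multiset \<Rightarrow>\<^sub>0 complex)"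
  where "top_symbol k f = (\<lambda>g. hpart k (abelianize (f g)))"

lemma tensor_upto_TV: "tensor_upto V k \<subseteq> TV"
  unfolding tensor_upto_def by (intro cvs.span_mono) auto

lemma upto_iff: "f \<in> upto k \<longleftrightarrow> (\<forall>g\<in>carrier G. f g \<in> tensor_upto V k) \<and> (\<forall>g. g \<notin> carrier G \<longrightarrow> f g = 0)"
  using tensor_upto_TV by (auto simp: upto_def T.scarrier_def)

lemma upto_scarrier: "f \<in> upto k \<Longrightarrow> f \<in> T.scarrier"
  by (simp add: upto_def)

lemma upto_closed:
  "(\<lambda>g. 0) \<in> upto k"
  "f \<in> upto k \<Longrightarrow> h \<in> upto k \<Longrightarrow> (\<lambda>g. f g + h g) \<in> upto k"
  "f \<in> upto k \<Longrightarrow> h \<in> upto k \<Longrightarrow> (\<lambda>g. f g - h g) \<in> upto k"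
  "f \<in> upto k \<Longrightarrow> (\<lambda>g. c *\<^sub>c f g) \<in> upto k"
  by (auto simp: upto_iff intro: tensor_upto_closed)

lemma upto_mono: "k \<le> l \<Longrightarrow> upto k \<subseteq> upto l"
  using tensor_upto_mono[of k l V] unfolding upto_iff subset_iff by auto

lemma below_upto: "below k \<subseteq> upto k"
  using upto_mono[of "k - 1" k] upto_closed(1) by (cases k) (auto simp: below_def)

lemma below_closed:
  "(\<lambda>g. 0) \<in> below k"
  "f \<in> below k \<Longrightarrow> h \<in> below k \<Longrightarrow> (\<lambda>g. f g + h g) \<in> below k"
  "f \<in> below k \<Longrightarrow> (\<lambda>g. c *\<^sub>c f g) \<in> below k"
  by (cases k; auto simp: below_def intro: upto_closed)+

lemma top_symbol_below: "f \<in> below k \<Longrightarrow> top_symbol k f = (\<lambda>g. 0)"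
proof (cases k)
  case (Suc j)
  assume "f \<in> below k"
  then have "f g \<in> tensor_upto V j" for g
    using Suc by (cases "g \<in> carrier G") (auto simp: below_def upto_iff tensor_upto_closed)
  then have "hpart k (abelianize (f g)) = 0" for g by (rule hpart_abelianize_tensor_upto) (simp add: Suc)
  then show ?thesis by (simp add: top_symbol_def)
qed (simp add: below_def top_symbol_def)

lemma top_symbol_add: "top_symbol k (\<lambda>g. f g + h g) = (\<lambda>g. top_symbol k f g + top_symbol k h g)"
  and top_symbol_diff: "top_symbol k (\<lambda>g. f g - h g) = (\<lambda>g. top_symbol k f g - top_symbol k h g)"
  by (simp_all add: top_symbol_def abelianize_add abelianize_diff hpart_add hpart_diff)

lemma smult_upto:
  assumes "f \<in> upto k" "h \<in> upto l"
  shows "T.smult f h \<in> upto (k + l)"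
proof -
  have "(\<Sum>x\<in>A. f x * tensor_map (\<rho> x) (h (inv x \<otimes> g))) \<in> tensor_upto V (k + l)"
    if "A \<subseteq> carrier G" "g \<in> carrier G" for A g
    using finite_subset[OF that(1) fin_G] that(1)
  proof (induction A rule: finite_induct)
    case (insert x A)
    then show ?case using assms that
      by (auto intro!: tensor_upto_closed tensor_upto_times tensor_upto_act simp: upto_iff)
  qed (simp add: tensor_upto_closed)
  then show ?thesis by (auto simp: upto_iff T.smult_def)
qed

lemma top_symbol_smult:
  assumes "f \<in> upto k" "h \<in> upto l"
  shows "top_symbol (k + l) (T.smult f h) = S.smult (top_symbol k f) (top_symbol l h)"
proof
  fix g
  have "hpart (k + l) (abelianize (\<Sum>x\<in>carrier G. f x * tensor_map (\<rho> x) (h (inv x \<otimes> g))))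
      = (\<Sum>x\<in>carrier G. hpart k (abelianize (f x)) * sym_map (\<rho> x) (hpart l (abelianize (h (inv x \<otimes> g)))))"
    if "g \<in> carrier G"
  proof -
    have "hpart (k + l) (abelianize (\<Sum>x\<in>carrier G. f x * tensor_map (\<rho> x) (h (inv x \<otimes> g))))
        = (\<Sum>x\<in>carrier G. hpart (k + l) (abelianize (f x * tensor_map (\<rho> x) (h (inv x \<otimes> g)))))"
      by (rule additive_sum) (simp add: abelianize_add hpart_add)
    also have "\<dots> = (\<Sum>x\<in>carrier G. hpart k (abelianize (f x)) * sym_map (\<rho> x) (hpart l (abelianize (h (inv x \<otimes> g)))))"
      using assms that
      by (intro sum.cong refl, subst hpart_abelianize_times)
         (auto simp: upto_iff abelianize_tensor_map[OF act_linear] hpart_sym_map[OF act_linear] intro!: tensor_upto_act)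
    finally show ?thesis .
  qed
  then show "top_symbol (k + l) (T.smult f h) g = S.smult (top_symbol k f) (top_symbol l h) g"
    by (simp add: top_symbol_def T.smult_def S.smult_def when_def)
qed

lemma top_symbol_image: "top_symbol k ` upto k = {s \<in> S.scarrier. \<forall>g\<in>carrier G. s g \<in> sym_power V k}"
proof (intro equalityI subsetI)
  fix s assume "s \<in> top_symbol k ` upto k"
  then obtain f where f: "f \<in> upto k" "s = top_symbol k f" by auto
  have "s g \<in> sym_power V k" if "g \<in> carrier G" for g
    using f that by (auto simp: upto_iff top_symbol_def sym_power_eq_image)
  moreover have "sym_power V k \<subseteq> SV" unfolding sym_power_def by (intro cvs.span_mono) auto
  ultimately show "s \<in> {s \<in> S.scarrier. \<forall>g\<in>carrier G. s g \<in> sym_power V k}"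
    using f by (auto simp: S.scarrier_def upto_iff top_symbol_def)
next
  fix s assume s: "s \<in> {s \<in> S.scarrier. \<forall>g\<in>carrier G. s g \<in> sym_power V k}"
  then have "\<forall>g\<in>carrier G. \<exists>p\<in>tensor_upto V k. s g = hpart k (abelianize p)" by (auto simp: sym_power_eq_image)
  then obtain p where p: "\<And>g. g \<in> carrier G \<Longrightarrow> p g \<in> tensor_upto V k \<and> s g = hpart k (abelianize (p g))" by metis
  show "s \<in> top_symbol k ` upto k"
    using s p by (intro image_eqI[where x="\<lambda>g. p g when g \<in> carrier G"])
      (auto simp: upto_iff top_symbol_def fun_eq_iff when_def S.scarrier_def)
qed

text \<open>A linear map from the symmetric to the tensor algebra of \<open>V\<close>: the letters of each monomial are put in some
  order and then projected to \<open>V\<close>.  On \<open>S(V)\<close> it is a section of \<open>abelianize\<close>.\<close>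

definition lift :: "('i multiset \<Rightarrow>\<^sub>0 complex) \<Rightarrow> ('i list \<Rightarrow>\<^sub>0 complex)"
  where "lift = lin_ext (\<lambda>m. tensor_map P (Poly_Mapping.single (SOME w. mset w = m) 1))"

lemma tensor_map_P: "p \<in> TV \<Longrightarrow> tensor_map P p = p"
proof (induction p rule: cvs.span_induct_alt)
  case base
  show ?case by (simp add: tensor_map_eq_lin_ext)
next
  case (step c a p)
  then obtain vs where vs: "a = tprod vs" "set vs \<subseteq> V" by auto
  then have "map P vs = vs" by (intro map_idI P_fix) auto
  then show ?case using step vs by (simp add: tensor_map_add tensor_map_cscale tensor_map_tprod[OF P_linear])
qed

lemma tensor_map_P_word: "tensor_map P (Poly_Mapping.single w 1) = tprod (map (\<lambda>i. P (Poly_Mapping.single i 1)) w)"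
  by (simp add: tensor_map_eq_lin_ext o_def)

end

locale orbifold_cochains = linear_action G \<rho> V P
  for G :: "('g, 'k) monoid_scheme" (structure) and \<rho> and V :: "('i \<Rightarrow>\<^sub>0 complex) set" and P +
  fixes \<kappa>L :: "'g \<Rightarrow> ('i \<Rightarrow>\<^sub>0 complex) \<Rightarrow> ('i \<Rightarrow>\<^sub>0 complex) \<Rightarrow> ('i \<Rightarrow>\<^sub>0 complex)"
    and \<kappa>C :: "'g \<Rightarrow> ('i \<Rightarrow>\<^sub>0 complex) \<Rightarrow> ('i \<Rightarrow>\<^sub>0 complex) \<Rightarrow> complex"
  assumes kL_linear: "linear_cochain G V \<kappa>L" and kC_constant: "constant_cochain G V \<kappa>C"
begin

lemma kL_V: "g \<in> carrier G \<Longrightarrow> u \<in> V \<Longrightarrow> v \<in> V \<Longrightarrow> \<kappa>L g u v \<in> V"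
  using kL_linear unfolding linear_cochain_def skew_bilinear_on_def by blast

abbreviation rel where "rel \<equiv> orbifold_relator G \<kappa>L \<kappa>C"
abbreviation I where "I \<equiv> orbifold_ideal G \<rho> V \<kappa>L \<kappa>C"

lemma kappa_upto:
  "g \<in> carrier G \<Longrightarrow> u \<in> V \<Longrightarrow> v \<in> V \<Longrightarrow>
     tvec (\<kappa>L g u v) + Poly_Mapping.single 0 (\<kappa>C g u v) \<in> tensor_upto V 1"
  by (intro tensor_upto_closed tensor_upto_tvec tensor_upto_single_zero kL_V)

lemma rel_scarrier: "u \<in> V \<Longrightarrow> v \<in> V \<Longrightarrow> rel u v \<in> T.scarrier"
proof -
  assume uv: "u \<in> V" "v \<in> V"
  have "tvec u * tvec v - tvec v * tvec u \<in> TV"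
    using uv tensor_upto_tvec tensor_upto_TV by (blast intro: cvs.span_diff TV_times)
  moreover have "tvec (\<kappa>L g u v) + Poly_Mapping.single 0 (\<kappa>C g u v) \<in> TV" if "g \<in> carrier G" for g
    using kappa_upto[OF that uv] tensor_upto_TV by blast
  ultimately have "(tvec u * tvec v - tvec v * tvec u when g = \<one>) \<in> TV"
    "(tvec (\<kappa>L g u v) + Poly_Mapping.single 0 (\<kappa>C g u v) when g \<in> carrier G) \<in> TV" for g
    by (simp_all add: when_def cvs.span_zero)
  then have "rel u v g \<in> TV" for g
    unfolding orbifold_relator_def by (intro cvs.span_diff) blast+
  then show ?thesis by (auto simp: T.scarrier_def) (auto simp: orbifold_relator_def when_def)
qed

sublocale A: ring T.skew by (rule T.ring_skew)

lemma ideal_I: "ideal I T.skew"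
  unfolding orbifold_ideal_def tensor_skew_eq
  by (rule A.genideal_ideal) (auto simp: T.skew_simps rel_scarrier)

sublocale I: ideal I T.skew by (rule ideal_I)

lemma rel_I: "u \<in> V \<Longrightarrow> v \<in> V \<Longrightarrow> rel u v \<in> I"
proof -
  have "{rel v w |v w. v \<in> V \<and> w \<in> V} \<subseteq> carrier T.skew" by (auto simp: T.skew_simps rel_scarrier)
  from A.genideal_self[OF this] show "u \<in> V \<Longrightarrow> v \<in> V \<Longrightarrow> rel u v \<in> I"
    unfolding orbifold_ideal_def tensor_skew_eq by blast
qed

lemma I_scarrier: "f \<in> I \<Longrightarrow> f \<in> T.scarrier"
  using I.a_subset by (auto simp: T.skew_simps)

lemma I_closed:
  "(\<lambda>g. 0) \<in> I"
  "f \<in> I \<Longrightarrow> h \<in> I \<Longrightarrow> (\<lambda>g. f g + h g) \<in> I"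
  "f \<in> I \<Longrightarrow> h \<in> T.scarrier \<Longrightarrow> T.smult h f \<in> I"
  "f \<in> I \<Longrightarrow> h \<in> T.scarrier \<Longrightarrow> T.smult f h \<in> I"
proof -
  show "(\<lambda>g. 0) \<in> I" using I.zero_closed by (simp add: T.skew_simps)
  show "f \<in> I \<Longrightarrow> h \<in> I \<Longrightarrow> (\<lambda>g. f g + h g) \<in> I" using I.a_closed[of f h] by (simp add: T.skew_simps)
  show "f \<in> I \<Longrightarrow> h \<in> T.scarrier \<Longrightarrow> T.smult h f \<in> I"
    using I.I_l_closed[of f h] by (simp add: T.skew_simps T.skew_mult I_scarrier)
  show "f \<in> I \<Longrightarrow> h \<in> T.scarrier \<Longrightarrow> T.smult f h \<in> I"
    using I.I_r_closed[of f h] by (simp add: T.skew_simps T.skew_mult I_scarrier)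
qed

lemma I_cscale: "f \<in> I \<Longrightarrow> (\<lambda>g. c *\<^sub>c f g) \<in> I"
proof -
  assume f: "f \<in> I"
  have c: "Poly_Mapping.single 0 c \<in> TV" using tensor_upto_single_zero[of c V 0] tensor_upto_TV by blast
  have "T.smult (T.pure \<one> (Poly_Mapping.single 0 c)) f = (\<lambda>g. c *\<^sub>c f g)"
    using I_scarrier[OF f]
    by (auto simp: T.smult_pure_left act_id when_def fun_eq_iff cscale_eq_single_times T.scarrier_def)
  then show ?thesis using I_closed(3)[OF f T.pure_closed[OF one_closed c]] by simp
qed

text \<open>The elements that the relations rewrite into elements of filtration degree below \<open>k\<close>.\<close>

definition reducible :: "nat \<Rightarrow> ('g \<Rightarrow> ('i list \<Rightarrow>\<^sub>0 complex)) set"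
  where "reducible k = {f. \<exists>f'\<in>below k. (\<lambda>g. f g - f' g) \<in> I}"

lemma reducible_closed:
  "f \<in> below k \<Longrightarrow> f \<in> reducible k"
  "f \<in> reducible k \<Longrightarrow> h \<in> reducible k \<Longrightarrow> (\<lambda>g. f g + h g) \<in> reducible k"
  "f \<in> reducible k \<Longrightarrow> (\<lambda>g. c *\<^sub>c f g) \<in> reducible k"
proof -
  show "f \<in> below k \<Longrightarrow> f \<in> reducible k" using I_closed(1) by (auto simp: reducible_def intro!: bexI[of _ f])
next
  assume "f \<in> reducible k" "h \<in> reducible k"
  then obtain f' h' where "f' \<in> below k" "(\<lambda>g. f g - f' g) \<in> I" "h' \<in> below k" "(\<lambda>g. h g - h' g) \<in> I"
    by (auto simp: reducible_def)
  then show "(\<lambda>g. f g + h g) \<in> reducible k"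
    using I_closed(2)[of "\<lambda>g. f g - f' g" "\<lambda>g. h g - h' g"] below_closed(2)[of f' k h']
    by (auto simp: reducible_def algebra_simps intro!: bexI[of _ "\<lambda>g. f' g + h' g"])
next
  assume "f \<in> reducible k"
  then obtain f' where "f' \<in> below k" "(\<lambda>g. f g - f' g) \<in> I" by (auto simp: reducible_def)
  then show "(\<lambda>g. c *\<^sub>c f g) \<in> reducible k"
    using I_cscale[of "\<lambda>g. f g - f' g" c] below_closed(3)[of f' k c]
    by (auto simp: reducible_def cvs.scale_right_diff_distrib intro!: bexI[of _ "\<lambda>g. c *\<^sub>c f' g"])
qed

text \<open>The relator, multiplied by words on both sides, exchanges two neighbours at the price of a linear and a
  constant term.\<close>

lemma swap_reducible:
  assumes V: "set xs \<subseteq> V" "v \<in> V" "w \<in> V" "set ys \<subseteq> V" and g: "g \<in> carrier G"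
  shows "T.pure g (tprod (xs @ v # w # ys) - tprod (xs @ w # v # ys)) \<in> reducible (length (xs @ v # w # ys))"
proof -
  let ?p = "tprod xs" and ?q = "tprod ys"
  let ?k = "\<lambda>x. tvec (\<kappa>L x v w) + Poly_Mapping.single 0 (\<kappa>C x v w)"
  have pq: "?p \<in> TV" "?q \<in> TV" using V by (auto intro!: cvs.span_base)
  define t where "t = T.smult (T.smult (T.pure \<one> ?p) (rel v w)) (T.pure g ?q)"
  define low where "low = (\<lambda>h. ?p * ?k (h \<otimes> inv g) * tensor_map (\<rho> (h \<otimes> inv g)) ?q when h \<in> carrier G)"
  have "t \<in> I" unfolding t_def
    by (intro I_closed rel_I T.pure_closed V g one_closed pq)
  have "t h = T.pure g (tprod (xs @ v # w # ys) - tprod (xs @ w # v # ys)) h - low h" for h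
  proof (cases "h \<in> carrier G")
    case True
    have one: "h \<otimes> inv g = \<one> \<longleftrightarrow> h = g" using True g by (metis inv_solve_right one_closed l_one)
    have "t h = ?p * rel v w (h \<otimes> inv g) * tensor_map (\<rho> (h \<otimes> inv g)) ?q"
      using True g by (simp add: t_def T.smult_pure_left T.smult_pure_right act_id)
    also have "\<dots> = (?p * (tvec v * tvec w - tvec w * tvec v) * ?q when h = g) - low h"
      using True g one by (auto simp: orbifold_relator_def low_def act_id algebra_simps when_def)
    also have "\<dots> = T.pure g (tprod (xs @ v # w # ys) - tprod (xs @ w # v # ys)) h - low h"
      by (auto simp: T.pure_def algebra_simps when_def)
    finally show ?thesis .
  next
    case False
    then show ?thesis using g by (auto simp: t_def T.smult_def low_def T.pure_def when_def)
  qed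
  then have "t = (\<lambda>h. T.pure g (tprod (xs @ v # w # ys) - tprod (xs @ w # v # ys)) h - low h)"
    by (rule ext)
  then have "(\<lambda>h. T.pure g (tprod (xs @ v # w # ys) - tprod (xs @ w # v # ys)) h - low h) \<in> I"
    using \<open>t \<in> I\<close> by simp
  moreover have "low \<in> below (length (xs @ v # w # ys))"
  proof -
    have "?p * ?k x * tensor_map (\<rho> x) ?q \<in> tensor_upto V (length xs + 1 + length ys)" if "x \<in> carrier G" for x
      using V that by (intro tensor_upto_times tensor_upto_act kappa_upto tensor_upto_tprod) auto
    then show ?thesis using g by (auto simp: below_def upto_iff low_def)
  qed
  ultimately show ?thesis by (auto simp: reducible_def)
qed

lemma perm_reducible:
  assumes "mset vs = mset ws" "set vs \<subseteq> V" "g \<in> carrier G"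
  shows "T.pure g (tprod vs - tprod ws) \<in> reducible (length vs)"
  using assms(1)
proof (rule mset_eq_induct_adjacent[where E="\<lambda>vs' ws'. T.pure g (tprod vs' - tprod ws') \<in> reducible (length vs)"])
  fix xs :: "('i \<Rightarrow>\<^sub>0 complex) list"
  show "T.pure g (tprod xs - tprod xs) \<in> reducible (length vs)"
    using reducible_closed(1)[OF below_closed(1)] by (simp add: T.pure_def)
next
  fix xs ys zs :: "('i \<Rightarrow>\<^sub>0 complex) list"
  assume "T.pure g (tprod xs - tprod ys) \<in> reducible (length vs)" "T.pure g (tprod ys - tprod zs) \<in> reducible (length vs)"
  from reducible_closed(2)[OF this] show "T.pure g (tprod xs - tprod zs) \<in> reducible (length vs)"
    by (simp add: T.pure_def flip: when_add_distrib)
next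
  fix xs v w ys assume m: "mset (xs @ v # w # ys) = mset vs"
  then have "length (xs @ v # w # ys) = length vs" by (rule mset_eq_length)
  moreover have "set (xs @ v # w # ys) \<subseteq> V" using mset_eq_setD[OF m] assms(2) by simp
  ultimately show "T.pure g (tprod (xs @ v # w # ys) - tprod (xs @ w # v # ys)) \<in> reducible (length vs)"
    using swap_reducible[of xs v w ys g] assms(3) by simp
qed

text \<open>Modulo the ideal and lower degrees the order of the letters is immaterial, so only the top-degree
  symmetric part of a tensor matters.\<close>

lemma lift_reducible:
  assumes g: "g \<in> carrier G" and p: "\<And>w. w \<in> Poly_Mapping.keys p \<Longrightarrow> length w \<le> k"
  shows "T.pure g (tensor_map P p - lift (hpart k (abelianize p))) \<in> reducible k"
proof (induction p rule: poly_mapping_linear_induct)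
  case (basis w)
  let ?vs = "\<lambda>w. map (\<lambda>i. P (Poly_Mapping.single i 1)) w"
  have V: "set (?vs w) \<subseteq> V" for w using P_V by auto
  show ?case
  proof (cases "length w = k")
    case True
    let ?w = "SOME w'. mset w' = mset w"
    have w: "mset ?w = mset w" by (rule someI[of _ w]) simp
    have "lift (hpart k (abelianize (Poly_Mapping.single w 1))) = tprod (?vs ?w)"
      using True by (simp add: abelianize_def hpart_def lift_def tensor_map_P_word)
    then show ?thesis
      using perm_reducible[of "?vs w" "?vs ?w" g] g V True w by (simp add: tensor_map_P_word)
  next
    case False
    then have "length w < k" using p[OF basis] by (simp add: le_neq_implies_less)
    then obtain j where j: "k = Suc j" "length w \<le> j" by (cases k) auto
    have "lift (hpart k (abelianize (Poly_Mapping.single w 1))) = 0"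
      using False by (simp add: abelianize_def hpart_def lift_def)
    moreover have "T.pure g (tprod (?vs w)) \<in> below k"
      using tensor_upto_tprod[OF V, of w j] j g
      by (auto simp: below_def upto_iff T.pure_def when_def tensor_upto_closed)
    ultimately show ?thesis by (simp add: tensor_map_P_word reducible_closed)
  qed
next
  case (cscale c q)
  from reducible_closed(3)[OF this, of c] show ?case
    by (simp add: T.pure_def tensor_map_cscale abelianize_cscale hpart_cscale lift_def lin_ext_cscale
        cvs.scale_right_diff_distrib when_def if_distrib[of "\<lambda>x. c *\<^sub>c x"] cong: if_cong)
next
  case (add q r)
  from reducible_closed(2)[OF this] show ?case
    by (simp add: T.pure_def tensor_map_add abelianize_add hpart_add lift_def lin_ext_add algebra_simps
        flip: when_add_distrib)
next
  case zero
  show ?case using reducible_closed(1)[OF below_closed(1)]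
    by (simp add: T.pure_def lift_def tensor_map_eq_lin_ext)
qed

text \<open>This is the inequality that holds for all cochains: the associated graded algebra is never larger
  than \<open>S(V) # G\<close>.\<close>

lemma top_symbol_zero_reducible:
  assumes f: "f \<in> upto k" and z: "top_symbol k f = (\<lambda>g. 0)"
  shows "f \<in> reducible k"
proof -
  have one: "T.pure g (f g) \<in> reducible k" if g: "g \<in> carrier G" for g
  proof -
    have fg: "f g \<in> tensor_upto V k" using f g by (simp add: upto_iff)
    have "tensor_map P (f g) = f g" using fg tensor_upto_TV by (intro tensor_map_P) blast
    moreover have "lift (hpart k (abelianize (f g))) = 0" using z by (simp add: top_symbol_def fun_eq_iff lift_def)
    ultimately show ?thesis using lift_reducible[OF g, of "f g" k] tensor_upto_keys[OF fg] by simp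
  qed
  have "(\<lambda>x. \<Sum>g\<in>B. T.pure g (f g) x) \<in> reducible k" if "B \<subseteq> carrier G" for B
    using finite_subset[OF that fin_G] that
  proof (induction B rule: finite_induct)
    case (insert g B)
    then show ?case using reducible_closed(2)[OF one[of g], of "\<lambda>x. \<Sum>g\<in>B. T.pure g (f g) x"] by simp
  qed (simp add: reducible_closed below_closed)
  from this[OF order_refl] have "(\<lambda>x. \<Sum>g\<in>carrier G. T.pure g (f g) x) \<in> reducible k" .
  moreover have "(\<lambda>x. \<Sum>g\<in>carrier G. T.pure g (f g) x) = f"
    using f fin_G by (auto simp: fun_eq_iff T.pure_def when_def upto_iff sum.delta)
  ultimately show ?thesis by simp
qed

abbreviation H where "H \<equiv> orbifold_algebra G \<rho> V \<kappa>L \<kappa>C"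
abbreviation Hfil where "Hfil \<equiv> orbifold_filtration G \<rho> V \<kappa>L \<kappa>C"
abbreviation cl where "cl f \<equiv> I +>\<^bsub>T.skew\<^esub> f"

text \<open>The choice of a representative is immaterial once elements of the ideal have zero symbol, which is assumed
  in the locale below.\<close>

definition quot_symbol where "quot_symbol k c = top_symbol k (SOME f. f \<in> upto k \<and> c = cl f)"

lemma H_eq: "H = T.skew Quot I"
  by (simp add: orbifold_algebra_def tensor_skew_eq)

lemma ring_H: "ring H"
  unfolding H_eq by (rule I.quotient_is_ring)

lemma F_eq: "Hfil k = cl ` upto k"
  by (auto simp: orbifold_filtration_def tensor_skew_eq upto_def T.skew_simps)

lemma cl_hom:
  "cl ` T.scarrier = carrier H"
  "f \<in> T.scarrier \<Longrightarrow> h \<in> T.scarrier \<Longrightarrow> cl f \<oplus>\<^bsub>H\<^esub> cl h = cl (\<lambda>g. f g + h g)"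
  "f \<in> T.scarrier \<Longrightarrow> h \<in> T.scarrier \<Longrightarrow> cl f \<otimes>\<^bsub>H\<^esub> cl h = cl (T.smult f h)"
  "\<one>\<^bsub>H\<^esub> = cl T.sone" "\<zero>\<^bsub>H\<^esub> = cl (\<lambda>g. 0)"
proof -
  show "cl ` T.scarrier = carrier H"
    by (auto simp: H_eq FactRing_def A_RCOSETS_def' T.skew_simps(1))
  show "f \<in> T.scarrier \<Longrightarrow> h \<in> T.scarrier \<Longrightarrow> cl f \<oplus>\<^bsub>H\<^esub> cl h = cl (\<lambda>g. f g + h g)"
    using ring_hom_add[OF I.rcos_ring_hom, of f h] by (simp add: H_eq T.skew_simps)
  show "f \<in> T.scarrier \<Longrightarrow> h \<in> T.scarrier \<Longrightarrow> cl f \<otimes>\<^bsub>H\<^esub> cl h = cl (T.smult f h)"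
    using ring_hom_mult[OF I.rcos_ring_hom, of f h] by (simp add: H_eq T.skew_simps T.skew_mult)
  show "\<one>\<^bsub>H\<^esub> = cl T.sone" by (simp add: H_eq FactRing_def T.skew_simps)
  have "cl (\<zero>\<^bsub>T.skew\<^esub>) = I" by (rule I.a_rcos_const) (rule I.zero_closed)
  then show "\<zero>\<^bsub>H\<^esub> = cl (\<lambda>g. 0)" by (simp add: H_eq FactRing_def T.skew_simps)
qed

lemma cl_eq_iff:
  assumes "f \<in> T.scarrier" "h \<in> T.scarrier"
  shows "cl f = cl h \<longleftrightarrow> (\<lambda>g. f g - h g) \<in> I"
  using A.quotient_eq_iff_same_a_r_cos[OF ideal_I, of f h] assms T.skew_a_minus[OF assms]
  by (simp add: T.skew_simps)

end

text \<open>If elements of the ideal have zero symbol, then the symbol descends to the quotient by the ideal and its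
  kernel there is exactly the previous step of the filtration, so the associated graded algebra
  is \<open>S(V) # G\<close>.\<close>

locale pbw_cochains = orbifold_cochains G \<rho> V P \<kappa>L \<kappa>C
  for G :: "('g, 'k) monoid_scheme" (structure) and \<rho> and V :: "('i \<Rightarrow>\<^sub>0 complex) set" and P \<kappa>L \<kappa>C +
  assumes top_symbol_ideal: "f \<in> I \<Longrightarrow> f \<in> upto k \<Longrightarrow> top_symbol k f = (\<lambda>g. 0)"
begin

lemma quot_symbol_cl:
  assumes "f \<in> upto k"
  shows "quot_symbol k (cl f) = top_symbol k f"
proof -
  have "\<exists>h. h \<in> upto k \<and> cl f = cl h" using assms by auto
  from someI_ex[OF this] have some: "(SOME h. h \<in> upto k \<and> cl f = cl h) \<in> upto k \<and>
      cl f = cl (SOME h. h \<in> upto k \<and> cl f = cl h)" .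
  define h where "h = (SOME h. h \<in> upto k \<and> cl f = cl h)"
  have h: "h = (SOME h. h \<in> upto k \<and> cl f = cl h)" "h \<in> upto k" "cl f = cl h"
    using some unfolding h_def by blast+
  have "(\<lambda>g. f g - h g) \<in> I" using h assms cl_eq_iff by (simp add: upto_scarrier)
  then have "top_symbol k (\<lambda>g. f g - h g) = (\<lambda>g. 0)"
    by (rule top_symbol_ideal) (intro upto_closed assms h)
  then show ?thesis using h(1) by (simp add: quot_symbol_def top_symbol_diff fun_eq_iff)
qed

lemma fil_below_H: "fil_below H Hfil k = cl ` below k"
  by (cases k) (auto simp: fil_below_def below_def F_eq cl_hom)

lemma quot_symbol_zero_iff:
  assumes "f \<in> upto k"
  shows "top_symbol k f = (\<lambda>g. 0) \<longleftrightarrow> cl f \<in> fil_below H Hfil k"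
proof
  assume "top_symbol k f = (\<lambda>g. 0)"
  from top_symbol_zero_reducible[OF assms this] obtain f' where "f' \<in> below k" "(\<lambda>g. f g - f' g) \<in> I"
    by (auto simp: reducible_def)
  moreover from this have "f' \<in> T.scarrier" using below_upto upto_scarrier by blast
  ultimately show "cl f \<in> fil_below H Hfil k"
    using cl_eq_iff[of f f'] assms by (auto simp: fil_below_H upto_scarrier)
next
  assume "cl f \<in> fil_below H Hfil k"
  then obtain f' where f': "f' \<in> below k" "cl f = cl f'" by (auto simp: fil_below_H)
  have u: "f' \<in> upto k" using f' below_upto by blast
  have "top_symbol k f = top_symbol k f'" using quot_symbol_cl[OF assms] quot_symbol_cl[OF u] f' by simp
  then show "top_symbol k f = (\<lambda>g. 0)" using top_symbol_below[OF f'(1)] by simp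
qed

abbreviation hproj where "hproj k s \<equiv> (\<lambda>g. hpart k (s g))"

lemma hpart_SV: assumes "p \<in> SV" shows "hpart k p \<in> sym_power V k"
  using assms unfolding sym_power_def
proof (rule span_linear_image)
  fix a assume "a \<in> {sprod vs |vs. set vs \<subseteq> V}"
  then obtain vs where a: "a = sprod vs" "set vs \<subseteq> V" by auto
  show "hpart k a \<in> cvs.span {sprod vs |vs. set vs \<subseteq> V \<and> length vs = k}"
    using a homogeneous_sprod[of vs]
    by (cases "length vs = k") (auto simp: homogeneous_def cvs.span_zero intro!: cvs.span_base)
qed (simp_all add: hpart_add hpart_cscale)

lemma quot_symbol_image: "quot_symbol k ` Hfil k = {s \<in> S.scarrier. \<forall>g\<in>carrier G. s g \<in> sym_power V k}"
  by (simp add: F_eq image_image quot_symbol_cl top_symbol_image[symmetric] cong: image_cong)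

lemma hproj_range: "s \<in> S.scarrier \<Longrightarrow> hproj k s \<in> quot_symbol k ` Hfil k"
proof -
  assume s: "s \<in> S.scarrier"
  have "sym_power V k \<subseteq> SV" unfolding sym_power_def by (intro cvs.span_mono) auto
  then show ?thesis using s hpart_SV by (auto simp: quot_symbol_image S.scarrier_def)
qed

lemma hproj_smult:
  "hproj k (S.smult s t) = (\<lambda>g. \<Sum>i\<le>k. S.smult (hproj i s) (hproj (k - i) t) g)"
proof
  fix g
  have "hpart k (\<Sum>x\<in>carrier G. s x * sym_map (\<rho> x) (t (inv x \<otimes> g)))
      = (\<Sum>x\<in>carrier G. \<Sum>i\<le>k. hpart i (s x) * sym_map (\<rho> x) (hpart (k - i) (t (inv x \<otimes> g))))"
    by (simp add: hpart_sum hpart_times hpart_sym_map[OF act_linear])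
  also have "\<dots> = (\<Sum>i\<le>k. \<Sum>x\<in>carrier G. hpart i (s x) * sym_map (\<rho> x) (hpart (k - i) (t (inv x \<otimes> g))))"
    by (rule sum.swap)
  finally show "hpart k (S.smult s t g) = (\<Sum>i\<le>k. S.smult (hproj i s) (hproj (k - i) t) g)"
    by (simp add: S.smult_def when_def)
qed

lemma sone_upto: "T.sone \<in> upto 0"
  using tensor_upto_single_zero[of 1 V 0]
  by (auto simp: upto_iff T.sone_def when_def tensor_upto_closed)

lemma hpart_one: "hpart k (1 :: 'i multiset \<Rightarrow>\<^sub>0 complex) = (1 when k = 0)"
  unfolding single_one[symmetric] hpart_def lin_ext_single by (auto simp: when_def cscale_single)

sublocale gr: symbol_maps H Hfil S.skew hproj quot_symbol
proof (intro symbol_maps.intro ring_H symbol_maps_axioms.intro)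
  note car = upto_scarrier
  fix k l :: nat
  show "Hfil k \<subseteq> carrier H" using cl_hom(1) by (auto simp: F_eq car)
  show "\<zero>\<^bsub>H\<^esub> \<in> Hfil k" by (auto simp: F_eq cl_hom upto_closed)
  show "Hfil k \<subseteq> Hfil (Suc k)" using upto_mono[of k "Suc k"] by (auto simp: F_eq)
  show "\<one>\<^bsub>H\<^esub> \<in> Hfil 0" using sone_upto by (auto simp: F_eq cl_hom)
  show "add S.skew = (\<lambda>f h g. f g + h g)" by (simp add: S.skew_simps)
  show "one S.skew \<in> carrier S.skew" by (simp add: S.skew_simps S.sone_closed)
  show "hproj k (one S.skew) = (if k = 0 then one S.skew else (\<lambda>g. 0))"
    by (auto simp: S.skew_simps S.sone_def fun_eq_iff hpart_one when_def)
  show "quot_symbol 0 \<one>\<^bsub>H\<^esub> = one S.skew"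
    by (auto simp: cl_hom quot_symbol_cl sone_upto top_symbol_def T.sone_def S.skew_simps S.sone_def fun_eq_iff when_def hpart_one)
  fix x y assume x: "x \<in> Hfil k"
  then obtain f where f: "f \<in> upto k" "x = cl f" by (auto simp: F_eq)
  show "quot_symbol k x = (\<lambda>g. 0) \<longleftrightarrow> x \<in> fil_below H Hfil k"
    using quot_symbol_zero_iff[OF f(1)] quot_symbol_cl[OF f(1)] f by simp
  show "\<ominus>\<^bsub>H\<^esub> x \<in> Hfil k"
  proof -
    interpret H: ring H by (rule ring_H)
    have m: "(\<lambda>g. - f g) \<in> upto k" using f by (auto simp: upto_iff tensor_upto_closed)
    have "cl (\<lambda>g. - f g) \<oplus>\<^bsub>H\<^esub> x = \<zero>\<^bsub>H\<^esub>" using f m by (simp add: cl_hom car)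
    then have "\<ominus>\<^bsub>H\<^esub> x = cl (\<lambda>g. - f g)"
      by (rule H.minus_equality) (use f m cl_hom(1) car in auto)
    then show ?thesis using m by (simp add: F_eq)
  qed
  { assume "y \<in> Hfil k"
    then obtain h where h: "h \<in> upto k" "y = cl h" by (auto simp: F_eq)
    show "x \<oplus>\<^bsub>H\<^esub> y \<in> Hfil k" using f h by (simp add: cl_hom car F_eq upto_closed)
    show "quot_symbol k (x \<oplus>\<^bsub>H\<^esub> y) = (\<lambda>g. quot_symbol k x g + quot_symbol k y g)"
      using f h by (simp add: cl_hom car quot_symbol_cl upto_closed top_symbol_add) }
  { assume "y \<in> Hfil l"
    then obtain h where h: "h \<in> upto l" "y = cl h" by (auto simp: F_eq)
    have m: "T.smult f h \<in> upto (k + l)" using f h by (simp add: smult_upto)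
    show "x \<otimes>\<^bsub>H\<^esub> y \<in> Hfil (k + l)" using f h m by (simp add: cl_hom car F_eq)
    have "top_symbol k f \<in> S.scarrier" "top_symbol l h \<in> S.scarrier"
      using top_symbol_image[of k] top_symbol_image[of l] f h by blast+
    then show "quot_symbol (k + l) (x \<otimes>\<^bsub>H\<^esub> y) = quot_symbol k x \<otimes>\<^bsub>S.skew\<^esub> quot_symbol l y"
      using f h m by (simp add: cl_hom car quot_symbol_cl top_symbol_smult S.skew_mult) }
next
  fix s t k assume s: "s \<in> carrier S.skew"
  then have s': "s \<in> S.scarrier" by (simp add: S.skew_simps)
  show "finite {k. hproj k s \<noteq> (\<lambda>g. 0)}"
  proof (rule finite_subset)
    show "{k. hproj k s \<noteq> (\<lambda>g. 0)} \<subseteq> (\<Union>g\<in>carrier G. {k. hpart k (s g) \<noteq> 0})"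
      using s' by (auto simp: fun_eq_iff S.scarrier_def)
  qed (simp add: fin_G hpart_finite)
  show "hproj k s \<in> quot_symbol k ` Hfil k" by (rule hproj_range[OF s'])
  assume t: "t \<in> carrier S.skew"
  then have t': "t \<in> S.scarrier" by (simp add: S.skew_simps)
  show "(\<lambda>g. s g + t g) \<in> carrier S.skew" using s' t' by (simp add: S.skew_simps S.sadd_closed)
  show "s \<otimes>\<^bsub>S.skew\<^esub> t \<in> carrier S.skew" using s' t' by (simp add: S.skew_simps S.skew_mult S.smult_closed)
  show "s = t" if "\<And>k. hproj k s = hproj k t"
    using that by (auto simp: fun_eq_iff intro: hpart_eqI)
  have "hproj i s \<in> S.scarrier" "hproj i t \<in> S.scarrier" for i
    using hproj_range[OF s'] hproj_range[OF t'] by (auto simp: quot_symbol_image)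
  then show "hproj k (s \<otimes>\<^bsub>S.skew\<^esub> t) = (\<lambda>g. \<Sum>i\<le>k. (hproj i s \<otimes>\<^bsub>S.skew\<^esub> hproj (k - i) t) g)"
    using s' t' by (simp add: S.skew_mult hproj_smult)
next
  fix s t k show "hproj k (\<lambda>g. s g + t g) = (\<lambda>g. hproj k s g + hproj k t g)" by (simp add: hpart_add)
next
  fix c assume c: "\<And>k. c k \<in> quot_symbol k ` Hfil k" and fin: "finite {k. c k \<noteq> (\<lambda>g. 0)}"
  have cs: "c k \<in> S.scarrier" "g \<in> carrier G \<Longrightarrow> c k g \<in> sym_power V k" for k g
    using c[of k] by (auto simp: quot_symbol_image)
  let ?K = "{k. c k \<noteq> (\<lambda>g. 0)}"
  define s where "s = (\<lambda>g. \<Sum>k\<in>?K. c k g)"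
  have "s \<in> carrier S.skew"
    using cs by (auto simp: S.skew_simps s_def S.scarrier_def intro!: cvs.span_sum)
  moreover have "hproj k s = c k" for k
  proof
    fix g
    have "hpart k (c j g) = (if j = k then c k g else 0)" for j
      using cs(2)[of g j] sym_power_homogeneous[of "c j g" V j] cs(1)[of j]
      by (cases "g \<in> carrier G") (auto simp: homogeneous_def S.scarrier_def)
    then have "hpart k (s g) = (\<Sum>j\<in>?K. if j = k then c k g else 0)"
      by (simp add: s_def hpart_sum)
    also have "\<dots> = c k g" using fin by (auto simp: sum.delta)
    finally show "hpart k (s g) = c k g" .
  qed
  ultimately show "\<exists>s\<in>carrier S.skew. \<forall>k. hproj k s = c k" by blast
qed

theorem pbw: "is_drinfeld_orbifold_algebra G \<rho> V \<kappa>L \<kappa>C"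
proof -
  have scal: "gr.gr_iso (\<lambda>k. fil_below H Hfil k +>\<^bsub>H\<^esub> (if k = 0 then orbifold_scalar G \<rho> V \<kappa>L \<kappa>C c else \<zero>\<^bsub>H\<^esub>))
      = (\<lambda>g. Poly_Mapping.single 0 c when g = \<one>)" for c
  proof -
    let ?f = "\<lambda>g. Poly_Mapping.single 0 c when g = \<one> :: 'i list \<Rightarrow>\<^sub>0 complex"
    have f: "?f \<in> upto 0"
      using tensor_upto_single_zero[of c V 0] by (auto simp: upto_iff when_def tensor_upto_closed)
    have eq: "orbifold_scalar G \<rho> V \<kappa>L \<kappa>C c = cl ?f"
      by (simp add: orbifold_scalar_def tensor_skew_eq)
    have "abelianize (Poly_Mapping.single (0 :: 'i list) c) = Poly_Mapping.single {#} c"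
      by (simp add: abelianize_def cscale_eq_single_times zero_list_def)
    then have sf: "top_symbol 0 ?f = (\<lambda>g. Poly_Mapping.single 0 c when g = \<one>)"
      by (auto simp: top_symbol_def fun_eq_iff when_def hpart_def cscale_single cscale_eq_single_times)
    have hp: "hpart k (Poly_Mapping.single 0 c :: 'i multiset \<Rightarrow>\<^sub>0 complex) = (Poly_Mapping.single 0 c when k = 0)" for k
      by (auto simp: hpart_def when_def cscale_single cscale_eq_single_times)
    have h: "quot_symbol 0 (cl ?f) = (\<lambda>g. Poly_Mapping.single 0 c when g = \<one>)"
      by (simp only: quot_symbol_cl[OF f] sf)
    have "top_symbol 0 ?f \<in> S.scarrier" using top_symbol_image[of 0] f by blast
    then have "quot_symbol 0 (cl ?f) \<in> carrier S.skew" by (simp only: h sf S.skew_simps)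
    moreover have "cl ?f \<in> Hfil 0" unfolding F_eq by (rule imageI[OF f])
    moreover have "hproj 0 (quot_symbol 0 (cl ?f)) = quot_symbol 0 (cl ?f)"
      unfolding h by (simp add: fun_eq_iff when_def hp)
    moreover have "hproj k (quot_symbol 0 (cl ?f)) = (\<lambda>g. 0)" if "k \<noteq> 0" for k
      using that unfolding h by (simp add: fun_eq_iff when_def hp)
    ultimately have "gr.gr_iso (\<lambda>k. fil_below H Hfil k +>\<^bsub>H\<^esub> (if k = 0 then cl ?f else \<zero>\<^bsub>H\<^esub>)) = quot_symbol 0 (cl ?f)"
      by (intro gr.gr_degree_zero(2))
    then show ?thesis unfolding eq h .
  qed
  have parts: "gr.gr_iso ` graded_part H Hfil k = {f \<in> carrier S.skew. \<forall>g\<in>carrier G. f g \<in> sym_power V k}" for k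
    unfolding gr.gr_iso_graded_part
  proof (rule Collect_cong, rule conj_cong[OF refl])
    fix s assume "s \<in> carrier S.skew"
    then have s: "s \<in> S.scarrier" by (simp add: S.skew_simps)
    show "(\<forall>j. j \<noteq> k \<longrightarrow> hproj j s = (\<lambda>g. 0)) \<longleftrightarrow> (\<forall>g\<in>carrier G. s g \<in> sym_power V k)"
    proof
      assume z: "\<forall>j. j \<noteq> k \<longrightarrow> hproj j s = (\<lambda>g. 0)"
      have "hpart k (s g) = s g" for g
      proof (rule hpart_eqI)
        fix j
        have "Poly_Mapping.lookup (hpart j (s g)) m = Poly_Mapping.lookup (hpart j (hpart k (s g))) m" for m
          using z by (cases "j = k") (auto simp: lookup_hpart fun_eq_iff when_def poly_mapping_eq_iff)
        then show "hpart j (hpart k (s g)) = hpart j (s g)" by (intro poly_mapping_eqI) simp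
      qed
      then show "\<forall>g\<in>carrier G. s g \<in> sym_power V k"
        using hpart_SV[OF S.scarrierD(1)[OF s], of _ k] by simp
    next
      assume "\<forall>g\<in>carrier G. s g \<in> sym_power V k"
      then have "homogeneous k (s g)" for g
        using sym_power_homogeneous[of "s g" V k] S.scarrierD(2)[OF s, of g] homogeneous_zero
        by (cases "g \<in> carrier G") auto
      then show "\<forall>j. j \<noteq> k \<longrightarrow> hproj j s = (\<lambda>g. 0)"
        by (simp add: homogeneous_def)
    qed
  qed
  show ?thesis
    unfolding is_drinfeld_orbifold_algebra_def Let_def graded_algebra_iso_def sym_skew_eq
    using gr.gr_iso_ring_iso scal parts by blast
qed

end


section \<open>Drinfeld orbifold algebras from operator representations\<close>

type_synonym 'i func = "('i \<Rightarrow> complex) \<Rightarrow> complex"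

definition vec_op :: "('i \<Rightarrow> 'i func \<Rightarrow> 'i func) \<Rightarrow> ('i \<Rightarrow>\<^sub>0 complex) \<Rightarrow> 'i func \<Rightarrow> 'i func"
  where "vec_op B v F z = lin_form (\<lambda>i. B i F z) v"

text \<open>Operators on functions that satisfy the defining relations.  For \<open>e \<noteq> 0\<close> a vector \<open>v\<close> acts by \<open>vec_op (B e) v\<close>
  and a group element by \<open>F \<mapsto> F \<circ> pact g\<close>; as \<open>e\<close> tends to zero, \<open>e B e i\<close> tends to multiplication by the
  coordinate \<open>z i\<close>.  Operators are given for the basis of the ambient space, so that words act without
  any choice.  Equations are required on a set \<open>R\<close> of points with trivial stabilizer only, since the
  operators have poles elsewhere; no nonzero polynomial vanishes on \<open>R\<close>.\<close>

locale orbifold_rep = orbifold_cochains G \<rho> V P \<kappa>L \<kappa>C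
  for G :: "('g, 'k) monoid_scheme" (structure) and \<rho> and V :: "('i \<Rightarrow>\<^sub>0 complex) set" and P \<kappa>L \<kappa>C +
  fixes pact :: "'g \<Rightarrow> ('i \<Rightarrow> complex) \<Rightarrow> ('i \<Rightarrow> complex)" and R :: "('i \<Rightarrow> complex) set"
    and B :: "complex \<Rightarrow> 'i \<Rightarrow> 'i func \<Rightarrow> 'i func"
  assumes pact_R: "g \<in> carrier G \<Longrightarrow> z \<in> R \<Longrightarrow> pact g z \<in> R"
    and pact_one: "pact \<one> z = z"
    and pact_times: "g \<in> carrier G \<Longrightarrow> h \<in> carrier G \<Longrightarrow> pact (g \<otimes> h) z = pact h (pact g z)"
    and pact_inj: "z \<in> R \<Longrightarrow> g \<in> carrier G \<Longrightarrow> h \<in> carrier G \<Longrightarrow> pact g z = pact h z \<Longrightarrow> g = h"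
    and R_dense: "(\<And>z. z \<in> R \<Longrightarrow> poly_eval q z = 0) \<Longrightarrow> q = 0"
    and B_linear: "B e i (\<lambda>z. a * F z + F' z) = (\<lambda>z. a * B e i F z + B e i F' z)"
    and B_local: "(\<And>z. z \<in> R \<Longrightarrow> F z = F' z) \<Longrightarrow> z \<in> R \<Longrightarrow> B e i F z = B e i F' z"
    and B_equivariant: "g \<in> carrier G \<Longrightarrow> z \<in> R \<Longrightarrow>
          vec_op (B e) (\<rho> g (Poly_Mapping.single i 1)) (\<lambda>z. F (pact g z)) z = B e i F (pact g z)"
    and B_limit: "(\<And>z. z \<in> R \<Longrightarrow> ((\<lambda>e. Fe e z) \<longlongrightarrow> F z) (at 0)) \<Longrightarrow> z \<in> R \<Longrightarrow>
          ((\<lambda>e. e * B e i (Fe e) z) \<longlongrightarrow> z i * F z) (at 0)"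
    and B_commutator: "e \<noteq> 0 \<Longrightarrow> u \<in> V \<Longrightarrow> v \<in> V \<Longrightarrow> z \<in> R \<Longrightarrow>
          vec_op (B e) u (vec_op (B e) v F) z - vec_op (B e) v (vec_op (B e) u F) z =
          (\<Sum>g\<in>carrier G. vec_op (B e) (\<kappa>L g u v) (\<lambda>z. F (pact g z)) z + \<kappa>C g u v * F (pact g z))"
begin

abbreviation D where "D e \<equiv> vec_op (B e)"

lemma B_zero: "B e i (\<lambda>z. 0) = (\<lambda>z. 0)"
  using B_linear[of e i "-1" "\<lambda>z. 0" "\<lambda>z. 0"] by simp

lemma B_sum: "B e i (\<lambda>z. \<Sum>j\<in>J. a j * F j z) = (\<lambda>z. \<Sum>j\<in>J. a j * B e i (F j) z)"
  by (induction J rule: infinite_finite_induct) (simp_all add: B_zero B_linear)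

lemma D_vec: "D e (u + v) F z = D e u F z + D e v F z" "D e (c *\<^sub>c v) F z = c * D e v F z"
  "D e (u - v) F z = D e u F z - D e v F z" "D e 0 F z = 0"
  by (simp_all add: vec_op_def lin_form_add lin_form_cscale lin_form_diff)

lemma D_linear: "D e v (\<lambda>z. a * F z + F' z) = (\<lambda>z. a * D e v F z + D e v F' z)"
  by (rule ext) (simp add: vec_op_def B_linear lin_form_def sum_distrib_left sum.distrib distrib_left mult.left_commute)

lemma D_fun: "D e v (\<lambda>z. F z + F' z) z = D e v F z + D e v F' z"
  "D e v (\<lambda>z. a * F z) z = a * D e v F z"
  "D e v (\<lambda>z. F z - F' z) z = D e v F z - D e v F' z"
  "D e v (\<lambda>z. 0) z = 0"
proof -
  show z: "D e v (\<lambda>z. 0) z = 0" for z by (simp add: vec_op_def B_zero lin_form_def)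
  show "D e v (\<lambda>z. F z + F' z) z = D e v F z + D e v F' z" using D_linear[of e v 1 F F'] by simp
  show "D e v (\<lambda>z. a * F z) z = a * D e v F z" using D_linear[of e v a F "\<lambda>z. 0"] z by simp
  show "D e v (\<lambda>z. F z - F' z) z = D e v F z - D e v F' z" using D_linear[of e v "-1" F' F] by simp
qed

lemma D_sum: "D e v (\<lambda>z. \<Sum>j\<in>J. F j z) z = (\<Sum>j\<in>J. D e v (F j) z)"
  by (induction J rule: infinite_finite_induct) (simp_all add: D_fun)

lemma D_local: "(\<And>z. z \<in> R \<Longrightarrow> F z = F' z) \<Longrightarrow> z \<in> R \<Longrightarrow> D e v F z = D e v F' z"
  using B_local[of F F' z e] by (simp add: vec_op_def)

lemma D_equivariant:
  assumes "g \<in> carrier G" "z \<in> R"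
  shows "D e (\<rho> g v) (\<lambda>z. F (pact g z)) z = D e v F (pact g z)"
proof -
  interpret lin: Vector_Spaces.linear cscale cscale "\<rho> g" by (rule act_linear[OF assms(1)])
  show ?thesis
    by (induction v rule: poly_mapping_linear_induct)
       (simp_all add: D_vec lin.scale lin.add lin.zero, simp add: B_equivariant[OF assms] vec_op_def[of _ "Poly_Mapping.single _ _"])
qed

lemma D_limit:
  assumes "\<And>z. z \<in> R \<Longrightarrow> ((\<lambda>e. Fe e z) \<longlongrightarrow> F z) (at 0)" "z \<in> R"
  shows "((\<lambda>e. e * D e v (Fe e) z) \<longlongrightarrow> vec_eval v z * F z) (at 0)"
proof -
  have "((\<lambda>e. \<Sum>i\<in>Poly_Mapping.keys v. Poly_Mapping.lookup v i * (e * B e i (Fe e) z)) \<longlongrightarrow>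
      (\<Sum>i\<in>Poly_Mapping.keys v. Poly_Mapping.lookup v i * (z i * F z))) (at 0)"
    by (intro tendsto_intros B_limit assms)
  then show ?thesis
    by (simp add: vec_op_def lin_form_def sum_distrib_left sum_distrib_right mult_ac)
qed

fun word_op :: "complex \<Rightarrow> 'i list \<Rightarrow> 'i func \<Rightarrow> 'i func"
  where "word_op e [] F = F" | "word_op e (i # w) F = B e i (word_op e w F)"

definition tens_op :: "complex \<Rightarrow> ('i list \<Rightarrow>\<^sub>0 complex) \<Rightarrow> 'i func \<Rightarrow> 'i func"
  where "tens_op e p F z = lin_form (\<lambda>w. word_op e w F z) p"

lemma word_op_append: "word_op e (w @ w') F = word_op e w (word_op e w' F)"
  by (induction w) simp_all

lemma word_op_sum: "word_op e w (\<lambda>z. \<Sum>j\<in>J. a j * F j z) = (\<lambda>z. \<Sum>j\<in>J. a j * word_op e w (F j) z)"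
  by (induction w) (simp_all add: B_sum)

lemma word_op_local: "(\<And>z. z \<in> R \<Longrightarrow> F z = F' z) \<Longrightarrow> z \<in> R \<Longrightarrow> word_op e w F z = word_op e w F' z"
  by (induction w arbitrary: z) (auto intro: B_local)

lemma tens_op_vec: "tens_op e (p + q) F z = tens_op e p F z + tens_op e q F z" "tens_op e (c *\<^sub>c p) F z = c * tens_op e p F z"
  "tens_op e (p - q) F z = tens_op e p F z - tens_op e q F z" "tens_op e 0 F z = 0"
  by (simp_all add: tens_op_def lin_form_add lin_form_cscale lin_form_diff)

lemma tens_op_sum: "tens_op e (\<Sum>j\<in>J. p j) F z = (\<Sum>j\<in>J. tens_op e (p j) F z)"
  by (simp add: tens_op_def lin_form_sum)

lemma tens_op_fun_sum: "tens_op e p (\<lambda>z. \<Sum>j\<in>J. F j z) z = (\<Sum>j\<in>J. tens_op e p (F j) z)"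
  using word_op_sum[of e _ "\<lambda>_. 1" F J]
  by (simp add: tens_op_def lin_form_def sum_distrib_left sum.swap[of _ J])

lemma tens_op_local: "(\<And>z. z \<in> R \<Longrightarrow> F z = F' z) \<Longrightarrow> z \<in> R \<Longrightarrow> tens_op e p F z = tens_op e p F' z"
  using word_op_local[of F F' z e] by (simp add: tens_op_def)

lemma tens_op_word: "tens_op e (Poly_Mapping.single w c) F z = c * word_op e w F z"
  by (simp add: tens_op_def)

lemma tens_op_times: "tens_op e (p * q) F z = tens_op e p (tens_op e q F) z"
proof (induction p rule: poly_mapping_linear_induct)
  case (basis w)
  have "tens_op e (Poly_Mapping.single w 1 * q) F z = lin_form (\<lambda>w'. word_op e (w @ w') F z) q"
    by (induction q rule: poly_mapping_linear_induct)
       (simp_all add: mult_single plus_list_def tens_op_word distrib_left tens_op_vec lin_form_add lin_form_cscale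
          cscale_times_right)
  also have "\<dots> = word_op e w (tens_op e q F) z"
    unfolding tens_op_def[abs_def] lin_form_def word_op_append by (subst word_op_sum) simp
  finally show ?case by (simp add: tens_op_word)
qed (simp_all add: distrib_right tens_op_vec cscale_times_left)

lemma tens_op_tvec: "tens_op e (tvec v) F z = D e v F z"
  by (induction v rule: poly_mapping_linear_induct)
     (simp_all add: tvec_single tens_op_word tvec_add tvec_cscale tens_op_vec D_vec, simp add: vec_op_def)

lemma tens_op_one: "tens_op e 1 F z = F z"
  by (simp add: tens_op_word flip: single_zero_one)

lemma tens_op_scalar: "tens_op e (Poly_Mapping.single 0 c) F z = c * F z"
  by (simp add: tens_op_word zero_list_def)

lemma tens_op_equivariant:
  assumes g: "g \<in> carrier G" and z: "z \<in> R"
  shows "tens_op e (tensor_map (\<rho> g) p) (\<lambda>z. F (pact g z)) z = tens_op e p F (pact g z)"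
proof (induction p rule: poly_mapping_linear_induct)
  case (basis w)
  have "tens_op e (tensor_map (\<rho> g) (Poly_Mapping.single w 1)) (\<lambda>z. F (pact g z)) z = word_op e w F (pact g z)"
    using z
  proof (induction w arbitrary: z)
    case Nil
    then show ?case by (simp add: tensor_map_eq_lin_ext tens_op_one)
  next
    case (Cons i w)
    have "tensor_map (\<rho> g) (Poly_Mapping.single (i # w) 1)
        = tvec (\<rho> g (Poly_Mapping.single i 1)) * tensor_map (\<rho> g) (Poly_Mapping.single w 1)"
      by (simp add: tensor_map_eq_lin_ext)
    then have "tens_op e (tensor_map (\<rho> g) (Poly_Mapping.single (i # w) 1)) (\<lambda>z. F (pact g z)) z
        = D e (\<rho> g (Poly_Mapping.single i 1)) (tens_op e (tensor_map (\<rho> g) (Poly_Mapping.single w 1)) (\<lambda>z. F (pact g z))) z"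
      by (simp add: tens_op_times tens_op_tvec)
    also have "\<dots> = D e (\<rho> g (Poly_Mapping.single i 1)) (\<lambda>z. word_op e w F (pact g z)) z"
      by (rule D_local) (use Cons in auto)
    also have "\<dots> = word_op e (i # w) F (pact g z)"
      using B_equivariant[OF g Cons.prems] by simp
    finally show ?case .
  qed
  then show ?case by (simp add: tens_op_word)
qed (simp_all add: tens_op_vec tensor_map_add tensor_map_cscale, simp add: tensor_map_eq_lin_ext tens_op_vec)

lemma word_op_limit:
  "z \<in> R \<Longrightarrow> ((\<lambda>e. e ^ length w * word_op e w F z) \<longlongrightarrow> prod_list (map z w) * F z) (at 0)"
proof (induction w arbitrary: z)
  case (Cons i w)
  have "((\<lambda>e. e * B e i (\<lambda>z. e ^ length w * word_op e w F z) z) \<longlongrightarrow> z i * (prod_list (map z w) * F z)) (at 0)"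
    using Cons by (intro B_limit)
  moreover have "B e i (\<lambda>z. e ^ length w * word_op e w F z) z = e ^ length w * B e i (word_op e w F) z" for e
    using B_linear[of e i "e ^ length w" "word_op e w F" "\<lambda>z. 0"] by (simp add: B_zero)
  ultimately show ?case by (simp add: mult_ac)
qed simp

text \<open>A word of length \<open>l\<close> has a pole of order at most \<open>l\<close> in \<open>e\<close>, with the monomial as its leading coefficient.  So the
  factor \<open>e ^ k\<close> isolates the part of degree \<open>k\<close>.\<close>

lemma tens_op_limit:
  assumes "p \<in> tensor_upto V k" "z \<in> R"
  shows "((\<lambda>e. e ^ k * tens_op e p F z) \<longlongrightarrow> poly_eval (hpart k (abelianize p)) z * F z) (at 0)"
proof -
  have w: "((\<lambda>e. e ^ k * word_op e w F z) \<longlongrightarrow> ((prod_list (map z w) * F z) when length w = k)) (at 0)"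
    if wp: "w \<in> Poly_Mapping.keys p" for w
  proof (cases "length w = k")
    case True
    then show ?thesis using word_op_limit[OF assms(2), of w F] by simp
  next
    case False
    then obtain j where j: "k = length w + Suc j"
      using tensor_upto_keys[OF assms(1) wp] by (metis add_Suc_right le_neq_implies_less less_iff_Suc_add)
    have "((\<lambda>e::complex. e ^ Suc j * (e ^ length w * word_op e w F z)) \<longlongrightarrow> 0 ^ Suc j * (prod_list (map z w) * F z)) (at 0)"
      by (intro tendsto_mult word_op_limit assms(2) tendsto_power tendsto_ident_at)
    then show ?thesis using False by (simp add: j power_add mult_ac)
  qed
  have "((\<lambda>e. \<Sum>w\<in>Poly_Mapping.keys p. Poly_Mapping.lookup p w * (e ^ k * word_op e w F z)) \<longlongrightarrow>
      (\<Sum>w\<in>Poly_Mapping.keys p. Poly_Mapping.lookup p w * ((prod_list (map z w) * F z) when length w = k))) (at 0)"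
    by (intro tendsto_intros w)
  moreover have "(\<Sum>w\<in>Poly_Mapping.keys p. Poly_Mapping.lookup p w * ((prod_list (map z w) * F z) when length w = k))
      = poly_eval (hpart k (abelianize p)) z * F z"
  proof -
    have "poly_eval (hpart k (abelianize p)) z = lin_form (\<lambda>w. prod_list (map z w) when length w = k) p"
    proof (induction p rule: poly_mapping_linear_induct)
      case (basis w)
      then show ?case
        by (auto simp: abelianize_def hpart_def when_def poly_eval_def mset_map[symmetric] prod_mset_prod_list
            simp del: mset_map)
    qed (simp_all add: abelianize_add abelianize_cscale hpart_add hpart_cscale poly_eval_add poly_eval_cscale lin_form_add
            lin_form_cscale)
    then show ?thesis by (auto simp: lin_form_def sum_distrib_right when_def intro!: sum.cong)
  qed
  ultimately show ?thesis
    by (simp add: tens_op_def lin_form_def sum_distrib_left mult_ac)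
qed

text \<open>The indicator function of a point in a free orbit isolates a single group element.\<close>

lemma separate:
  fixes c :: "'g \<Rightarrow> complex"
  assumes "z \<in> R" "\<And>F. (\<Sum>g\<in>carrier G. c g * F (pact g z)) = 0" "h \<in> carrier G"
  shows "c h = 0"
proof -
  have "(\<Sum>g\<in>carrier G. c g * (if pact g z = pact h z then 1 else 0)) = (\<Sum>g\<in>carrier G. if g = h then c h else 0)"
    using pact_inj[OF assms(1)] assms(3) by (intro sum.cong) auto
  with assms(2)[of "\<lambda>y. if y = pact h z then 1 else 0"] show ?thesis
    using assms(3) fin_G by (simp add: sum.delta)
qed

definition alg_op :: "complex \<Rightarrow> ('g \<Rightarrow> ('i list \<Rightarrow>\<^sub>0 complex)) \<Rightarrow> 'i func \<Rightarrow> 'i func"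
  where "alg_op e f F z = (\<Sum>g\<in>carrier G. tens_op e (f g) (\<lambda>z. F (pact g z)) z)"

lemma alg_op_local: "(\<And>z. z \<in> R \<Longrightarrow> F z = F' z) \<Longrightarrow> z \<in> R \<Longrightarrow> alg_op e f F z = alg_op e f F' z"
  unfolding alg_op_def by (intro sum.cong refl tens_op_local) (auto intro: pact_R)

lemma alg_op_smult:
  assumes z: "z \<in> R"
  shows "alg_op e (T.smult f h) F z = alg_op e f (alg_op e h F) z"
proof -
  have "alg_op e f (alg_op e h F) z
      = (\<Sum>x\<in>carrier G. tens_op e (f x) (\<lambda>z. \<Sum>y\<in>carrier G. tens_op e (h y) (\<lambda>z. F (pact y z)) (pact x z)) z)"
    by (simp add: alg_op_def[abs_def])
  also have "\<dots> = (\<Sum>x\<in>carrier G. \<Sum>y\<in>carrier G. tens_op e (f x) (\<lambda>z. tens_op e (h y) (\<lambda>z. F (pact y z)) (pact x z)) z)"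
    by (simp add: tens_op_fun_sum)
  also have "\<dots> = (\<Sum>x\<in>carrier G. \<Sum>y\<in>carrier G.
      tens_op e (f x) (tens_op e (tensor_map (\<rho> x) (h y)) (\<lambda>z. F (pact (x \<otimes> y) z))) z)"
    by (intro sum.cong refl tens_op_local z) (simp add: pact_times tens_op_equivariant[where F="\<lambda>z. F (pact y z)" for y])
  also have "\<dots> = (\<Sum>x\<in>carrier G. \<Sum>y\<in>carrier G.
      tens_op e (f x * tensor_map (\<rho> x) (h y)) (\<lambda>z. F (pact (x \<otimes> y) z)) z)"
    by (simp add: tens_op_times)
  also have "\<dots> = (\<Sum>x\<in>carrier G. \<Sum>y\<in>carrier G.
      tens_op e (f x * tensor_map (\<rho> x) (h (inv x \<otimes> y))) (\<lambda>z. F (pact y z)) z)"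
  proof (rule sum.cong[OF refl])
    fix x assume x: "x \<in> carrier G"
    have "(\<Sum>y\<in>carrier G. tens_op e (f x * tensor_map (\<rho> x) (h (inv x \<otimes> y))) (\<lambda>z. F (pact (x \<otimes> (inv x \<otimes> y)) z)) z)
        = (\<Sum>y\<in>carrier G. tens_op e (f x * tensor_map (\<rho> x) (h y)) (\<lambda>z. F (pact (x \<otimes> y) z)) z)"
      by (rule T.reindex_inv_left[OF x])
    moreover have "(\<Sum>y\<in>carrier G. tens_op e (f x * tensor_map (\<rho> x) (h (inv x \<otimes> y))) (\<lambda>z. F (pact (x \<otimes> (inv x \<otimes> y)) z)) z)
        = (\<Sum>y\<in>carrier G. tens_op e (f x * tensor_map (\<rho> x) (h (inv x \<otimes> y))) (\<lambda>z. F (pact y z)) z)"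
      using x by (intro sum.cong refl) (simp add: m_assoc[symmetric])
    ultimately show "(\<Sum>y\<in>carrier G. tens_op e (f x * tensor_map (\<rho> x) (h y)) (\<lambda>z. F (pact (x \<otimes> y) z)) z)
        = (\<Sum>y\<in>carrier G. tens_op e (f x * tensor_map (\<rho> x) (h (inv x \<otimes> y))) (\<lambda>z. F (pact y z)) z)" by simp
  qed
  also have "\<dots> = alg_op e (T.smult f h) F z"
    by (subst sum.swap) (simp add: alg_op_def T.smult_def tens_op_sum)
  finally show ?thesis by simp
qed

lemma alg_op_add: "alg_op e (\<lambda>g. f g + h g) F z = alg_op e f F z + alg_op e h F z"
  by (simp add: alg_op_def tens_op_vec sum.distrib)

lemma alg_op_zero: "alg_op e f (\<lambda>z. 0) z = 0"
  using tens_op_fun_sum[of e _ "\<lambda>_ _. 0" "{} :: nat set"] by (simp add: alg_op_def)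

lemma alg_op_rel:
  assumes "e \<noteq> 0" "u \<in> V" "v \<in> V" "z \<in> R"
  shows "alg_op e (rel u v) F z = 0"
proof -
  have "alg_op e (rel u v) F z
      = (\<Sum>g\<in>carrier G. if g = \<one> then D e u (D e v F) z - D e v (D e u F) z else 0)
        - (\<Sum>g\<in>carrier G. D e (\<kappa>L g u v) (\<lambda>z. F (pact g z)) z + \<kappa>C g u v * F (pact g z))"
    unfolding alg_op_def sum_subtractf[symmetric]
    by (intro sum.cong refl)
       (auto simp: orbifold_relator_def tens_op_vec tens_op_times tens_op_tvec[abs_def] tens_op_scalar pact_one)
  then show ?thesis using B_commutator[OF assms, of F] fin_G by (simp add: sum.delta)
qed

lemma alg_op_ideal:
  assumes e: "e \<noteq> 0" and f: "f \<in> I" and z: "z \<in> R"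
  shows "alg_op e f F z = 0"
proof -
  let ?K = "{f \<in> T.scarrier. \<forall>F. \<forall>z\<in>R. alg_op e f F z = 0}"
  have zl: "alg_op e h F z = 0" if "\<And>z. z \<in> R \<Longrightarrow> F z = 0" "z \<in> R" for h F z
    using alg_op_local[of F "\<lambda>z. 0" z e h] that by (simp add: alg_op_zero)
  have "ideal ?K T.skew"
  proof (rule idealI)
    show "ring T.skew" by (rule T.ring_skew)
    show "subgroup ?K (add_monoid T.skew)"
    proof
      fix f h assume "f \<in> ?K" "h \<in> ?K"
      then show "f \<otimes>\<^bsub>add_monoid T.skew\<^esub> h \<in> ?K"
        by (auto simp: T.skew_simps T.sadd_closed alg_op_add)
    next
      fix f assume f: "f \<in> ?K"
      have m: "(\<lambda>g. - f g) \<in> T.scarrier" using f by (auto simp: T.scarrier_def cvs.span_neg)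
      have "inv\<^bsub>add_monoid T.skew\<^esub> f = (\<lambda>g. - f g)"
        unfolding a_inv_def[symmetric] by (rule A.minus_equality) (use f m in \<open>auto simp: T.skew_simps\<close>)
      moreover have "alg_op e (\<lambda>g. - f g) F z = 0" if "z \<in> R" for F z
        using alg_op_add[of e f "\<lambda>g. - f g" F z] f that by (simp add: alg_op_def tens_op_vec)
      ultimately show "inv\<^bsub>add_monoid T.skew\<^esub> f \<in> ?K" using m by simp
    next
      show "\<one>\<^bsub>add_monoid T.skew\<^esub> \<in> ?K"
        by (auto simp: T.skew_simps T.scarrier_def cvs.span_zero alg_op_def tens_op_vec)
    qed (auto simp: T.skew_simps)
  next
    fix f x assume "f \<in> ?K" "x \<in> carrier T.skew"
    then show "x \<otimes>\<^bsub>T.skew\<^esub> f \<in> ?K" "f \<otimes>\<^bsub>T.skew\<^esub> x \<in> ?K"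
      by (auto simp: T.skew_simps T.skew_mult T.smult_closed alg_op_smult zl)
  qed
  then have "Idl\<^bsub>T.skew\<^esub> {rel v w |v w. v \<in> V \<and> w \<in> V} \<subseteq> ?K"
    by (rule A.genideal_minimal) (auto simp: rel_scarrier alg_op_rel[OF e])
  then show ?thesis using f z by (auto simp: orbifold_ideal_def tensor_skew_eq)
qed

text \<open>An element of the ideal acts by zero for every \<open>e \<noteq> 0\<close>.  Multiplied by \<open>e ^ k\<close>, its operator tends to the sum over \<open>g\<close> of
  the values of its symbols followed by \<open>g\<close>, which is zero as well; free orbits and density of \<open>R\<close>
  then give that the symbols vanish.\<close>

lemma top_symbol_ideal_zero:
  assumes f: "f \<in> I" "f \<in> upto k"
  shows "top_symbol k f = (\<lambda>g. 0)"
proof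
  fix g
  show "top_symbol k f g = 0"
  proof (cases "g \<in> carrier G")
    case True
    show ?thesis
    proof (rule R_dense)
      fix z assume z: "z \<in> R"
      show "poly_eval (top_symbol k f g) z = 0"
      proof (rule separate[OF z _ True])
        fix F :: "'i func"
        have "((\<lambda>e. \<Sum>g\<in>carrier G. e ^ k * tens_op e (f g) (\<lambda>z. F (pact g z)) z) \<longlongrightarrow>
            (\<Sum>g\<in>carrier G. poly_eval (top_symbol k f g) z * F (pact g z))) (at 0)"
          unfolding top_symbol_def by (intro tendsto_sum tens_op_limit z) (use f in \<open>simp add: upto_iff\<close>)
        moreover have "((\<lambda>e. \<Sum>g\<in>carrier G. e ^ k * tens_op e (f g) (\<lambda>z. F (pact g z)) z) \<longlongrightarrow> 0) (at 0)"
          using alg_op_ideal[OF _ f(1) z, of _ F]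
          by (intro tendsto_eventually) (simp add: eventually_at_filter alg_op_def flip: sum_distrib_left)
        ultimately show "(\<Sum>g\<in>carrier G. poly_eval (top_symbol k f g) z * F (pact g z)) = 0"
          by (rule tendsto_unique[rotated]) simp
      qed
    qed
  next
    case False
    then show ?thesis using f by (simp add: top_symbol_def upto_iff)
  qed
qed

sublocale pbw_cochains G \<rho> V P \<kappa>L \<kappa>C
  by unfold_locales (rule top_symbol_ideal_zero)

text \<open>A quadratic relation between vectors holds in the commutative algebra \<open>S(V)\<close>; comparing coefficients, it
  holds for the operators once their products are symmetrized.\<close>

lemma polarization:
  assumes "\<And>z. vec_eval a1 z * vec_eval b1 z + vec_eval a2 z * vec_eval b2 z + vec_eval a3 z * vec_eval b3 z = 0"
  shows "D e a1 (D e b1 F) z + D e b1 (D e a1 F) z + (D e a2 (D e b2 F) z + D e b2 (D e a2 F) z)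
      + (D e a3 (D e b3 F) z + D e b3 (D e a3 F) z) = 0"
proof -
  have ev: "vec_eval a (\<lambda>i. c * (1 when i = p) + d * (1 when i = q)) =
      c * Poly_Mapping.lookup a p + d * Poly_Mapping.lookup a q" for a :: "'i \<Rightarrow>\<^sub>0 complex" and p q c d
    by (induction a rule: poly_mapping_linear_induct)
       (auto simp: lin_form_add lin_form_cscale lookup_add lookup_single algebra_simps when_def)
  let ?l = "Poly_Mapping.lookup"
  have coeff: "?l a1 p * ?l b1 q + ?l b1 p * ?l a1 q + (?l a2 p * ?l b2 q + ?l b2 p * ?l a2 q)
      + (?l a3 p * ?l b3 q + ?l b3 p * ?l a3 q) = 0" for p q
  proof -
    have polar: "(x1 + y1) * (u1 + w1) + (x2 + y2) * (u2 + w2) + (x3 + y3) * (u3 + w3)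
        - (x1 * u1 + x2 * u2 + x3 * u3) - (y1 * w1 + y2 * w2 + y3 * w3)
        = x1 * w1 + u1 * y1 + (x2 * w2 + u2 * y2) + (x3 * w3 + u3 * y3)"
      for x1 x2 x3 y1 y2 y3 u1 u2 u3 w1 w2 w3 :: complex by (simp add: algebra_simps)
    show ?thesis
      using assms[of "\<lambda>i. 1 * (1 when i = p) + 1 * (1 when i = q)"]
        assms[of "\<lambda>i. 1 * (1 when i = p) + 0 * (1 when i = q)"]
        assms[of "\<lambda>i. 0 * (1 when i = p) + 1 * (1 when i = q)"]
      unfolding ev polar[symmetric] by simp
  qed
  let ?A = "Poly_Mapping.keys a1 \<union> Poly_Mapping.keys b1 \<union> Poly_Mapping.keys a2 \<union> Poly_Mapping.keys b2
      \<union> Poly_Mapping.keys a3 \<union> Poly_Mapping.keys b3"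
  have DD: "D e a (D e b F) z = (\<Sum>p\<in>?A. \<Sum>q\<in>?A. ?l a p * ?l b q * B e p (B e q F) z)"
    if "Poly_Mapping.keys a \<subseteq> ?A" "Poly_Mapping.keys b \<subseteq> ?A" for a b
  proof -
    have "D e b F = (\<lambda>z. \<Sum>q\<in>?A. ?l b q * B e q F z)"
      unfolding vec_op_def by (rule ext, rule lin_form_superset) (use that in auto)
    then have "D e a (D e b F) z = (\<Sum>p\<in>?A. ?l a p * B e p (\<lambda>z. \<Sum>q\<in>?A. ?l b q * B e q F z) z)"
      unfolding vec_op_def by (subst lin_form_superset[where A="?A"]) (use that in auto)
    then show ?thesis by (simp add: B_sum sum_distrib_left mult.assoc)
  qed
  have "D e a1 (D e b1 F) z + D e b1 (D e a1 F) z + (D e a2 (D e b2 F) z + D e b2 (D e a2 F) z)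
      + (D e a3 (D e b3 F) z + D e b3 (D e a3 F) z)
    = (\<Sum>p\<in>?A. \<Sum>q\<in>?A. (?l a1 p * ?l b1 q + ?l b1 p * ?l a1 q + (?l a2 p * ?l b2 q + ?l b2 p * ?l a2 q)
      + (?l a3 p * ?l b3 q + ?l b3 p * ?l a3 q)) * B e p (B e q F) z)"
    by (subst (1 2 3 4 5 6) DD) (auto simp: sum.distrib[symmetric] algebra_simps)
  also have "\<dots> = 0" by (simp only: coeff) simp
  finally show ?thesis .
qed

definition bracket_op :: "complex \<Rightarrow> 'g \<Rightarrow> ('i \<Rightarrow>\<^sub>0 complex) \<Rightarrow> ('i \<Rightarrow>\<^sub>0 complex) \<Rightarrow> 'i func \<Rightarrow> 'i func"
  where "bracket_op e g u v F z = D e (\<kappa>L g u v) F z + \<kappa>C g u v * F z"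

abbreviation shift :: "'g \<Rightarrow> 'i func \<Rightarrow> 'i func" where "shift g F \<equiv> (\<lambda>z. F (pact g z))"

lemma commutator:
  "e \<noteq> 0 \<Longrightarrow> u \<in> V \<Longrightarrow> v \<in> V \<Longrightarrow> z \<in> R \<Longrightarrow>
     D e u (D e v F) z - D e v (D e u F) z = (\<Sum>g\<in>carrier G. bracket_op e g u v (shift g F) z)"
  by (simp add: B_commutator bracket_op_def)

lemma bracket_op_local:
  "(\<And>z. z \<in> R \<Longrightarrow> F z = F' z) \<Longrightarrow> z \<in> R \<Longrightarrow> bracket_op e g u v F z = bracket_op e g u v F' z"
  using D_local[of F F' z e] by (simp add: bracket_op_def)

text \<open>The contribution of \<open>g\<close> to the commutator of \<open>v\<^sub>1\<close> with \<open>[v\<^sub>2, v\<^sub>3]\<close>; moving \<open>v\<^sub>1\<close> past \<open>g\<close> turns it into \<open>\<rho> g v1\<close>.\<close>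

definition jac_term where
  "jac_term e g v1 v2 v3 F z = D e v1 (bracket_op e g v2 v3 F) z - bracket_op e g v2 v3 (D e (\<rho> g v1) F) z"

text \<open>The Jacobi identity for three operators, in which every inner commutator is replaced by its value from the
  defining relation.\<close>

lemma jacobi:
  assumes e: "e \<noteq> 0" and V: "v1 \<in> V" "v2 \<in> V" "v3 \<in> V" and z: "z \<in> R"
  shows "(\<Sum>g\<in>carrier G. alt3_sum (\<lambda>v1 v2 v3. jac_term e g v1 v2 v3 (shift g F) z) v1 v2 v3) = 0"
proof -
  have t: "D e u (D e v (D e w F)) z - D e u (D e w (D e v F)) z - D e v (D e w (D e u F)) z + D e w (D e v (D e u F)) z
      = (\<Sum>g\<in>carrier G. jac_term e g u v w (shift g F) z)"
    if uvw: "u \<in> V" "v \<in> V" "w \<in> V" for u v w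
  proof -
    have "D e u (D e v (D e w F)) z - D e u (D e w (D e v F)) z
        = D e u (\<lambda>z. D e v (D e w F) z - D e w (D e v F) z) z" by (simp add: D_fun)
    also have "\<dots> = D e u (\<lambda>z. \<Sum>g\<in>carrier G. bracket_op e g v w (shift g F) z) z"
      by (rule D_local) (use commutator[OF e uvw(2,3)] z in auto)
    also have "\<dots> = (\<Sum>g\<in>carrier G. D e u (bracket_op e g v w (shift g F)) z)" by (rule D_sum)
    finally have 1: "D e u (D e v (D e w F)) z - D e u (D e w (D e v F)) z = \<dots>" .
    have "D e v (D e w (D e u F)) z - D e w (D e v (D e u F)) z
        = (\<Sum>g\<in>carrier G. bracket_op e g v w (shift g (D e u F)) z)"
      by (rule commutator[OF e uvw(2,3) z])
    also have "\<dots> = (\<Sum>g\<in>carrier G. bracket_op e g v w (D e (\<rho> g u) (shift g F)) z)"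
      by (intro sum.cong refl bracket_op_local z) (simp add: D_equivariant)
    finally have 2: "D e v (D e w (D e u F)) z - D e w (D e v (D e u F)) z = \<dots>" .
    have "D e u (D e v (D e w F)) z - D e u (D e w (D e v F)) z - D e v (D e w (D e u F)) z + D e w (D e v (D e u F)) z
        = (D e u (D e v (D e w F)) z - D e u (D e w (D e v F)) z)
          - (D e v (D e w (D e u F)) z - D e w (D e v (D e u F)) z)" by simp
    then show ?thesis by (simp only: 1 2 jac_term_def sum_subtractf)
  qed
  show ?thesis
    unfolding alt3_sum_def sum.distrib t[OF V(1,2,3), symmetric] t[OF V(2,3,1), symmetric] t[OF V(3,1,2), symmetric]
    by simp
qed

lemma jac_term_expand:
  "jac_term e g v1 v2 v3 F z = D e v1 (D e (\<kappa>L g v2 v3) F) z - D e (\<kappa>L g v2 v3) (D e (\<rho> g v1) F) z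
     + \<kappa>C g v2 v3 * D e (v1 - \<rho> g v1) F z"
proof -
  have "D e v1 (bracket_op e g v2 v3 F) z = D e v1 (D e (\<kappa>L g v2 v3) F) z + \<kappa>C g v2 v3 * D e v1 F z"
    unfolding bracket_op_def[abs_def] by (simp add: D_fun)
  then show ?thesis by (simp add: jac_term_def bracket_op_def D_vec algebra_simps)
qed

lemma D_limit0: "z \<in> R \<Longrightarrow> ((\<lambda>e. e * D e v F z) \<longlongrightarrow> vec_eval v z * F z) (at 0)"
  by (rule D_limit) auto

lemma DD_limit: "z \<in> R \<Longrightarrow> ((\<lambda>e. e\<^sup>2 * D e u (D e v F) z) \<longlongrightarrow> vec_eval u z * (vec_eval v z * F z)) (at 0)"
  using D_limit[of "\<lambda>e z. e * D e v F z" "\<lambda>z. vec_eval v z * F z" z u] D_limit0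
  by (simp add: D_fun power2_eq_square mult.assoc)

lemma vec_eval_eq_zero:
  assumes "\<And>z. z \<in> R \<Longrightarrow> vec_eval v z = 0"
  shows "v = 0"
proof -
  have "svec v = 0" by (rule R_dense) (simp add: poly_eval_svec assms)
  show ?thesis
  proof (rule poly_mapping_eqI)
    fix i
    have "Poly_Mapping.lookup (svec v) {#i#} = Poly_Mapping.lookup v i"
      by (induction v rule: poly_mapping_linear_induct)
         (auto simp: svec_single svec_add svec_cscale lookup_add lookup_single when_def)
    with \<open>svec v = 0\<close> show "Poly_Mapping.lookup v i = Poly_Mapping.lookup 0 i" by simp
  qed
qed

text \<open>The coefficient of \<open>e\<^sup>-\<^sup>2\<close> in the Jacobi identity.\<close>

lemma linear_condition:
  assumes g: "g \<in> carrier G" and V: "v1 \<in> V" "v2 \<in> V" "v3 \<in> V"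
  shows "alt3_sum (\<lambda>v1 v2 v3. svec (\<kappa>L g v2 v3) * svec (\<rho> g v1 - v1)) v1 v2 v3 = 0"
proof (rule R_dense)
  fix z assume z: "z \<in> R"
  let ?c = "\<lambda>g. alt3_sum (\<lambda>v1 v2 v3. vec_eval (\<kappa>L g v2 v3) z * vec_eval (v1 - \<rho> g v1) z) v1 v2 v3"
  have "?c g = 0"
  proof (rule separate[OF z _ g])
    fix F :: "'i func"
    have "((\<lambda>e. e\<^sup>2 * jac_term e g v1 v2 v3 F z) \<longlongrightarrow> vec_eval (\<kappa>L g v2 v3) z * vec_eval (v1 - \<rho> g v1) z * F z) (at 0)"
      for g v1 v2 v3 F
    proof -
      have "((\<lambda>e. e\<^sup>2 * D e v1 (D e (\<kappa>L g v2 v3) F) z - e\<^sup>2 * D e (\<kappa>L g v2 v3) (D e (\<rho> g v1) F) z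
          + \<kappa>C g v2 v3 * (e * (e * D e (v1 - \<rho> g v1) F z))) \<longlongrightarrow>
          vec_eval v1 z * (vec_eval (\<kappa>L g v2 v3) z * F z) - vec_eval (\<kappa>L g v2 v3) z * (vec_eval (\<rho> g v1) z * F z)
          + \<kappa>C g v2 v3 * (0 * (vec_eval (v1 - \<rho> g v1) z * F z))) (at 0)"
        by (intro tendsto_intros DD_limit D_limit0 z)
      then show ?thesis
        by (simp add: jac_term_expand lin_form_diff algebra_simps power2_eq_square)
    qed
    then have "((\<lambda>e. e\<^sup>2 * (\<Sum>g\<in>carrier G. alt3_sum (\<lambda>v1 v2 v3. jac_term e g v1 v2 v3 (shift g F) z) v1 v2 v3))
        \<longlongrightarrow> (\<Sum>g\<in>carrier G. ?c g * F (pact g z))) (at 0)"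
      unfolding alt3_sum_def sum_distrib_left distrib_left distrib_right
      by (intro tendsto_sum tendsto_add)
    moreover have "((\<lambda>e. e\<^sup>2 * (\<Sum>g\<in>carrier G. alt3_sum (\<lambda>v1 v2 v3. jac_term e g v1 v2 v3 (shift g F) z) v1 v2 v3))
        \<longlongrightarrow> 0) (at 0)"
      by (intro tendsto_eventually) (simp add: eventually_at_filter jacobi[OF _ V z])
    ultimately show "(\<Sum>g\<in>carrier G. ?c g * F (pact g z)) = 0"
      by (rule tendsto_unique[rotated]) simp
  qed
  then have "- ?c g = 0" by simp
  then show "poly_eval (alt3_sum (\<lambda>v1 v2 v3. svec (\<kappa>L g v2 v3) * svec (\<rho> g v1 - v1)) v1 v2 v3) z = 0"
    by (simp add: alt3_sum_def poly_eval_add poly_eval_times poly_eval_svec lin_form_diff algebra_simps)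
qed

text \<open>Half the difference of the two sides of the vector-valued quadratic condition on a Drinfeld orbifold algebra
  map, and below half the left-hand side of the scalar one.  The factorizations of \<open>g\<close> are written as
  \<open>x\<close> and \<open>x\<inverse> g\<close>.\<close>

definition quad_vec where
  "quad_vec g = alt3_sum (\<lambda>v1 v2 v3. (1/2) *\<^sub>c (\<Sum>x\<in>carrier G.
      \<kappa>L x (v1 + \<rho> (inv x \<otimes> g) v1) (\<kappa>L (inv x \<otimes> g) v2 v3)) + \<kappa>C g v2 v3 *\<^sub>c (v1 - \<rho> g v1))"

definition quad_scal where
  "quad_scal g = alt3_sum (\<lambda>v1 v2 v3. (1/2) * (\<Sum>x\<in>carrier G.
      \<kappa>C x (v1 + \<rho> (inv x \<otimes> g) v1) (\<kappa>L (inv x \<otimes> g) v2 v3)))"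

text \<open>With \<open>w = \<kappa>L g v2 v3\<close> and \<open>v' = \<rho> g v1\<close>, the product \<open>v1 w - w v'\<close> is half of the commutator \<open>[v1 + v', w]\<close> minus half
  of the symmetrized product of \<open>w\<close> and \<open>v' - v1\<close>.  The symmetrized products cancel in the cyclic sum, by the
  previous condition and polarization, and the commutator is again known from the defining relation.\<close>

lemma jac_term_sum:
  assumes e: "e \<noteq> 0" and V: "v1 \<in> V" "v2 \<in> V" "v3 \<in> V" and z: "z \<in> R" and g: "g \<in> carrier G"
  shows "alt3_sum (\<lambda>v1 v2 v3. jac_term e g v1 v2 v3 F z) v1 v2 v3 =
    alt3_sum (\<lambda>v1 v2 v3. (1/2) * (\<Sum>x\<in>carrier G. bracket_op e x (v1 + \<rho> g v1) (\<kappa>L g v2 v3) (shift x F) z)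
      + \<kappa>C g v2 v3 * D e (v1 - \<rho> g v1) F z) v1 v2 v3"
proof -
  let ?k = "\<lambda>v2 v3. \<kappa>L g v2 v3" and ?b = "\<lambda>v1. \<rho> g v1 - v1"
  let ?sym = "\<lambda>v1 v2 v3. D e (?k v2 v3) (D e (?b v1) F) z + D e (?b v1) (D e (?k v2 v3) F) z"
  have sym: "?sym v1 v2 v3 + ?sym v2 v3 v1 + ?sym v3 v1 v2 = 0"
  proof (rule polarization)
    fix z
    show "vec_eval (?k v2 v3) z * vec_eval (?b v1) z + vec_eval (?k v3 v1) z * vec_eval (?b v2) z
        + vec_eval (?k v1 v2) z * vec_eval (?b v3) z = 0"
      using arg_cong[OF linear_condition[OF g V], of "\<lambda>p. poly_eval p z"]
      by (simp add: alt3_sum_def poly_eval_add poly_eval_times poly_eval_svec)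
  qed
  have reduction: "jac_term e g v1 v2 v3 F z =
      (1/2) * (\<Sum>x\<in>carrier G. bracket_op e x (v1 + \<rho> g v1) (\<kappa>L g v2 v3) (shift x F) z)
      + \<kappa>C g v2 v3 * D e (v1 - \<rho> g v1) F z - (1/2) * ?sym v1 v2 v3"
    if v: "v1 \<in> V" "v2 \<in> V" "v3 \<in> V" for v1 v2 v3
  proof -
    have "v1 + \<rho> g v1 \<in> V" using v g by (simp add: V_subspace cvs.subspace_add act_V)
    from commutator[OF e this kL_V[OF g v(2,3)] z, of F, symmetric]
    show ?thesis
      by (simp only:) (simp add: jac_term_expand D_vec D_vec[abs_def] D_fun field_simps)
  qed
  have "alt3_sum (\<lambda>v1 v2 v3. jac_term e g v1 v2 v3 F z) v1 v2 v3 =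
    alt3_sum (\<lambda>v1 v2 v3. (1/2) * (\<Sum>x\<in>carrier G. bracket_op e x (v1 + \<rho> g v1) (\<kappa>L g v2 v3) (shift x F) z)
      + \<kappa>C g v2 v3 * D e (v1 - \<rho> g v1) F z) v1 v2 v3
     - (1/2) * (?sym v1 v2 v3 + ?sym v2 v3 v1 + ?sym v3 v1 v2)"
    unfolding alt3_sum_def reduction[OF V(1,2,3)] reduction[OF V(2,3,1)] reduction[OF V(3,1,2)] by (simp add: field_simps)
  then show ?thesis unfolding sym by simp
qed

lemma sum_products:
  fixes f :: "'g \<Rightarrow> 'g \<Rightarrow> 'w::comm_monoid_add"
  shows "(\<Sum>g\<in>carrier G. \<Sum>x\<in>carrier G. f x g) = (\<Sum>g\<in>carrier G. \<Sum>x\<in>carrier G. f x (inv x \<otimes> g))"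
proof -
  have "(\<Sum>g\<in>carrier G. \<Sum>x\<in>carrier G. f x g) = (\<Sum>x\<in>carrier G. \<Sum>g\<in>carrier G. f x (inv x \<otimes> g))"
    by (subst sum.swap, rule sum.cong[OF refl], rule T.reindex_inv_left[symmetric])
  then show ?thesis by (subst (asm) (2) sum.swap)
qed

text \<open>The Jacobi identity, collected by group elements: a product \<open>x g\<close> is renamed \<open>g\<close>.\<close>

lemma jacobi_reduced:
  assumes e: "e \<noteq> 0" and V: "v1 \<in> V" "v2 \<in> V" "v3 \<in> V" and z: "z \<in> R"
  shows "(\<Sum>g\<in>carrier G. D e (quad_vec g v1 v2 v3) (shift g F) z + quad_scal g v1 v2 v3 * F (pact g z)) = 0"
proof -
  have D_vsum: "D e (\<Sum>x\<in>X. f x) F z = (\<Sum>x\<in>X. D e (f x) F z)" for X :: "'g set" and f F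
    by (simp add: vec_op_def lin_form_sum)
  have one: "(\<Sum>g\<in>carrier G. (1/2) * (\<Sum>x\<in>carrier G. bracket_op e x (v1 + \<rho> g v1) (\<kappa>L g v2 v3) (shift x (shift g F)) z)
      + \<kappa>C g v2 v3 * D e (v1 - \<rho> g v1) (shift g F) z)
    = (\<Sum>g\<in>carrier G. D e ((1/2) *\<^sub>c (\<Sum>x\<in>carrier G. \<kappa>L x (v1 + \<rho> (inv x \<otimes> g) v1) (\<kappa>L (inv x \<otimes> g) v2 v3))
          + \<kappa>C g v2 v3 *\<^sub>c (v1 - \<rho> g v1)) (shift g F) z
        + (1/2) * (\<Sum>x\<in>carrier G. \<kappa>C x (v1 + \<rho> (inv x \<otimes> g) v1) (\<kappa>L (inv x \<otimes> g) v2 v3)) * F (pact g z))"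
    for v1 v2 v3
  proof -
    have "(\<Sum>g\<in>carrier G. \<Sum>x\<in>carrier G. bracket_op e x (v1 + \<rho> g v1) (\<kappa>L g v2 v3) (shift x (shift g F)) z)
        = (\<Sum>g\<in>carrier G. \<Sum>x\<in>carrier G. bracket_op e x (v1 + \<rho> g v1) (\<kappa>L g v2 v3) (shift (x \<otimes> g) F) z)"
      by (intro sum.cong refl) (simp add: pact_times)
    also have "\<dots> = (\<Sum>g\<in>carrier G. \<Sum>x\<in>carrier G.
        bracket_op e x (v1 + \<rho> (inv x \<otimes> g) v1) (\<kappa>L (inv x \<otimes> g) v2 v3) (shift (x \<otimes> (inv x \<otimes> g)) F) z)"
      by (rule sum_products)
    also have "\<dots> = (\<Sum>g\<in>carrier G. \<Sum>x\<in>carrier G.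
        bracket_op e x (v1 + \<rho> (inv x \<otimes> g) v1) (\<kappa>L (inv x \<otimes> g) v2 v3) (shift g F) z)"
      by (intro sum.cong refl) (simp add: m_assoc[symmetric])
    finally have A: "(\<Sum>g\<in>carrier G. \<Sum>x\<in>carrier G. bracket_op e x (v1 + \<rho> g v1) (\<kappa>L g v2 v3) (shift x (shift g F)) z) = \<dots>" .
    have "(\<Sum>g\<in>carrier G. (1/2) * (\<Sum>x\<in>carrier G. bracket_op e x (v1 + \<rho> g v1) (\<kappa>L g v2 v3) (shift x (shift g F)) z)
        + \<kappa>C g v2 v3 * D e (v1 - \<rho> g v1) (shift g F) z)
      = (1/2) * (\<Sum>g\<in>carrier G. \<Sum>x\<in>carrier G. bracket_op e x (v1 + \<rho> g v1) (\<kappa>L g v2 v3) (shift x (shift g F)) z)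
        + (\<Sum>g\<in>carrier G. \<kappa>C g v2 v3 * D e (v1 - \<rho> g v1) (shift g F) z)"
      by (simp only: sum.distrib sum_distrib_left)
    also have "\<dots> = (\<Sum>g\<in>carrier G. (1/2) * (\<Sum>x\<in>carrier G.
        bracket_op e x (v1 + \<rho> (inv x \<otimes> g) v1) (\<kappa>L (inv x \<otimes> g) v2 v3) (shift g F) z)
        + \<kappa>C g v2 v3 * D e (v1 - \<rho> g v1) (shift g F) z)"
      by (simp only: A sum.distrib sum_distrib_left)
    also have "\<dots> = (\<Sum>g\<in>carrier G. D e ((1/2) *\<^sub>c (\<Sum>x\<in>carrier G. \<kappa>L x (v1 + \<rho> (inv x \<otimes> g) v1) (\<kappa>L (inv x \<otimes> g) v2 v3))
          + \<kappa>C g v2 v3 *\<^sub>c (v1 - \<rho> g v1)) (shift g F) z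
        + (1/2) * (\<Sum>x\<in>carrier G. \<kappa>C x (v1 + \<rho> (inv x \<otimes> g) v1) (\<kappa>L (inv x \<otimes> g) v2 v3)) * F (pact g z))"
      by (rule sum.cong[OF refl])
         (simp only: bracket_op_def D_vec(1,2) D_vsum sum.distrib sum_distrib_right[symmetric], simp add: algebra_simps)
    finally show ?thesis .
  qed
  have "0 = (\<Sum>g\<in>carrier G. alt3_sum (\<lambda>v1 v2 v3. jac_term e g v1 v2 v3 (shift g F) z) v1 v2 v3)"
    by (simp add: jacobi[OF e V z])
  also have "\<dots> = (\<Sum>g\<in>carrier G. alt3_sum (\<lambda>v1 v2 v3. (1/2) *
      (\<Sum>x\<in>carrier G. bracket_op e x (v1 + \<rho> g v1) (\<kappa>L g v2 v3) (shift x (shift g F)) z)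
      + \<kappa>C g v2 v3 * D e (v1 - \<rho> g v1) (shift g F) z) v1 v2 v3)"
    by (intro sum.cong refl jac_term_sum[OF e V z])
  also have "\<dots> = alt3_sum (\<lambda>v1 v2 v3. \<Sum>g\<in>carrier G. (1/2) *
      (\<Sum>x\<in>carrier G. bracket_op e x (v1 + \<rho> g v1) (\<kappa>L g v2 v3) (shift x (shift g F)) z)
      + \<kappa>C g v2 v3 * D e (v1 - \<rho> g v1) (shift g F) z) v1 v2 v3"
    by (simp only: alt3_sum_def sum.distrib)
  also have "\<dots> = (\<Sum>g\<in>carrier G. D e (quad_vec g v1 v2 v3) (shift g F) z + quad_scal g v1 v2 v3 * F (pact g z))"
    unfolding one by (simp add: quad_vec_def quad_scal_def alt3_sum_def D_vec sum.distrib distrib_right)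
  finally show ?thesis by simp
qed

text \<open>The coefficient of \<open>e\<^sup>-\<^sup>1\<close> in the reduced identity is \<open>quad_vec\<close>.  Once it vanishes, the identity involves no operator
  of degree one, and \<open>quad_scal\<close> can be read off at any \<open>e \<noteq> 0\<close>.\<close>

lemma quad_zero:
  assumes V: "v1 \<in> V" "v2 \<in> V" "v3 \<in> V" and g: "g \<in> carrier G"
  shows "quad_vec g v1 v2 v3 = 0" "quad_scal g v1 v2 v3 = 0"
proof -
  have vec: "quad_vec g v1 v2 v3 = 0" if g: "g \<in> carrier G" for g
  proof (rule vec_eval_eq_zero, rule separate[OF _ _ g, where c="\<lambda>g. vec_eval (quad_vec g v1 v2 v3) z" for z])
    fix z F assume z: "z \<in> R"
    have "((\<lambda>e. \<Sum>g\<in>carrier G. e * D e (quad_vec g v1 v2 v3) (shift g F) z + e * (quad_scal g v1 v2 v3 * F (pact g z))) \<longlongrightarrow>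
        (\<Sum>g\<in>carrier G. vec_eval (quad_vec g v1 v2 v3) z * F (pact g z) + 0 * (quad_scal g v1 v2 v3 * F (pact g z)))) (at 0)"
      by (intro tendsto_sum tendsto_add D_limit0[OF z, where F="shift _ F"] tendsto_mult tendsto_ident_at tendsto_const)
    moreover have "((\<lambda>e. \<Sum>g\<in>carrier G. e * D e (quad_vec g v1 v2 v3) (shift g F) z + e * (quad_scal g v1 v2 v3 * F (pact g z))) \<longlongrightarrow> 0) (at 0)"
      unfolding distrib_left[symmetric] sum_distrib_left[symmetric]
      by (intro tendsto_eventually) (simp add: eventually_at_filter jacobi_reduced[OF _ V z])
    ultimately have "(\<Sum>g\<in>carrier G. vec_eval (quad_vec g v1 v2 v3) z * F (pact g z)
        + 0 * (quad_scal g v1 v2 v3 * F (pact g z))) = 0"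
      by (rule tendsto_unique[rotated]) simp
    then show "(\<Sum>g\<in>carrier G. vec_eval (quad_vec g v1 v2 v3) z * F (pact g z)) = 0" by simp
  qed
  show "quad_vec g v1 v2 v3 = 0" by (rule vec[OF g])
  have "R \<noteq> {}" using R_dense[of 1] by auto
  then obtain z where z: "z \<in> R" by auto
  show "quad_scal g v1 v2 v3 = 0"
    using separate[OF z _ g, of "\<lambda>g. quad_scal g v1 v2 v3"] jacobi_reduced[OF one_neq_zero V z]
    by (simp add: vec D_vec)
qed

theorem drinfeld:
  assumes fixed: "\<And>g u v. g \<in> carrier G \<Longrightarrow> u \<in> V \<Longrightarrow> v \<in> V \<Longrightarrow> \<rho> g (\<kappa>L g u v) = \<kappa>L g u v"
    and invL: "\<And>g h u v. g \<in> carrier G \<Longrightarrow> h \<in> carrier G \<Longrightarrow> u \<in> V \<Longrightarrow> v \<in> V \<Longrightarrow>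
          \<rho> h (\<kappa>L g u v) = \<kappa>L (h \<otimes> g \<otimes> inv h) (\<rho> h u) (\<rho> h v)"
    and invC: "\<And>g h u v. g \<in> carrier G \<Longrightarrow> h \<in> carrier G \<Longrightarrow> u \<in> V \<Longrightarrow> v \<in> V \<Longrightarrow>
          \<kappa>C g u v = \<kappa>C (h \<otimes> g \<otimes> inv h) (\<rho> h u) (\<rho> h v)"
  shows "drinfeld_orbifold_map G \<rho> V \<kappa>L \<kappa>C"
proof -
  have iii: "alt3_sum (\<lambda>v1 v2 v3. \<Sum>(x, y)\<in>factorizations G g. \<kappa>L x (v1 + \<rho> y v1) (\<kappa>L y v2 v3)) v1 v2 v3 =
       2 *\<^sub>c alt3_sum (\<lambda>v1 v2 v3. \<kappa>C g v2 v3 *\<^sub>c (\<rho> g v1 - v1)) v1 v2 v3"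
    if "g \<in> carrier G" "v1 \<in> V" "v2 \<in> V" "v3 \<in> V" for g v1 v2 v3
  proof -
    have "2 *\<^sub>c quad_vec g v1 v2 v3 = 0" using quad_zero(1)[OF that(2-4,1)] by simp
    then show ?thesis
      using that(1) T.sum_factorizations[of "\<lambda>x y. \<kappa>L x (v1 + \<rho> y v1) (\<kappa>L y v2 v3)" g for v1 v2 v3]
      by (simp add: quad_vec_def alt3_sum_def case_prod_unfold cvs.scale_right_distrib cvs.scale_right_diff_distrib)
         (simp add: algebra_simps)
  qed
  have iv: "alt3_sum (\<lambda>v1 v2 v3. \<Sum>(x, y)\<in>factorizations G g. \<kappa>C x (v1 + \<rho> y v1) (\<kappa>L y v2 v3)) v1 v2 v3 = 0"
    if "g \<in> carrier G" "v1 \<in> V" "v2 \<in> V" "v3 \<in> V" for g v1 v2 v3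
  proof -
    have "2 * quad_scal g v1 v2 v3 = 0" using quad_zero(2)[OF that(2-4,1)] by simp
    then show ?thesis
      using that(1) T.sum_factorizations[of "\<lambda>x y. \<kappa>C x (v1 + \<rho> y v1) (\<kappa>L y v2 v3)" g for v1 v2 v3]
      by (simp add: quad_scal_def alt3_sum_def case_prod_unfold distrib_left)
  qed
  show ?thesis
    unfolding drinfeld_orbifold_map_def
    by (intro conjI ballI kL_linear kC_constant fixed invL invC linear_condition iii iv)
qed

end


section \<open>The doubled standard representation\<close>

abbreviation X :: "xy_space \<Rightarrow> nat \<Rightarrow> complex" where "X v i \<equiv> Poly_Mapping.lookup v (Inl i)"
abbreviation Y :: "xy_space \<Rightarrow> nat \<Rightarrow> complex" where "Y v i \<equiv> Poly_Mapping.lookup v (Inr i)"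
abbreviation swp :: "nat \<Rightarrow> nat \<Rightarrow> nat \<Rightarrow> nat" where "swp \<equiv> Transposition.transpose"
abbreviation perm_pt :: "(nat \<Rightarrow> nat) \<Rightarrow> (nat + nat \<Rightarrow> complex) \<Rightarrow> (nat + nat \<Rightarrow> complex)"
  where "perm_pt \<sigma> z \<equiv> z \<circ> map_sum \<sigma> \<sigma>"

lemma perm_act_eq_lin_ext: "perm_act \<sigma> = lin_ext (\<lambda>b. Poly_Mapping.single (map_sum \<sigma> \<sigma> b) 1)"
  by (simp add: fun_eq_iff perm_act_def lin_ext_def cscale_single)

lemma linear_perm_act: "Vector_Spaces.linear cscale cscale (perm_act \<sigma>)"
  unfolding perm_act_eq_lin_ext by (rule linear_lin_ext)

lemma perm_act_add: "perm_act \<sigma> (u + v) = perm_act \<sigma> u + perm_act \<sigma> v"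
  and perm_act_diff: "perm_act \<sigma> (u - v) = perm_act \<sigma> u - perm_act \<sigma> v"
  and perm_act_cscale: "perm_act \<sigma> (c *\<^sub>c v) = c *\<^sub>c perm_act \<sigma> v"
  and perm_act_zero [simp]: "perm_act \<sigma> 0 = 0"
  and perm_act_sum: "perm_act \<sigma> (\<Sum>i\<in>J. f i) = (\<Sum>i\<in>J. perm_act \<sigma> (f i))"
  by (simp_all add: perm_act_eq_lin_ext lin_ext_add lin_ext_diff lin_ext_cscale lin_ext_sum)

lemma perm_act_id: "perm_act id = id"
  by (simp add: fun_eq_iff perm_act_eq_lin_ext map_sum.id)

lemma perm_act_comp: "perm_act (\<sigma> \<circ> \<tau>) = perm_act \<sigma> \<circ> perm_act \<tau>"
  by (simp add: fun_eq_iff perm_act_eq_lin_ext lin_ext_comp map_sum.compositionality)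

lemma perm_act_b: "perm_act \<sigma> (xb i) = xb (\<sigma> i)" "perm_act \<sigma> (yb i) = yb (\<sigma> i)"
  by (simp_all add: perm_act_eq_lin_ext xb_def yb_def)

lemma lookup_perm_act:
  assumes "inj \<sigma>"
  shows "X (perm_act \<sigma> v) (\<sigma> i) = X v i" "Y (perm_act \<sigma> v) (\<sigma> i) = Y v i"
proof -
  have "X (perm_act \<sigma> v) (\<sigma> i) = X v i \<and> Y (perm_act \<sigma> v) (\<sigma> i) = Y v i"
  proof (induction v rule: poly_mapping_linear_induct)
    case (basis b)
    then show ?case using assms by (cases b) (auto simp: perm_act_eq_lin_ext lookup_single when_def inj_def)
  qed (auto simp: perm_act_add perm_act_cscale lookup_add)
  then show "X (perm_act \<sigma> v) (\<sigma> i) = X v i" "Y (perm_act \<sigma> v) (\<sigma> i) = Y v i" by auto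
qed

lemma vec_eval_perm_act: "vec_eval (perm_act \<sigma> v) z = vec_eval v (perm_pt \<sigma> z)"
  by (simp add: perm_act_eq_lin_ext lin_form_lin_ext o_def)

lemma vec_eval_bars:
  "vec_eval (xbar n i) z = z (Inl i) - (\<Sum>j\<in>{1..n}. z (Inl j)) / of_nat n"
  "vec_eval (ybar n i) z = z (Inr i) - (\<Sum>j\<in>{1..n}. z (Inr j)) / of_nat n"
  by (simp_all add: xbar_def ybar_def xb_def yb_def lin_form_diff lin_form_cscale lin_form_sum)

lemma lookup_bars:
  "X (xbar n i) k = (1 when k = i) - ((1 / of_nat n) when k \<in> {1..n})" "Y (xbar n i) k = 0"
  "Y (ybar n i) k = (1 when k = i) - ((1 / of_nat n) when k \<in> {1..n})" "X (ybar n i) k = 0"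
  by (auto simp: xbar_def ybar_def xb_def yb_def lookup_minus lookup_sum lookup_single when_def sum.delta)

lemma sum_permutes: "\<sigma> permutes N \<Longrightarrow> (\<Sum>i\<in>N. f (\<sigma> i)) = (\<Sum>i\<in>N. f i)"
  using sum.permute[of \<sigma> N f] by (simp add: o_def)

lemma perm_act_bars:
  assumes "\<sigma> permutes {1..n}"
  shows "perm_act \<sigma> (xbar n i) = xbar n (\<sigma> i)" "perm_act \<sigma> (ybar n i) = ybar n (\<sigma> i)"
  using sum_permutes[OF assms, of xb] sum_permutes[OF assms, of yb]
  by (simp_all add: xbar_def ybar_def perm_act_diff perm_act_cscale perm_act_sum perm_act_b)

lemma doubled_std_iff:
  assumes "n > 0"
  shows "v \<in> doubled_std n \<longleftrightarrow> (\<forall>k. k \<notin> {1..n} \<longrightarrow> X v k = 0 \<and> Y v k = 0) \<and>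
    (\<Sum>k\<in>{1..n}. X v k) = 0 \<and> (\<Sum>k\<in>{1..n}. Y v k) = 0"
    and "v \<in> doubled_std n \<Longrightarrow> v = (\<Sum>i\<in>{1..n}. X v i *\<^sub>c xbar n i + Y v i *\<^sub>c ybar n i)"
proof -
  let ?Q = "\<lambda>v. (\<forall>k. k \<notin> {1..n} \<longrightarrow> X v k = 0 \<and> Y v k = 0) \<and>
    (\<Sum>k\<in>{1..n}. X v k) = 0 \<and> (\<Sum>k\<in>{1..n}. Y v k) = 0"
  have rep: "v = (\<Sum>i\<in>{1..n}. X v i *\<^sub>c xbar n i + Y v i *\<^sub>c ybar n i)" if q: "?Q v" for v
  proof (rule poly_mapping_eqI)
    fix b
    let ?r = "\<Sum>i\<in>{1..n}. X v i *\<^sub>c xbar n i + Y v i *\<^sub>c ybar n i"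
    have "Poly_Mapping.lookup ?r (Inl k) = X v k" for k
    proof -
      have "Poly_Mapping.lookup ?r (Inl k) = (\<Sum>i\<in>{1..n}. X v i * (1 when k = i)) - (\<Sum>i\<in>{1..n}. X v i) * ((1 / of_nat n) when k \<in> {1..n})"
        by (simp add: lookup_sum lookup_add lookup_bars algebra_simps sum_subtractf sum_distrib_left sum_distrib_right)
      also have "(\<Sum>i\<in>{1..n}. X v i * (1 when k = i)) = (\<Sum>i\<in>{1..n}. if i = k then X v k else 0)"
        by (rule sum.cong) auto
      also have "\<dots> = X v k" using q by (auto simp: sum.delta)
      finally show ?thesis using q by simp
    qed
    moreover have "Poly_Mapping.lookup ?r (Inr k) = Y v k" for k
    proof -
      have "Poly_Mapping.lookup ?r (Inr k) = (\<Sum>i\<in>{1..n}. Y v i * (1 when k = i)) - (\<Sum>i\<in>{1..n}. Y v i) * ((1 / of_nat n) when k \<in> {1..n})"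
        by (simp add: lookup_sum lookup_add lookup_bars algebra_simps sum_subtractf sum_distrib_left sum_distrib_right)
      also have "(\<Sum>i\<in>{1..n}. Y v i * (1 when k = i)) = (\<Sum>i\<in>{1..n}. if i = k then Y v k else 0)"
        by (rule sum.cong) auto
      also have "\<dots> = Y v k" using q by (auto simp: sum.delta)
      finally show ?thesis using q by simp
    qed
    ultimately show "Poly_Mapping.lookup v b = Poly_Mapping.lookup ?r b" by (cases b) auto
  qed
  show iff: "v \<in> doubled_std n \<longleftrightarrow> ?Q v"
  proof
    assume "v \<in> doubled_std n"
    then show "?Q v"
      unfolding doubled_std_def
    proof (induction v rule: cvs.span_induct_alt)
      case (step c a v)
      have d: "(\<Sum>k\<in>{1..n}. (1 when k = i) - ((1 / complex_of_nat n) when k \<in> {1..n})) = 0" if "i \<in> {1..n}" for i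
      proof -
        have "(\<Sum>k\<in>{1..n}. (1 when k = i) - ((1 / complex_of_nat n) when k \<in> {1..n}))
            = (\<Sum>k\<in>{1..n}. (if k = i then 1 else 0)) - (\<Sum>k\<in>{1..n}. 1 / complex_of_nat n)"
          unfolding sum_subtractf[symmetric] by (rule sum.cong) (auto simp: when_def)
        then show ?thesis using that assms by (simp add: sum.delta)
      qed
      have "?Q a"
        using step.hyps
      proof
        assume "a \<in> xbar n ` {1..n}"
        then show ?thesis using d by (auto simp: lookup_bars)
      next
        assume "a \<in> ybar n ` {1..n}"
        then show ?thesis using d by (auto simp: lookup_bars)
      qed
      with step.IH show ?case
        by (simp add: lookup_add sum.distrib sum_distrib_left[symmetric])
    qed simp
  next
    assume "?Q v"
    have "(\<Sum>i\<in>{1..n}. X v i *\<^sub>c xbar n i + Y v i *\<^sub>c ybar n i) \<in> doubled_std n"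
      unfolding doubled_std_def by (intro cvs.span_sum cvs.span_add cvs.span_scale cvs.span_base) auto
    with rep[OF \<open>?Q v\<close>] show "v \<in> doubled_std n" by simp
  qed
  show "v \<in> doubled_std n \<Longrightarrow> v = (\<Sum>i\<in>{1..n}. X v i *\<^sub>c xbar n i + Y v i *\<^sub>c ybar n i)"
    using iff rep by blast
qed

text \<open>The projection along the invariant vectors \<open>\<Sum>i. x\<^sub>i\<close> and \<open>\<Sum>i. y\<^sub>i\<close> and along all basis vectors with index outside
  \<open>{1..n}\<close>.\<close>

definition std_proj :: "nat \<Rightarrow> xy_space \<Rightarrow> xy_space"
  where "std_proj n = lin_ext (\<lambda>b. case b of
     Inl i \<Rightarrow> if i \<in> {1..n} then xbar n i else 0 | Inr i \<Rightarrow> if i \<in> {1..n} then ybar n i else 0)"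

lemma bars_doubled_std: "i \<in> {1..n} \<Longrightarrow> xbar n i \<in> doubled_std n" "i \<in> {1..n} \<Longrightarrow> ybar n i \<in> doubled_std n"
  by (auto simp: doubled_std_def intro: cvs.span_base)

lemma subspace_doubled_std: "cvs.subspace (doubled_std n)"
  by (simp add: doubled_std_def)

lemma std_proj_doubled_std: "std_proj n v \<in> doubled_std n"
  unfolding std_proj_def
proof (induction v rule: poly_mapping_linear_induct)
  case (basis b)
  then show ?case
    using cvs.subspace_0[OF subspace_doubled_std] by (cases b) (auto intro: bars_doubled_std)
qed (auto simp: lin_ext_add lin_ext_cscale intro: cvs.subspace_add cvs.subspace_scale subspace_doubled_std
      cvs.subspace_0)

lemma std_proj_eq: "std_proj n v = (\<Sum>i\<in>{1..n}. X v i *\<^sub>c xbar n i + Y v i *\<^sub>c ybar n i)"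
proof (induction v rule: poly_mapping_linear_induct)
  case (basis b)
  show ?case
  proof (cases b)
    case (Inl k)
    then have "(\<Sum>i\<in>{1..n}. X (Poly_Mapping.single b 1) i *\<^sub>c xbar n i + Y (Poly_Mapping.single b 1) i *\<^sub>c ybar n i)
        = (\<Sum>i\<in>{1..n}. if i = k then xbar n k else 0)"
      by (intro sum.cong refl) (simp add: lookup_single)
    then show ?thesis using Inl by (simp add: std_proj_def sum.delta)
  next
    case (Inr k)
    then have "(\<Sum>i\<in>{1..n}. X (Poly_Mapping.single b 1) i *\<^sub>c xbar n i + Y (Poly_Mapping.single b 1) i *\<^sub>c ybar n i)
        = (\<Sum>i\<in>{1..n}. if i = k then ybar n k else 0)"
      by (intro sum.cong refl) (simp add: lookup_single)
    then show ?thesis using Inr by (simp add: std_proj_def sum.delta)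
  qed
next
  case (cscale c q)
  then show ?case by (simp add: std_proj_def lin_ext_cscale cvs.scale_sum_right cvs.scale_right_distrib)
next
  case (add q r)
  then show ?case
    by (simp add: std_proj_def lin_ext_add lookup_add cvs.scale_left_distrib sum.distrib algebra_simps)
qed (simp add: std_proj_def)

lemma perm_act_doubled_std:
  assumes "\<sigma> permutes {1..n}" "v \<in> doubled_std n"
  shows "perm_act \<sigma> v \<in> doubled_std n"
  using assms(2) unfolding doubled_std_def
proof (induction v rule: cvs.span_induct_alt)
  case (step c a v)
  have "perm_act \<sigma> a \<in> cvs.span (xbar n ` {1..n} \<union> ybar n ` {1..n})"
    using step.hyps permutes_in_image[OF assms(1)]
    by (auto simp: perm_act_bars[OF assms(1)] intro!: cvs.span_base)
  with step.IH show ?case by (simp add: perm_act_add perm_act_cscale cvs.span_add cvs.span_scale)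
qed (simp add: cvs.span_zero)

lemma linear_action_sym:
  assumes "n > 0"
  shows "linear_action (sym_group n) perm_act (doubled_std n) (std_proj n)"
proof (intro linear_action.intro linear_action_axioms.intro)
  show "group (sym_group n)" by (rule sym_group_is_group)
  show "finite (carrier (sym_group n))" by (simp add: sym_group_def finite_permutations)
  show "Vector_Spaces.linear cscale cscale (std_proj n)" unfolding std_proj_def by (rule linear_lin_ext)
  show "std_proj n v = v" if "v \<in> doubled_std n" for v
    using doubled_std_iff(2)[OF assms that] by (simp add: std_proj_eq)
qed (simp_all add: linear_perm_act sym_group_one sym_group_mult perm_act_id perm_act_comp subspace_doubled_std
    perm_act_doubled_std sym_group_carrier std_proj_doubled_std)


section \<open>Dunkl operators\<close>

text \<open>A symmetric sum over pairs \<open>(k, l)\<close>, sorted by the number of common indices with \<open>{i, j}\<close>.\<close>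

lemma sum_pairs_split:
  fixes h :: "nat \<Rightarrow> nat \<Rightarrow> complex"
  assumes "finite N" "i \<in> N" "j \<in> N" "i \<noteq> j" "\<And>k l. h k l = h l k" "\<And>k. h k k = 0"
  shows "(\<Sum>k\<in>N. \<Sum>l\<in>N. h k l) =
    2 * h i j + 2 * (\<Sum>m\<in>N - {i, j}. h i m + h j m) + (\<Sum>k\<in>N - {i, j}. \<Sum>l\<in>N - {i, j}. h k l)"
proof -
  let ?M = "N - {i, j}"
  have N: "N = insert i (insert j ?M)" using assms by auto
  have s: "(\<Sum>l\<in>N. f l) = f i + (f j + sum f ?M)" for f :: "nat \<Rightarrow> complex"
    by (subst N) (use assms in simp)
  have "(\<Sum>k\<in>?M. h k i) = (\<Sum>k\<in>?M. h i k)" "(\<Sum>k\<in>?M. h k j) = (\<Sum>k\<in>?M. h j k)" "h j i = h i j"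
    using assms(5) by (auto intro: sum.cong)
  then show ?thesis by (simp only: s sum.distrib assms(6)) simp
qed

lemma conj_swp:
  assumes "h permutes {1..n}"
  shows "h \<circ> swp i j = swp (h i) (h j) \<circ> h"
  using transpose_comp_eq[OF permutes_bij[OF assms], of "h i" "h j"]
  by (simp add: permutes_inverses[OF assms])

lemma sum_triple_rotate:
  fixes h :: "nat \<Rightarrow> nat \<Rightarrow> nat \<Rightarrow> 'w::comm_monoid_add"
  shows "(\<Sum>i\<in>N. \<Sum>j\<in>N. \<Sum>k\<in>N. h j k i) = (\<Sum>i\<in>N. \<Sum>j\<in>N. \<Sum>k\<in>N. h i j k)"
proof -
  have "(\<Sum>i\<in>N. \<Sum>j\<in>N. \<Sum>k\<in>N. h j k i) = (\<Sum>j\<in>N. \<Sum>i\<in>N. \<Sum>k\<in>N. h j k i)" by (rule sum.swap)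
  also have "\<dots> = (\<Sum>j\<in>N. \<Sum>k\<in>N. \<Sum>i\<in>N. h j k i)" by (rule sum.cong[OF refl], rule sum.swap)
  finally show ?thesis .
qed

lemma sum_quadruple_antisym:
  fixes q :: "nat \<Rightarrow> nat \<Rightarrow> nat \<Rightarrow> nat \<Rightarrow> complex"
  assumes "\<And>i j k l. q k l i j = - q i j k l"
  shows "(\<Sum>i\<in>N. \<Sum>j\<in>N. \<Sum>k\<in>N. \<Sum>l\<in>N. q i j k l) = 0"
proof -
  let ?s = "\<Sum>i\<in>N. \<Sum>j\<in>N. \<Sum>k\<in>N. \<Sum>l\<in>N. q i j k l"
  have P: "(\<Sum>i\<in>N. \<Sum>j\<in>N. f i j) = (\<Sum>p\<in>N \<times> N. f (fst p) (snd p))" for f :: "nat \<Rightarrow> nat \<Rightarrow> complex"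
    by (simp add: sum.cartesian_product case_prod_unfold)
  have s: "?s = (\<Sum>p\<in>N \<times> N. \<Sum>r\<in>N \<times> N. q (fst p) (snd p) (fst r) (snd r))"
    by (simp only: P)
  also have "\<dots> = (\<Sum>r\<in>N \<times> N. \<Sum>p\<in>N \<times> N. q (fst p) (snd p) (fst r) (snd r))" by (rule sum.swap)
  also have "\<dots> = (\<Sum>r\<in>N \<times> N. \<Sum>p\<in>N \<times> N. - q (fst r) (snd r) (fst p) (snd p))"
    by (intro sum.cong refl assms)
  also have "\<dots> = - ?s" by (simp only: s sum_negf)
  finally show ?thesis by simp
qed

text \<open>The operators \<open>B e b\<close> below represent the member of the family with parameters \<open>a = A \<alpha>\<close>, \<open>b = A \<beta>\<close> and \<open>c\<close>.  The factor
  \<open>A\<close> is kept apart from \<open>(\<alpha>, \<beta>)\<close> because the denominators need \<open>(\<alpha>, \<beta>) \<noteq> 0\<close> while \<open>a = b = 0\<close> is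
  allowed.\<close>

locale dunkl =
  fixes n :: nat and \<alpha> \<beta> A c :: complex
  assumes n3: "n \<ge> 3" and nontrivial: "\<alpha> \<noteq> 0 \<or> \<beta> \<noteq> 0"
begin

abbreviation N where "N \<equiv> {1..n}"

definition xi :: "nat \<Rightarrow> (nat + nat \<Rightarrow> complex) \<Rightarrow> complex"
  where "xi i z = \<alpha> * vec_eval (xbar n i) z + \<beta> * vec_eval (ybar n i) z"

definition reg :: "(nat + nat \<Rightarrow> complex) set"
  where "reg = {z. \<forall>i\<in>N. \<forall>j\<in>N. i \<noteq> j \<longrightarrow> xi i z \<noteq> xi j z}"

text \<open>The form \<open>theta v i j\<close> is zero on every \<open>\<alpha> x\<^sub>k + \<beta> y\<^sub>k\<close>.  Hence these vectors act by mere multiplication, and it is in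
  their span that \<open>\<kappa>L\<close> takes its values.\<close>

definition theta :: "xy_space \<Rightarrow> nat \<Rightarrow> nat \<Rightarrow> complex"
  where "theta v i j = \<alpha> * (Y v i - Y v j) - \<beta> * (X v i - X v j)"

text \<open>In a commutator the numerator appears divided by \<open>e\<close>.  The first summand then is the operator of a vector, which is
  a value of \<open>\<kappa>L\<close>, and the second one becomes the constant \<open>c\<close>.\<close>

definition phi :: "complex \<Rightarrow> nat \<Rightarrow> nat \<Rightarrow> (nat + nat \<Rightarrow> complex) \<Rightarrow> complex"
  where "phi e i j z = (- (of_nat n / 2) * A * (xi i z + xi j z) + e * c) / (xi i z - xi j z)"

text \<open>Pairs are summed in both orders, whence the factor \<open>1/2\<close>.\<close>

definition B :: "complex \<Rightarrow> nat + nat \<Rightarrow> (nat + nat) func \<Rightarrow> (nat + nat) func"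
  where "B e b F z = z b * F z / e +
    (\<Sum>i\<in>N. \<Sum>j\<in>N. 1/2 * theta (Poly_Mapping.single b 1) i j * phi e i j z * F (perm_pt (swp i j) z))"

lemma theta_linear: "theta (u + v) i j = theta u i j + theta v i j" "theta (a *\<^sub>c v) i j = a * theta v i j" "theta 0 i j = 0"
  by (simp_all add: theta_def lookup_add algebra_simps)

lemma theta_antisym: "theta v i j = - theta v j i" and theta_diag: "theta v i i = 0"
  by (simp_all add: theta_def algebra_simps)

lemma phi_antisym: "phi e i j z = - phi e j i z"
  unfolding phi_def minus_divide_right by (simp add: add.commute)

lemma D_eq: "vec_op (B e) v F z = vec_eval v z * F z / e +
    (\<Sum>i\<in>N. \<Sum>j\<in>N. 1/2 * theta v i j * phi e i j z * F (perm_pt (swp i j) z))"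
proof (induction v rule: poly_mapping_linear_induct)
  case (basis b)
  then show ?case by (simp add: vec_op_def B_def o_def)
next
  case (cscale a v)
  then show ?case
    by (simp add: vec_op_def lin_form_cscale theta_linear distrib_left sum_distrib_left mult_ac)
next
  case (add u v)
  then show ?case
    by (simp add: vec_op_def lin_form_add theta_linear algebra_simps add_divide_distrib sum.distrib)
qed (simp add: vec_op_def theta_linear)

lemma xi_perm_pt:
  assumes "\<sigma> permutes N"
  shows "xi i (perm_pt \<sigma> z) = xi (\<sigma> i) z"
  using sum_permutes[OF assms, of "\<lambda>j. z (Inl j)"] sum_permutes[OF assms, of "\<lambda>j. z (Inr j)"]
  by (simp add: xi_def vec_eval_bars)

lemma phi_perm_pt: "\<sigma> permutes N \<Longrightarrow> phi e i j (perm_pt \<sigma> z) = phi e (\<sigma> i) (\<sigma> j) z"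
  by (simp add: phi_def xi_perm_pt)

lemma reg_perm_pt: "\<sigma> permutes N \<Longrightarrow> z \<in> reg \<Longrightarrow> perm_pt \<sigma> z \<in> reg"
  unfolding reg_def by (simp add: xi_perm_pt permutes_in_image inj_eq[OF permutes_inj] del: atLeastAtMost_iff)

lemma swp_permutes: "i \<in> N \<Longrightarrow> j \<in> N \<Longrightarrow> swp i j permutes N"
  by (rule permutes_swap_id)

lemma perm_pt_comp: "perm_pt \<tau> (perm_pt \<sigma> z) = perm_pt (\<sigma> \<circ> \<tau>) z"
  by (simp add: fun_eq_iff map_sum.comp comp_assoc)

lemma theta_perm: "inj \<sigma> \<Longrightarrow> theta (perm_act \<sigma> v) (\<sigma> i) (\<sigma> j) = theta v i j"
  by (simp add: theta_def lookup_perm_act)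

lemma D_equivariant:
  assumes "\<sigma> permutes N"
  shows "vec_op (B e) (perm_act \<sigma> v) (\<lambda>z. F (perm_pt \<sigma> z)) z = vec_op (B e) v F (perm_pt \<sigma> z)"
proof -
  have "(\<Sum>i\<in>N. \<Sum>j\<in>N. 1/2 * theta v i j * phi e i j (perm_pt \<sigma> z) * F (perm_pt (swp i j) (perm_pt \<sigma> z)))
      = (\<Sum>i\<in>N. \<Sum>j\<in>N. 1/2 * theta (perm_act \<sigma> v) (\<sigma> i) (\<sigma> j) * phi e (\<sigma> i) (\<sigma> j) z * F (perm_pt \<sigma> (perm_pt (swp (\<sigma> i) (\<sigma> j)) z)))"
    by (simp only: perm_pt_comp conj_swp[OF assms] phi_perm_pt[OF assms] theta_perm[OF permutes_inj[OF assms]])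
  also have "\<dots> = (\<Sum>i\<in>N. \<Sum>j\<in>N. 1/2 * theta (perm_act \<sigma> v) i j * phi e i j z * F (perm_pt \<sigma> (perm_pt (swp i j) z)))"
    by (subst sum_permutes[OF assms], rule sum.cong[OF refl], rule sum_permutes[OF assms])
  finally show ?thesis by (simp only: D_eq vec_eval_perm_act)
qed

end

text \<open>The skew form on \<open>V\<close> that factors through the plane moved by the transposition of \<open>i\<close> and \<open>j\<close>.\<close>

definition xy_minor :: "nat \<Rightarrow> nat \<Rightarrow> xy_space \<Rightarrow> xy_space \<Rightarrow> complex"
  where "xy_minor i j u v = (X u i - X u j) * (Y v i - Y v j) - (Y u i - Y u j) * (X v i - X v j)"

text \<open>The left-hand side is symmetric in \<open>x\<close>, \<open>y\<close>, \<open>w\<close> with at most simple poles, so it has none, and its degree is zero; hence it is constant.  With \<open>x\<close>, \<open>y\<close>, \<open>w\<close>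
  the values of three \<open>\<xi>\<close>, it removes all denominators from the coefficient of a three-cycle.\<close>

lemma lagrange_identity:
  fixes x y w k d :: complex
  assumes "x \<noteq> y" "x \<noteq> w" "y \<noteq> w"
  shows "(k * (x + y) + d) / (x - y) * ((k * (x + w) + d) / (x - w))
    + (k * (y + w) + d) / (y - w) * ((k * (y + x) + d) / (y - x))
    + (k * (w + x) + d) / (w - x) * ((k * (w + y) + d) / (w - y)) = k\<^sup>2"
proof -
  have "x - y \<noteq> 0" "x - w \<noteq> 0" "y - w \<noteq> 0" using assms by auto
  moreover have "y - x = - (x - y)" "w - x = - (x - w)" "w - y = - (y - w)" by simp_all
  ultimately show ?thesis
    by (simp only: divide_minus_right times_divide_times_eq mult_minus_left mult_minus_right minus_minus)
       (simp add: divide_simps, simp add: algebra_simps power2_eq_square)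
qed

lemma vec_eval_swap:
  "vec_eval u (perm_pt (swp i j) z) = vec_eval u z -
     ((X u i - X u j) * (z (Inl i) - z (Inl j)) + (Y u i - Y u j) * (z (Inr i) - z (Inr j)))"
proof (induction u rule: poly_mapping_linear_induct)
  case (basis b)
  show ?case
  proof (cases b)
    case (Inl k)
    then show ?thesis by (cases "k = i"; cases "k = j") (simp_all add: lookup_single)
  next
    case (Inr k)
    then show ?thesis by (cases "k = i"; cases "k = j") (simp_all add: lookup_single)
  qed
next
  case (cscale c q)
  show ?case unfolding lin_form_cscale cscale lookup_cscale by (simp add: algebra_simps)
next
  case (add q r)
  show ?case unfolding lin_form_add add lookup_add by (simp add: algebra_simps)
qed simp

lemma cyc_rotate: "i \<noteq> j \<Longrightarrow> j \<noteq> k \<Longrightarrow> i \<noteq> k \<Longrightarrow> swp j k \<circ> swp k i = swp i j \<circ> swp j k"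
  by (auto simp: fun_eq_iff Transposition.transpose_def)

lemma swp_disjoint: "{i, j} \<inter> {k, l} = {} \<Longrightarrow> swp k l \<circ> swp i j = swp i j \<circ> swp k l"
  by (auto simp: fun_eq_iff Transposition.transpose_def)

context dunkl
begin

lemma xi_diff: "xi i z - xi j z = \<alpha> * (z (Inl i) - z (Inl j)) + \<beta> * (z (Inr i) - z (Inr j))"
  by (simp add: xi_def vec_eval_bars algebra_simps)

definition theta_minor :: "nat \<Rightarrow> nat \<Rightarrow> nat \<Rightarrow> xy_space \<Rightarrow> xy_space \<Rightarrow> complex"
  where "theta_minor i j k u v = theta u i j * theta v j k - theta v i j * theta u j k"

lemma theta_minor_rotate: "theta_minor j k i u v = theta_minor i j k u v"
  by (simp add: theta_minor_def theta_def algebra_simps)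

lemma theta_minor_degenerate: "theta_minor i i k u v = 0" "theta_minor i k k u v = 0" "theta_minor i k i u v = 0"
  by (simp_all add: theta_minor_def theta_def algebra_simps)

text \<open>Commuting a multiplication operator past the transposition of \<open>i\<close> and \<open>j\<close> produces exactly the denominator
  of \<open>phi\<close> as a factor.\<close>

lemma first_order:
  "theta v i j * (vec_eval u z - vec_eval u (perm_pt (swp i j) z)) - theta u i j * (vec_eval v z - vec_eval v (perm_pt (swp i j) z))
    = xy_minor i j u v * (xi i z - xi j z)"
  unfolding vec_eval_swap xi_diff by (simp add: theta_def xy_minor_def algebra_simps)

text \<open>The terms of a commutator with two transpositions.  Those with disjoint transpositions cancel in pairs, and equal
  transpositions contribute zero.  Each three-cycle is a product of two transpositions in three ways, and
  the three coefficients add up to a constant by \<open>lagrange_identity\<close>.\<close>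

lemma second_order:
  assumes z: "z \<in> reg"
  shows "(\<Sum>i\<in>N. \<Sum>j\<in>N. \<Sum>k\<in>N. \<Sum>l\<in>N. 1/4 * (theta u i j * theta v k l - theta v i j * theta u k l)
      * phi e i j z * phi e k l (perm_pt (swp i j) z) * F (perm_pt (swp i j \<circ> swp k l) z))
    = (\<Sum>i\<in>N. \<Sum>j\<in>N. \<Sum>k\<in>N. (of_nat n)\<^sup>2 / 12 * A\<^sup>2 * theta_minor i j k u v * F (perm_pt (swp i j \<circ> swp j k) z))"
proof -
  define p where "p i j = phi e i j z" for i j
  have p_anti: "p j i = - p i j" for i j unfolding p_def by (rule phi_antisym)
  define Q where "Q i j k l = 1/4 * (theta u i j * theta v k l - theta v i j * theta u k l)
      * p i j * phi e k l (perm_pt (swp i j) z) * F (perm_pt (swp i j \<circ> swp k l) z)" for i j k l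
  define T where "T i j m = 1/4 * theta_minor i j m u v * (p i j * p i m) * F (perm_pt (swp i j \<circ> swp j m) z)" for i j m
  \<comment> \<open>the terms with disjoint transpositions; \<open>T\<close> collects those with one common index\<close>
  define W where "W i j k l = (if {i, j} \<inter> {k, l} = {} then Q i j k l else 0)" for i j k l
  have ph: "phi e k l (perm_pt (swp i j) z) = p (swp i j k) (swp i j l)" if "i \<in> N" "j \<in> N" for i j k l
    using phi_perm_pt[OF swp_permutes[OF that]] by (simp add: p_def)
  have Q_sym: "Q i j k l = Q i j l k" for i j k l
    unfolding Q_def theta_antisym[of _ k l] phi_antisym[of e k l] transpose_commute[of k l] by (simp add: algebra_simps)
  have Q_sym': "Q i j k l = Q j i k l" for i j k l
    unfolding Q_def theta_antisym[of _ i j] p_anti[of i j] transpose_commute[of i j] by (simp add: algebra_simps)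
  have Q_diag: "Q i j k k = 0" "Q i i k l = 0" "Q i j i j = 0" for i j k l by (simp_all add: Q_def theta_diag)
  have T_deg: "T i i m = 0" "T i j i = 0" "T i j j = 0" for i j m by (simp_all add: T_def theta_minor_degenerate)
  have QT: "Q i j j m = T i j m" if "i \<in> N" "j \<in> N" "m \<in> N - {i, j}" for i j m
    using that ph[OF that(1,2), of j m] by (simp add: Q_def T_def theta_minor_def)
  have inner: "(\<Sum>k\<in>N. \<Sum>l\<in>N. Q i j k l) = 2 * (\<Sum>m\<in>N. T i j m + T j i m) + (\<Sum>k\<in>N. \<Sum>l\<in>N. W i j k l)"
    if ij: "i \<in> N" "j \<in> N" for i j
  proof (cases "i = j")
    case True
    have "W i i k l = 0" for i k l by (auto simp: W_def Q_diag)
    with True show ?thesis by (simp add: Q_diag T_deg)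
  next
    case False
    have "(\<Sum>k\<in>N. \<Sum>l\<in>N. Q i j k l) = 2 * Q i j i j + 2 * (\<Sum>m\<in>N - {i, j}. Q i j i m + Q i j j m)
        + (\<Sum>k\<in>N - {i, j}. \<Sum>l\<in>N - {i, j}. Q i j k l)"
      by (rule sum_pairs_split) (use ij False Q_sym Q_diag in auto)
    moreover have "(\<Sum>m\<in>N - {i, j}. Q i j i m + Q i j j m) = (\<Sum>m\<in>N - {i, j}. T i j m + T j i m)"
      using QT ij Q_sym'[of i j i] by (intro sum.cong refl) (auto simp: insert_commute)
    moreover have "\<dots> = (\<Sum>m\<in>N. T i j m + T j i m)"
      by (rule sum.mono_neutral_left) (auto simp: T_deg)
    moreover have "(\<Sum>k\<in>N - {i, j}. \<Sum>l\<in>N - {i, j}. Q i j k l) = (\<Sum>k\<in>N. \<Sum>l\<in>N. W i j k l)"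
    proof -
      have "(\<Sum>k\<in>N - {i, j}. \<Sum>l\<in>N - {i, j}. Q i j k l) = (\<Sum>k\<in>N - {i, j}. \<Sum>l\<in>N. W i j k l)"
        by (intro sum.cong refl sum.mono_neutral_cong_left) (auto simp: W_def)
      also have "\<dots> = (\<Sum>k\<in>N. \<Sum>l\<in>N. W i j k l)"
        by (intro sum.mono_neutral_left) (auto simp: W_def intro!: sum.neutral)
      finally show ?thesis .
    qed
    ultimately show ?thesis by (simp add: Q_diag)
  qed
  have "(\<Sum>i\<in>N. \<Sum>j\<in>N. \<Sum>k\<in>N. \<Sum>l\<in>N. Q i j k l)
      = 2 * (\<Sum>i\<in>N. \<Sum>j\<in>N. \<Sum>m\<in>N. T i j m) + 2 * (\<Sum>i\<in>N. \<Sum>j\<in>N. \<Sum>m\<in>N. T j i m)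
        + (\<Sum>i\<in>N. \<Sum>j\<in>N. \<Sum>k\<in>N. \<Sum>l\<in>N. W i j k l)"
    by (simp only: inner sum.distrib sum_distrib_left distrib_left cong: sum.cong)
  also have "(\<Sum>i\<in>N. \<Sum>j\<in>N. \<Sum>m\<in>N. T j i m) = (\<Sum>i\<in>N. \<Sum>j\<in>N. \<Sum>m\<in>N. T i j m)" by (rule sum.swap)
  also have "(\<Sum>i\<in>N. \<Sum>j\<in>N. \<Sum>k\<in>N. \<Sum>l\<in>N. W i j k l) = 0"
  proof -
    have W_anti: "W k l i j = - W i j k l" if "i \<in> N" "j \<in> N" "k \<in> N" "l \<in> N" for i j k l
    proof (cases "{i, j} \<inter> {k, l} = {}")
      case True
      then have "swp i j k = k" "swp i j l = l" "swp k l i = i" "swp k l j = j"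
        by (auto simp: Transposition.transpose_def)
      then show ?thesis using True ph[OF that(1,2), of k l] ph[OF that(3,4), of i j] swp_disjoint[OF True]
        by (auto simp: W_def Q_def algebra_simps)
    qed (auto simp: W_def)
    define W' where "W' i j k l = (if i \<in> N \<and> j \<in> N \<and> k \<in> N \<and> l \<in> N then W i j k l else 0)" for i j k l
    have "(\<Sum>i\<in>N. \<Sum>j\<in>N. \<Sum>k\<in>N. \<Sum>l\<in>N. W i j k l) = (\<Sum>i\<in>N. \<Sum>j\<in>N. \<Sum>k\<in>N. \<Sum>l\<in>N. W' i j k l)"
      by (intro sum.cong refl) (simp add: W'_def)
    also have "\<dots> = 0"
    proof (rule sum_quadruple_antisym)
      fix i j k l
      show "W' k l i j = - W' i j k l"
      proof (cases "i \<in> N \<and> j \<in> N \<and> k \<in> N \<and> l \<in> N")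
        case True
        then show ?thesis unfolding W'_def using W_anti[of i j k l] by simp
      next
        case False
        then show ?thesis unfolding W'_def by auto
      qed
    qed
    finally show ?thesis .
  qed
  finally have Q4: "(\<Sum>i\<in>N. \<Sum>j\<in>N. \<Sum>k\<in>N. \<Sum>l\<in>N. Q i j k l) = (\<Sum>i\<in>N. \<Sum>j\<in>N. \<Sum>m\<in>N. 4 * T i j m)"
    by (simp add: sum_distrib_left)
  let ?U = "\<lambda>i j m. 4 * T i j m"
  have rot: "(\<Sum>i\<in>N. \<Sum>j\<in>N. \<Sum>k\<in>N. ?U j k i) = (\<Sum>i\<in>N. \<Sum>j\<in>N. \<Sum>k\<in>N. ?U i j k)"
    "(\<Sum>i\<in>N. \<Sum>j\<in>N. \<Sum>k\<in>N. ?U k i j) = (\<Sum>i\<in>N. \<Sum>j\<in>N. \<Sum>k\<in>N. ?U i j k)"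
    using sum_triple_rotate[of ?U N] sum_triple_rotate[of "\<lambda>i j k. ?U j k i" N] by simp_all
  \<comment> \<open>averaging over the three rotations of \<open>(i, j, k)\<close>, which all give the same three-cycle\<close>
  have "3 * (\<Sum>i\<in>N. \<Sum>j\<in>N. \<Sum>k\<in>N. ?U i j k) = (\<Sum>i\<in>N. \<Sum>j\<in>N. \<Sum>k\<in>N. ?U i j k)
      + (\<Sum>i\<in>N. \<Sum>j\<in>N. \<Sum>k\<in>N. ?U j k i) + (\<Sum>i\<in>N. \<Sum>j\<in>N. \<Sum>k\<in>N. ?U k i j)"
    unfolding rot by simp
  also have "\<dots> = (\<Sum>i\<in>N. \<Sum>j\<in>N. \<Sum>k\<in>N. ?U i j k + ?U j k i + ?U k i j)"
    by (simp only: sum.distrib)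
  also have "\<dots> = (\<Sum>i\<in>N. \<Sum>j\<in>N. \<Sum>k\<in>N. 3 * ((of_nat n)\<^sup>2 / 12 * A\<^sup>2 * theta_minor i j k u v * F (perm_pt (swp i j \<circ> swp j k) z)))"
  proof (intro sum.cong refl)
    fix i j k assume ijk: "i \<in> N" "j \<in> N" "k \<in> N"
    show "?U i j k + ?U j k i + ?U k i j = 3 * ((of_nat n)\<^sup>2 / 12 * A\<^sup>2 * theta_minor i j k u v * F (perm_pt (swp i j \<circ> swp j k) z))"
    proof (cases "i = j \<or> j = k \<or> i = k")
      case True
      then show ?thesis by (auto simp: T_deg theta_minor_degenerate)
    next
      case False
      then have d: "i \<noteq> j" "j \<noteq> k" "i \<noteq> k" "k \<noteq> i" by auto
      have x: "xi i z \<noteq> xi j z" "xi i z \<noteq> xi k z" "xi j z \<noteq> xi k z" using z ijk d by (auto simp: reg_def)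
      have sq: "p i j * p i k + p j k * p j i + p k i * p k j = (- (of_nat n / 2) * A)\<^sup>2"
        unfolding p_def phi_def by (rule lagrange_identity[OF x])
      have "swp j k \<circ> swp k i = swp i j \<circ> swp j k" "swp k i \<circ> swp i j = swp i j \<circ> swp j k"
        using cyc_rotate[of i j k] cyc_rotate[of j k i] d by auto
      moreover have "theta_minor j k i u v = theta_minor i j k u v" "theta_minor k i j u v = theta_minor i j k u v"
        using theta_minor_rotate[of j k i u v] theta_minor_rotate[of k i j u v] by auto
      ultimately have "?U i j k + ?U j k i + ?U k i j = theta_minor i j k u v * (p i j * p i k + p j k * p j i + p k i * p k j)
          * F (perm_pt (swp i j \<circ> swp j k) z)"
        unfolding T_def by (simp add: distrib_left distrib_right)
      then have "?U i j k + ?U j k i + ?U k i j = theta_minor i j k u v * (- (of_nat n / 2) * A)\<^sup>2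
          * F (perm_pt (swp i j \<circ> swp j k) z)" by (simp only: sq)
      then show ?thesis by (simp add: power_mult_distrib power_divide)
    qed
  qed
  also have "\<dots> = 3 * (\<Sum>i\<in>N. \<Sum>j\<in>N. \<Sum>k\<in>N. (of_nat n)\<^sup>2 / 12 * A\<^sup>2 * theta_minor i j k u v * F (perm_pt (swp i j \<circ> swp j k) z))"
    by (simp only: sum_distrib_left)
  finally have "(\<Sum>i\<in>N. \<Sum>j\<in>N. \<Sum>k\<in>N. ?U i j k)
      = (\<Sum>i\<in>N. \<Sum>j\<in>N. \<Sum>k\<in>N. (of_nat n)\<^sup>2 / 12 * A\<^sup>2 * theta_minor i j k u v * F (perm_pt (swp i j \<circ> swp j k) z))"
    by (rule mult_left_cancel[of 3, THEN iffD1, rotated]) simp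
  with Q4 show ?thesis by (simp only: Q_def p_def)
qed

lemma commutator:
  assumes e: "e \<noteq> 0" and z: "z \<in> reg"
  shows "vec_op (B e) u (vec_op (B e) v F) z - vec_op (B e) v (vec_op (B e) u F) z =
    (\<Sum>i\<in>N. \<Sum>j\<in>N. 1/2 * xy_minor i j u v * (- (of_nat n / 2) * A * (xi i z + xi j z) / e + c) * F (perm_pt (swp i j) z))
    + (\<Sum>i\<in>N. \<Sum>j\<in>N. \<Sum>k\<in>N. (of_nat n)\<^sup>2 / 12 * A\<^sup>2 * theta_minor i j k u v * F (perm_pt (swp i j \<circ> swp j k) z))"
proof -
  let ?s = "\<lambda>i j. perm_pt (swp i j) z"
  have expand: "vec_op (B e) u (vec_op (B e) v F) z = vec_eval u z * (vec_eval v z * F z / e) / e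
      + (\<Sum>i\<in>N. \<Sum>j\<in>N. 1/2 * phi e i j z * F (?s i j) / e * (theta v i j * vec_eval u z + theta u i j * vec_eval v (?s i j)))
      + (\<Sum>i\<in>N. \<Sum>j\<in>N. \<Sum>k\<in>N. \<Sum>l\<in>N. 1/4 * (theta u i j * theta v k l)
          * phi e i j z * phi e k l (?s i j) * F (perm_pt (swp i j \<circ> swp k l) z))" for u v
  proof -
    have "vec_op (B e) u (vec_op (B e) v F) z = vec_eval u z * (vec_eval v z * F z / e +
        (\<Sum>i\<in>N. \<Sum>j\<in>N. 1/2 * theta v i j * phi e i j z * F (?s i j))) / e
      + (\<Sum>i\<in>N. \<Sum>j\<in>N. 1/2 * theta u i j * phi e i j z * (vec_eval v (?s i j) * F (?s i j) / e +
        (\<Sum>k\<in>N. \<Sum>l\<in>N. 1/2 * theta v k l * phi e k l (?s i j) * F (perm_pt (swp i j \<circ> swp k l) z))))"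
      by (simp only: D_eq perm_pt_comp)
    then show ?thesis
      by (simp add: distrib_left distrib_right add_divide_distrib sum.distrib sum_distrib_left sum_divide_distrib mult_ac)
  qed
  have "vec_op (B e) u (vec_op (B e) v F) z - vec_op (B e) v (vec_op (B e) u F) z =
      (\<Sum>i\<in>N. \<Sum>j\<in>N. 1/2 * phi e i j z * F (?s i j) / e * (theta v i j * (vec_eval u z - vec_eval u (?s i j))
          - theta u i j * (vec_eval v z - vec_eval v (?s i j))))
      + (\<Sum>i\<in>N. \<Sum>j\<in>N. \<Sum>k\<in>N. \<Sum>l\<in>N. 1/4 * (theta u i j * theta v k l - theta v i j * theta u k l)
          * phi e i j z * phi e k l (?s i j) * F (perm_pt (swp i j \<circ> swp k l) z))"
    unfolding expand[of u v] expand[of v u]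
    by (simp add: algebra_simps sum.distrib sum_subtractf)
  also have "(\<Sum>i\<in>N. \<Sum>j\<in>N. 1/2 * phi e i j z * F (?s i j) / e * (theta v i j * (vec_eval u z - vec_eval u (?s i j))
          - theta u i j * (vec_eval v z - vec_eval v (?s i j))))
      = (\<Sum>i\<in>N. \<Sum>j\<in>N. 1/2 * xy_minor i j u v * (- (of_nat n / 2) * A * (xi i z + xi j z) / e + c) * F (perm_pt (swp i j) z))"
  proof (intro sum.cong refl)
    fix i j assume ij: "i \<in> N" "j \<in> N"
    show "1/2 * phi e i j z * F (?s i j) / e * (theta v i j * (vec_eval u z - vec_eval u (?s i j))
          - theta u i j * (vec_eval v z - vec_eval v (?s i j)))
        = 1/2 * xy_minor i j u v * (- (of_nat n / 2) * A * (xi i z + xi j z) / e + c) * F (?s i j)"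
    proof (cases "i = j")
      case True
      then show ?thesis unfolding first_order by (simp add: xy_minor_def)
    next
      case False
      then have "xi i z - xi j z \<noteq> 0" using z ij by (auto simp: reg_def)
      then have "phi e i j z * (xi i z - xi j z) = - (of_nat n / 2) * A * (xi i z + xi j z) + e * c"
        by (simp add: phi_def)
      then have "phi e i j z * (xi i z - xi j z) / e = - (of_nat n / 2) * A * (xi i z + xi j z) / e + c"
        using e by (simp add: add_divide_distrib diff_divide_distrib)
      moreover have "1/2 * phi e i j z * F (?s i j) / e * (xy_minor i j u v * (xi i z - xi j z))
          = 1/2 * xy_minor i j u v * (phi e i j z * (xi i z - xi j z) / e) * F (?s i j)" by simp
      ultimately show ?thesis unfolding first_order by metis
    qed
  qed
  also note second_order[OF z]
  finally show ?thesis .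
qed

lemma B_limit:
  assumes F: "\<And>z. z \<in> reg \<Longrightarrow> ((\<lambda>e. Fe e z) \<longlongrightarrow> F z) (at 0)" and z: "z \<in> reg"
  shows "((\<lambda>e. e * B e b (Fe e) z) \<longlongrightarrow> z b * F z) (at 0)"
proof -
  have ph: "((\<lambda>e. phi e i j z) \<longlongrightarrow> phi 0 i j z) (at 0)" for i j
    unfolding phi_def divide_inverse by (intro tendsto_intros)
  have "((\<lambda>e. e * (\<Sum>i\<in>N. \<Sum>j\<in>N. 1/2 * theta (Poly_Mapping.single b 1) i j * phi e i j z * Fe e (perm_pt (swp i j) z)) + z b * Fe e z)
      \<longlongrightarrow> 0 * (\<Sum>i\<in>N. \<Sum>j\<in>N. 1/2 * theta (Poly_Mapping.single b 1) i j * phi 0 i j z * F (perm_pt (swp i j) z)) + z b * F z) (at 0)"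
    by (intro tendsto_add tendsto_mult tendsto_sum tendsto_ident_at tendsto_const ph F z reg_perm_pt swp_permutes)
  then have "((\<lambda>e. e * (\<Sum>i\<in>N. \<Sum>j\<in>N. 1/2 * theta (Poly_Mapping.single b 1) i j * phi e i j z * Fe e (perm_pt (swp i j) z)) + z b * Fe e z)
      \<longlongrightarrow> z b * F z) (at 0)" by simp
  moreover have "\<forall>\<^sub>F e in at 0. e * (\<Sum>i\<in>N. \<Sum>j\<in>N. 1/2 * theta (Poly_Mapping.single b 1) i j * phi e i j z * Fe e (perm_pt (swp i j) z)) + z b * Fe e z
      = e * B e b (Fe e) z"
    unfolding eventually_at_filter by (rule always_eventually) (auto simp: B_def distrib_left)
  ultimately show ?thesis by (rule Lim_transform_eventually)
qed

text \<open>Every point \<open>z\<close> is a limit of regular points \<open>z + t r\<close>: the direction \<open>r\<close> is chosen such that \<open>\<xi>\<^sub>i(r) - \<xi>\<^sub>j(r) = i - j\<close>.\<close>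

lemma reg_dense:
  assumes "\<And>z. z \<in> reg \<Longrightarrow> poly_eval q z = 0"
  shows "q = 0"
proof (rule poly_eval_eq_zero_imp)
  fix z :: "nat + nat \<Rightarrow> complex"
  obtain a b where ab: "\<alpha> * a + \<beta> * b = 1"
  proof (cases "\<alpha> = 0")
    case True
    then show ?thesis using that[of 0 "1 / \<beta>"] nontrivial by simp
  next
    case False
    then show ?thesis using that[of "1 / \<alpha>" 0] by simp
  qed
  define r :: "nat + nat \<Rightarrow> complex" where "r = case_sum (\<lambda>i. of_nat i * a) (\<lambda>i. of_nat i * b)"
  define y where "y t = (\<lambda>k. z k + t * r k)" for t
  have d: "xi i (y t) - xi j (y t) = (xi i z - xi j z) + t * (of_nat i - of_nat j)" for i j t
  proof -
    have "xi i (y t) - xi j (y t) = (xi i z - xi j z) + t * ((\<alpha> * a + \<beta> * b) * (of_nat i - of_nat j))"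
      unfolding xi_diff by (simp add: y_def r_def algebra_simps)
    then show ?thesis by (simp add: ab)
  qed
  have "\<forall>\<^sub>F t in at 0. xi i (y t) \<noteq> xi j (y t)" if "i \<noteq> j" for i j
  proof (cases "xi i z = xi j z")
    case True
    then have "xi i (y t) \<noteq> xi j (y t)" if "t \<noteq> 0" for t
      using d[of i t j] that \<open>i \<noteq> j\<close> by auto
    then show ?thesis by (simp add: eventually_at_filter)
  next
    case False
    have "((\<lambda>t. (xi i z - xi j z) + t * (of_nat i - of_nat j)) \<longlongrightarrow> (xi i z - xi j z) + 0 * (of_nat i - of_nat j)) (at 0)"
      by (intro tendsto_intros)
    then have "\<forall>\<^sub>F t in at 0. (xi i z - xi j z) + t * (of_nat i - of_nat j) \<noteq> 0"
      by (rule tendsto_imp_eventually_ne) (use False in simp)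
    then show ?thesis by (rule eventually_mono) (simp add: d[symmetric])
  qed
  then have "\<forall>\<^sub>F t in at 0. \<forall>i\<in>N. \<forall>j\<in>N. i \<noteq> j \<longrightarrow> xi i (y t) \<noteq> xi j (y t)"
    by (intro eventually_ball_finite ballI finite_atLeastAtMost) (auto intro: always_eventually simp: eventually_conj_iff)
  then have "\<forall>\<^sub>F t in at 0. poly_eval q (y t) = 0"
    by (rule eventually_mono) (rule assms, simp add: reg_def)
  then have "((\<lambda>t. poly_eval q (y t)) \<longlongrightarrow> 0) (at 0)" by (rule tendsto_eventually)
  moreover have "((\<lambda>t. poly_eval q (y t)) \<longlongrightarrow> poly_eval q (y 0)) (at 0)"
  proof -
    have m: "((\<lambda>t. prod_mset (image_mset (y t) m)) \<longlongrightarrow> prod_mset (image_mset (y 0) m)) (at 0)" for m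
    proof (induction m)
      case (add k m)
      have "((\<lambda>t. y t k) \<longlongrightarrow> y 0 k) (at 0)" unfolding y_def by (intro tendsto_intros)
      then show ?case using add by (auto intro: tendsto_mult)
    qed simp
    show ?thesis unfolding poly_eval_def lin_form_def by (intro tendsto_sum tendsto_mult tendsto_const m)
  qed
  ultimately have "poly_eval q (y 0) = 0" 
    using tendsto_unique[of "at 0" "\<lambda>t. poly_eval q (y t)" "poly_eval q (y 0)" 0] by simp
  then show "poly_eval q z = 0" by (simp add: y_def)
qed

text \<open>The values \<open>\<xi>\<^sub>i(z)\<close> at a regular point are distinct and are permuted by the action.\<close>

lemma perm_pt_inj:
  assumes "z \<in> reg" "\<sigma> permutes N" "\<tau> permutes N" "perm_pt \<sigma> z = perm_pt \<tau> z"
  shows "\<sigma> = \<tau>"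
proof
  fix i
  show "\<sigma> i = \<tau> i"
  proof (cases "i \<in> N")
    case True
    have "xi (\<sigma> i) z = xi (\<tau> i) z" using assms(4) xi_perm_pt[OF assms(2), of i z] xi_perm_pt[OF assms(3), of i z] by simp
    moreover have "\<sigma> i \<in> N" "\<tau> i \<in> N" 
      using permutes_in_image[OF assms(2), of i] permutes_in_image[OF assms(3), of i] True by simp_all
    ultimately show ?thesis using assms(1) unfolding reg_def by blast
  next
    case False
    then show ?thesis using assms(2,3) by (simp add: permutes_def)
  qed
qed

lemma B_linear: "B e b (\<lambda>z. a * F z + F' z) = (\<lambda>z. a * B e b F z + B e b F' z)"
  by (rule ext) (simp add: B_def distrib_left add_divide_distrib sum.distrib sum_distrib_left mult_ac)

lemma B_local:
  assumes "\<And>z. z \<in> reg \<Longrightarrow> F z = F' z" "z \<in> reg"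
  shows "B e b F z = B e b F' z"
  unfolding B_def using assms reg_perm_pt swp_permutes by (intro arg_cong2[where f="(+)"] sum.cong refl) auto

end


section \<open>The three-parameter family\<close>

definition pair_vec :: "nat \<Rightarrow> complex \<Rightarrow> complex \<Rightarrow> nat \<Rightarrow> nat \<Rightarrow> xy_space"
  where "pair_vec n a b i j = a *\<^sub>c (xbar n i + xbar n j) + b *\<^sub>c (ybar n i + ybar n j)"

text \<open>The combination of the two coordinates that is zero on the vectors \<open>a x\<^sub>k + b y\<^sub>k\<close>.\<close>

definition ab_coord :: "complex \<Rightarrow> complex \<Rightarrow> xy_space \<Rightarrow> nat \<Rightarrow> complex"
  where "ab_coord a b u i = b * X u i - a * Y u i"

definition ab_minor :: "complex \<Rightarrow> complex \<Rightarrow> nat \<Rightarrow> nat \<Rightarrow> nat \<Rightarrow> xy_space \<Rightarrow> xy_space \<Rightarrow> complex"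
  where "ab_minor a b i j k u v = (ab_coord a b u i - ab_coord a b u j) * (ab_coord a b v j - ab_coord a b v k)
     - (ab_coord a b v i - ab_coord a b v j) * (ab_coord a b u j - ab_coord a b u k)"

text \<open>Closed formulas for the family on all of \<open>V\<close>.  A transposition is counted twice in the sum over \<open>(i, j)\<close>, and a
  three-cycle three times in the sum over \<open>(i, j, k)\<close>; triples with equal indices contribute zero.\<close>

definition family_L :: "nat \<Rightarrow> complex \<Rightarrow> complex \<Rightarrow> (nat \<Rightarrow> nat) \<Rightarrow> xy_space \<Rightarrow> xy_space \<Rightarrow> xy_space"
  where "family_L n a b g u v =
    (\<Sum>i\<in>{1..n}. \<Sum>j\<in>{1..n}. (- (of_nat n / 4) * xy_minor i j u v) *\<^sub>c pair_vec n a b i j when g = swp i j)"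

definition family_C :: "nat \<Rightarrow> complex \<Rightarrow> complex \<Rightarrow> complex \<Rightarrow> (nat \<Rightarrow> nat) \<Rightarrow> xy_space \<Rightarrow> xy_space \<Rightarrow> complex"
  where "family_C n a b c g u v = (\<Sum>i\<in>{1..n}. \<Sum>j\<in>{1..n}. c / 2 * xy_minor i j u v when g = swp i j)
    + (\<Sum>i\<in>{1..n}. \<Sum>j\<in>{1..n}. \<Sum>k\<in>{1..n}. (of_nat n)\<^sup>2 / 12 * ab_minor a b i j k u v when g = swp i j \<circ> swp j k)"

lemma xy_minor_skew: "xy_minor i j u v = - xy_minor i j v u"
  and xy_minor_add: "xy_minor i j (u + u') v = xy_minor i j u v + xy_minor i j u' v"
  and xy_minor_cscale: "xy_minor i j (a *\<^sub>c u) v = a * xy_minor i j u v"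
  and xy_minor_sym: "xy_minor j i u v = xy_minor i j u v"
  and xy_minor_diag: "xy_minor i i u v = 0"
  by (simp_all add: xy_minor_def lookup_add algebra_simps)

lemma ab_minor_skew: "ab_minor a b i j k u v = - ab_minor a b i j k v u"
  and ab_minor_add: "ab_minor a b i j k (u + u') v = ab_minor a b i j k u v + ab_minor a b i j k u' v"
  and ab_minor_cscale: "ab_minor a b i j k (d *\<^sub>c u) v = d * ab_minor a b i j k u v"
  by (simp_all add: ab_minor_def ab_coord_def lookup_add algebra_simps)

lemma pair_vec_doubled_std: "i \<in> {1..n} \<Longrightarrow> j \<in> {1..n} \<Longrightarrow> pair_vec n a b i j \<in> doubled_std n"
  unfolding pair_vec_def by (intro cvs.subspace_add cvs.subspace_scale subspace_doubled_std bars_doubled_std)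

lemma when_linear:
  "(c *\<^sub>c w when Q) = c *\<^sub>c (w when Q)" "(- w' when Q) = - (w' when Q)" "((c * d) when Q) = c * (d when Q)"
  for w :: "'a \<Rightarrow>\<^sub>0 complex" and w' :: "'b::ab_group_add" and d :: complex
  by (simp_all add: when_def)

lemma linear_cochain_family_L: "linear_cochain (sym_group n) (doubled_std n) (family_L n a b)"
  unfolding linear_cochain_def skew_bilinear_on_def
proof (intro ballI conjI allI)
  fix g u v c u'
  show "family_L n a b g u v \<in> doubled_std n"
    unfolding family_L_def
    by (intro cvs.subspace_sum[OF subspace_doubled_std])
       (auto simp: when_def intro!: pair_vec_doubled_std cvs.subspace_neg cvs.subspace_scale cvs.subspace_0 subspace_doubled_std)
  have "((- (of_nat n / 4) * xy_minor i j u v) *\<^sub>c pair_vec n a b i j when g = swp i j) =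
      - ((- (of_nat n / 4) * xy_minor i j v u) *\<^sub>c pair_vec n a b i j when g = swp i j)" for i j
    using xy_minor_skew[of i j u v] by (simp add: when_def)
  then show "family_L n a b g u v = - family_L n a b g v u"
    unfolding family_L_def by (simp add: sum_negf)
  show "family_L n a b g (u + u') v = family_L n a b g u v + family_L n a b g u' v"
    by (simp add: family_L_def xy_minor_add distrib_left cvs.scale_left_distrib cvs.scale_left_diff_distrib sum.distrib[symmetric] when_add_distrib[symmetric])
  show "family_L n a b g (c *\<^sub>c u) v = c *\<^sub>c family_L n a b g u v"
    by (simp add: family_L_def xy_minor_cscale cvs.scale_sum_right when_linear(1)[symmetric] mult_ac)
qed

lemma constant_cochain_family_C: "constant_cochain (sym_group n) (doubled_std n) (family_C n a b c)"
  unfolding constant_cochain_def skew_bilinear_on_def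
proof (intro ballI conjI allI)
  fix g u v d u'
  show "family_C n a b c g u v \<in> UNIV" by simp
  have "(c / 2 * xy_minor i j u v when g = swp i j) = - (c / 2 * xy_minor i j v u when g = swp i j)"
    and "((of_nat n)\<^sup>2 / 12 * ab_minor a b i j k u v when g = swp i j \<circ> swp j k)
      = - ((of_nat n)\<^sup>2 / 12 * ab_minor a b i j k v u when g = swp i j \<circ> swp j k)" for i j k
    using xy_minor_skew[of i j u v] ab_minor_skew[of a b i j k u v] by (simp_all add: when_def)
  then show "family_C n a b c g u v = - family_C n a b c g v u"
    unfolding family_C_def by (simp add: sum_negf)
  show "family_C n a b c g (u + u') v = family_C n a b c g u v + family_C n a b c g u' v"
    by (simp add: family_C_def xy_minor_add ab_minor_add distrib_left sum.distrib when_add_distrib add_divide_distrib)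
  show "family_C n a b c g (d *\<^sub>c u) v = d * family_C n a b c g u v"
    by (simp add: family_C_def xy_minor_cscale ab_minor_cscale sum_distrib_left distrib_left when_linear(3)[symmetric] mult_ac)
qed

text \<open>The values at \<open>(x\<^sub>i, x\<^sub>i)\<close> and \<open>(y\<^sub>i, y\<^sub>i)\<close> are their own negatives and thus zero by \<open>char0\<close>; the other values are
  given or follow by skew symmetry.\<close>

lemma skew_bilinear_eqI:
  fixes C C' :: "xy_space \<Rightarrow> xy_space \<Rightarrow> 'w::ab_group_add"
  assumes C: "skew_bilinear_on (doubled_std n) sc U C" and C': "skew_bilinear_on (doubled_std n) sc U C'"
    and char0: "\<And>w :: 'w. w = - w \<Longrightarrow> w = 0"
    and gen: "\<And>i j. i \<in> {1..n} \<Longrightarrow> j \<in> {1..n} \<Longrightarrow> i \<noteq> j \<Longrightarrow> C (xbar n i) (xbar n j) = C' (xbar n i) (xbar n j)"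
      "\<And>i j. i \<in> {1..n} \<Longrightarrow> j \<in> {1..n} \<Longrightarrow> i \<noteq> j \<Longrightarrow> C (ybar n i) (ybar n j) = C' (ybar n i) (ybar n j)"
      "\<And>i j. i \<in> {1..n} \<Longrightarrow> j \<in> {1..n} \<Longrightarrow> C (xbar n i) (ybar n j) = C' (xbar n i) (ybar n j)"
    and uv: "u \<in> doubled_std n" "v \<in> doubled_std n"
  shows "C u v = C' u v"
proof -
  let ?V = "doubled_std n" and ?S = "xbar n ` {1..n} \<union> ybar n ` {1..n}"
  note V = cvs.subspace_add[OF subspace_doubled_std] cvs.subspace_scale[OF subspace_doubled_std]
    cvs.subspace_0[OF subspace_doubled_std]
  have skew: "C x y = - C y x" "C' x y = - C' y x" if "x \<in> ?V" "y \<in> ?V" for x y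
    using C C' that unfolding skew_bilinear_on_def by blast+
  have add: "C (x + x') y = C x y + C x' y" "C' (x + x') y = C' x y + C' x' y"
    if "x \<in> ?V" "x' \<in> ?V" "y \<in> ?V" for x x' y
    using C C' that unfolding skew_bilinear_on_def by blast+
  have scale: "C (c *\<^sub>c x) y = sc c (C x y)" "C' (c *\<^sub>c x) y = sc c (C' x y)" if "x \<in> ?V" "y \<in> ?V" for x y c
    using C C' that unfolding skew_bilinear_on_def by blast+
  have zero: "C 0 y = 0" "C' 0 y = 0" if "y \<in> ?V" for y
    using add[OF V(3) V(3) that] by auto
  have SV: "s \<in> ?V" if "s \<in> ?S" for s using that bars_doubled_std by auto
  have ext: "C x y = C' x y" if x: "x \<in> ?V" and y: "y \<in> ?V" and g: "\<And>s. s \<in> ?S \<Longrightarrow> C s y = C' s y" for x y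
  proof -
    have "x \<in> ?V \<and> C x y = C' x y"
      using x unfolding doubled_std_def
    proof (induction x rule: cvs.span_induct_alt)
      case base
      show ?case using zero[OF y] V(3) by (simp add: doubled_std_def)
    next
      case (step c s x)
      then have "s \<in> ?V" "x \<in> ?V" using SV by (auto simp: doubled_std_def)
      then show ?case using step V add[OF V(2) _ y, of s x c] scale[OF _ y, of s c] g[of s]
        by (simp add: doubled_std_def)
    qed
    then show ?thesis by simp
  qed
  have "C s t = C' s t" if "s \<in> ?S" "t \<in> ?S" for s t
  proof -
    have d: "C x x = C' x x" if "x \<in> ?V" for x
      using char0[of "C x x"] char0[of "C' x x"] skew[OF that that] by auto
    have "C (ybar n i) (xbar n j) = C' (ybar n i) (xbar n j)" if "i \<in> {1..n}" "j \<in> {1..n}" for i j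
      using gen(3)[OF that(2,1)] skew[of "ybar n i" "xbar n j"] that bars_doubled_std by simp
    then show ?thesis using that gen d bars_doubled_std by (auto simp del: atLeastAtMost_iff) (metis)+
  qed
  then have "C s v = C' s v" if s: "s \<in> ?S" for s
  proof -
    have "C v s = C' v s"
    proof (rule ext[OF uv(2) SV[OF s]])
      fix t assume "t \<in> ?S"
      with s show "C t s = C' t s" using \<open>\<And>t s. s \<in> ?S \<Longrightarrow> t \<in> ?S \<Longrightarrow> C s t = C' s t\<close> by blast
    qed
    then show ?thesis using skew[OF SV[OF s] uv(2)] by simp
  qed
  then show ?thesis by (rule ext[OF uv])
qed

lemma complex_eq_neg: "w = - w \<Longrightarrow> w = (0::complex)"
  by (simp add: eq_neg_iff_add_eq_0 mult_2[symmetric])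

lemma poly_eq_neg: "w = - w \<Longrightarrow> w = (0::'a \<Rightarrow>\<^sub>0 complex)"
proof (rule poly_mapping_eqI)
  fix k assume "w = - w"
  then have "Poly_Mapping.lookup w k = - Poly_Mapping.lookup w k" by (metis lookup_uminus)
  then show "Poly_Mapping.lookup w k = Poly_Mapping.lookup 0 k" using complex_eq_neg by simp
qed

lemma sum_when_eq: "finite S \<Longrightarrow> h \<in> S \<Longrightarrow> (\<Sum>g\<in>S. f g when g = h) = f h"
  for f :: "'a \<Rightarrow> 'w::comm_monoid_add"
  by (simp add: when_def sum.delta)

lemma finite_sym_group: "finite (carrier (sym_group n))"
  by (simp add: sym_group_def finite_permutations)

lemma swp_sym_group: "i \<in> {1..n} \<Longrightarrow> j \<in> {1..n} \<Longrightarrow> swp i j \<in> carrier (sym_group n)"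
  by (simp add: sym_group_carrier permutes_swap_id)

lemma swp_comp_sym_group: "i \<in> {1..n} \<Longrightarrow> j \<in> {1..n} \<Longrightarrow> k \<in> {1..n} \<Longrightarrow> swp i j \<circ> swp j k \<in> carrier (sym_group n)"
  by (simp add: sym_group_carrier permutes_swap_id permutes_compose)

lemma conj_eq_iff:
  assumes "h permutes {1..n}" "h \<circ> t = t' \<circ> h"
  shows "h \<circ> g \<circ> inv' h = t' \<longleftrightarrow> g = t"
proof
  assume "h \<circ> g \<circ> inv' h = t'"
  then have "h \<circ> g \<circ> (inv' h \<circ> h) = t' \<circ> h" by (simp add: o_assoc)
  then have "h \<circ> g = h \<circ> t" using assms permutes_inv_o(2)[OF assms(1)] by simp
  then show "g = t" using permutes_inj[OF assms(1)] by (metis fun.inj_map inj_eq)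
next
  assume "g = t"
  then have "h \<circ> g \<circ> inv' h = t' \<circ> (h \<circ> inv' h)" using assms(2) by (simp add: o_assoc)
  then show "h \<circ> g \<circ> inv' h = t'" using permutes_inv_o(1)[OF assms(1)] by simp
qed

lemma conj_swp2:
  assumes "h permutes {1..n}"
  shows "h \<circ> (swp i j \<circ> swp j k) = (swp (h i) (h j) \<circ> swp (h j) (h k)) \<circ> h"
  using conj_swp[OF assms, of i j] conj_swp[OF assms, of j k] by (metis comp_assoc)

lemma xy_minor_perm: "h permutes {1..n} \<Longrightarrow> xy_minor (h i) (h j) (perm_act h u) (perm_act h v) = xy_minor i j u v"
  by (simp add: xy_minor_def lookup_perm_act permutes_inj)

lemma ab_minor_perm: "h permutes {1..n} \<Longrightarrow> ab_minor a b (h i) (h j) (h k) (perm_act h u) (perm_act h v) = ab_minor a b i j k u v"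
  by (simp add: ab_minor_def ab_coord_def lookup_perm_act permutes_inj)

lemma pair_vec_perm: "h permutes {1..n} \<Longrightarrow> perm_act h (pair_vec n a b i j) = pair_vec n a b (h i) (h j)"
  by (simp add: pair_vec_def perm_act_add perm_act_cscale perm_act_bars)

lemma perm_act_when: "perm_act h (w when Q) = (perm_act h w when Q)"
  by (simp add: when_def)

lemma family_L_invariant:
  assumes h: "h permutes {1..n}"
  shows "perm_act h (family_L n a b g u v) = family_L n a b (h \<circ> g \<circ> inv' h) (perm_act h u) (perm_act h v)"
proof -
  let ?t = "\<lambda>i j. (- (of_nat n / 4) * xy_minor i j (perm_act h u) (perm_act h v)) *\<^sub>c pair_vec n a b i j when h \<circ> g \<circ> inv' h = swp i j"
  have "perm_act h (family_L n a b g u v) = (\<Sum>i\<in>{1..n}. \<Sum>j\<in>{1..n}. ?t (h i) (h j))"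
    unfolding family_L_def perm_act_sum perm_act_when perm_act_cscale pair_vec_perm[OF h] xy_minor_perm[OF h]
      conj_eq_iff[OF h conj_swp[OF h]] ..
  also have "\<dots> = (\<Sum>i\<in>{1..n}. \<Sum>j\<in>{1..n}. ?t (h i) j)"
    by (rule sum.cong[OF refl], rule sum_permutes[OF h])
  also have "\<dots> = (\<Sum>i\<in>{1..n}. \<Sum>j\<in>{1..n}. ?t i j)"
    by (rule sum_permutes[OF h, where f="\<lambda>i. \<Sum>j\<in>{1..n}. ?t i j"])
  finally show ?thesis by (simp only: family_L_def)
qed

lemma family_C_invariant:
  assumes h: "h permutes {1..n}"
  shows "family_C n a b c g u v = family_C n a b c (h \<circ> g \<circ> inv' h) (perm_act h u) (perm_act h v)"
proof -
  let ?t = "\<lambda>i j. c / 2 * xy_minor i j (perm_act h u) (perm_act h v) when h \<circ> g \<circ> inv' h = swp i j"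
  let ?s = "\<lambda>i j k. (of_nat n)\<^sup>2 / 12 * ab_minor a b i j k (perm_act h u) (perm_act h v) when h \<circ> g \<circ> inv' h = swp i j \<circ> swp j k"
  have "family_C n a b c g u v = (\<Sum>i\<in>{1..n}. \<Sum>j\<in>{1..n}. ?t (h i) (h j)) + (\<Sum>i\<in>{1..n}. \<Sum>j\<in>{1..n}. \<Sum>k\<in>{1..n}. ?s (h i) (h j) (h k))"
    unfolding family_C_def xy_minor_perm[OF h] ab_minor_perm[OF h] conj_eq_iff[OF h conj_swp[OF h]] conj_eq_iff[OF h conj_swp2[OF h]] ..
  also have "(\<Sum>i\<in>{1..n}. \<Sum>j\<in>{1..n}. ?t (h i) (h j)) = (\<Sum>i\<in>{1..n}. \<Sum>j\<in>{1..n}. ?t (h i) j)"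
    by (rule sum.cong[OF refl], rule sum_permutes[OF h])
  also have "\<dots> = (\<Sum>i\<in>{1..n}. \<Sum>j\<in>{1..n}. ?t i j)"
    by (rule sum_permutes[OF h, where f="\<lambda>i. \<Sum>j\<in>{1..n}. ?t i j"])
  also have "(\<Sum>i\<in>{1..n}. \<Sum>j\<in>{1..n}. \<Sum>k\<in>{1..n}. ?s (h i) (h j) (h k)) = (\<Sum>i\<in>{1..n}. \<Sum>j\<in>{1..n}. \<Sum>k\<in>{1..n}. ?s (h i) (h j) k)"
    by (rule sum.cong[OF refl], rule sum.cong[OF refl], rule sum_permutes[OF h])
  also have "\<dots> = (\<Sum>i\<in>{1..n}. \<Sum>j\<in>{1..n}. \<Sum>k\<in>{1..n}. ?s (h i) j k)"
    by (rule sum.cong[OF refl], rule sum_permutes[OF h, where f="\<lambda>j. \<Sum>k\<in>{1..n}. ?s i j k" for i])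
  also have "\<dots> = (\<Sum>i\<in>{1..n}. \<Sum>j\<in>{1..n}. \<Sum>k\<in>{1..n}. ?s i j k)"
    by (rule sum_permutes[OF h, where f="\<lambda>i. \<Sum>j\<in>{1..n}. \<Sum>k\<in>{1..n}. ?s i j k"])
  finally show ?thesis by (simp only: family_C_def)
qed

lemma family_L_fixed:
  assumes "g permutes {1..n}"
  shows "perm_act g (family_L n a b g u v) = family_L n a b g u v"
  unfolding family_L_def perm_act_sum perm_act_when perm_act_cscale pair_vec_perm[OF assms]
  by (intro sum.cong refl) (auto simp: when_def pair_vec_def add.commute)

lemma family_L_id: "family_L n a b id u v = 0"
proof -
  have "((- (of_nat n / 4) * xy_minor i j u v) *\<^sub>c pair_vec n a b i j when id = swp i j) = 0" for i j
    using transpose_eq_id_iff[of i j] by (auto simp: when_def xy_minor_diag)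
  then show ?thesis by (simp add: family_L_def)
qed


section \<open>Values of the family on the spanning vectors\<close>

lemma sum_delta_left: "finite S \<Longrightarrow> i \<in> S \<Longrightarrow> (\<Sum>p\<in>S. (1 when p = i) * f p) = f i" for f :: "'a \<Rightarrow> complex"
proof -
  assume "finite S" "i \<in> S"
  have "(\<Sum>p\<in>S. (1 when p = i) * f p) = (\<Sum>p\<in>S. f p when p = i)"
    by (rule sum.cong) (auto simp: when_def)
  then show ?thesis using \<open>finite S\<close> \<open>i \<in> S\<close> by (simp add: sum_when_eq)
qed

lemma sum_pair_deltas:
  fixes t :: "nat \<Rightarrow> nat \<Rightarrow> complex"
  assumes N: "finite N" "i \<in> N" "j \<in> N" and sym: "\<And>p q. t p q = t q p"
  shows "(\<Sum>p\<in>N. \<Sum>q\<in>N. ((1 when p = i) - (1 when q = i)) * ((1 when p = j) - (1 when q = j)) * t p q)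
    = (if i = j then 2 * (\<Sum>q\<in>N - {i}. t i q) else - 2 * t i j)"
proof -
  have "(\<Sum>p\<in>N. \<Sum>q\<in>N. ((1 when p = i) - (1 when q = i)) * ((1 when p = j) - (1 when q = j)) * t p q)
      = (\<Sum>p\<in>N. (1 when p = i) * ((1 when p = j) * (\<Sum>q\<in>N. t p q)))
        - (\<Sum>p\<in>N. (1 when p = i) * (\<Sum>q\<in>N. (1 when q = j) * t p q))
        - (\<Sum>p\<in>N. (1 when p = j) * (\<Sum>q\<in>N. (1 when q = i) * t p q))
        + (\<Sum>p\<in>N. \<Sum>q\<in>N. (1 when q = i) * ((1 when q = j) * t p q))"
    unfolding sum_distrib_left sum_subtractf[symmetric] sum.distrib[symmetric]
    by (intro sum.cong refl) (simp add: algebra_simps)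
  also have "\<dots> = (1 when i = j) * (\<Sum>q\<in>N. t i q) - t i j - t j i + (1 when i = j) * (\<Sum>p\<in>N. t p i)"
    using N by (simp add: sum_delta_left sum_distrib_left[symmetric])
  also have "(\<Sum>p\<in>N. t p i) = (\<Sum>q\<in>N. t i q)" by (rule sum.cong[OF refl]) (rule sym)
  also have "t j i = t i j" by (rule sym)
  finally show ?thesis using N by (simp add: sum.remove[of N i] when_def)
qed

lemma bar_differences:
  assumes "p \<in> {1..n}" "q \<in> {1..n}"
  shows "X (xbar n i) p - X (xbar n i) q = (1 when p = i) - (1 when q = i)"
    "Y (ybar n i) p - Y (ybar n i) q = (1 when p = i) - (1 when q = i)"
  using assms by (simp_all add: lookup_bars)

lemma xy_minor_bars:
  "xy_minor p q (xbar n i) (xbar n j) = 0" "xy_minor p q (ybar n i) (ybar n j) = 0"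
  "p \<in> {1..n} \<Longrightarrow> q \<in> {1..n} \<Longrightarrow> xy_minor p q (xbar n i) (ybar n j) =
     ((1 when p = i) - (1 when q = i)) * ((1 when p = j) - (1 when q = j))"
  by (simp_all add: xy_minor_def bar_differences) (simp_all add: lookup_bars)

lemma family_L_bars:
  assumes i: "i \<in> {1..n}" and j: "j \<in> {1..n}"
  shows "family_L n a b g (xbar n i) (xbar n j) = 0" "family_L n a b g (ybar n i) (ybar n j) = 0"
    "family_L n a b g (xbar n i) (ybar n i) = (- (of_nat n / 2)) *\<^sub>c (\<Sum>k\<in>{1..n} - {i}. pair_vec n a b i k when g = swp i k)"
    "i \<noteq> j \<Longrightarrow> family_L n a b g (xbar n i) (ybar n j) = (of_nat n / 2) *\<^sub>c (pair_vec n a b i j when g = swp i j)"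
proof -
  show "family_L n a b g (xbar n i) (xbar n j) = 0" "family_L n a b g (ybar n i) (ybar n j) = 0"
    by (simp_all add: family_L_def xy_minor_bars)
  have l: "Poly_Mapping.lookup (family_L n a b g (xbar n i) (ybar n k)) s =
      (if i = k then 2 * (\<Sum>q\<in>{1..n} - {i}. - (of_nat n / 4) * Poly_Mapping.lookup (pair_vec n a b i q when g = swp i q) s)
       else - 2 * (- (of_nat n / 4) * Poly_Mapping.lookup (pair_vec n a b i k when g = swp i k) s))"
    if k: "k \<in> {1..n}" for k s
  proof -
    let ?t = "\<lambda>p q. - (of_nat n / 4) * Poly_Mapping.lookup (pair_vec n a b p q when g = swp p q) s"
    have "Poly_Mapping.lookup (family_L n a b g (xbar n i) (ybar n k)) s = (\<Sum>p\<in>{1..n}. \<Sum>q\<in>{1..n}.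
        ((1 when p = i) - (1 when q = i)) * ((1 when p = k) - (1 when q = k)) * ?t p q)"
      unfolding family_L_def lookup_sum
      by (intro sum.cong refl) (simp only: xy_minor_bars(3), auto simp: when_def)
    also have "\<dots> = (if i = k then 2 * (\<Sum>q\<in>{1..n} - {i}. ?t i q) else - 2 * ?t i k)"
      by (rule sum_pair_deltas) (use i k in \<open>auto simp: pair_vec_def transpose_commute add.commute\<close>)
    finally show ?thesis .
  qed
  show "family_L n a b g (xbar n i) (ybar n i) = (- (of_nat n / 2)) *\<^sub>c (\<Sum>k\<in>{1..n} - {i}. pair_vec n a b i k when g = swp i k)"
    by (rule poly_mapping_eqI) (simp only: l[OF i] lookup_cscale lookup_sum sum_distrib_left, simp add: sum_distrib_left)
  show "family_L n a b g (xbar n i) (ybar n j) = (of_nat n / 2) *\<^sub>c (pair_vec n a b i j when g = swp i j)" if "i \<noteq> j"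
    by (rule poly_mapping_eqI) (use that in \<open>simp add: l[OF j]\<close>)
qed

text \<open>Each \<open>k\<close> contributes six terms with \<open>{p, q, r} = {i, j, k}\<close>; the three rotations of \<open>(i, j, k)\<close> all give the cycle
  \<open>(i j k)\<close>, and the other three give its inverse with the opposite sign.\<close>

lemma triple_deltas:
  assumes i: "i \<in> {1..n}" and j: "j \<in> {1..n}" and ij: "i \<noteq> j"
  shows "(\<Sum>p\<in>{1..n}. \<Sum>q\<in>{1..n}. \<Sum>r\<in>{1..n}.
      (((1 when p = i) - (1 when q = i)) * ((1 when q = j) - (1 when r = j))
       - ((1 when p = j) - (1 when q = j)) * ((1 when q = i) - (1 when r = i))) * (1 when g = swp p q \<circ> swp q r))
    = 3 * three_cycle_diff n i j g"
proof -
  let ?N = "{1..n}"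
  define s :: "nat \<Rightarrow> nat \<Rightarrow> nat \<Rightarrow> complex" where "s p q r = (1 when g = swp p q \<circ> swp q r)" for p q r
  have fin: "finite ?N" by simp
  note theta_minor = sum_delta_left[OF fin i] sum_delta_left[OF fin j]
  have "(\<Sum>p\<in>?N. \<Sum>q\<in>?N. \<Sum>r\<in>?N.
      (((1 when p = i) - (1 when q = i)) * ((1 when q = j) - (1 when r = j))
       - ((1 when p = j) - (1 when q = j)) * ((1 when q = i) - (1 when r = i))) * s p q r)
    = (\<Sum>p\<in>?N. (1 when p = i) * (\<Sum>q\<in>?N. (1 when q = j) * (\<Sum>r\<in>?N. s p q r)))
      - (\<Sum>p\<in>?N. (1 when p = j) * (\<Sum>q\<in>?N. (1 when q = i) * (\<Sum>r\<in>?N. s p q r)))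
      + (\<Sum>p\<in>?N. \<Sum>q\<in>?N. (1 when q = i) * (\<Sum>r\<in>?N. (1 when r = j) * s p q r))
      - (\<Sum>p\<in>?N. \<Sum>q\<in>?N. (1 when q = j) * (\<Sum>r\<in>?N. (1 when r = i) * s p q r))
      + (\<Sum>p\<in>?N. (1 when p = j) * (\<Sum>q\<in>?N. \<Sum>r\<in>?N. (1 when r = i) * s p q r))
      - (\<Sum>p\<in>?N. (1 when p = i) * (\<Sum>q\<in>?N. \<Sum>r\<in>?N. (1 when r = j) * s p q r))"
    unfolding sum_distrib_left sum_subtractf[symmetric] sum.distrib[symmetric]
    by (intro sum.cong refl) (simp add: algebra_simps)
  also have "\<dots> = (\<Sum>k\<in>?N. s i j k - s j i k + s k i j - s k j i + s j k i - s i k j)"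
    unfolding theta_minor by (simp add: sum.distrib sum_subtractf)
  also have "\<dots> = (\<Sum>k\<in>?N - {i, j}. s i j k - s j i k + s k i j - s k j i + s j k i - s i k j)"
    by (rule sum.mono_neutral_right) auto
  also have "\<dots> = (\<Sum>k\<in>?N - {i, j}. 3 * ((1 when g = cycle_of_list [i, j, k]) - (1 when g = cycle_of_list [k, j, i])))"
  proof (rule sum.cong[OF refl])
    fix k assume "k \<in> ?N - {i, j}"
    then have k: "k \<noteq> i" "k \<noteq> j" "i \<noteq> k" "j \<noteq> k" by auto
    have "swp j k \<circ> swp k i = swp i j \<circ> swp j k" "swp k i \<circ> swp i j = swp i j \<circ> swp j k"
      "swp j i \<circ> swp i k = swp k j \<circ> swp j i" "swp i k \<circ> swp k j = swp k j \<circ> swp j i"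
      using cyc_rotate[of i j k] cyc_rotate[of j k i] cyc_rotate[of k j i] cyc_rotate[of j i k] ij k by auto
    then have "s j k i = s i j k" "s k i j = s i j k" "s j i k = s k j i" "s i k j = s k j i"
      by (simp_all add: s_def)
    moreover have "s i j k = (1 when g = cycle_of_list [i, j, k])" "s k j i = (1 when g = cycle_of_list [k, j, i])"
      by (simp_all add: s_def)
    ultimately show "s i j k - s j i k + s k i j - s k j i + s j k i - s i k j
        = 3 * ((1 when g = cycle_of_list [i, j, k]) - (1 when g = cycle_of_list [k, j, i]))" by simp
  qed
  also have "\<dots> = 3 * three_cycle_diff n i j g"
    by (simp add: three_cycle_diff_def sum_distrib_left)
  finally show ?thesis by (simp add: s_def)
qed

lemma ab_minor_bars:
  assumes "p \<in> {1..n}" "q \<in> {1..n}" "r \<in> {1..n}"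
  defines "dt i j \<equiv> ((1 when p = i) - (1 when q = i)) * ((1 when q = j) - (1 when r = j))
       - ((1 when p = j) - (1 when q = j)) * ((1 when q = i) - (1 when r = i)) :: complex"
  shows "ab_minor a b p q r (xbar n i) (xbar n j) = b\<^sup>2 * dt i j" "ab_minor a b p q r (ybar n i) (ybar n j) = a\<^sup>2 * dt i j"
    "ab_minor a b p q r (xbar n i) (ybar n j) = - a * b * dt i j"
  using assms(1-3) unfolding dt_def
  by (simp_all add: ab_minor_def ab_coord_def lookup_bars algebra_simps power2_eq_square)

lemma family_C_bars:
  assumes i: "i \<in> {1..n}" and j: "j \<in> {1..n}" and ij: "i \<noteq> j"
  shows "family_C n a b c g (xbar n i) (xbar n j) = (of_nat n)\<^sup>2 / 4 * b\<^sup>2 * three_cycle_diff n i j g"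
    "family_C n a b c g (ybar n i) (ybar n j) = (of_nat n)\<^sup>2 / 4 * a\<^sup>2 * three_cycle_diff n i j g"
    "family_C n a b c g (xbar n i) (ybar n i) = c * (\<Sum>k\<in>{1..n} - {i}. 1 when g = swp i k)"
    "family_C n a b c g (xbar n i) (ybar n j) = - c * (1 when g = swp i j) - (of_nat n)\<^sup>2 / 4 * a * b * three_cycle_diff n i j g"
proof -
  let ?N = "{1..n}"
  let ?dt = "\<lambda>i j p q r. ((1 when p = i) - (1 when q = i)) * ((1 when q = j) - (1 when r = j))
       - ((1 when p = j) - (1 when q = j)) * ((1 when q = i) - (1 when r = i)) :: complex"
  have lin: "(\<Sum>p\<in>?N. \<Sum>q\<in>?N. \<Sum>r\<in>?N. (of_nat n)\<^sup>2 / 12 * (d * ?dt i j p q r) when g = swp p q \<circ> swp q r)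
      = (of_nat n)\<^sup>2 / 4 * d * three_cycle_diff n i j g" for d
  proof -
    have "(\<Sum>p\<in>?N. \<Sum>q\<in>?N. \<Sum>r\<in>?N. (of_nat n)\<^sup>2 / 12 * (d * ?dt i j p q r) when g = swp p q \<circ> swp q r)
      = (of_nat n)\<^sup>2 / 12 * d * (\<Sum>p\<in>?N. \<Sum>q\<in>?N. \<Sum>r\<in>?N. ?dt i j p q r * (1 when g = swp p q \<circ> swp q r))"
      unfolding sum_distrib_left by (intro sum.cong refl) (auto simp: when_def)
    then show ?thesis by (simp only: triple_deltas[OF i j ij]) simp
  qed
  have tri: "(\<Sum>p\<in>?N. \<Sum>q\<in>?N. \<Sum>r\<in>?N. (of_nat n)\<^sup>2 / 12 * ab_minor a b p q r u v when g = swp p q \<circ> swp q r)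
      = (\<Sum>p\<in>?N. \<Sum>q\<in>?N. \<Sum>r\<in>?N. (of_nat n)\<^sup>2 / 12 * (d * ?dt i k p q r) when g = swp p q \<circ> swp q r)"
    if "\<And>p q r. p \<in> ?N \<Longrightarrow> q \<in> ?N \<Longrightarrow> r \<in> ?N \<Longrightarrow> ab_minor a b p q r u v = d * ?dt i k p q r" for u v d k
    by (intro sum.cong refl) (simp only: that)
  have pairs: "(\<Sum>p\<in>?N. \<Sum>q\<in>?N. c / 2 * xy_minor p q (xbar n i) (ybar n k) when g = swp p q) =
      (if i = k then 2 * (\<Sum>q\<in>?N - {i}. c / 2 * (1 when g = swp i q)) else - 2 * (c / 2 * (1 when g = swp i k)))"
    if k: "k \<in> ?N" for k
  proof -
    have "(\<Sum>p\<in>?N. \<Sum>q\<in>?N. c / 2 * xy_minor p q (xbar n i) (ybar n k) when g = swp p q) =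
      (\<Sum>p\<in>?N. \<Sum>q\<in>?N. ((1 when p = i) - (1 when q = i)) * ((1 when p = k) - (1 when q = k)) * (c / 2 * (1 when g = swp p q)))"
      by (intro sum.cong refl) (simp only: xy_minor_bars(3), auto simp: when_def)
    also have "\<dots> = (if i = k then 2 * (\<Sum>q\<in>?N - {i}. c / 2 * (1 when g = swp i q)) else - 2 * (c / 2 * (1 when g = swp i k)))"
      by (rule sum_pair_deltas) (use i k in \<open>auto simp: transpose_commute\<close>)
    finally show ?thesis .
  qed
  have "(\<Sum>p\<in>?N. \<Sum>q\<in>?N. \<Sum>r\<in>?N. (of_nat n)\<^sup>2 / 12 * ab_minor a b p q r (xbar n i) (xbar n j) when g = swp p q \<circ> swp q r)
      = (of_nat n)\<^sup>2 / 4 * b\<^sup>2 * three_cycle_diff n i j g"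
    unfolding lin[symmetric] by (rule tri) (rule ab_minor_bars(1))
  then show "family_C n a b c g (xbar n i) (xbar n j) = (of_nat n)\<^sup>2 / 4 * b\<^sup>2 * three_cycle_diff n i j g"
    by (simp only: family_C_def) (simp add: xy_minor_bars)
  have "(\<Sum>p\<in>?N. \<Sum>q\<in>?N. \<Sum>r\<in>?N. (of_nat n)\<^sup>2 / 12 * ab_minor a b p q r (ybar n i) (ybar n j) when g = swp p q \<circ> swp q r)
      = (of_nat n)\<^sup>2 / 4 * a\<^sup>2 * three_cycle_diff n i j g"
    unfolding lin[symmetric] by (rule tri) (rule ab_minor_bars(2))
  then show "family_C n a b c g (ybar n i) (ybar n j) = (of_nat n)\<^sup>2 / 4 * a\<^sup>2 * three_cycle_diff n i j g"
    by (simp only: family_C_def) (simp add: xy_minor_bars)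
  have "(\<Sum>p\<in>?N. \<Sum>q\<in>?N. \<Sum>r\<in>?N. (of_nat n)\<^sup>2 / 12 * ab_minor a b p q r (xbar n i) (ybar n i) when g = swp p q \<circ> swp q r)
      = (\<Sum>p\<in>?N. \<Sum>q\<in>?N. \<Sum>r\<in>?N. (of_nat n)\<^sup>2 / 12 * (- a * b * ?dt i i p q r) when g = swp p q \<circ> swp q r)"
    by (rule tri) (rule ab_minor_bars(3))
  then show "family_C n a b c g (xbar n i) (ybar n i) = c * (\<Sum>k\<in>?N - {i}. 1 when g = swp i k)"
    by (simp only: family_C_def pairs[OF i]) (simp add: sum_distrib_left)
  have "(\<Sum>p\<in>?N. \<Sum>q\<in>?N. \<Sum>r\<in>?N. (of_nat n)\<^sup>2 / 12 * ab_minor a b p q r (xbar n i) (ybar n j) when g = swp p q \<circ> swp q r)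
      = (of_nat n)\<^sup>2 / 4 * (- a * b) * three_cycle_diff n i j g"
    unfolding lin[symmetric] by (rule tri) (rule ab_minor_bars(3))
  then show "family_C n a b c g (xbar n i) (ybar n j) = - c * (1 when g = swp i j) - (of_nat n)\<^sup>2 / 4 * a * b * three_cycle_diff n i j g"
    by (simp only: family_C_def pairs[OF j]) (use ij in simp)
qed

lemma family_in_family: "in_family n a b c (family_L n a b) (family_C n a b c)"
  unfolding in_family_def
  by (intro conjI ballI impI linear_cochain_family_L constant_cochain_family_C)
     (simp_all add: family_L_bars family_C_bars pair_vec_def del: atLeastAtMost_iff)

text \<open>The defining equations of the family mention pairs of distinct indices only, so the value at
  \<open>(x\<^sub>i, y\<^sub>i)\<close> is known as soon as there is a second index.\<close>

lemma in_family_unique: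
  assumes f: "in_family n a b c \<kappa>L \<kappa>C" and n: "n \<ge> 2" and g: "g \<in> carrier (sym_group n)"
    and uv: "u \<in> doubled_std n" "v \<in> doubled_std n"
  shows "\<kappa>L g u v = family_L n a b g u v" "\<kappa>C g u v = family_C n a b c g u v"
proof -
  note f' = family_in_family[of n a b c]
  have other: "\<exists>j\<in>{1..n}. i \<noteq> j" if "i \<in> {1..n}" for i
    using n by (cases "i = 1") (auto intro: bexI[of _ 1] bexI[of _ 2])
  have gen: "\<kappa>L g (xbar n i) (xbar n j) = family_L n a b g (xbar n i) (xbar n j)"
    "\<kappa>L g (ybar n i) (ybar n j) = family_L n a b g (ybar n i) (ybar n j)"
    "\<kappa>L g (xbar n i) (ybar n i) = family_L n a b g (xbar n i) (ybar n i)"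
    "\<kappa>L g (xbar n i) (ybar n j) = family_L n a b g (xbar n i) (ybar n j)"
    "\<kappa>C g (xbar n i) (xbar n j) = family_C n a b c g (xbar n i) (xbar n j)"
    "\<kappa>C g (ybar n i) (ybar n j) = family_C n a b c g (ybar n i) (ybar n j)"
    "\<kappa>C g (xbar n i) (ybar n i) = family_C n a b c g (xbar n i) (ybar n i)"
    "\<kappa>C g (xbar n i) (ybar n j) = family_C n a b c g (xbar n i) (ybar n j)"
    if "i \<in> {1..n}" "j \<in> {1..n}" "i \<noteq> j" for i j
    using bspec[OF bspec[OF bspec[OF conjunct2[OF conjunct2[OF f[unfolded in_family_def]]] g] that(1)] that(2), THEN mp, OF that(3)]
      bspec[OF bspec[OF bspec[OF conjunct2[OF conjunct2[OF f'[unfolded in_family_def]]] g] that(1)] that(2), THEN mp, OF that(3)]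
    by (simp_all only:)
  have gen': "\<kappa>L g (xbar n i) (ybar n j) = family_L n a b g (xbar n i) (ybar n j)"
    "\<kappa>C g (xbar n i) (ybar n j) = family_C n a b c g (xbar n i) (ybar n j)"
    if ij: "i \<in> {1..n}" "j \<in> {1..n}" for i j
  proof -
    obtain k where "k \<in> {1..n}" "i \<noteq> k" using other[OF ij(1)] by blast
    then show "\<kappa>L g (xbar n i) (ybar n j) = family_L n a b g (xbar n i) (ybar n j)"
      "\<kappa>C g (xbar n i) (ybar n j) = family_C n a b c g (xbar n i) (ybar n j)"
      using gen(3,7)[OF ij(1), of k] gen(4,8)[OF ij] by (cases "i = j"; simp)+
  qed
  have "skew_bilinear_on (doubled_std n) cscale (doubled_std n) (\<kappa>L g)"
    "skew_bilinear_on (doubled_std n) cscale (doubled_std n) (family_L n a b g)"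
    using f f' g by (auto simp: in_family_def linear_cochain_def)
  then show "\<kappa>L g u v = family_L n a b g u v"
    by (rule skew_bilinear_eqI[OF _ _ poly_eq_neg _ _ _ uv]) (blast intro: gen gen')+
  have "skew_bilinear_on (doubled_std n) (*) UNIV (\<kappa>C g)"
    "skew_bilinear_on (doubled_std n) (*) UNIV (family_C n a b c g)"
    using f f' g by (auto simp: in_family_def constant_cochain_def)
  then show "\<kappa>C g u v = family_C n a b c g u v"
    by (rule skew_bilinear_eqI[OF _ _ complex_eq_neg _ _ _ uv]) (blast intro: gen gen')+
qed

lemma in_familyI:
  assumes "n \<ge> 2" "linear_cochain (sym_group n) (doubled_std n) \<kappa>L" "constant_cochain (sym_group n) (doubled_std n) \<kappa>C"
    and L: "\<And>g u v. g \<in> carrier (sym_group n) \<Longrightarrow> u \<in> doubled_std n \<Longrightarrow> v \<in> doubled_std n \<Longrightarrow> \<kappa>L g u v = family_L n a b g u v"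
    and C: "\<And>g u v. g \<in> carrier (sym_group n) \<Longrightarrow> u \<in> doubled_std n \<Longrightarrow> v \<in> doubled_std n \<Longrightarrow> \<kappa>C g u v = family_C n a b c g u v"
  shows "in_family n a b c \<kappa>L \<kappa>C"
  using family_in_family[of n a b c] assms(2,3) bars_doubled_std
  unfolding in_family_def by (simp add: L C del: atLeastAtMost_iff)


section \<open>The operator representation of the family\<close>

context dunkl
begin

lemma theta_pair_vec: "k \<in> N \<Longrightarrow> l \<in> N \<Longrightarrow> theta (pair_vec n (A * \<alpha>) (A * \<beta>) i j) k l = 0"
  by (simp add: theta_def pair_vec_def lookup_add lookup_bars algebra_simps)

lemma D_pair_vec: "vec_op (B e) (pair_vec n (A * \<alpha>) (A * \<beta>) i j) F z = A * (xi i z + xi j z) * F z / e"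
proof -
  have "vec_eval (pair_vec n (A * \<alpha>) (A * \<beta>) i j) z = A * (xi i z + xi j z)"
    by (simp add: pair_vec_def lin_form_add lin_form_cscale xi_def algebra_simps)
  then show ?thesis by (simp add: D_eq theta_pair_vec del: atLeastAtMost_iff)
qed

lemma ab_minor_theta_minor: "ab_minor (A * \<alpha>) (A * \<beta>) i j k u v = A\<^sup>2 * theta_minor i j k u v"
  by (simp add: ab_minor_def theta_minor_def ab_coord_def theta_def power2_eq_square algebra_simps)

lemma sum_group_pairs:
  "(\<Sum>g\<in>carrier (sym_group n). \<Sum>i\<in>N. \<Sum>j\<in>N. f i j g when g = swp i j) = (\<Sum>i\<in>N. \<Sum>j\<in>N. f i j (swp i j))"
  for f :: "nat \<Rightarrow> nat \<Rightarrow> (nat \<Rightarrow> nat) \<Rightarrow> complex"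
proof -
  have "(\<Sum>g\<in>carrier (sym_group n). \<Sum>i\<in>N. \<Sum>j\<in>N. f i j g when g = swp i j)
      = (\<Sum>i\<in>N. \<Sum>j\<in>N. \<Sum>g\<in>carrier (sym_group n). f i j g when g = swp i j)"
    by (subst sum.swap, rule sum.cong[OF refl], rule sum.swap)
  then show ?thesis
    by (simp only: sum_when_eq[OF finite_sym_group swp_sym_group] cong: sum.cong)
qed

lemma sum_group_triples:
  "(\<Sum>g\<in>carrier (sym_group n). \<Sum>i\<in>N. \<Sum>j\<in>N. \<Sum>k\<in>N. f i j k g when g = swp i j \<circ> swp j k)
    = (\<Sum>i\<in>N. \<Sum>j\<in>N. \<Sum>k\<in>N. f i j k (swp i j \<circ> swp j k))"
  for f :: "nat \<Rightarrow> nat \<Rightarrow> nat \<Rightarrow> (nat \<Rightarrow> nat) \<Rightarrow> complex"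
proof -
  have "(\<Sum>g\<in>carrier (sym_group n). \<Sum>i\<in>N. \<Sum>j\<in>N. \<Sum>k\<in>N. f i j k g when g = swp i j \<circ> swp j k)
      = (\<Sum>i\<in>N. \<Sum>j\<in>N. \<Sum>k\<in>N. \<Sum>g\<in>carrier (sym_group n). f i j k g when g = swp i j \<circ> swp j k)"
    by (subst sum.swap, rule sum.cong[OF refl], subst sum.swap, rule sum.cong[OF refl], rule sum.swap)
  then show ?thesis
    by (simp only: sum_when_eq[OF finite_sym_group swp_comp_sym_group] cong: sum.cong)
qed

lemma commutator_family:
  assumes e: "e \<noteq> 0" and z: "z \<in> reg"
  shows "vec_op (B e) u (vec_op (B e) v F) z - vec_op (B e) v (vec_op (B e) u F) z =
    (\<Sum>g\<in>carrier (sym_group n). vec_op (B e) (family_L n (A * \<alpha>) (A * \<beta>) g u v) (\<lambda>z. F (perm_pt g z)) z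
       + family_C n (A * \<alpha>) (A * \<beta>) c g u v * F (perm_pt g z))"
proof -
  have D_when: "vec_op (B e) (d *\<^sub>c w when Q) F z = (d * vec_op (B e) w F z when Q)" for d w Q F
    by (simp add: vec_op_def lin_form_cscale when_def)
  have "(\<Sum>g\<in>carrier (sym_group n). vec_op (B e) (family_L n (A * \<alpha>) (A * \<beta>) g u v) (\<lambda>z. F (perm_pt g z)) z)
      = (\<Sum>g\<in>carrier (sym_group n). \<Sum>i\<in>N. \<Sum>j\<in>N.
          (- (of_nat n / 4) * xy_minor i j u v) * (A * (xi i z + xi j z) * F (perm_pt g z) / e) when g = swp i j)"
  proof (rule sum.cong[OF refl])
    fix g
    have "vec_op (B e) (family_L n (A * \<alpha>) (A * \<beta>) g u v) (\<lambda>z. F (perm_pt g z)) z = (\<Sum>i\<in>N. \<Sum>j\<in>N.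
        vec_op (B e) ((- (of_nat n / 4) * xy_minor i j u v) *\<^sub>c pair_vec n (A * \<alpha>) (A * \<beta>) i j when g = swp i j) (\<lambda>z. F (perm_pt g z)) z)"
      by (simp add: family_L_def vec_op_def lin_form_sum)
    then show "vec_op (B e) (family_L n (A * \<alpha>) (A * \<beta>) g u v) (\<lambda>z. F (perm_pt g z)) z = (\<Sum>i\<in>N. \<Sum>j\<in>N.
          (- (of_nat n / 4) * xy_minor i j u v) * (A * (xi i z + xi j z) * F (perm_pt g z) / e) when g = swp i j)"
      by (simp only: D_when D_pair_vec)
  qed
  also have "\<dots> = (\<Sum>i\<in>N. \<Sum>j\<in>N. (- (of_nat n / 4) * xy_minor i j u v) * (A * (xi i z + xi j z) * F (perm_pt (swp i j) z) / e))"
    by (rule sum_group_pairs)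
  finally have L: "(\<Sum>g\<in>carrier (sym_group n). vec_op (B e) (family_L n (A * \<alpha>) (A * \<beta>) g u v) (\<lambda>z. F (perm_pt g z)) z) = \<dots>" .
  have "(\<Sum>g\<in>carrier (sym_group n). family_C n (A * \<alpha>) (A * \<beta>) c g u v * F (perm_pt g z))
      = (\<Sum>g\<in>carrier (sym_group n). \<Sum>i\<in>N. \<Sum>j\<in>N. c / 2 * xy_minor i j u v * F (perm_pt g z) when g = swp i j)
      + (\<Sum>g\<in>carrier (sym_group n). \<Sum>i\<in>N. \<Sum>j\<in>N. \<Sum>k\<in>N.
          (of_nat n)\<^sup>2 / 12 * (A\<^sup>2 * theta_minor i j k u v) * F (perm_pt g z) when g = swp i j \<circ> swp j k)"
    by (simp only: family_C_def ab_minor_theta_minor distrib_right sum.distrib sum_distrib_right when_mult)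
  also have "\<dots> = (\<Sum>i\<in>N. \<Sum>j\<in>N. c / 2 * xy_minor i j u v * F (perm_pt (swp i j) z))
      + (\<Sum>i\<in>N. \<Sum>j\<in>N. \<Sum>k\<in>N. (of_nat n)\<^sup>2 / 12 * (A\<^sup>2 * theta_minor i j k u v) * F (perm_pt (swp i j \<circ> swp j k) z))"
    by (simp only: sum_group_pairs sum_group_triples)
  finally have C: "(\<Sum>g\<in>carrier (sym_group n). family_C n (A * \<alpha>) (A * \<beta>) c g u v * F (perm_pt g z)) = \<dots>" .
  have "(\<Sum>i\<in>N. \<Sum>j\<in>N. 1/2 * xy_minor i j u v * (- (of_nat n / 2) * A * (xi i z + xi j z) / e + c) * F (perm_pt (swp i j) z))
      = (\<Sum>i\<in>N. \<Sum>j\<in>N. (- (of_nat n / 4) * xy_minor i j u v) * (A * (xi i z + xi j z) * F (perm_pt (swp i j) z) / e))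
      + (\<Sum>i\<in>N. \<Sum>j\<in>N. c / 2 * xy_minor i j u v * F (perm_pt (swp i j) z))"
    unfolding sum.distrib[symmetric] using e by (intro sum.cong refl) (simp add: field_simps)
  then show ?thesis
    unfolding commutator[OF e z] sum.distrib L C by (simp add: mult.assoc)
qed

lemma orbifold_rep_family:
  assumes f: "in_family n (A * \<alpha>) (A * \<beta>) c \<kappa>L \<kappa>C"
  shows "orbifold_rep (sym_group n) perm_act (doubled_std n) (std_proj n) \<kappa>L \<kappa>C perm_pt reg B"
proof -
  have n: "n > 0" "n \<ge> 2" using n3 by auto
  interpret la: linear_action "sym_group n" perm_act "doubled_std n" "std_proj n"
    by (rule linear_action_sym[OF n(1)])
  show ?thesis
  proof (intro orbifold_rep.intro orbifold_cochains.intro orbifold_cochains_axioms.intro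
      orbifold_rep_axioms.intro la.linear_action_axioms)
    show "linear_cochain (sym_group n) (doubled_std n) \<kappa>L" "constant_cochain (sym_group n) (doubled_std n) \<kappa>C"
      using f by (simp_all add: in_family_def)
    fix g h z assume g: "g \<in> carrier (sym_group n)"
    then have gp: "g permutes N" by (simp add: sym_group_carrier)
    show "perm_pt g z \<in> reg" if "z \<in> reg" using reg_perm_pt[OF gp that] .
    show "perm_pt (g \<otimes>\<^bsub>sym_group n\<^esub> h) z = perm_pt h (perm_pt g z)" by (simp only: sym_group_mult perm_pt_comp)
    show "g = h" if "z \<in> reg" "h \<in> carrier (sym_group n)" "perm_pt g z = perm_pt h z"
      using perm_pt_inj[OF that(1) gp _ that(3)] that(2) by (simp add: sym_group_carrier)
    show "vec_op (B e) (perm_act g (Poly_Mapping.single i 1)) (\<lambda>z. F (perm_pt g z)) z = B e i F (perm_pt g z)" for e i F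
      unfolding D_equivariant[OF gp] by (simp add: vec_op_def)
  next
    show "perm_pt (\<one>\<^bsub>sym_group n\<^esub>) z = z" for z by (simp add: sym_group_one map_sum.id)
    show "q = 0" if "\<And>z. z \<in> reg \<Longrightarrow> poly_eval q z = 0" for q using that by (rule reg_dense)
    show "B e i (\<lambda>z. a * F z + F' z) = (\<lambda>z. a * B e i F z + B e i F' z)" for e i a F F' by (rule B_linear)
    show "B e i F z = B e i F' z" if "\<And>z. z \<in> reg \<Longrightarrow> F z = F' z" "z \<in> reg" for e i F F' z
      using that by (rule B_local)
    show "((\<lambda>e. e * B e i (Fe e) z) \<longlongrightarrow> z i * F z) (at 0)"
      if "\<And>z. z \<in> reg \<Longrightarrow> ((\<lambda>e. Fe e z) \<longlongrightarrow> F z) (at 0)" "z \<in> reg" for Fe F i z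
      using that by (rule B_limit)
    fix e :: complex and u v z F
    assume e: "e \<noteq> 0" and uv: "u \<in> doubled_std n" "v \<in> doubled_std n" and z: "z \<in> reg"
    show "vec_op (B e) u (vec_op (B e) v F) z - vec_op (B e) v (vec_op (B e) u F) z =
      (\<Sum>g\<in>carrier (sym_group n). vec_op (B e) (\<kappa>L g u v) (\<lambda>z. F (perm_pt g z)) z + \<kappa>C g u v * F (perm_pt g z))"
      unfolding commutator_family[OF e z]
      by (intro sum.cong refl) (simp only: in_family_unique[OF f n(2) _ uv])
  qed
qed

end

text \<open>For \<open>a = b = 0\<close> the representation is used with \<open>A = 0\<close> and the arbitrary choice \<open>(\<alpha>, \<beta>) = (1, 0)\<close>.\<close>

lemma in_family_drinfeld:
  assumes n: "n \<ge> 3" and f: "in_family n a b c \<kappa>L \<kappa>C"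
  shows "drinfeld_orbifold_map (sym_group n) perm_act (doubled_std n) \<kappa>L \<kappa>C"
    "is_drinfeld_orbifold_algebra (sym_group n) perm_act (doubled_std n) \<kappa>L \<kappa>C"
    "supported_only_off (sym_group n) (doubled_std n) \<kappa>L {\<one>\<^bsub>sym_group n\<^esub>}"
proof -
  obtain \<alpha> \<beta> A where ab: "a = A * \<alpha>" "b = A * \<beta>" "\<alpha> \<noteq> 0 \<or> \<beta> \<noteq> 0"
  proof (cases "a = 0 \<and> b = 0")
    case True
    then show ?thesis using that[of 0 1 0] by simp
  next
    case False
    then show ?thesis using that[of 1 a b] by auto
  qed
  interpret dunkl n \<alpha> \<beta> A c using n ab(3) by unfold_locales
  interpret orbifold_rep "sym_group n" perm_act "doubled_std n" "std_proj n" \<kappa>L \<kappa>C perm_pt reg B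
    by (rule orbifold_rep_family) (use f ab in simp)
  have n2: "n \<ge> 2" using n by simp
  note eq = in_family_unique[OF f n2]
  show "drinfeld_orbifold_map (sym_group n) perm_act (doubled_std n) \<kappa>L \<kappa>C"
  proof (rule drinfeld)
    fix g h u v
    assume g: "g \<in> carrier (sym_group n)" and uv: "u \<in> doubled_std n" "v \<in> doubled_std n"
    show "perm_act g (\<kappa>L g u v) = \<kappa>L g u v"
      using family_L_fixed g by (simp add: eq[OF g uv] sym_group_carrier)
    assume h: "h \<in> carrier (sym_group n)"
    then have hp: "h permutes {1..n}" by (simp add: sym_group_carrier)
    have c: "h \<otimes>\<^bsub>sym_group n\<^esub> g \<otimes>\<^bsub>sym_group n\<^esub> inv\<^bsub>sym_group n\<^esub> h = h \<circ> g \<circ> inv' h"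
      "h \<otimes>\<^bsub>sym_group n\<^esub> g \<otimes>\<^bsub>sym_group n\<^esub> inv\<^bsub>sym_group n\<^esub> h \<in> carrier (sym_group n)"
      using g h by (simp_all only: sym_group_inv_equality[OF h] sym_group_mult) (metis g h inv_closed m_closed sym_group_inv_equality sym_group_mult)
    note huv = perm_act_doubled_std[OF hp uv(1)] perm_act_doubled_std[OF hp uv(2)]
    show "perm_act h (\<kappa>L g u v) = \<kappa>L (h \<otimes>\<^bsub>sym_group n\<^esub> g \<otimes>\<^bsub>sym_group n\<^esub> inv\<^bsub>sym_group n\<^esub> h) (perm_act h u) (perm_act h v)"
      unfolding eq(1)[OF c(2) huv] eq(1)[OF g uv] unfolding c(1) by (rule family_L_invariant[OF hp])
    show "\<kappa>C g u v = \<kappa>C (h \<otimes>\<^bsub>sym_group n\<^esub> g \<otimes>\<^bsub>sym_group n\<^esub> inv\<^bsub>sym_group n\<^esub> h) (perm_act h u) (perm_act h v)"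
      unfolding eq(2)[OF c(2) huv] eq(2)[OF g uv] unfolding c(1) by (rule family_C_invariant[OF hp])
  qed
  show "is_drinfeld_orbifold_algebra (sym_group n) perm_act (doubled_std n) \<kappa>L \<kappa>C" by (rule pbw)
  show "supported_only_off (sym_group n) (doubled_std n) \<kappa>L {\<one>\<^bsub>sym_group n\<^esub>}"
    by (auto simp: supported_only_off_def eq sym_group_one family_L_id)
qed


section \<open>Skew forms on the doubled standard representation\<close>

text \<open>The scalar multiplication \<open>sc\<close> is a parameter in order to cover vector-valued and scalar-valued forms at once.\<close>

locale skew_form =
  fixes n :: nat and sc :: "complex \<Rightarrow> 'w \<Rightarrow> 'w::ab_group_add" and U and C :: "xy_space \<Rightarrow> xy_space \<Rightarrow> 'w"
  assumes skew_bilinear: "skew_bilinear_on (doubled_std n) sc U C"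
    and sc_add: "sc c (w + w') = sc c w + sc c w'"
begin

abbreviation V where "V \<equiv> doubled_std n"

lemma V_closed: "u \<in> V \<Longrightarrow> v \<in> V \<Longrightarrow> u + v \<in> V" "u \<in> V \<Longrightarrow> v \<in> V \<Longrightarrow> u - v \<in> V"
  "u \<in> V \<Longrightarrow> c *\<^sub>c u \<in> V" "0 \<in> V" "u \<in> V \<Longrightarrow> - u \<in> V"
  by (fact cvs.subspace_add[OF subspace_doubled_std] cvs.subspace_diff[OF subspace_doubled_std]
      cvs.subspace_scale[OF subspace_doubled_std] cvs.subspace_0[OF subspace_doubled_std]
      cvs.subspace_neg[OF subspace_doubled_std])+

lemma range: "u \<in> V \<Longrightarrow> v \<in> V \<Longrightarrow> C u v \<in> U"
  using skew_bilinear unfolding skew_bilinear_on_def by blast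

lemma skew: "u \<in> V \<Longrightarrow> v \<in> V \<Longrightarrow> C u v = - C v u"
  using skew_bilinear unfolding skew_bilinear_on_def by blast

lemma add_left: "u \<in> V \<Longrightarrow> u' \<in> V \<Longrightarrow> v \<in> V \<Longrightarrow> C (u + u') v = C u v + C u' v"
  using skew_bilinear unfolding skew_bilinear_on_def by blast

lemma scale_left: "u \<in> V \<Longrightarrow> v \<in> V \<Longrightarrow> C (c *\<^sub>c u) v = sc c (C u v)"
  using skew_bilinear unfolding skew_bilinear_on_def by blast

lemma add_right: "u \<in> V \<Longrightarrow> u' \<in> V \<Longrightarrow> v \<in> V \<Longrightarrow> C v (u + u') = C v u + C v u'"
  using add_left[of u u' v] skew[of v "u + u'"] skew[of v u] skew[of v u'] by (simp add: V_closed)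

lemma scale_right: "u \<in> V \<Longrightarrow> v \<in> V \<Longrightarrow> C v (c *\<^sub>c u) = sc c (C v u)"
  using scale_left[of u v c] skew[of v "c *\<^sub>c u"] skew[of v u] additive_uminus_diff(2)[of "sc c", OF sc_add]
  by (simp add: V_closed)

lemma zero_left: "v \<in> V \<Longrightarrow> C 0 v = 0" and zero_right: "v \<in> V \<Longrightarrow> C v 0 = 0"
  using add_left[of 0 0 v] add_right[of 0 0 v] by (auto simp: V_closed)

lemma neg_right: "u \<in> V \<Longrightarrow> v \<in> V \<Longrightarrow> C v (- u) = - C v u"
  using add_right[of u "- u" v] by (simp add: V_closed zero_right eq_neg_iff_add_eq_0 add.commute)

lemma sum_right: "(\<And>i. i \<in> S \<Longrightarrow> f i \<in> V) \<Longrightarrow> v \<in> V \<Longrightarrow> C v (\<Sum>i\<in>S. f i) = (\<Sum>i\<in>S. C v (f i))"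
proof (induction S rule: infinite_finite_induct)
  case (insert i S)
  then have "(\<Sum>i\<in>S. f i) \<in> V" by (auto intro: cvs.subspace_sum[OF subspace_doubled_std])
  with insert show ?case by (simp add: add_right)
qed (simp_all add: zero_right)

lemma eq_zeroI:
  assumes char0: "\<And>w :: 'w. w = - w \<Longrightarrow> w = 0" and U: "0 \<in> U"
    and gen: "\<And>i j. i \<in> {1..n} \<Longrightarrow> j \<in> {1..n} \<Longrightarrow> i \<noteq> j \<Longrightarrow> C (xbar n i) (xbar n j) = 0"
      "\<And>i j. i \<in> {1..n} \<Longrightarrow> j \<in> {1..n} \<Longrightarrow> i \<noteq> j \<Longrightarrow> C (ybar n i) (ybar n j) = 0"
      "\<And>i j. i \<in> {1..n} \<Longrightarrow> j \<in> {1..n} \<Longrightarrow> C (xbar n i) (ybar n j) = 0"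
    and uv: "u \<in> V" "v \<in> V"
  shows "C u v = 0"
proof -
  have "skew_bilinear_on V sc U (\<lambda>u v. 0)"
    using additive_uminus_diff(1)[of "sc c" for c, OF sc_add] U unfolding skew_bilinear_on_def by simp
  from skew_bilinear_eqI[OF skew_bilinear this char0 gen uv] show ?thesis by simp
qed

end

lemma sum_bars: "n > 0 \<Longrightarrow> (\<Sum>j\<in>{1..n}. xbar n j) = 0" "n > 0 \<Longrightarrow> (\<Sum>j\<in>{1..n}. ybar n j) = 0"
proof -
  assume n: "n > 0"
  have s: "(\<Sum>j\<in>{1..n}. (1 when k = j) - ((1 / complex_of_nat n) when k \<in> {1..n})) = 0" for k
  proof -
    have "(\<Sum>j\<in>{1..n}. (1 when k = j) - ((1 / complex_of_nat n) when k \<in> {1..n}))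
        = (\<Sum>j\<in>{1..n}. if j = k then 1 else 0) - (\<Sum>j\<in>{1..n}. (1 / complex_of_nat n) when k \<in> {1..n})"
      unfolding sum_subtractf[symmetric] by (rule sum.cong) (auto simp: when_def)
    then show ?thesis using n by (auto simp: sum.delta)
  qed
  have "Poly_Mapping.lookup (\<Sum>j\<in>{1..n}. xbar n j) b = 0" "Poly_Mapping.lookup (\<Sum>j\<in>{1..n}. ybar n j) b = 0" for b
    using s by (cases b; simp add: lookup_sum lookup_bars)+
  then show "(\<Sum>j\<in>{1..n}. xbar n j) = 0" "(\<Sum>j\<in>{1..n}. ybar n j) = 0"
    by (auto intro!: poly_mapping_eqI)
qed


section \<open>Invariant tensors of the standard representation\<close>

text \<open>An invariant bilinear map on the standard representation with values in it, in coordinates: \<open>T i j k\<close> is the \<open>k\<close>-th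
  coordinate of the value at the \<open>i\<close>-th and the \<open>j\<close>-th spanning vector.  These vectors add up to zero, which
  gives the first two sums, and so do the coordinates of a value, which gives the third.\<close>

definition inv_tensor :: "nat \<Rightarrow> (nat \<Rightarrow> nat \<Rightarrow> nat \<Rightarrow> complex) \<Rightarrow> bool"
  where "inv_tensor n T \<longleftrightarrow>
    (\<forall>h i j k. h permutes {1..n} \<longrightarrow> i \<in> {1..n} \<longrightarrow> j \<in> {1..n} \<longrightarrow> k \<in> {1..n} \<longrightarrow> T (h i) (h j) (h k) = T i j k) \<and>
    (\<forall>j\<in>{1..n}. \<forall>k\<in>{1..n}. (\<Sum>i\<in>{1..n}. T i j k) = 0) \<and>
    (\<forall>i\<in>{1..n}. \<forall>k\<in>{1..n}. (\<Sum>j\<in>{1..n}. T i j k) = 0) \<and>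
    (\<forall>i\<in>{1..n}. \<forall>j\<in>{1..n}. (\<Sum>k\<in>{1..n}. T i j k) = 0)"

lemma inv_tensor_swp:
  assumes "inv_tensor n T" "i \<in> {1..n}" "j \<in> {1..n}" "k \<in> {1..n}" "p \<in> {1..n}" "q \<in> {1..n}"
  shows "T (swp p q i) (swp p q j) (swp p q k) = T i j k"
  using assms permutes_swap_id[of p "{1..n}" q] unfolding inv_tensor_def by blast

text \<open>The transposition of \<open>i\<close> and \<open>j\<close> fixes every other \<open>k\<close>, so \<open>T i j k = 0\<close> by antisymmetry unless \<open>k\<close> is \<open>i\<close> or \<open>j\<close>.
  The remaining coordinates \<open>T i j i\<close> are all equal for fixed \<open>i\<close>, and their sum over \<open>j\<close> is zero.\<close>

lemma antisym_tensor_zero: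
  assumes n: "n \<ge> 3" and T: "inv_tensor n T"
    and anti: "\<And>i j k. i \<in> {1..n} \<Longrightarrow> j \<in> {1..n} \<Longrightarrow> k \<in> {1..n} \<Longrightarrow> T i j k = - T j i k"
    and ijk: "i \<in> {1..n}" "j \<in> {1..n}" "k \<in> {1..n}"
  shows "T i j k = 0"
proof -
  let ?N = "{1..n}"
  note swap = inv_tensor_swp[OF T]
  have diag: "T i i k = 0" if "i \<in> ?N" "k \<in> ?N" for i k using anti[OF that(1,1,2)] by (rule complex_eq_neg)
  have dist: "T i j k = 0" if "i \<in> ?N" "j \<in> ?N" "k \<in> ?N" "k \<noteq> i" "k \<noteq> j" for i j k
  proof -
    have "T j i k = T i j k" using swap[of i j k i j] that by simp
    then show ?thesis using anti[of i j k] that by (intro complex_eq_neg) simp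
  qed
  have left: "T i j i = 0" if ij: "i \<in> ?N" "j \<in> ?N" "i \<noteq> j" for i j
  proof -
    have eq: "T i l i = T i j i" if l: "l \<in> ?N - {i}" for l
      using swap[of i j i j l] l ij by (cases "l = j") auto
    have "0 = (\<Sum>l\<in>?N. T i l i)" using T ij(1) unfolding inv_tensor_def by simp
    also have "\<dots> = T i i i + (\<Sum>l\<in>?N - {i}. T i l i)" using ij by (simp add: sum.remove)
    also have "(\<Sum>l\<in>?N - {i}. T i l i) = (\<Sum>l\<in>?N - {i}. T i j i)" by (rule sum.cong[OF refl eq])
    also have "T i i i + (\<Sum>l\<in>?N - {i}. T i j i) = of_nat (n - 1) * T i j i" using ij diag[of i i] by simp
    finally show ?thesis using n by simp
  qed
  show ?thesis
  proof (cases "i = j")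
    case True then show ?thesis using diag ijk by simp
  next
    case False
    consider "k = i" | "k = j" | "k \<noteq> i" "k \<noteq> j" by blast
    then show ?thesis
    proof cases
      case 1 then show ?thesis using left[of i j] ijk False by simp
    next
      case 2 then show ?thesis using left[of j i] anti[of i j j] ijk False by simp
    next
      case 3 then show ?thesis using dist ijk by blast
    qed
  qed
qed

lemma sum_split2:
  fixes f :: "nat \<Rightarrow> complex"
  assumes "p \<in> {1..n}" "q \<in> {1..n}" "p \<noteq> q" "\<And>l. l \<in> {1..n} - {p, q} \<Longrightarrow> f l = r" "n \<ge> 2"
  shows "sum f {1..n} = f p + f q + (of_nat n - 2) * r"
proof -
  have "sum f {1..n} = f p + (f q + sum f ({1..n} - {p} - {q}))"
    using assms(1-3) by (simp add: sum.remove)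
  also have "{1..n} - {p} - {q} = {1..n} - {p, q}" by auto
  also have "sum f ({1..n} - {p, q}) = (\<Sum>l\<in>{1..n} - {p, q}. r)" by (rule sum.cong[OF refl]) (rule assms(4))
  also have "\<dots> = of_nat (n - 2) * r" using assms(1-3) by (simp add: card_Diff_subset)
  finally show ?thesis using assms(5) by (simp add: of_nat_diff)
qed

lemma third_index:
  fixes n i j :: nat
  assumes n: "n \<ge> 3"
  shows "\<exists>k\<in>{1..n}. k \<noteq> i \<and> k \<noteq> j"
proof -
  have "card {i, j} < card {1..n}" using n by (simp add: card_insert_if)
  then have "\<not> {1..n} \<subseteq> {i, j}" by (meson card_mono finite.emptyI finite.insertI not_le)
  then show ?thesis by blast
qed

lemma permutation_of_three:
  fixes n i j k :: nat
  assumes n: "n \<ge> 3" and ijk: "i \<in> {1..n}" "j \<in> {1..n}" "k \<in> {1..n}" "i \<noteq> j" "i \<noteq> k" "j \<noteq> k"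
  shows "\<exists>h. h permutes {1..n} \<and> h 1 = i \<and> h 2 = j \<and> h 3 = k"
proof -
  let ?N = "{1..n}"
  have N: "1 \<in> ?N" "2 \<in> ?N" "3 \<in> ?N" using n by auto
  define h1 where "h1 = swp 1 i"
  define j' where "j' = h1 j"
  define h2 where "h2 = swp 2 j'"
  define k' where "k' = h2 (h1 k)"
  define h3 where "h3 = swp 3 k'"
  have p1: "h1 permutes ?N" unfolding h1_def by (rule permutes_swap_id) (use N ijk in auto)
  have j': "j' \<in> ?N" unfolding j'_def using permutes_in_image[OF p1] ijk by blast
  have p2: "h2 permutes ?N" unfolding h2_def by (rule permutes_swap_id) (use N j' in auto)
  have k': "k' \<in> ?N" unfolding k'_def using permutes_in_image[OF p1] permutes_in_image[OF p2] ijk by blast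
  have p3: "h3 permutes ?N" unfolding h3_def by (rule permutes_swap_id) (use N k' in auto)
  have inv1: "h1 (h1 x) = x" and inv2: "h2 (h2 x) = x" for x by (simp_all add: h1_def h2_def)
  have j1: "j' \<noteq> 1" using ijk inv1 unfolding j'_def by (metis h1_def transpose_apply_first)
  have "h1 k \<noteq> 1" "h1 k \<noteq> j'" using ijk inv1 unfolding j'_def by (metis h1_def transpose_apply_first, metis)
  then have k1: "k' \<noteq> 1" "k' \<noteq> 2" using j1 unfolding k'_def h2_def
    by (auto simp: Transposition.transpose_def split: if_splits)
  have "h1 (h2 (h3 1)) = i" "h1 (h2 (h3 2)) = j" "h1 (h2 (h3 3)) = k"
    using j1 k1 inv1 inv2 by (simp_all add: h3_def k'_def) (simp_all add: h2_def j'_def inv1, simp add: h1_def)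
  then show ?thesis
    using permutes_compose[OF p3 permutes_compose[OF p2 p1]] by (intro exI[of _ "h1 \<circ> h2 \<circ> h3"]) (simp add: comp_assoc)
qed

text \<open>There are five orbits of triples of indices, and the vanishing sums leave one parameter.  The solution is,
  up to a factor, the componentwise product of \<open>\<complex>\<^sup>n\<close> projected to the vectors with coordinate sum zero.\<close>

lemma inv_tensor_unique:
  assumes n: "n \<ge> 3" and T: "inv_tensor n T"
  obtains \<mu> where
    "\<And>i j k. i \<in> {1..n} \<Longrightarrow> j \<in> {1..n} \<Longrightarrow> k \<in> {1..n} \<Longrightarrow> i \<noteq> j \<Longrightarrow> T i j k = \<mu> * X (xbar n i + xbar n j) k"
    "\<And>i k. i \<in> {1..n} \<Longrightarrow> k \<in> {1..n} \<Longrightarrow> T i i k = (2 - of_nat n) * \<mu> * X (xbar n i) k"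
proof -
  let ?N = "{1..n}"
  have N: "1 \<in> ?N" "2 \<in> ?N" "3 \<in> ?N" "1 \<noteq> (2::nat)" "1 \<noteq> (3::nat)" "2 \<noteq> (3::nat)" using n by auto
  have n2: "n \<ge> 2" using n by simp
  define s where "s = T 1 2 1"
  define t where "t = T 1 2 2"
  define r where "r = T 1 2 3"
  define m where "m = T 1 1 2"
  define d where "d = T 1 1 1"
  have perm: "\<exists>h. h permutes ?N \<and> h 1 = i \<and> h 2 = j \<and> h 3 = k"
    if "i \<in> ?N" "j \<in> ?N" "k \<in> ?N" "i \<noteq> j" "i \<noteq> k" "j \<noteq> k" for i j k
    using permutation_of_three[OF n that] .
  have inv: "T (h i) (h j) (h k) = T i j k" if "h permutes ?N" "i \<in> ?N" "j \<in> ?N" "k \<in> ?N" for h i j k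
    using T that unfolding inv_tensor_def by blast
  have third: "\<exists>k\<in>?N. k \<noteq> i \<and> k \<noteq> j" for i j using third_index[OF n] .
  have Tr: "T i j k = r" if "i \<in> ?N" "j \<in> ?N" "k \<in> ?N" "i \<noteq> j" "i \<noteq> k" "j \<noteq> k" for i j k
    using perm[OF that] inv[OF _ N(1,2,3)] by (auto simp: r_def)
  have Tij: "T i j i = s" "T i j j = t" "T i i j = m" "T i i i = d" if "i \<in> ?N" "j \<in> ?N" "i \<noteq> j" for i j
  proof -
    obtain k where k: "k \<in> ?N" "k \<noteq> i" "k \<noteq> j" using third by blast
    then obtain h where h: "h permutes ?N" "h 1 = i" "h 2 = j" using perm[of i j k] \<open>i \<in> ?N\<close> \<open>j \<in> ?N\<close> \<open>i \<noteq> j\<close> by auto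
    show "T i j i = s" "T i j j = t" "T i i j = m" "T i i i = d"
      using inv[OF h(1) N(1,2,1)] inv[OF h(1) N(1,2,2)] inv[OF h(1) N(1,1,2)] inv[OF h(1) N(1,1,1)] h
      by (auto simp: s_def t_def m_def d_def)
  qed
  have S1: "s + t + (of_nat n - 2) * r = 0"
  proof -
    have "(\<Sum>k\<in>?N. T 1 2 k) = T 1 2 1 + T 1 2 2 + (of_nat n - 2) * r"
      by (rule sum_split2[OF N(1,2,4) _ n2]) (use Tr N in auto)
    then show ?thesis using T N unfolding inv_tensor_def s_def t_def by simp
  qed
  have S2: "m + t + (of_nat n - 2) * r = 0"
  proof -
    have "(\<Sum>j\<in>?N. T 1 j 2) = T 1 1 2 + T 1 2 2 + (of_nat n - 2) * r"
      by (rule sum_split2[OF N(1,2,4) _ n2]) (use Tr N in auto)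
    then show ?thesis using T N unfolding inv_tensor_def m_def t_def by simp
  qed
  have S3: "m + s + (of_nat n - 2) * r = 0"
  proof -
    have "(\<Sum>i\<in>?N. T i 1 2) = T 1 1 2 + T 2 1 2 + (of_nat n - 2) * r"
      by (rule sum_split2[OF N(1,2,4) _ n2]) (use Tr N in auto)
    moreover have "T 2 1 2 = s" using Tij(1)[of 2 1] N by simp
    ultimately show ?thesis using T N unfolding inv_tensor_def m_def by simp
  qed
  have S4: "d + s + (of_nat n - 2) * s = 0"
  proof -
    have "(\<Sum>j\<in>?N. T 1 j 1) = T 1 1 1 + T 1 2 1 + (of_nat n - 2) * s"
      by (rule sum_split2[OF N(1,2,4) _ n2]) (use Tij N in auto)
    then show ?thesis using T N unfolding inv_tensor_def d_def s_def by simp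
  qed
  have "s - m = (s + t + (of_nat n - 2) * r) - (m + t + (of_nat n - 2) * r)"
    "t - s = (m + t + (of_nat n - 2) * r) - (m + s + (of_nat n - 2) * r)" by simp_all
  then have st: "s = t" "m = t" unfolding S1 S2 S3 by simp_all
  define \<mu> where "\<mu> = s - r"
  have nz: "(of_nat n :: complex) \<noteq> 0" using n by simp
  have "of_nat n * r = (s + t + (of_nat n - 2) * r) - 2 * s + 2 * r" using st by (simp add: algebra_simps)
  then have "of_nat n * r = - 2 * \<mu>" unfolding S1 by (simp add: \<mu>_def)
  then have r: "r = \<mu> * (- 2 / of_nat n)" using nz by (simp add: field_simps)
  have s: "s = \<mu> * (1 - 2 / of_nat n)"
  proof -
    have "\<mu> * (1 - 2 / of_nat n) = \<mu> + \<mu> * (- 2 / of_nat n)" by (simp add: algebra_simps)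
    also have "\<dots> = \<mu> + r" using r by simp
    finally show ?thesis by (simp add: \<mu>_def)
  qed
  have "d = (d + s + (of_nat n - 2) * s) + (1 - of_nat n) * s" by (simp add: algebra_simps)
  then have d: "d = (1 - of_nat n) * s" unfolding S4 by simp
  show ?thesis
  proof (rule that[of \<mu>])
    fix i j k assume ijk: "i \<in> ?N" "j \<in> ?N" "k \<in> ?N" "i \<noteq> j"
    consider "k = i" | "k = j" | "k \<noteq> i" "k \<noteq> j" by blast
    then show "T i j k = \<mu> * X (xbar n i + xbar n j) k"
    proof cases
      case 1
      then show ?thesis using Tij(1)[of i j] ijk s by (simp add: lookup_add lookup_bars)
    next
      case 2
      then show ?thesis using Tij(2)[of i j] ijk s st by (simp add: lookup_add lookup_bars)
    next
      case 3
      then show ?thesis using Tr[of i j k] ijk r by (simp add: lookup_add lookup_bars)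
    qed
  next
    fix i k assume ik: "i \<in> ?N" "k \<in> ?N"
    obtain j where j: "j \<in> ?N" "j \<noteq> i" using third by blast
    show "T i i k = (2 - of_nat n) * \<mu> * X (xbar n i) k"
    proof (cases "k = i")
      case True
      then show ?thesis using Tij(4)[of i j] ik j d s nz by (simp add: lookup_bars field_simps)
    next
      case False
      then show ?thesis using Tij(3)[of i k] ik s st nz by (simp add: lookup_bars field_simps)
    qed
  qed
qed


section \<open>Lie brackets invariant under the symmetric group\<close>

lemma perm_act_V_sum: "v \<in> doubled_std n \<Longrightarrow> n > 0 \<Longrightarrow> (\<Sum>k\<in>{1..n}. X v k) = 0"
  "v \<in> doubled_std n \<Longrightarrow> n > 0 \<Longrightarrow> (\<Sum>k\<in>{1..n}. Y v k) = 0"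
  by (simp_all add: doubled_std_iff(1))

lemma doubled_std_eqI:
  assumes "n > 0" "u \<in> doubled_std n" "v \<in> doubled_std n"
    and "\<And>k. k \<in> {1..n} \<Longrightarrow> X u k = X v k" "\<And>k. k \<in> {1..n} \<Longrightarrow> Y u k = Y v k"
  shows "u = v"
proof (rule poly_mapping_eqI)
  fix b
  show "Poly_Mapping.lookup u b = Poly_Mapping.lookup v b"
  proof (cases b)
    case (Inl k)
    then show ?thesis
      using assms(2,3) assms(4)[of k] by (cases "k \<in> {1..n}") (simp_all add: doubled_std_iff(1)[OF assms(1)] del: atLeastAtMost_iff)
  next
    case (Inr k)
    then show ?thesis
      using assms(2,3) assms(5)[of k] by (cases "k \<in> {1..n}") (simp_all add: doubled_std_iff(1)[OF assms(1)] del: atLeastAtMost_iff)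
  qed
qed

locale invariant_bracket = skew_form n cscale "doubled_std n" C for n C +
  assumes n3: "n \<ge> 3"
    and invariant: "h permutes {1..n} \<Longrightarrow> u \<in> doubled_std n \<Longrightarrow> v \<in> doubled_std n \<Longrightarrow>
          perm_act h (C u v) = C (perm_act h u) (perm_act h v)"
begin

lemma n0: "n > 0" using n3 by simp

text \<open>Each of the four types of values of a bracket, \<open>x\<close> or \<open>y\<close> in either argument, and each of the two groups of coordinates
  gives an invariant tensor; \<open>b\<close>, \<open>b'\<close> and \<open>l\<close> range over the possibilities.\<close>

lemma bracket_tensor:
  assumes b: "\<And>i. i \<in> {1..n} \<Longrightarrow> b i \<in> V" "\<And>h i. h permutes {1..n} \<Longrightarrow> perm_act h (b i) = b (h i)" "(\<Sum>i\<in>{1..n}. b i) = 0"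
    and b': "\<And>i. i \<in> {1..n} \<Longrightarrow> b' i \<in> V" "\<And>h i. h permutes {1..n} \<Longrightarrow> perm_act h (b' i) = b' (h i)" "(\<Sum>i\<in>{1..n}. b' i) = 0"
    and l: "\<And>h v k. h permutes {1..n} \<Longrightarrow> l (perm_act h v) (h k) = l v k" "\<And>v. v \<in> V \<Longrightarrow> (\<Sum>k\<in>{1..n}. l v k) = 0"
      "\<And>u v k. l (u + v) k = l u k + l v k"
  shows "inv_tensor n (\<lambda>i j k. l (C (b i) (b' j)) k)"
  unfolding inv_tensor_def
proof (intro conjI allI impI ballI)
  fix h i j k assume h: "h permutes {1..n}" and ijk: "i \<in> {1..n}" "j \<in> {1..n}" "k \<in> {1..n}"
  show "l (C (b (h i)) (b' (h j))) (h k) = l (C (b i) (b' j)) k"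
    using invariant[OF h b(1)[OF ijk(1)] b'(1)[OF ijk(2)]] l(1)[OF h, of "C (b i) (b' j)" k] b(2)[OF h] b'(2)[OF h] by simp
next
  have ls: "l (\<Sum>i\<in>S. f i) k = (\<Sum>i\<in>S. l (f i) k)" for f :: "nat \<Rightarrow> xy_space" and S k
    by (rule additive_sum[where f="\<lambda>v. l v k"]) (rule l(3))
  have l0: "l 0 k = 0" for k using ls[of "\<lambda>_. 0" "{}" k] by simp
  fix j k :: nat assume j: "j \<in> {1..n}"
  have "(\<Sum>i\<in>{1..n}. C (b i) (b' j)) = (\<Sum>i\<in>{1..n}. - C (b' j) (b i))"
    by (rule sum.cong[OF refl]) (rule skew[OF b(1) b'(1)[OF j]])
  also have "\<dots> = - C (b' j) (\<Sum>i\<in>{1..n}. b i)"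
    by (simp only: sum_negf sum_right[OF b(1) b'(1)[OF j]])
  finally have "(\<Sum>i\<in>{1..n}. C (b i) (b' j)) = - C (b' j) (\<Sum>i\<in>{1..n}. b i)" .
  then show "(\<Sum>i\<in>{1..n}. l (C (b i) (b' j)) k) = 0"
    by (simp only: ls[symmetric] b(3) zero_right[OF b'(1)[OF j]] minus_zero l0)
next
  have ls: "l (\<Sum>i\<in>S. f i) k = (\<Sum>i\<in>S. l (f i) k)" for f :: "nat \<Rightarrow> xy_space" and S k
    by (rule additive_sum[where f="\<lambda>v. l v k"]) (rule l(3))
  have l0: "l 0 k = 0" for k using ls[of "\<lambda>_. 0" "{}" k] by simp
  fix i k :: nat assume i: "i \<in> {1..n}"
  have "(\<Sum>j\<in>{1..n}. C (b i) (b' j)) = C (b i) (\<Sum>j\<in>{1..n}. b' j)"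
    by (rule sum_right[OF b'(1) b(1)[OF i], symmetric])
  then show "(\<Sum>j\<in>{1..n}. l (C (b i) (b' j)) k) = 0"
    by (simp only: ls[symmetric] b'(3) zero_right[OF b(1)[OF i]] l0)
next
  fix i j :: nat assume "i \<in> {1..n}" "j \<in> {1..n}"
  then show "(\<Sum>k\<in>{1..n}. l (C (b i) (b' j)) k) = 0" by (intro l(2) range b b')
qed

lemma xbar_props: "\<And>i. i \<in> {1..n} \<Longrightarrow> xbar n i \<in> V" "\<And>h i. h permutes {1..n} \<Longrightarrow> perm_act h (xbar n i) = xbar n (h i)"
    "(\<Sum>i\<in>{1..n}. xbar n i) = 0"
  and ybar_props: "\<And>i. i \<in> {1..n} \<Longrightarrow> ybar n i \<in> V" "\<And>h i. h permutes {1..n} \<Longrightarrow> perm_act h (ybar n i) = ybar n (h i)"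
    "(\<Sum>i\<in>{1..n}. ybar n i) = 0"
  and X_props: "\<And>h v k. h permutes {1..n} \<Longrightarrow> X (perm_act h v) (h k) = X v k" "\<And>v. v \<in> V \<Longrightarrow> (\<Sum>k\<in>{1..n}. X v k) = 0"
      "\<And>u v k. X (u + v) k = X u k + X v k"
  and Y_props: "\<And>h v k. h permutes {1..n} \<Longrightarrow> Y (perm_act h v) (h k) = Y v k" "\<And>v. v \<in> V \<Longrightarrow> (\<Sum>k\<in>{1..n}. Y v k) = 0"
      "\<And>u v k. Y (u + v) k = Y u k + Y v k"
  using n0 bars_doubled_std perm_act_bars sum_bars perm_act_V_sum lookup_perm_act[OF permutes_inj]
  by (auto simp: lookup_add)

lemma same_type_zero:
  assumes ij: "i \<in> {1..n}" "j \<in> {1..n}"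
  shows "C (xbar n i) (xbar n j) = 0" "C (ybar n i) (ybar n j) = 0"
proof -
  have sk: "Poly_Mapping.lookup (C u v) b = - Poly_Mapping.lookup (C v u) b" if "u \<in> V" "v \<in> V" for u v b
    by (subst skew[OF that]) simp
  have "X (C (xbar n i) (xbar n j)) k = 0" if "k \<in> {1..n}" for k
    by (rule antisym_tensor_zero[OF n3 bracket_tensor[OF xbar_props xbar_props X_props] _ ij that])
       (assumption | rule sk[OF xbar_props(1) xbar_props(1)])+
  moreover have "Y (C (xbar n i) (xbar n j)) k = 0" if "k \<in> {1..n}" for k
    by (rule antisym_tensor_zero[OF n3 bracket_tensor[OF xbar_props xbar_props Y_props] _ ij that])
       (assumption | rule sk[OF xbar_props(1) xbar_props(1)])+
  ultimately show "C (xbar n i) (xbar n j) = 0"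
    by (intro doubled_std_eqI[OF n0 range[OF xbar_props(1)[OF ij(1)] xbar_props(1)[OF ij(2)]] V_closed(4)]) simp_all
  have "X (C (ybar n i) (ybar n j)) k = 0" if "k \<in> {1..n}" for k
    by (rule antisym_tensor_zero[OF n3 bracket_tensor[OF ybar_props ybar_props X_props] _ ij that])
       (assumption | rule sk[OF ybar_props(1) ybar_props(1)])+
  moreover have "Y (C (ybar n i) (ybar n j)) k = 0" if "k \<in> {1..n}" for k
    by (rule antisym_tensor_zero[OF n3 bracket_tensor[OF ybar_props ybar_props Y_props] _ ij that])
       (assumption | rule sk[OF ybar_props(1) ybar_props(1)])+
  ultimately show "C (ybar n i) (ybar n j) = 0"
    by (intro doubled_std_eqI[OF n0 range[OF ybar_props(1)[OF ij(1)] ybar_props(1)[OF ij(2)]] V_closed(4)]) simp_all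
qed

lemma mixed_type:
  "\<exists>\<mu> \<nu>. (\<forall>i\<in>{1..n}. \<forall>j\<in>{1..n}. i \<noteq> j \<longrightarrow> C (xbar n i) (ybar n j) = pair_vec n \<mu> \<nu> i j) \<and>
    (\<forall>i\<in>{1..n}. C (xbar n i) (ybar n i) = (2 - of_nat n) *\<^sub>c (\<mu> *\<^sub>c xbar n i + \<nu> *\<^sub>c ybar n i))"
proof -
  obtain \<mu> where \<mu>: "\<And>i j k. i \<in> {1..n} \<Longrightarrow> j \<in> {1..n} \<Longrightarrow> k \<in> {1..n} \<Longrightarrow> i \<noteq> j \<Longrightarrow>
        X (C (xbar n i) (ybar n j)) k = \<mu> * X (xbar n i + xbar n j) k"
      "\<And>i k. i \<in> {1..n} \<Longrightarrow> k \<in> {1..n} \<Longrightarrow> X (C (xbar n i) (ybar n i)) k = (2 - of_nat n) * \<mu> * X (xbar n i) k"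
    using inv_tensor_unique[OF n3 bracket_tensor[OF xbar_props ybar_props X_props]] by blast
  obtain \<nu> where \<nu>: "\<And>i j k. i \<in> {1..n} \<Longrightarrow> j \<in> {1..n} \<Longrightarrow> k \<in> {1..n} \<Longrightarrow> i \<noteq> j \<Longrightarrow>
        Y (C (xbar n i) (ybar n j)) k = \<nu> * X (xbar n i + xbar n j) k"
      "\<And>i k. i \<in> {1..n} \<Longrightarrow> k \<in> {1..n} \<Longrightarrow> Y (C (xbar n i) (ybar n i)) k = (2 - of_nat n) * \<nu> * X (xbar n i) k"
    using inv_tensor_unique[OF n3 bracket_tensor[OF xbar_props ybar_props Y_props]] by blast
  show ?thesis
  proof (rule exI[of _ \<mu>], rule exI[of _ \<nu>], intro conjI ballI impI)
    fix i j assume ij: "i \<in> {1..n}" "j \<in> {1..n}" "i \<noteq> j"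
    show "C (xbar n i) (ybar n j) = pair_vec n \<mu> \<nu> i j"
      by (rule doubled_std_eqI[OF n0 range[OF xbar_props(1)[OF ij(1)] ybar_props(1)[OF ij(2)]] pair_vec_doubled_std[OF ij(1,2)]])
         (simp_all only: \<mu>(1)[OF ij(1,2) _ ij(3)] \<nu>(1)[OF ij(1,2) _ ij(3)], simp_all add: pair_vec_def lookup_add lookup_bars)
  next
    fix i assume i: "i \<in> {1..n}"
    have "(2 - of_nat n) *\<^sub>c (\<mu> *\<^sub>c xbar n i + \<nu> *\<^sub>c ybar n i) \<in> V"
      using i by (intro V_closed xbar_props ybar_props)
    then show "C (xbar n i) (ybar n i) = (2 - of_nat n) *\<^sub>c (\<mu> *\<^sub>c xbar n i + \<nu> *\<^sub>c ybar n i)"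
      by (rule doubled_std_eqI[OF n0 range[OF xbar_props(1)[OF i] ybar_props(1)[OF i]]])
         (simp_all only: \<mu>(2)[OF i] \<nu>(2)[OF i], simp_all add: lookup_add lookup_bars)
  qed
qed

text \<open>The brackets of two \<open>x\<close> and of two \<open>y\<close> are zero, and the mixed ones have parameters \<open>\<mu>\<close> and \<open>\<nu>\<close>.  The Jacobi identity
  for \<open>x\<^sub>1, x\<^sub>2, y\<^sub>3\<close> then involves \<open>\<nu>\<close> only as a factor and gives \<open>\<nu> = 0\<close>; the one for \<open>y\<^sub>1, y\<^sub>2, x\<^sub>3\<close> gives \<open>\<mu> = 0\<close>.\<close>

lemma lie_zero:
  assumes jac: "\<And>v1 v2 v3. v1 \<in> V \<Longrightarrow> v2 \<in> V \<Longrightarrow> v3 \<in> V \<Longrightarrow> alt3_sum (\<lambda>v1 v2 v3. C v1 (C v2 v3)) v1 v2 v3 = 0"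
    and uv: "u \<in> V" "v \<in> V"
  shows "C u v = 0"
proof -
  obtain \<mu> \<nu> where mixed: "\<And>i j. i \<in> {1..n} \<Longrightarrow> j \<in> {1..n} \<Longrightarrow> i \<noteq> j \<Longrightarrow> C (xbar n i) (ybar n j) = pair_vec n \<mu> \<nu> i j"
    "\<And>i. i \<in> {1..n} \<Longrightarrow> C (xbar n i) (ybar n i) = (2 - of_nat n) *\<^sub>c (\<mu> *\<^sub>c xbar n i + \<nu> *\<^sub>c ybar n i)"
    using mixed_type by blast
  have N: "1 \<in> {1..n}" "2 \<in> {1..n}" "3 \<in> {1..n}" using n3 by auto
  note b = xbar_props(1)[OF N(1)] xbar_props(1)[OF N(2)] xbar_props(1)[OF N(3)]
    ybar_props(1)[OF N(1)] ybar_props(1)[OF N(2)] ybar_props(1)[OF N(3)]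
  have xy: "C (xbar n i) (pair_vec n \<mu> \<nu> j k) = \<nu> *\<^sub>c (C (xbar n i) (ybar n j) + C (xbar n i) (ybar n k))"
    if "i \<in> {1..n}" "j \<in> {1..n}" "k \<in> {1..n}" for i j k
    using that unfolding pair_vec_def
    by (simp add: add_right scale_right same_type_zero xbar_props ybar_props V_closed del: atLeastAtMost_iff)
  have yx: "C (ybar n i) (pair_vec n \<mu> \<nu> j k) = - (\<mu> *\<^sub>c (C (xbar n j) (ybar n i) + C (xbar n k) (ybar n i)))"
    if "i \<in> {1..n}" "j \<in> {1..n}" "k \<in> {1..n}" for i j k
    using that skew[of "ybar n i" "xbar n j"] skew[of "ybar n i" "xbar n k"] unfolding pair_vec_def
    by (simp add: add_right scale_right same_type_zero xbar_props ybar_props V_closed cvs.scale_right_distrib del: atLeastAtMost_iff)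
  have sk: "C (ybar n i) (xbar n j) = - pair_vec n \<mu> \<nu> j i" if "i \<in> {1..n}" "j \<in> {1..n}" "i \<noteq> j" for i j
    using skew[of "ybar n i" "xbar n j"] that mixed(1)[of j i] by (simp add: xbar_props ybar_props del: atLeastAtMost_iff)
  have nr: "C v (- pair_vec n \<mu> \<nu> j k) = - C v (pair_vec n \<mu> \<nu> j k)" if "v \<in> V" "j \<in> {1..n}" "k \<in> {1..n}" for v j k
    using neg_right[OF pair_vec_doubled_std[OF that(2,3)] that(1)] .
  have "\<nu> = 0"
  proof -
    have "C (xbar n 1) (pair_vec n \<mu> \<nu> 2 3) - C (xbar n 2) (pair_vec n \<mu> \<nu> 1 3) = 0"
      using jac[OF b(1,2,6)] N b
      by (simp add: alt3_sum_def mixed sk nr same_type_zero zero_right del: atLeastAtMost_iff)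
    then have "\<nu> *\<^sub>c (pair_vec n \<mu> \<nu> 1 2 + pair_vec n \<mu> \<nu> 1 3 - (pair_vec n \<mu> \<nu> 2 1 + pair_vec n \<mu> \<nu> 2 3)) = 0"
      using N by (simp add: xy mixed cvs.scale_right_diff_distrib del: atLeastAtMost_iff)
    from arg_cong[OF this, of "\<lambda>v. Y v 1"] show ?thesis
      using n3 by (simp add: pair_vec_def lookup_add lookup_minus lookup_bars algebra_simps)
  qed
  moreover have "\<mu> = 0"
  proof -
    have "C (ybar n 1) (pair_vec n \<mu> \<nu> 3 2) - C (ybar n 2) (pair_vec n \<mu> \<nu> 3 1) = 0"
      using jac[OF b(4,5,3)] N b
      by (simp add: alt3_sum_def mixed sk nr same_type_zero zero_right del: atLeastAtMost_iff)
    then have "\<mu> *\<^sub>c (pair_vec n \<mu> \<nu> 3 1 + pair_vec n \<mu> \<nu> 2 1 - (pair_vec n \<mu> \<nu> 3 2 + pair_vec n \<mu> \<nu> 1 2)) = 0"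
      using N by (simp add: yx mixed cvs.scale_right_diff_distrib algebra_simps del: atLeastAtMost_iff)
    from arg_cong[OF this, of "\<lambda>v. X v 1"] show ?thesis
      using n3 by (simp add: pair_vec_def lookup_add lookup_minus lookup_bars algebra_simps)
  qed
  ultimately have "C (xbar n i) (ybar n j) = 0" if "i \<in> {1..n}" "j \<in> {1..n}" for i j
    using mixed that by (cases "i = j") (simp_all add: pair_vec_def del: atLeastAtMost_iff)
  then show ?thesis
    by (intro eq_zeroI[OF poly_eq_neg _ _ _ _ uv]) (simp_all add: same_type_zero V_closed del: atLeastAtMost_iff)
qed

end


section \<open>Forms compatible with a group element\<close>

text \<open>A basis of the plane moved by the transposition of \<open>i\<close> and \<open>j\<close>, scaled such that \<open>xy_minor i j\<close> is \<open>1\<close> on it.\<close>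

definition x_half_diff :: "nat \<Rightarrow> nat \<Rightarrow> nat \<Rightarrow> xy_space" where "x_half_diff n i j = (1/2) *\<^sub>c (xbar n i - xbar n j)"
definition y_half_diff :: "nat \<Rightarrow> nat \<Rightarrow> nat \<Rightarrow> xy_space" where "y_half_diff n i j = (1/2) *\<^sub>c (ybar n i - ybar n j)"

lemma half_diff_V: "i \<in> {1..n} \<Longrightarrow> j \<in> {1..n} \<Longrightarrow> x_half_diff n i j \<in> doubled_std n"
  "i \<in> {1..n} \<Longrightarrow> j \<in> {1..n} \<Longrightarrow> y_half_diff n i j \<in> doubled_std n"
  unfolding x_half_diff_def y_half_diff_def
  by (intro cvs.subspace_scale cvs.subspace_diff subspace_doubled_std bars_doubled_std; assumption)+

lemma half_diff_perm: "h permutes {1..n} \<Longrightarrow> perm_act h (x_half_diff n i j) = x_half_diff n (h i) (h j)"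
  "h permutes {1..n} \<Longrightarrow> perm_act h (y_half_diff n i j) = y_half_diff n (h i) (h j)"
  by (simp_all add: x_half_diff_def y_half_diff_def perm_act_cscale perm_act_diff perm_act_bars)

lemma half_diff_neg: "x_half_diff n j i = - x_half_diff n i j" "y_half_diff n j i = - y_half_diff n i j"
  by (simp_all add: x_half_diff_def y_half_diff_def cvs.scale_right_diff_distrib)

lemma half_diff_coords:
  assumes "i \<in> {1..n}" "j \<in> {1..n}" "i \<noteq> j"
  shows "X (x_half_diff n i j) i - X (x_half_diff n i j) j = 1" "Y (x_half_diff n i j) i - Y (x_half_diff n i j) j = 0"
    "X (y_half_diff n i j) i - X (y_half_diff n i j) j = 0" "Y (y_half_diff n i j) i - Y (y_half_diff n i j) j = 1"
  using assms by (simp_all add: x_half_diff_def y_half_diff_def lookup_minus lookup_bars)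

lemma xy_minor_half_diff: "i \<in> {1..n} \<Longrightarrow> j \<in> {1..n} \<Longrightarrow> i \<noteq> j \<Longrightarrow> xy_minor i j (x_half_diff n i j) (y_half_diff n i j) = 1"
  by (simp add: xy_minor_def half_diff_coords)

lemma sum3: "a \<noteq> b \<Longrightarrow> a \<noteq> c \<Longrightarrow> b \<noteq> c \<Longrightarrow> (\<Sum>v\<in>{a, b, c}. f v) = f a + f b + f c"
  by (simp add: add.assoc)

text \<open>This condition arises twice: for the linear part of a Drinfeld orbifold algebra map, evaluated at a fixed point of
  \<open>g\<close>, and for the difference of two constant parts with the same linear part.\<close>

locale compatible_form = skew_form n "(*)" UNIV C for n C +
  fixes g :: "nat \<Rightarrow> nat"
  assumes g: "g permutes {1..n}"
    and compatible: "\<And>v1 v2 v3. v1 \<in> doubled_std n \<Longrightarrow> v2 \<in> doubled_std n \<Longrightarrow> v3 \<in> doubled_std n \<Longrightarrow>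
          alt3_sum (\<lambda>v1 v2 v3. C v2 v3 *\<^sub>c (perm_act g v1 - v1)) v1 v2 v3 = 0"
begin

text \<open>The vector \<open>g v - v\<close> lies in a plane and is determined by \<open>X v i - X v j\<close> and \<open>Y v i - Y v j\<close>.  The condition, read in
  these two coordinates and with arguments from the dual basis of the plane, expresses \<open>C\<close> by its value on that basis.\<close>

lemma transposition_form:
  assumes ij: "i \<in> {1..n}" "j \<in> {1..n}" "i \<noteq> j" and gij: "g = swp i j" and uv: "u \<in> V" "v \<in> V"
  shows "C u v = xy_minor i j u v * C (x_half_diff n i j) (y_half_diff n i j)"
proof -
  let ?p = "x_half_diff n i j" and ?q = "y_half_diff n i j"
  have pq: "?p \<in> V" "?q \<in> V" using half_diff_V ij by auto
  have inj: "inj (swp i j)" by (rule inj_transpose)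
  have e: "X (perm_act g v - v) i = - (X v i - X v j)" "Y (perm_act g v - v) i = - (Y v i - Y v j)" for v
    using lookup_perm_act[OF inj, of v j] by (simp_all add: gij lookup_minus)
  have x: "C v2 v3 * (X v1 i - X v1 j) + C v3 v1 * (X v2 i - X v2 j) + C v1 v2 * (X v3 i - X v3 j) = 0"
    and y: "C v2 v3 * (Y v1 i - Y v1 j) + C v3 v1 * (Y v2 i - Y v2 j) + C v1 v2 * (Y v3 i - Y v3 j) = 0"
    if "v1 \<in> V" "v2 \<in> V" "v3 \<in> V" for v1 v2 v3
  proof -
    let ?A = "alt3_sum (\<lambda>v1 v2 v3. C v2 v3 *\<^sub>c (perm_act g v1 - v1)) v1 v2 v3"
    have eqs: "C v2 v3 * (X v1 i - X v1 j) + C v3 v1 * (X v2 i - X v2 j) + C v1 v2 * (X v3 i - X v3 j) = - X ?A i"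
      "C v2 v3 * (Y v1 i - Y v1 j) + C v3 v1 * (Y v2 i - Y v2 j) + C v1 v2 * (Y v3 i - Y v3 j) = - Y ?A i"
      by (simp_all only: alt3_sum_def lookup_add lookup_cscale e) (simp_all add: algebra_simps)
    show "C v2 v3 * (X v1 i - X v1 j) + C v3 v1 * (X v2 i - X v2 j) + C v1 v2 * (X v3 i - X v3 j) = 0"
      "C v2 v3 * (Y v1 i - Y v1 j) + C v3 v1 * (Y v2 i - Y v2 j) + C v1 v2 * (Y v3 i - Y v3 j) = 0"
      unfolding eqs compatible[OF that] by simp_all
  qed
  have 1: "C ?p w = (Y w i - Y w j) * C ?p ?q" if "w \<in> V" for w
    using y[OF pq(1) that pq(2)] skew[OF pq(2,1)] by (simp add: half_diff_coords[OF ij] algebra_simps eq_neg_iff_add_eq_0)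
  have "C u v + C v ?p * (X u i - X u j) + C ?p u * (X v i - X v j) = 0"
    using x[OF pq(1) uv] by (simp add: half_diff_coords[OF ij])
  then have "C u v = C ?p v * (X u i - X u j) - C ?p u * (X v i - X v j)"
    using skew[OF uv(2) pq(1)] by (simp add: algebra_simps eq_neg_iff_add_eq_0)
  then show ?thesis unfolding 1[OF uv(1)] 1[OF uv(2)] by (simp add: xy_minor_def algebra_simps)
qed

text \<open>If \<open>C u v \<noteq> 0\<close>, the condition writes every \<open>g w - w\<close> as a combination of \<open>g u - u\<close> and \<open>g v - v\<close>.  But the image of
  \<open>g - 1\<close> has dimension at least three: \<open>g\<close> moves a point \<open>i\<close>, and some \<open>j\<close> other than \<open>i\<close> and \<open>g i\<close>, and then the images
  of \<open>x\<^sub>i\<close>, \<open>x\<^sub>j\<close> and \<open>y\<^sub>i\<close> are independent.\<close>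

lemma other_form:
  assumes gid: "g \<noteq> id" and gt: "\<And>i j. i \<in> {1..n} \<Longrightarrow> j \<in> {1..n} \<Longrightarrow> i \<noteq> j \<Longrightarrow> g \<noteq> swp i j"
    and uv: "u \<in> V" "v \<in> V"
  shows "C u v = 0"
proof (rule ccontr)
  assume nz: "C u v \<noteq> 0"
  obtain i where i: "g i \<noteq> i" using gid by (auto simp: fun_eq_iff)
  have inj: "g x = g y \<longleftrightarrow> x = y" for x y using permutes_inj[OF g] by (simp add: inj_eq)
  have mem: "x \<in> {1..n}" if "g x \<noteq> x" for x using that g by (auto simp: permutes_def)
  have iN: "i \<in> {1..n}" "g i \<in> {1..n}" using mem[OF i] permutes_in_image[OF g] by auto
  have "\<exists>j. g j \<noteq> j \<and> j \<noteq> i \<and> j \<noteq> g i"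
  proof (rule ccontr)
    assume "\<not> (\<exists>j. g j \<noteq> j \<and> j \<noteq> i \<and> j \<noteq> g i)"
    then have out: "g x = x" if "x \<noteq> i" "x \<noteq> g i" for x using that by blast
    have "g (g i) = i" using out[of "g (g i)"] i inj by metis
    then have "g = swp i (g i)" using out by (auto simp: fun_eq_iff Transposition.transpose_def)
    with gt[OF iN] i show False by metis
  qed
  then obtain j where j: "g j \<noteq> j" "j \<noteq> i" "j \<noteq> g i" by blast
  have jN: "j \<in> {1..n}" "g j \<in> {1..n}" using mem[OF j(1)] permutes_in_image[OF g] by auto
  let ?e = "\<lambda>v. perm_act g v - v"
  let ?E1 = "?e (xbar n i)" and ?E2 = "?e (xbar n j)" and ?E3 = "?e (ybar n i)"
  have c: "X ?E1 i = -1" "X ?E2 j = -1" "X ?E1 j = 0" "Y ?E1 i = 0" "Y ?E2 i = 0" "Y ?E3 i = -1" "X ?E3 j = 0" "X ?E3 i = 0"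
    using i j iN jN by (simp_all add: perm_act_bars[OF g] lookup_minus lookup_bars when_def)
  have ne: "?E1 \<noteq> ?E2" "?E1 \<noteq> ?E3" "?E2 \<noteq> ?E3"
  proof -
    show "?E1 \<noteq> ?E2" using c(2,3) by auto
    show "?E1 \<noteq> ?E3" using c(4,6) by auto
    show "?E2 \<noteq> ?E3" using c(5,6) by auto
  qed
  have "\<not> cvs.dependent {?E1, ?E2, ?E3}"
  proof
    assume "cvs.dependent {?E1, ?E2, ?E3}"
    then obtain t where t: "t ?E1 \<noteq> 0 \<or> t ?E2 \<noteq> 0 \<or> t ?E3 \<noteq> 0" "(\<Sum>v\<in>{?E1, ?E2, ?E3}. t v *\<^sub>c v) = 0"
      by (subst (asm) cvs.dependent_finite) auto
    have s: "t ?E1 *\<^sub>c ?E1 + t ?E2 *\<^sub>c ?E2 + t ?E3 *\<^sub>c ?E3 = 0"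
      using t(2) unfolding sum3[OF ne] .
    have "t ?E3 = 0" using arg_cong[OF s, of "\<lambda>v. Y v i"] by (simp only: lookup_add lookup_cscale c) simp
    moreover have "t ?E2 = 0" using arg_cong[OF s, of "\<lambda>v. X v j"] by (simp only: lookup_add lookup_cscale c) simp
    moreover have "t ?E1 = 0"
      using arg_cong[OF s, of "\<lambda>v. X v i"] calculation by (simp only: lookup_add lookup_cscale c) simp
    ultimately show False using t(1) by simp
  qed
  moreover have span: "?e w \<in> cvs.span {?e u, ?e v}" if w: "w \<in> V" for w
  proof -
    have "C u v *\<^sub>c ?e w + C v w *\<^sub>c ?e u + C w u *\<^sub>c ?e v = 0"
      using compatible[OF w uv] by (simp add: alt3_sum_def)
    then have "C u v *\<^sub>c ?e w = - (C v w *\<^sub>c ?e u + C w u *\<^sub>c ?e v)"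
      by (simp only: add.assoc eq_neg_iff_add_eq_0)
    then have "C u v *\<^sub>c ?e w = (- C v w) *\<^sub>c ?e u + (- C w u) *\<^sub>c ?e v"
      by (simp only: cvs.scale_minus_left minus_add_distrib)
    then have "(1 / C u v) *\<^sub>c (C u v *\<^sub>c ?e w) = (1 / C u v) *\<^sub>c ((- C v w) *\<^sub>c ?e u + (- C w u) *\<^sub>c ?e v)" by simp
    then have "?e w = (1 / C u v) *\<^sub>c ((- C v w) *\<^sub>c ?e u + (- C w u) *\<^sub>c ?e v)" using nz by simp
    also have "\<dots> \<in> cvs.span {?e u, ?e v}"
      by (intro cvs.span_scale cvs.span_add cvs.span_base) auto
    finally show ?thesis .
  qed
  then have "{?E1, ?E2, ?E3} \<subseteq> cvs.span {?e u, ?e v}" using bars_doubled_std iN jN by simp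
  ultimately have "card {?E1, ?E2, ?E3} \<le> card {?e u, ?e v}"
    using cvs.independent_span_bound[of "{?e u, ?e v}" "{?E1, ?E2, ?E3}"] by simp
  then show False using ne by (simp add: card_insert_if split: if_splits)
qed

end


section \<open>Drinfeld orbifold algebra maps for the symmetric group\<close>

lemma vec_eval_point_add: "vec_eval v (\<lambda>b. z b + z' b) = vec_eval v z + vec_eval v z'"
  by (simp add: lin_form_def distrib_left sum.distrib)

lemma vec_eval_delta: "vec_eval v (\<lambda>b. if b = k then 1 else 0) = Poly_Mapping.lookup v k"
proof -
  have "vec_eval v (\<lambda>b. if b = k then 1 else 0) = (\<Sum>b\<in>Poly_Mapping.keys v. if b = k then Poly_Mapping.lookup v k else 0)"
    unfolding lin_form_def by (rule sum.cong) auto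
  then show ?thesis by (simp add: sum.delta in_keys_iff)
qed

text \<open>A fixed vector is detected by its values at fixed points, in particular at its own complex conjugate.\<close>

lemma fixed_vector_zero:
  assumes g: "inj g" and fixed: "perm_act g w = w" and zero: "\<And>z. perm_pt g z = z \<Longrightarrow> vec_eval w z = 0"
  shows "w = 0"
proof -
  define z where "z = (\<lambda>b. cnj (Poly_Mapping.lookup w b))"
  have "perm_pt g z = z"
  proof
    fix b show "perm_pt g z b = z b"
      using lookup_perm_act[OF g, of w] fixed by (cases b) (simp_all add: z_def)
  qed
  then have "vec_eval w z = 0" by (rule zero)
  then have "of_real (\<Sum>b\<in>Poly_Mapping.keys w. (cmod (Poly_Mapping.lookup w b))\<^sup>2) = (0::complex)"
    by (simp only: lin_form_def z_def complex_norm_square of_real_sum)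
  then have "(\<Sum>b\<in>Poly_Mapping.keys w. (cmod (Poly_Mapping.lookup w b))\<^sup>2) = 0"
    by (simp only: of_real_eq_0_iff)
  then have "\<forall>b\<in>Poly_Mapping.keys w. Poly_Mapping.lookup w b = 0"
    by (simp add: sum_nonneg_eq_0_iff)
  then show ?thesis by (intro poly_mapping_eqI) (auto simp: in_keys_iff)
qed

locale sym_drinfeld =
  fixes n :: nat and \<kappa>L :: "(nat \<Rightarrow> nat) \<Rightarrow> xy_space \<Rightarrow> xy_space \<Rightarrow> xy_space"
    and \<kappa>C :: "(nat \<Rightarrow> nat) \<Rightarrow> xy_space \<Rightarrow> xy_space \<Rightarrow> complex"
  assumes n3: "n \<ge> 3" and map: "drinfeld_orbifold_map (sym_group n) perm_act (doubled_std n) \<kappa>L \<kappa>C"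
begin

abbreviation V where "V \<equiv> doubled_std n"
abbreviation G where "G \<equiv> carrier (sym_group n)"

lemma G_iff: "g \<in> G \<longleftrightarrow> g permutes {1..n}"
  by (simp add: sym_group_carrier)

lemma conj_eq:
  assumes "g permutes {1..n}" "h permutes {1..n}"
  shows "h \<otimes>\<^bsub>sym_group n\<^esub> g \<otimes>\<^bsub>sym_group n\<^esub> inv\<^bsub>sym_group n\<^esub> h = h \<circ> g \<circ> inv' h"
  using assms by (simp add: sym_group_mult sym_group_inv_equality sym_group_carrier)

lemmas map_conditions = map[unfolded drinfeld_orbifold_map_def, THEN conjunct1]
  map[unfolded drinfeld_orbifold_map_def, THEN conjunct2, THEN conjunct1]
  map[unfolded drinfeld_orbifold_map_def, THEN conjunct2, THEN conjunct2, THEN conjunct1]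
  map[unfolded drinfeld_orbifold_map_def, THEN conjunct2, THEN conjunct2, THEN conjunct2, THEN conjunct1]
  map[unfolded drinfeld_orbifold_map_def, THEN conjunct2, THEN conjunct2, THEN conjunct2, THEN conjunct2, THEN conjunct1]
  map[unfolded drinfeld_orbifold_map_def, THEN conjunct2, THEN conjunct2, THEN conjunct2, THEN conjunct2, THEN conjunct2, THEN conjunct1]
  map[unfolded drinfeld_orbifold_map_def, THEN conjunct2, THEN conjunct2, THEN conjunct2, THEN conjunct2, THEN conjunct2, THEN conjunct2, THEN conjunct1]
  map[unfolded drinfeld_orbifold_map_def, THEN conjunct2, THEN conjunct2, THEN conjunct2, THEN conjunct2, THEN conjunct2, THEN conjunct2, THEN conjunct2]

lemma L_form: "g permutes {1..n} \<Longrightarrow> skew_form n cscale V (\<kappa>L g)"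
  using map_conditions(1) by unfold_locales (simp_all add: linear_cochain_def sym_group_carrier cvs.scale_right_distrib)

lemma C_form: "g permutes {1..n} \<Longrightarrow> skew_form n (*) UNIV (\<kappa>C g)"
  using map_conditions(2) by unfold_locales (simp_all add: constant_cochain_def sym_group_carrier distrib_left)

lemma L_fixed: "g permutes {1..n} \<Longrightarrow> u \<in> V \<Longrightarrow> v \<in> V \<Longrightarrow> perm_act g (\<kappa>L g u v) = \<kappa>L g u v"
  using map_conditions(3) by (simp add: sym_group_carrier)

lemma L_invariant:
  assumes "g permutes {1..n}" "h permutes {1..n}" "u \<in> V" "v \<in> V"
  shows "perm_act h (\<kappa>L g u v) = \<kappa>L (h \<circ> g \<circ> inv' h) (perm_act h u) (perm_act h v)"
proof -
  have "perm_act h (\<kappa>L g u v) = \<kappa>L (h \<otimes>\<^bsub>sym_group n\<^esub> g \<otimes>\<^bsub>sym_group n\<^esub> inv\<^bsub>sym_group n\<^esub> h) (perm_act h u) (perm_act h v)"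
    by (rule bspec[OF bspec[OF bspec[OF bspec[OF map_conditions(4) assms(1)[folded G_iff]] assms(2)[folded G_iff]] assms(3)] assms(4)])
  then show ?thesis by (simp only: conj_eq[OF assms(1,2)])
qed

lemma C_invariant:
  assumes "g permutes {1..n}" "h permutes {1..n}" "u \<in> V" "v \<in> V"
  shows "\<kappa>C g u v = \<kappa>C (h \<circ> g \<circ> inv' h) (perm_act h u) (perm_act h v)"
proof -
  have "\<kappa>C g u v = \<kappa>C (h \<otimes>\<^bsub>sym_group n\<^esub> g \<otimes>\<^bsub>sym_group n\<^esub> inv\<^bsub>sym_group n\<^esub> h) (perm_act h u) (perm_act h v)"
    by (rule bspec[OF bspec[OF bspec[OF bspec[OF map_conditions(5) assms(1)[folded G_iff]] assms(2)[folded G_iff]] assms(3)] assms(4)])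
  then show ?thesis by (simp only: conj_eq[OF assms(1,2)])
qed

lemma linear_condition:
  assumes "g permutes {1..n}" "v1 \<in> V" "v2 \<in> V" "v3 \<in> V"
  shows "alt3_sum (\<lambda>v1 v2 v3. svec (\<kappa>L g v2 v3) * svec (perm_act g v1 - v1)) v1 v2 v3 = 0"
  by (rule bspec[OF bspec[OF bspec[OF bspec[OF map_conditions(6) assms(1)[folded G_iff]] assms(2)] assms(3)] assms(4)])

lemma vector_condition:
  assumes "g permutes {1..n}" "v1 \<in> V" "v2 \<in> V" "v3 \<in> V"
  shows "alt3_sum (\<lambda>v1 v2 v3. \<Sum>(x, y)\<in>factorizations (sym_group n) g. \<kappa>L x (v1 + perm_act y v1) (\<kappa>L y v2 v3)) v1 v2 v3 =
       2 *\<^sub>c alt3_sum (\<lambda>v1 v2 v3. \<kappa>C g v2 v3 *\<^sub>c (perm_act g v1 - v1)) v1 v2 v3"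
  by (rule bspec[OF bspec[OF bspec[OF bspec[OF map_conditions(7) assms(1)[folded G_iff]] assms(2)] assms(3)] assms(4)])

lemma scalar_condition:
  assumes "g permutes {1..n}" "v1 \<in> V" "v2 \<in> V" "v3 \<in> V"
  shows "alt3_sum (\<lambda>v1 v2 v3. \<Sum>(x, y)\<in>factorizations (sym_group n) g. \<kappa>C x (v1 + perm_act y v1) (\<kappa>L y v2 v3)) v1 v2 v3 = 0"
  by (rule bspec[OF bspec[OF bspec[OF bspec[OF map_conditions(8) assms(1)[folded G_iff]] assms(2)] assms(3)] assms(4)])

lemma finite_factorizations: "finite (factorizations (sym_group n) g)"
  by (rule finite_subset[of _ "G \<times> G"]) (auto simp: factorizations_def finite_sym_group)

lemma L_range: "g permutes {1..n} \<Longrightarrow> u \<in> V \<Longrightarrow> v \<in> V \<Longrightarrow> \<kappa>L g u v \<in> V"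
  using skew_form.range[OF L_form] .

lemma V_closed: "u \<in> V \<Longrightarrow> v \<in> V \<Longrightarrow> u + v \<in> V" "u \<in> V \<Longrightarrow> v \<in> V \<Longrightarrow> u - v \<in> V" "u \<in> V \<Longrightarrow> c *\<^sub>c u \<in> V" "0 \<in> V" "u \<in> V \<Longrightarrow> - u \<in> V"
  using skew_form.V_closed[OF L_form[OF permutes_id]] by blast+

text \<open>With \<open>\<kappa>L\<close> concentrated at the identity, the vector-valued quadratic condition at the identity is the Jacobi identity
  for \<open>\<kappa>L id\<close>.\<close>

lemma lie_part_zero:
  assumes lie: "supported_only_on (sym_group n) V \<kappa>L {\<one>\<^bsub>sym_group n\<^esub>}"
  shows "zero_cochain (sym_group n) V \<kappa>L"
proof -
  have off: "\<kappa>L g u v = 0" if "g permutes {1..n}" "g \<noteq> id" "u \<in> V" "v \<in> V" for g u v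
    using lie that by (auto simp: supported_only_on_def sym_group_carrier sym_group_one)
  note idp = permutes_id[of "{1..n}"]
  interpret i: skew_form n cscale V "\<kappa>L id" by (rule L_form[OF idp])
  interpret invariant_bracket n "\<kappa>L id"
  proof
    fix h u v assume h: "h permutes {1..n}" and uv: "u \<in> V" "v \<in> V"
    show "perm_act h (\<kappa>L id u v) = \<kappa>L id (perm_act h u) (perm_act h v)"
      using L_invariant[OF idp h uv] permutes_inv_o(1)[OF h] by simp
  qed (rule n3)
  have "alt3_sum (\<lambda>v1 v2 v3. \<kappa>L id v1 (\<kappa>L id v2 v3)) v1 v2 v3 = 0" if v: "v1 \<in> V" "v2 \<in> V" "v3 \<in> V" for v1 v2 v3
  proof -
    have F: "(\<Sum>(x, y)\<in>factorizations (sym_group n) id. \<kappa>L x (v1 + perm_act y v1) (\<kappa>L y v2 v3)) = 2 *\<^sub>c \<kappa>L id v1 (\<kappa>L id v2 v3)"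
      if v: "v1 \<in> V" "v2 \<in> V" "v3 \<in> V" for v1 v2 v3
    proof -
      have "(\<Sum>(x, y)\<in>factorizations (sym_group n) id. \<kappa>L x (v1 + perm_act y v1) (\<kappa>L y v2 v3))
        = (\<Sum>(x, y)\<in>{(id, id)}. \<kappa>L x (v1 + perm_act y v1) (\<kappa>L y v2 v3))"
      proof (rule sum.mono_neutral_right[OF finite_factorizations], goal_cases)
        case 1
        then show ?case by (simp add: factorizations_def sym_group_carrier sym_group_mult permutes_id)
      next
        case 2
        show ?case
        proof
          fix r assume r: "r \<in> factorizations (sym_group n) id - {(id, id)}"
          obtain x y where r_def: "r = (x, y)" by (cases r)
          from r have xy: "(x, y) \<in> factorizations (sym_group n) id" "(x, y) \<notin> {(id, id)}"
            by (simp_all add: r_def)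
          then have p: "x permutes {1..n}" "y permutes {1..n}" "x \<circ> y = id"
            by (auto simp: factorizations_def sym_group_carrier sym_group_mult)
          then have "y \<noteq> id" using xy(2) by auto
          then have "\<kappa>L y v2 v3 = 0" using off p v by blast
          moreover have "v1 + perm_act y v1 \<in> V" using v perm_act_doubled_std[OF p(2)] V_closed by blast
          ultimately show "(case r of (x, y) \<Rightarrow> \<kappa>L x (v1 + perm_act y v1) (\<kappa>L y v2 v3)) = 0"
            using skew_form.zero_right[OF L_form[OF p(1)]] by (simp add: r_def)
        qed
      qed
      also have "\<dots> = \<kappa>L id (2 *\<^sub>c v1) (\<kappa>L id v2 v3)"
        using cvs.scale_left_distrib[of 1 1 v1] by (simp add: perm_act_id)
      finally show ?thesis using i.scale_left[OF v(1) i.range[OF v(2,3)]] by simp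
    qed
    have "2 *\<^sub>c alt3_sum (\<lambda>v1 v2 v3. \<kappa>L id v1 (\<kappa>L id v2 v3)) v1 v2 v3 = 0"
      using vector_condition[OF idp v] v
      by (simp add: alt3_sum_def F perm_act_id cvs.scale_right_distrib)
    then show ?thesis by simp
  qed
  then have "\<kappa>L id u v = 0" if "u \<in> V" "v \<in> V" for u v by (rule lie_zero[OF _ that])
  then have "\<kappa>L g u v = 0" if "g permutes {1..n}" "u \<in> V" "v \<in> V" for g u v
    using off[OF that(1) _ that(2,3)] that by (cases "g = id") simp_all
  then show ?thesis by (simp add: zero_cochain_def G_iff)
qed

text \<open>A point \<open>z\<close> fixed by \<open>g\<close> is a zero of every \<open>g v - v\<close>.  So the quadratic polynomial of the linear condition has, at
  \<open>z + z'\<close>, only the mixed term in addition to its value at \<open>z'\<close>.\<close>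

lemma fixed_value_form:
  assumes g: "g permutes {1..n}" and z: "perm_pt g z = z"
  shows "compatible_form n (\<lambda>u v. vec_eval (\<kappa>L g u v) z) g"
proof -
  interpret k: skew_form n cscale V "\<kappa>L g" by (rule L_form[OF g])
  have sk: "vec_eval (\<kappa>L g u v) z = - vec_eval (\<kappa>L g v u) z" if "u \<in> V" "v \<in> V" for u v
    using k.skew[OF that] by (simp only: lin_form_uminus)
  show ?thesis
  proof unfold_locales
    show "skew_bilinear_on V (*) UNIV (\<lambda>u v. vec_eval (\<kappa>L g u v) z)"
      unfolding skew_bilinear_on_def
    proof (intro conjI ballI allI)
      fix u v assume uv: "u \<in> V" "v \<in> V"
      show "vec_eval (\<kappa>L g u v) z \<in> UNIV" by simp
      show "vec_eval (\<kappa>L g u v) z = - vec_eval (\<kappa>L g v u) z" by (rule sk[OF uv])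
    qed (simp_all add: k.add_left k.scale_left lin_form_add lin_form_cscale)
    show "g permutes {1..n}" by (rule g)
    fix v1 v2 v3 assume v: "v1 \<in> V" "v2 \<in> V" "v3 \<in> V"
    let ?e = "\<lambda>v. perm_act g v - v" and ?E = "\<lambda>y. \<lambda>v1 v2 v3. vec_eval (\<kappa>L g v2 v3) y *\<^sub>c (perm_act g v1 - v1)"
    have e0: "vec_eval (?e v) z = 0" for v by (simp add: lin_form_diff vec_eval_perm_act z)
    have q: "alt3_sum (\<lambda>v1 v2 v3. vec_eval (\<kappa>L g v2 v3) y * vec_eval (?e v1) y) v1 v2 v3 = 0" for y
      using arg_cong[OF linear_condition[OF g v], of "\<lambda>p. poly_eval p y"]
      by (simp only: alt3_sum_def poly_eval_add poly_eval_times poly_eval_svec poly_eval_zero)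
    have T: "vec_eval (alt3_sum (?E z) v1 v2 v3) z' = 0" for z'
    proof -
      have "vec_eval (alt3_sum (?E z) v1 v2 v3) z'
        = alt3_sum (\<lambda>v1 v2 v3. vec_eval (\<kappa>L g v2 v3) (\<lambda>b. z b + z' b) * vec_eval (?e v1) (\<lambda>b. z b + z' b)) v1 v2 v3
        - alt3_sum (\<lambda>v1 v2 v3. vec_eval (\<kappa>L g v2 v3) z' * vec_eval (?e v1) z') v1 v2 v3"
        by (simp only: alt3_sum_def lin_form_add lin_form_cscale vec_eval_point_add e0) (simp add: algebra_simps)
      then show ?thesis by (simp only: q) simp
    qed
    show "alt3_sum (?E z) v1 v2 v3 = 0"
    proof (rule poly_mapping_eqI)
      fix k show "Poly_Mapping.lookup (alt3_sum (?E z) v1 v2 v3) k = Poly_Mapping.lookup 0 k"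
        using T[of "\<lambda>b. if b = k then 1 else 0"] unfolding vec_eval_delta by simp
    qed
  qed (simp add: distrib_left)
qed

text \<open>Since \<open>\<kappa>L g u v\<close> is fixed by \<open>g\<close>, it is determined by its values at the fixed points.\<close>

lemma L_other:
  assumes g: "g permutes {1..n}" "g \<noteq> id" "\<And>i j. i \<in> {1..n} \<Longrightarrow> j \<in> {1..n} \<Longrightarrow> i \<noteq> j \<Longrightarrow> g \<noteq> swp i j"
    and uv: "u \<in> V" "v \<in> V"
  shows "\<kappa>L g u v = 0"
  by (rule fixed_vector_zero[OF permutes_inj[OF g(1)] L_fixed[OF g(1) uv]])
     (rule compatible_form.other_form[OF fixed_value_form[OF g(1)] g(2,3) uv])

lemma L_transposition:
  assumes ij: "i \<in> {1..n}" "j \<in> {1..n}" "i \<noteq> j" and uv: "u \<in> V" "v \<in> V"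
  shows "\<kappa>L (swp i j) u v = xy_minor i j u v *\<^sub>c \<kappa>L (swp i j) (x_half_diff n i j) (y_half_diff n i j)"
proof -
  have g: "swp i j permutes {1..n}" using ij by (intro permutes_swap_id)
  note pq = half_diff_V[OF ij(1,2)]
  have "\<kappa>L (swp i j) u v - xy_minor i j u v *\<^sub>c \<kappa>L (swp i j) (x_half_diff n i j) (y_half_diff n i j) = 0"
  proof (rule fixed_vector_zero[OF permutes_inj[OF g]])
    show "perm_act (swp i j) (\<kappa>L (swp i j) u v - xy_minor i j u v *\<^sub>c \<kappa>L (swp i j) (x_half_diff n i j) (y_half_diff n i j))
      = \<kappa>L (swp i j) u v - xy_minor i j u v *\<^sub>c \<kappa>L (swp i j) (x_half_diff n i j) (y_half_diff n i j)"
      by (simp only: perm_act_diff perm_act_cscale L_fixed[OF g uv] L_fixed[OF g pq])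
    fix z assume z: "perm_pt (swp i j) z = z"
    show "vec_eval (\<kappa>L (swp i j) u v - xy_minor i j u v *\<^sub>c \<kappa>L (swp i j) (x_half_diff n i j) (y_half_diff n i j)) z = 0"
      using compatible_form.transposition_form[OF fixed_value_form[OF g z] ij refl uv]
      by (simp add: lin_form_diff lin_form_cscale)
  qed
  then show ?thesis by simp
qed

end

lemma swp_eq_swp_iff:
  assumes "i \<noteq> j"
  shows "swp i j = swp p q \<longleftrightarrow> (p = i \<and> q = j) \<or> (p = j \<and> q = i)"
proof
  assume e: "swp i j = swp p q"
  from fun_cong[OF e, of i] fun_cong[OF e, of j] assms
  show "(p = i \<and> q = j) \<or> (p = j \<and> q = i)"
    by (auto simp: Transposition.transpose_def split: if_splits)
qed (auto simp: transpose_commute)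

lemma sum_pairs_swp:
  fixes f :: "nat \<Rightarrow> nat \<Rightarrow> 'w::comm_monoid_add"
  assumes "i \<in> {1..n}" "j \<in> {1..n}" "i \<noteq> j"
  shows "(\<Sum>p\<in>{1..n}. \<Sum>q\<in>{1..n}. f p q when swp i j = swp p q) = f i j + f j i"
proof -
  have "(\<Sum>p\<in>{1..n}. \<Sum>q\<in>{1..n}. f p q when swp i j = swp p q)
      = (\<Sum>p\<in>{1..n}. \<Sum>q\<in>{1..n}. (if q = j then if p = i then f i j else 0 else 0) + (if q = i then if p = j then f j i else 0 else 0))"
    unfolding swp_eq_swp_iff[OF assms(3)] using assms(3) by (intro sum.cong refl) (auto simp: when_def)
  also have "\<dots> = (\<Sum>p\<in>{1..n}. (if p = i then f i j else 0) + (if p = j then f j i else 0))"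
    using assms(1,2) by (intro sum.cong refl) (simp add: sum.distrib sum.delta del: atLeastAtMost_iff)
  also have "\<dots> = f i j + f j i"
    using assms(1,2) by (simp add: sum.distrib sum.delta del: atLeastAtMost_iff)
  finally show ?thesis .
qed

lemma sum_pairs_other:
  fixes f :: "nat \<Rightarrow> nat \<Rightarrow> 'w::comm_monoid_add"
  assumes "\<And>i j. i \<in> {1..n} \<Longrightarrow> j \<in> {1..n} \<Longrightarrow> i \<noteq> j \<Longrightarrow> g \<noteq> swp i j" "\<And>i. f i i = 0"
  shows "(\<Sum>p\<in>{1..n}. \<Sum>q\<in>{1..n}. f p q when g = swp p q) = 0"
proof -
  have "(f p q when g = swp p q) = 0" if "p \<in> {1..n}" "q \<in> {1..n}" for p q
    using assms(1)[OF that] assms(2)[of p] by (cases "p = q") simp_all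
  then show ?thesis by (simp del: atLeastAtMost_iff)
qed

lemma family_L_swp:
  assumes "i \<in> {1..n}" "j \<in> {1..n}" "i \<noteq> j"
  shows "family_L n a b (swp i j) u v = xy_minor i j u v *\<^sub>c ((- (of_nat n / 2)) *\<^sub>c pair_vec n a b i j)"
proof -
  have "pair_vec n a b j i = pair_vec n a b i j" by (simp add: pair_vec_def add.commute)
  then show ?thesis
    unfolding family_L_def sum_pairs_swp[OF assms] xy_minor_sym[of j i]
    by (simp add: cvs.scale_left_distrib[symmetric] algebra_simps)
qed

lemma family_L_other:
  assumes "\<And>i j. i \<in> {1..n} \<Longrightarrow> j \<in> {1..n} \<Longrightarrow> i \<noteq> j \<Longrightarrow> g \<noteq> swp i j"
  shows "family_L n a b g u v = 0"
  unfolding family_L_def by (rule sum_pairs_other[OF assms]) (simp_all add: xy_minor_diag)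

lemma family_C_swp:
  assumes "i \<in> {1..n}" "j \<in> {1..n}" "i \<noteq> j"
  shows "family_C n a b c (swp i j) u v = family_C n a b 0 (swp i j) u v + c * xy_minor i j u v"
  unfolding family_C_def sum_pairs_swp[OF assms] xy_minor_sym[of j i] by simp

text \<open>The stabilizer of \<open>{1, 2}\<close> has two orbits on \<open>{1..n}\<close>, so an invariant function with sum zero has one parameter.  The
  right-hand side is a multiple of the coordinates of \<open>x\<^sub>1 + x\<^sub>2\<close>.\<close>

lemma two_orbit_values:
  fixes f :: "nat \<Rightarrow> complex"
  assumes n: "n \<ge> 3" and "f 2 = f 1" "\<And>k. k \<in> {1..n} - {1, 2} \<Longrightarrow> f k = f 3"
    and s: "(\<Sum>k\<in>{1..n}. f k) = 0" and k: "k \<in> {1..n}"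
  shows "f k = (f 1 - f 3) * ((1 when k = 1) + (1 when k = 2) - 2 / of_nat n)"
proof -
  have "sum f {1..n} = f 1 + f 2 + (of_nat n - 2) * f 3"
    by (rule sum_split2[OF _ _ _ assms(3)]) (use n in auto)
  then have e: "2 * f 1 + (of_nat n - 2) * f 3 = 0" using s assms(2) by simp
  have n0: "of_nat n \<noteq> (0::complex)" using n by simp
  define d where "d = f 1 - f 3"
  have "of_nat n * f 1 = (of_nat n - 2) * d + (2 * f 1 + (of_nat n - 2) * f 3)"
    "of_nat n * f 3 = - 2 * d + (2 * f 1 + (of_nat n - 2) * f 3)" by (simp_all add: d_def algebra_simps)
  then have m: "of_nat n * f 1 = (of_nat n - 2) * d" "of_nat n * f 3 = - 2 * d"
    unfolding e by simp_all
  have div: "x = y / of_nat n" if "of_nat n * x = y" for x y :: complex using that n0 by auto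
  have v: "f 1 = d * (1 - 2 / of_nat n)" "f 3 = d * (- 2 / of_nat n)"
    unfolding div[OF m(1)] div[OF m(2)] using n0 by (simp_all add: field_simps)
  consider "k = 1" | "k = 2" | "k \<noteq> 1" "k \<noteq> 2" by blast
  then have "f k = d * ((1 when k = 1) + (1 when k = 2) - 2 / of_nat n)"
  proof cases
    case 3
    then have k12: "k \<in> {1..n} - {1, 2}" using k by simp
    have "f k = f 3" by (rule assms(3)[OF k12])
    then show ?thesis using 3 by (simp add: v(2))
  qed (simp_all add: assms(2) v(1) del: One_nat_def)
  then show ?thesis by (simp only: d_def)
qed

lemma pair_vec_cscale: "d *\<^sub>c pair_vec n a b i j = pair_vec n (d * a) (d * b) i j"
  by (simp add: pair_vec_def cvs.scale_right_distrib)

context sym_drinfeld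
begin

definition pair_value :: "nat \<Rightarrow> nat \<Rightarrow> xy_space" where "pair_value i j = \<kappa>L (swp i j) (x_half_diff n i j) (y_half_diff n i j)"

lemma pair_value_perm:
  assumes h: "h permutes {1..n}" and ij: "i \<in> {1..n}" "j \<in> {1..n}"
  shows "perm_act h (pair_value i j) = pair_value (h i) (h j)"
proof -
  have s: "swp i j permutes {1..n}" using ij by (intro permutes_swap_id)
  have "h \<circ> swp i j \<circ> inv' h = swp (h i) (h j)" using conj_eq_iff[OF h conj_swp[OF h]] by blast
  then show ?thesis using L_invariant[OF s h half_diff_V[OF ij]] by (simp add: pair_value_def half_diff_perm[OF h])
qed

lemma pair_value_V: "i \<in> {1..n} \<Longrightarrow> j \<in> {1..n} \<Longrightarrow> pair_value i j \<in> V"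
  unfolding pair_value_def by (intro L_range permutes_swap_id half_diff_V)

text \<open>The value for \<open>(1, 2)\<close> is invariant under the stabilizer of \<open>{1, 2}\<close>, hence a combination of \<open>x\<^sub>1 + x\<^sub>2\<close> and
  \<open>y\<^sub>1 + y\<^sub>2\<close>; the other values are its images.\<close>

lemma pair_value_eq_pair_vec:
  obtains a b where "\<And>i j. i \<in> {1..n} \<Longrightarrow> j \<in> {1..n} \<Longrightarrow> i \<noteq> j \<Longrightarrow> pair_value i j = (- (of_nat n / 2)) *\<^sub>c pair_vec n a b i j"
proof -
  let ?N = "{1..n}"
  have N: "1 \<in> ?N" "2 \<in> ?N" "3 \<in> ?N" using n3 by auto
  define w where "w = pair_value 1 2"
  have wV: "w \<in> V" unfolding w_def by (rule pair_value_V[OF N(1,2)])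
  define \<nu> where "\<nu> = X w 1 - X w 3"
  define \<mu> where "\<mu> = Y w 1 - Y w 3"
  have inj: "inj (swp p q)" for p q :: nat by (rule inj_transpose)
  have "perm_act (swp 1 2) w = w" unfolding w_def pair_value_def
    by (intro L_fixed permutes_swap_id half_diff_V N)
  then have 12: "X w 2 = X w 1" "Y w 2 = Y w 1"
    using lookup_perm_act[OF inj, of 1 2 w 1] by auto
  have k: "X w k = X w 3" "Y w k = Y w 3" if k: "k \<in> ?N - {1, 2}" for k
  proof -
    have "perm_act (swp 3 k) w = pair_value (swp 3 k 1) (swp 3 k 2)" unfolding w_def
      using N k by (intro pair_value_perm permutes_swap_id) simp_all
    also have "\<dots> = w" using k by (auto simp: w_def Transposition.transpose_def)
    finally show "X w k = X w 3" "Y w k = Y w 3"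
      using lookup_perm_act[OF inj, of 3 k w 3] by auto
  qed
  have w: "w = pair_vec n \<nu> \<mu> 1 2"
  proof (rule doubled_std_eqI[OF _ wV pair_vec_doubled_std[OF N(1,2)]])
    show "n > 0" using n3 by simp
    fix l assume l: "l \<in> {1..n}"
    show "X w l = X (pair_vec n \<nu> \<mu> 1 2) l"
      using two_orbit_values[OF n3 12(1) k(1) perm_act_V_sum(1)[OF wV] l] n3 l
      by (simp add: pair_vec_def lookup_add lookup_bars \<nu>_def)
    show "Y w l = Y (pair_vec n \<nu> \<mu> 1 2) l"
      using two_orbit_values[OF n3 12(2) k(2) perm_act_V_sum(2)[OF wV] l] n3 l
      by (simp add: pair_vec_def lookup_add lookup_bars \<mu>_def)
  qed
  have ij: "pair_value i j = pair_vec n \<nu> \<mu> i j" if ij: "i \<in> ?N" "j \<in> ?N" "i \<noteq> j" for i j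
  proof -
    obtain k where k: "k \<in> ?N" "k \<noteq> i" "k \<noteq> j" using third_index[OF n3] by blast
    then obtain h where h: "h permutes ?N" "h 1 = i" "h 2 = j"
      using permutation_of_three[OF n3 ij(1,2) k(1) ij(3)] by auto
    have "perm_act h w = pair_vec n \<nu> \<mu> i j" unfolding w pair_vec_perm[OF h(1)] h(2,3) ..
    then show ?thesis using pair_value_perm[OF h(1) N(1,2)] unfolding w_def h(2,3) by simp
  qed
  have "pair_vec n \<nu> \<mu> i j = (- (of_nat n / 2)) *\<^sub>c pair_vec n (- 2 * \<nu> / of_nat n) (- 2 * \<mu> / of_nat n) i j" for i j
    using n3 by (simp add: pair_vec_cscale)
  with ij show ?thesis by (intro that) simp
qed

lemma L_eq_family_L:
  assumes off: "supported_only_off (sym_group n) V \<kappa>L {\<one>\<^bsub>sym_group n\<^esub>}"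
  obtains a b where "\<And>g u v. g permutes {1..n} \<Longrightarrow> u \<in> V \<Longrightarrow> v \<in> V \<Longrightarrow> \<kappa>L g u v = family_L n a b g u v"
proof -
  obtain a b where pair_value: "\<And>i j. i \<in> {1..n} \<Longrightarrow> j \<in> {1..n} \<Longrightarrow> i \<noteq> j \<Longrightarrow> pair_value i j = (- (of_nat n / 2)) *\<^sub>c pair_vec n a b i j"
    using pair_value_eq_pair_vec by blast
  have "\<kappa>L g u v = family_L n a b g u v" if g: "g permutes {1..n}" and uv: "u \<in> V" "v \<in> V" for g u v
  proof (cases "g = id")
    case True
    have "\<kappa>L id u v = 0" using off uv permutes_id by (simp add: supported_only_off_def sym_group_one sym_group_carrier)
    then show ?thesis using True by (simp only: family_L_id)
  next
    case False
    show ?thesis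
    proof (cases "\<exists>i\<in>{1..n}. \<exists>j\<in>{1..n}. i \<noteq> j \<and> g = swp i j")
      case True
      then obtain i j where ij: "i \<in> {1..n}" "j \<in> {1..n}" "i \<noteq> j" and gij: "g = swp i j" by blast
      show ?thesis using L_transposition[OF ij uv] pair_value[OF ij] unfolding gij family_L_swp[OF ij] pair_value_def by simp
    next
      case no: False
      then have gt: "\<And>i j. i \<in> {1..n} \<Longrightarrow> j \<in> {1..n} \<Longrightarrow> i \<noteq> j \<Longrightarrow> g \<noteq> swp i j" by blast
      have "family_L n a b g u v = 0" by (rule family_L_other) (rule gt)
      moreover have "\<kappa>L g u v = 0" by (rule L_other[OF g False gt uv])
      ultimately show ?thesis by simp
    qed
  qed
  then show ?thesis by (rule that)
qed

end

lemma sym_drinfeld_family: "n \<ge> 3 \<Longrightarrow> sym_drinfeld n (family_L n a b) (family_C n a b c)"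
  by (intro sym_drinfeld.intro in_family_drinfeld(1)[OF _ family_in_family])

text \<open>For two Drinfeld orbifold algebra maps with the same linear part the terms of the quadratic conditions that involve
  \<open>\<kappa>L\<close> alone agree, and homogeneous conditions remain for the difference of the constant parts.  The second map will
  be a member of the family.\<close>

locale drinfeld_pair = sym_drinfeld n \<kappa>L \<kappa>C + other: sym_drinfeld n \<kappa>L' \<kappa>C'
  for n \<kappa>L \<kappa>C \<kappa>L' \<kappa>C' +
  assumes same: "\<And>g u v. g permutes {1..n} \<Longrightarrow> u \<in> doubled_std n \<Longrightarrow> v \<in> doubled_std n \<Longrightarrow> \<kappa>L g u v = \<kappa>L' g u v"
begin

definition \<delta> :: "(nat \<Rightarrow> nat) \<Rightarrow> xy_space \<Rightarrow> xy_space \<Rightarrow> complex"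
  where "\<delta> g u v = \<kappa>C g u v - \<kappa>C' g u v"

lemma \<delta>_form: assumes g: "g permutes {1..n}" shows "skew_form n (*) UNIV (\<delta> g)"
proof -
  interpret f: skew_form n "(*)" UNIV "\<kappa>C g" by (rule C_form[OF g])
  interpret f': skew_form n "(*)" UNIV "\<kappa>C' g" by (rule other.C_form[OF g])
  have s: "\<delta> g u v = - \<delta> g v u" if "u \<in> V" "v \<in> V" for u v
    unfolding \<delta>_def using f.skew[OF that] f'.skew[OF that] by (simp only:) simp
  show ?thesis
  proof unfold_locales
    show "skew_bilinear_on V (*) UNIV (\<delta> g)"
      unfolding skew_bilinear_on_def
    proof (intro conjI ballI allI)
      fix u v assume "u \<in> V" "v \<in> V"
      then show "\<delta> g u v = - \<delta> g v u" by (rule s)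
    qed (simp_all add: \<delta>_def f.add_left f'.add_left f.scale_left f'.scale_left algebra_simps)
  qed (simp add: distrib_left)
qed

lemma \<delta>_invariant:
  assumes "g permutes {1..n}" "h permutes {1..n}" "u \<in> V" "v \<in> V"
  shows "\<delta> g u v = \<delta> (h \<circ> g \<circ> inv' h) (perm_act h u) (perm_act h v)"
  unfolding \<delta>_def using C_invariant[OF assms] other.C_invariant[OF assms] by simp

lemma factorization_perm:
  "(x, y) \<in> factorizations (sym_group n) g \<Longrightarrow> x permutes {1..n} \<and> y permutes {1..n} \<and> x \<circ> y = g"
  by (simp add: factorizations_def sym_group_carrier sym_group_mult)

lemma args_V: "y permutes {1..n} \<Longrightarrow> v1 \<in> V \<Longrightarrow> v1 + perm_act y v1 \<in> V"
  by (intro V_closed perm_act_doubled_std)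

lemma \<delta>_compatible:
  assumes g: "g permutes {1..n}"
  shows "compatible_form n (\<delta> g) g"
proof -
  interpret sk: skew_form n "(*)" UNIV "\<delta> g" by (rule \<delta>_form[OF g])
  show ?thesis
  proof unfold_locales
    fix v1 v2 v3 assume v: "v1 \<in> V" "v2 \<in> V" "v3 \<in> V"
    have F: "(\<Sum>(x, y)\<in>factorizations (sym_group n) g. \<kappa>L x (v1 + perm_act y v1) (\<kappa>L y v2 v3))
        = (\<Sum>(x, y)\<in>factorizations (sym_group n) g. \<kappa>L' x (v1 + perm_act y v1) (\<kappa>L' y v2 v3))"
      if v: "v1 \<in> V" "v2 \<in> V" "v3 \<in> V" for v1 v2 v3
    proof (rule sum.cong[OF refl])
      fix r assume r: "r \<in> factorizations (sym_group n) g"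
      obtain x y where xy: "r = (x, y)" by (cases r)
      with r factorization_perm have p: "x permutes {1..n}" "y permutes {1..n}" by auto
      have "\<kappa>L x (v1 + perm_act y v1) (\<kappa>L y v2 v3) = \<kappa>L' x (v1 + perm_act y v1) (\<kappa>L' y v2 v3)"
        using same[OF p(1) args_V[OF p(2) v(1)] L_range[OF p(2) v(2,3)]] same[OF p(2) v(2,3)] by simp
      then show "(case r of (x, y) \<Rightarrow> \<kappa>L x (v1 + perm_act y v1) (\<kappa>L y v2 v3))
        = (case r of (x, y) \<Rightarrow> \<kappa>L' x (v1 + perm_act y v1) (\<kappa>L' y v2 v3))"
        by (simp add: xy)
    qed
    have "2 *\<^sub>c alt3_sum (\<lambda>v1 v2 v3. \<kappa>C g v2 v3 *\<^sub>c (perm_act g v1 - v1)) v1 v2 v3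
        = 2 *\<^sub>c alt3_sum (\<lambda>v1 v2 v3. \<kappa>C' g v2 v3 *\<^sub>c (perm_act g v1 - v1)) v1 v2 v3"
      unfolding vector_condition[OF g v, symmetric] other.vector_condition[OF g v, symmetric]
      by (simp only: alt3_sum_def F[OF v] F[OF v(2,3,1)] F[OF v(3,1,2)])
    then have "alt3_sum (\<lambda>v1 v2 v3. \<kappa>C g v2 v3 *\<^sub>c (perm_act g v1 - v1)) v1 v2 v3
        = alt3_sum (\<lambda>v1 v2 v3. \<kappa>C' g v2 v3 *\<^sub>c (perm_act g v1 - v1)) v1 v2 v3" by simp
    then show "alt3_sum (\<lambda>v1 v2 v3. \<delta> g v2 v3 *\<^sub>c (perm_act g v1 - v1)) v1 v2 v3 = 0"
      by (simp add: alt3_sum_def \<delta>_def cvs.scale_left_diff_distrib) (simp add: algebra_simps)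
  qed (rule g)
qed

lemma \<delta>_other:
  assumes "g permutes {1..n}" "g \<noteq> id" "\<And>i j. i \<in> {1..n} \<Longrightarrow> j \<in> {1..n} \<Longrightarrow> i \<noteq> j \<Longrightarrow> g \<noteq> swp i j"
    and "u \<in> V" "v \<in> V"
  shows "\<delta> g u v = 0"
  by (rule compatible_form.other_form[OF \<delta>_compatible[OF assms(1)] assms(2,3,4,5)])

lemma \<delta>_transposition:
  obtains c where "\<And>i j u v. i \<in> {1..n} \<Longrightarrow> j \<in> {1..n} \<Longrightarrow> i \<noteq> j \<Longrightarrow> u \<in> V \<Longrightarrow> v \<in> V \<Longrightarrow>
    \<delta> (swp i j) u v = c * xy_minor i j u v"
proof (rule that)
  fix i j u v assume ij: "i \<in> {1..n}" "j \<in> {1..n}" "i \<noteq> j" and uv: "u \<in> V" "v \<in> V"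
  have N: "1 \<in> {1..n}" "2 \<in> {1..n}" using n3 by auto
  have p: "swp i j permutes {1..n}" "swp 1 2 permutes {1..n}" using ij N by (auto intro: permutes_swap_id simp del: atLeastAtMost_iff)
  obtain k where k: "k \<in> {1..n}" "k \<noteq> i" "k \<noteq> j" using third_index[OF n3] by blast
  then obtain h where h: "h permutes {1..n}" "h 1 = i" "h 2 = j"
    using permutation_of_three[OF n3 ij(1,2) k(1) ij(3)] by auto
  have "h \<circ> swp 1 2 \<circ> inv' h = swp i j" using conj_eq_iff[OF h(1) conj_swp[OF h(1)], of "swp 1 2" 1 2] h by simp
  then have "\<delta> (swp i j) (x_half_diff n i j) (y_half_diff n i j) = \<delta> (swp 1 2) (x_half_diff n 1 2) (y_half_diff n 1 2)"
    using \<delta>_invariant[OF p(2) h(1) half_diff_V[OF N]] by (simp only: half_diff_perm[OF h(1)] h)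
  then show "\<delta> (swp i j) u v = \<delta> (swp 1 2) (x_half_diff n 1 2) (y_half_diff n 1 2) * xy_minor i j u v"
    using compatible_form.transposition_form[OF \<delta>_compatible[OF p(1)] ij refl uv] by simp
qed

text \<open>If the constant parts differ at the identity only, then in the difference of the two scalar conditions at \<open>g\<close> just
  the factorization \<open>id \<circ> g\<close> survives.\<close>

lemma \<delta>_id_condition:
  assumes off: "\<And>g u v. g permutes {1..n} \<Longrightarrow> g \<noteq> id \<Longrightarrow> u \<in> V \<Longrightarrow> v \<in> V \<Longrightarrow> \<delta> g u v = 0"
    and g: "g permutes {1..n}" and v: "v1 \<in> V" "v2 \<in> V" "v3 \<in> V"
  shows "alt3_sum (\<lambda>v1 v2 v3. \<delta> id (v1 + perm_act g v1) (\<kappa>L g v2 v3)) v1 v2 v3 = 0"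
proof -
  have F: "(\<Sum>(x, y)\<in>factorizations (sym_group n) g. \<kappa>C x (v1 + perm_act y v1) (\<kappa>L y v2 v3))
      - (\<Sum>(x, y)\<in>factorizations (sym_group n) g. \<kappa>C' x (v1 + perm_act y v1) (\<kappa>L' y v2 v3))
      = \<delta> id (v1 + perm_act g v1) (\<kappa>L g v2 v3)"
    if v: "v1 \<in> V" "v2 \<in> V" "v3 \<in> V" for v1 v2 v3
  proof -
    have t: "(case r of (x, y) \<Rightarrow> \<kappa>C x (v1 + perm_act y v1) (\<kappa>L y v2 v3)) - (case r of (x, y) \<Rightarrow> \<kappa>C' x (v1 + perm_act y v1) (\<kappa>L' y v2 v3))
      = (if r = (id, g) then \<delta> id (v1 + perm_act g v1) (\<kappa>L g v2 v3) else 0)"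
      if r: "r \<in> factorizations (sym_group n) g" for r
    proof -
      obtain x y where xy: "r = (x, y)" by (cases r)
      with r factorization_perm have p: "x permutes {1..n}" "y permutes {1..n}" "x \<circ> y = g" by auto
      have "\<kappa>C x (v1 + perm_act y v1) (\<kappa>L y v2 v3) - \<kappa>C' x (v1 + perm_act y v1) (\<kappa>L' y v2 v3)
        = \<delta> x (v1 + perm_act y v1) (\<kappa>L y v2 v3)"
        unfolding \<delta>_def same[OF p(2) v(2,3)] ..
      moreover have "\<delta> x (v1 + perm_act y v1) (\<kappa>L y v2 v3) = 0" if "x \<noteq> id"
        by (rule off[OF p(1) that args_V[OF p(2) v(1)] L_range[OF p(2) v(2,3)]])
      moreover have "y = g" if "x = id" using p(3) that by simp
      ultimately show ?thesis by (cases "x = id") (auto simp: xy)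
    qed
    have "(id, g) \<in> factorizations (sym_group n) g"
      using g permutes_id by (simp add: factorizations_def sym_group_carrier sym_group_mult)
    moreover have "(\<Sum>r\<in>factorizations (sym_group n) g. (case r of (x, y) \<Rightarrow> \<kappa>C x (v1 + perm_act y v1) (\<kappa>L y v2 v3))
          - (case r of (x, y) \<Rightarrow> \<kappa>C' x (v1 + perm_act y v1) (\<kappa>L' y v2 v3)))
        = (\<Sum>r\<in>factorizations (sym_group n) g. if r = (id, g) then \<delta> id (v1 + perm_act g v1) (\<kappa>L g v2 v3) else 0)"
      by (rule sum.cong[OF refl t])
    ultimately show ?thesis
      unfolding sum_subtractf[symmetric] by (simp add: sum.delta finite_factorizations)
  qed
  have "alt3_sum (\<lambda>v1 v2 v3. \<delta> id (v1 + perm_act g v1) (\<kappa>L g v2 v3)) v1 v2 v3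
    = alt3_sum (\<lambda>v1 v2 v3. \<Sum>(x, y)\<in>factorizations (sym_group n) g. \<kappa>C x (v1 + perm_act y v1) (\<kappa>L y v2 v3)) v1 v2 v3
    - alt3_sum (\<lambda>v1 v2 v3. \<Sum>(x, y)\<in>factorizations (sym_group n) g. \<kappa>C' x (v1 + perm_act y v1) (\<kappa>L' y v2 v3)) v1 v2 v3"
    unfolding alt3_sum_def F[OF v, symmetric] F[OF v(2,3,1), symmetric] F[OF v(3,1,2), symmetric] by simp
  then show ?thesis unfolding scalar_condition[OF g v] other.scalar_condition[OF g v] by simp
qed

text \<open>For \<open>g\<close> the transposition of \<open>i\<close> and \<open>j\<close>, the previous condition applied to \<open>u\<close> and the basis of the plane moved by
  \<open>g\<close>, on which \<open>1 + g\<close> is zero, shows that \<open>\<delta> id\<close> vanishes on \<open>(u + g u, pair_vec n a b i j)\<close>, and by invariance on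
  \<open>(u, pair_vec n a b i j)\<close>.  Three indices give that \<open>a x\<^sub>i + b y\<^sub>i\<close> lies in the kernel.  Since \<open>\<delta> id\<close> is zero on two \<open>x\<close>
  and on two \<open>y\<close>, by invariance under a transposition, only mixed values are left, and one of \<open>a\<close>, \<open>b\<close> is not zero.\<close>

lemma \<delta>_id_zero:
  assumes off: "\<And>g u v. g permutes {1..n} \<Longrightarrow> g \<noteq> id \<Longrightarrow> u \<in> V \<Longrightarrow> v \<in> V \<Longrightarrow> \<delta> g u v = 0"
    and kap: "\<And>g u v. g permutes {1..n} \<Longrightarrow> u \<in> V \<Longrightarrow> v \<in> V \<Longrightarrow> \<kappa>L g u v = family_L n a b g u v"
    and ab: "a \<noteq> 0 \<or> b \<noteq> 0" and uv: "u \<in> V" "v \<in> V"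
  shows "\<delta> id u v = 0"
proof -
  note idp = permutes_id[of "{1..n}"]
  interpret d: skew_form n "(*)" UNIV "\<delta> id" by (rule \<delta>_form[OF idp])
  have inv: "\<delta> id (perm_act h u) (perm_act h v) = \<delta> id u v" if "h permutes {1..n}" "u \<in> V" "v \<in> V" for h u v
    using \<delta>_invariant[OF idp that] permutes_inv_o(1)[OF that(1)] by simp
  have W: "\<delta> id u (pair_vec n a b i j) = 0" if u: "u \<in> V" and ij: "i \<in> {1..n}" "j \<in> {1..n}" "i \<noteq> j" for u i j
  proof -
    let ?s = "swp i j" and ?p = "x_half_diff n i j" and ?q = "y_half_diff n i j" and ?w = "(- (of_nat n / 2)) *\<^sub>c pair_vec n a b i j"
    have s: "?s permutes {1..n}" using ij by (intro permutes_swap_id)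
    note pq = half_diff_V[OF ij(1,2)]
    have wV: "pair_vec n a b i j \<in> V" "?w \<in> V" using pair_vec_doubled_std[OF ij(1,2)] V_closed by blast+
    have su: "perm_act ?s u \<in> V" by (rule perm_act_doubled_std[OF s u])
    have neg: "?p + perm_act ?s ?p = 0" "?q + perm_act ?s ?q = 0"
      using half_diff_neg[of n j i] by (simp_all add: half_diff_perm[OF s])
    have k: "\<kappa>L ?s x y = xy_minor i j x y *\<^sub>c ?w" if "x \<in> V" "y \<in> V" for x y
      unfolding kap[OF s that] by (rule family_L_swp[OF ij])
    have "alt3_sum (\<lambda>v1 v2 v3. \<delta> id (v1 + perm_act ?s v1) (\<kappa>L ?s v2 v3)) u ?p ?q = 0"
      by (rule \<delta>_id_condition[OF _ s u pq]) (rule off)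
    then have "\<delta> id (u + perm_act ?s u) (\<kappa>L ?s ?p ?q) + \<delta> id (?p + perm_act ?s ?p) (\<kappa>L ?s ?q u)
        + \<delta> id (?q + perm_act ?s ?q) (\<kappa>L ?s u ?p) = 0"
      by (simp only: alt3_sum_def)
    then have "\<delta> id (u + perm_act ?s u) ?w = 0"
      unfolding neg d.zero_left[OF L_range[OF s pq(2) u]] d.zero_left[OF L_range[OF s u pq(1)]]
        k[OF pq] xy_minor_half_diff[OF ij] by simp
    then have "of_nat n * \<delta> id (u + perm_act ?s u) (pair_vec n a b i j) = 0"
      unfolding d.scale_right[OF wV(1) V_closed(1)[OF u su]] by simp
    then have "\<delta> id u (pair_vec n a b i j) + \<delta> id (perm_act ?s u) (pair_vec n a b i j) = 0"
      using n3 d.add_left[OF u su wV(1)] by simp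
    moreover have "perm_act ?s (pair_vec n a b i j) = pair_vec n a b i j"
      by (simp add: pair_vec_perm[OF s]) (simp add: pair_vec_def add.commute)
    then have "\<delta> id (perm_act ?s u) (pair_vec n a b i j) = \<delta> id u (pair_vec n a b i j)"
      using inv[OF s u wV(1)] by simp
    ultimately show ?thesis by simp
  qed
  let ?x = "xbar n" and ?y = "ybar n"
  note bV = bars_doubled_std
  have one: "a * \<delta> id u (?x i) + b * \<delta> id u (?y i) = 0" if u: "u \<in> V" and i: "i \<in> {1..n}" for u i
  proof -
    obtain j where j: "j \<in> {1..n}" "j \<noteq> i" using third_index[OF n3] by blast
    obtain k where k: "k \<in> {1..n}" "k \<noteq> i" "k \<noteq> j" using third_index[OF n3] by blast
    have e: "\<delta> id u (pair_vec n a b p q) = a * (\<delta> id u (?x p) + \<delta> id u (?x q)) + b * (\<delta> id u (?y p) + \<delta> id u (?y q))"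
      if "p \<in> {1..n}" "q \<in> {1..n}" for p q
      unfolding pair_vec_def using u that by (simp add: d.add_right d.scale_right V_closed bV del: atLeastAtMost_iff)
    have "2 * (a * \<delta> id u (?x i) + b * \<delta> id u (?y i))
      = \<delta> id u (pair_vec n a b i j) + \<delta> id u (pair_vec n a b i k) - \<delta> id u (pair_vec n a b j k)"
      unfolding e[OF i j(1)] e[OF i k(1)] e[OF j(1) k(1)] by (simp add: algebra_simps)
    also have "\<dots> = 0" using W[OF u] i j k by (simp del: atLeastAtMost_iff)
    finally have "2 * (a * \<delta> id u (?x i) + b * \<delta> id u (?y i)) = 0" .
    then show ?thesis by (simp only: mult_eq_0_iff) simp
  qed
  have swap: "\<delta> id (?x i) (?x j) = 0" "\<delta> id (?y i) (?y j) = 0" if "i \<in> {1..n}" "j \<in> {1..n}" for i j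
  proof -
    have s: "swp i j permutes {1..n}" using that by (intro permutes_swap_id)
    note V = bV(1)[OF that(1)] bV(1)[OF that(2)] bV(2)[OF that(1)] bV(2)[OF that(2)]
    have "\<delta> id (?x i) (?x j) = - \<delta> id (?x i) (?x j)" "\<delta> id (?y i) (?y j) = - \<delta> id (?y i) (?y j)"
      using inv[OF s V(1,2)] inv[OF s V(3,4)] d.skew[OF V(2,1)] d.skew[OF V(4,3)] by (simp_all add: perm_act_bars[OF s])
    then show "\<delta> id (?x i) (?x j) = 0" "\<delta> id (?y i) (?y j) = 0" using complex_eq_neg by blast+
  qed
  have xy: "\<delta> id (?x i) (?y j) = 0" if ij: "i \<in> {1..n}" "j \<in> {1..n}" for i j
  proof -
    have "b * \<delta> id (?x i) (?y j) = 0" using one[OF bV(1)[OF ij(1)] ij(2)] swap(1)[OF ij] by simp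
    moreover have "a * \<delta> id (?y j) (?x i) = 0" using one[OF bV(2)[OF ij(2)] ij(1)] swap(2)[OF ij(2,1)] by simp
    ultimately show ?thesis using ab d.skew[OF bV(1)[OF ij(1)] bV(2)[OF ij(2)]] by auto
  qed
  show ?thesis
    by (rule d.eq_zeroI[OF complex_eq_neg UNIV_I swap(1) swap(2) xy uv])
qed

end

text \<open>The map is first compared with the member of the family that has the same linear part and \<open>c = 0\<close>, which
  determines \<open>c\<close>, and then with the member for this \<open>c\<close>.\<close>

theorem (in sym_drinfeld) classification:
  assumes off: "supported_only_off (sym_group n) V \<kappa>L {\<one>\<^bsub>sym_group n\<^esub>}"
    and nonzero: "\<not> zero_cochain (sym_group n) V \<kappa>L"
  shows "\<exists>a b c. in_family n a b c \<kappa>L \<kappa>C"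
proof -
  obtain a b where L: "\<And>g u v. g permutes {1..n} \<Longrightarrow> u \<in> V \<Longrightarrow> v \<in> V \<Longrightarrow> \<kappa>L g u v = family_L n a b g u v"
    using L_eq_family_L[OF off] by blast
  have ab: "a \<noteq> 0 \<or> b \<noteq> 0"
  proof (rule ccontr)
    assume "\<not> (a \<noteq> 0 \<or> b \<noteq> 0)"
    then have "family_L n a b g u v = 0" for g u v by (simp add: family_L_def pair_vec_def)
    then show False using nonzero L by (simp add: zero_cochain_def G_iff)
  qed
  interpret P0: drinfeld_pair n \<kappa>L \<kappa>C "family_L n a b" "family_C n a b 0"
    by (intro drinfeld_pair.intro drinfeld_pair_axioms.intro sym_drinfeld_axioms sym_drinfeld_family n3) (rule L)
  obtain c where c: "\<And>i j u v. i \<in> {1..n} \<Longrightarrow> j \<in> {1..n} \<Longrightarrow> i \<noteq> j \<Longrightarrow> u \<in> V \<Longrightarrow> v \<in> V \<Longrightarrow>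
    P0.\<delta> (swp i j) u v = c * xy_minor i j u v" using P0.\<delta>_transposition by blast
  interpret Pc: drinfeld_pair n \<kappa>L \<kappa>C "family_L n a b" "family_C n a b c"
    by (intro drinfeld_pair.intro drinfeld_pair_axioms.intro sym_drinfeld_axioms sym_drinfeld_family n3) (rule L)
  have C: "Pc.\<delta> g u v = 0" if g: "g permutes {1..n}" "g \<noteq> id" and uv: "u \<in> V" "v \<in> V" for g u v
  proof (cases "\<exists>i\<in>{1..n}. \<exists>j\<in>{1..n}. i \<noteq> j \<and> g = swp i j")
    case True
    then obtain i j where ij: "i \<in> {1..n}" "j \<in> {1..n}" "i \<noteq> j" and gij: "g = swp i j" by blast
    show ?thesis using c[OF ij uv] unfolding gij P0.\<delta>_def Pc.\<delta>_def family_C_swp[OF ij, of a b c] by (simp add: diff_eq_eq add.commute)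
  next
    case False
    then have gt: "\<And>i j. i \<in> {1..n} \<Longrightarrow> j \<in> {1..n} \<Longrightarrow> i \<noteq> j \<Longrightarrow> g \<noteq> swp i j" by blast
    show ?thesis by (rule Pc.\<delta>_other[OF g gt uv])
  qed
  have id: "Pc.\<delta> id u v = 0" if "u \<in> V" "v \<in> V" for u v
    by (rule Pc.\<delta>_id_zero[OF _ _ ab that]) (fact C, fact L)
  have "\<kappa>C g u v = family_C n a b c g u v" if "g permutes {1..n}" "u \<in> V" "v \<in> V" for g u v
    using C[OF that(1) _ that(2,3)] id[OF that(2,3)] unfolding Pc.\<delta>_def by (cases "g = id") simp_all
  then have "in_family n a b c \<kappa>L \<kappa>C"
    by (intro in_familyI map_conditions(1,2) L) (use n3 in \<open>simp_all add: G_iff\<close>)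
  then show ?thesis by blast
qed

theorem theorem1p2:
  fixes n :: nat
  assumes "n \<ge> 3"
  shows
    "(\<forall>\<kappa>L \<kappa>C. lie_orbifold_map (sym_group n) perm_act (doubled_std n) \<kappa>L \<kappa>C \<longrightarrow>
        zero_cochain (sym_group n) (doubled_std n) \<kappa>L)
     \<and>
     (\<forall>a b c. (\<exists>\<kappa>L \<kappa>C. in_family n a b c \<kappa>L \<kappa>C) \<and>
        (\<forall>\<kappa>L \<kappa>C. in_family n a b c \<kappa>L \<kappa>C \<longrightarrow>
           drinfeld_orbifold_map (sym_group n) perm_act (doubled_std n) \<kappa>L \<kappa>C \<and>
           supported_only_off (sym_group n) (doubled_std n) \<kappa>L {\<one>\<^bsub>sym_group n\<^esub>} \<and>
           is_drinfeld_orbifold_algebra (sym_group n) perm_act (doubled_std n) \<kappa>L \<kappa>C))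
     \<and>
     (\<forall>\<kappa>L \<kappa>C.
        drinfeld_orbifold_map (sym_group n) perm_act (doubled_std n) \<kappa>L \<kappa>C \<and>
        \<not> zero_cochain (sym_group n) (doubled_std n) \<kappa>L \<and>
        (supported_only_on (sym_group n) (doubled_std n) \<kappa>L {\<one>\<^bsub>sym_group n\<^esub>} \<or>
         supported_only_off (sym_group n) (doubled_std n) \<kappa>L {\<one>\<^bsub>sym_group n\<^esub>}) \<longrightarrow>
        (\<exists>a b c. in_family n a b c \<kappa>L \<kappa>C))"
proof (intro conjI allI impI)
  fix \<kappa>L \<kappa>C assume "lie_orbifold_map (sym_group n) perm_act (doubled_std n) \<kappa>L \<kappa>C"
  then show "zero_cochain (sym_group n) (doubled_std n) \<kappa>L"
    using sym_drinfeld.lie_part_zero[OF sym_drinfeld.intro[OF assms]] unfolding lie_orbifold_map_def by blast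
next
  fix a b c
  show "\<exists>\<kappa>L \<kappa>C. in_family n a b c \<kappa>L \<kappa>C" using family_in_family by blast
next
  fix a b c \<kappa>L \<kappa>C assume f: "in_family n a b c \<kappa>L \<kappa>C"
  show "drinfeld_orbifold_map (sym_group n) perm_act (doubled_std n) \<kappa>L \<kappa>C"
    "supported_only_off (sym_group n) (doubled_std n) \<kappa>L {\<one>\<^bsub>sym_group n\<^esub>}"
    "is_drinfeld_orbifold_algebra (sym_group n) perm_act (doubled_std n) \<kappa>L \<kappa>C"
    by (fact in_family_drinfeld[OF assms f])+
next
  fix \<kappa>L \<kappa>C
  assume a: "drinfeld_orbifold_map (sym_group n) perm_act (doubled_std n) \<kappa>L \<kappa>C \<and>
        \<not> zero_cochain (sym_group n) (doubled_std n) \<kappa>L \<and>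
        (supported_only_on (sym_group n) (doubled_std n) \<kappa>L {\<one>\<^bsub>sym_group n\<^esub>} \<or>
         supported_only_off (sym_group n) (doubled_std n) \<kappa>L {\<one>\<^bsub>sym_group n\<^esub>})"
  then interpret sym_drinfeld n \<kappa>L \<kappa>C by (intro sym_drinfeld.intro assms) blast
  show "\<exists>a b c. in_family n a b c \<kappa>L \<kappa>C" using a lie_part_zero classification by blast
qed

end
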